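(* Let $R=R_0[x_1,\dots,x_d]$ be a Noetherian $\mathbb{N}$-graded ring, let $L$ and $M$ be finitely generated $\mathbb{Z}$-graded $R$-modules, let $N$ be a graded submodule of $M$, and let $I$ be a homogeneous ideal of $R$. Let $J$ be a reduction ideal of $I$ generated by homogeneous elements $y_1,\dots,y_c$ of degrees $d_1\le\cdots\le d_c$ respectively. Fix $k\in\mathbb{N}$, and put $H:=\operatorname{Tor}_k^R(L,M)$ and $H_n:=\operatorname{Tor}_k^R(L,M/I^nN)$ for each $n\ge 0$. Assume that $(0:_H I)=0$. (1) Let $\mathfrak{p}$ be such that $\mathfrak{p}\in\operatorname{Ass}_R(H_n)$ for all $n\gg 0$, and suppose that $I\subseteq\mathfrak{p}$. Then there exist $a_{\mathfrak{p}}\in\{d_1,\dots,d_c\}$ and $b_{\mathfrak{p}}\in\mathbb{Z}$ such that $v_{\mathfrak{p}}(H_n)=a_{\mathfrak{p}}n+b_{\mathfrak{p}}$ for all $n\gg 0$. (2) Suppose that $I^{n_0}M\subseteq N$ for some $n_0\in\mathbb{N}$ (e.g., $N=M$, or $N=\mathfrak{a}M$ for some homogeneous ideal $\mathfrak{a}$ with $I\subseteq\sqrt{\mathfrak{a}}$). Then there exist $a\in\{d_1,\dots,d_c\}$ and $b\in\mathbb{Z}\cup\{\infty\}$ such that $v(H_n)=an+b$ for all $n\gg 0$.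
   Context: Rings are commutative and $\mathbb{N}=\{0,1,2,\dots\}$. $R=R_0[x_1,\dots,x_d]$ means that $R$ is generated over its degree-zero component $R_0$ by homogeneous elements $x_1,\dots,x_d$. An ideal $J\subseteq I$ is a reduction of $I$ if $JI^m=I^{m+1}$ for some $m\ge 0$. Tor of finitely generated graded $R$-modules carries its natural $\mathbb{Z}$-graded structure. For an $R$-module $H$, $(0:_H I):=\{x\in H: Ix=0\}$. v-numbers: for a finitely generated $\mathbb{Z}$-graded $R$-module $E$ with graded components $E_n$ and $\mathfrak{p}\in\operatorname{Ass}_R(E)$, the local v-number is $v_{\mathfrak{p}}(E):=\inf\{n:\text{there exists }x\in E_n\text{ with }\mathfrak{p}=(0:_R x)\}$, where $(0:_R x)$ is the annihilator of $x$ in $R$. The v-number is $v(E):=\inf\{v_{\mathfrak{p}}(E):\mathfrak{p}\in\operatorname{Ass}_R(E)\}$, with $v(0)=\infty$. *)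

theory Defs
  imports "HOL-Algebra.Algebra" "HOL-Library.Extended_Real"
begin

section \<open>Graded rings and graded modules\<close>

record 'a graded_ring = "'a ring" +
  rgrade :: "nat \<Rightarrow> 'a set"

record ('a, 'b) graded_module = "('a, 'b) module" +
  grade :: "int \<Rightarrow> 'b set"

definition internal_direct_sum :: "('a, 'c) ring_scheme \<Rightarrow> ('i \<Rightarrow> 'a set) \<Rightarrow> bool" where
  "internal_direct_sum G C \<longleftrightarrow>
     (\<forall>i. additive_subgroup (C i) G) \<and>
     (\<forall>x\<in>carrier G. \<exists>!f. (\<forall>i. f i \<in> C i) \<and> finite {i. f i \<noteq> \<zero>\<^bsub>G\<^esub>} \<and>
        x = (\<Oplus>\<^bsub>G\<^esub>i\<in>{i. f i \<noteq> \<zero>\<^bsub>G\<^esub>}. f i))"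

locale graded_ring = R?: cring R for R :: "'a graded_ring" (structure) +
  assumes ring_direct_sum: "internal_direct_sum R (rgrade R)"
    and rgrade_mult: "\<lbrakk>a \<in> rgrade R i; b \<in> rgrade R j\<rbrakk> \<Longrightarrow> a \<otimes> b \<in> rgrade R (i + j)"

locale graded_module = graded_ring R + module R M
  for R :: "'a graded_ring" (structure) and M :: "('a, 'b) graded_module" (structure) +
  assumes module_direct_sum: "internal_direct_sum M (grade M)"
    and grade_smult: "\<lbrakk>a \<in> rgrade R i; x \<in> grade M j\<rbrakk> \<Longrightarrow> a \<odot>\<^bsub>M\<^esub> x \<in> grade M (int i + j)"

text \<open>For an additive subgroup \<open>U\<close>, the following says \<open>U = \<Sum>\<^sub>n (U \<inter> C n)\<close>.\<close>

definition homogeneous :: "('a, 'c) ring_scheme \<Rightarrow> ('i \<Rightarrow> 'a set) \<Rightarrow> 'a set \<Rightarrow> bool" where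
  "homogeneous G C U \<longleftrightarrow> U \<subseteq> generate (add_monoid G) (\<Union>n. U \<inter> C n)"

definition homogeneous_ideal :: "'a graded_ring \<Rightarrow> 'a set \<Rightarrow> bool" where
  "homogeneous_ideal R I \<longleftrightarrow> ideal I R \<and> homogeneous R (rgrade R) I"

definition graded_submodule ::
    "'a graded_ring \<Rightarrow> ('a, 'b) graded_module \<Rightarrow> 'b set \<Rightarrow> bool" where
  "graded_submodule R M N \<longleftrightarrow> submodule N R M \<and> homogeneous M (grade M) N"

text \<open>\<open>ideal_smult M I N\<close> is \<open>I N\<close>: all finite sums of products \<open>a x\<close> with \<open>a \<in> I\<close>, \<open>x \<in> N\<close>.\<close>

definition ideal_smult :: "('a, 'b, 'c) module_scheme \<Rightarrow> 'a set \<Rightarrow> 'b set \<Rightarrow> 'b set" where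
  "ideal_smult M I N = generate (add_monoid M) {a \<odot>\<^bsub>M\<^esub> x | a x. a \<in> I \<and> x \<in> N}"

definition module_span ::
    "('a, 'c) ring_scheme \<Rightarrow> ('a, 'b, 'd) module_scheme \<Rightarrow> 'b set \<Rightarrow> 'b set" where
  "module_span R M S = ideal_smult M (carrier R) S"

definition fin_gen_module :: "('a, 'c) ring_scheme \<Rightarrow> ('a, 'b, 'd) module_scheme \<Rightarrow> bool" where
  "fin_gen_module R M \<longleftrightarrow>
     (\<exists>S. finite S \<and> S \<subseteq> carrier M \<and> module_span R M S = carrier M)"

text \<open>The unit of the monoid \<open>ideals_set R\<close> is \<open>carrier R\<close>, so that \<open>I\<^sup>0 = R\<close>.\<close>

abbreviation ideal_power :: "('a, 'c) ring_scheme \<Rightarrow> 'a set \<Rightarrow> nat \<Rightarrow> 'a set" where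
  "ideal_power R I n \<equiv> I [^]\<^bsub>ideals_set R\<^esub> n"

definition is_reduction :: "('a, 'c) ring_scheme \<Rightarrow> 'a set \<Rightarrow> 'a set \<Rightarrow> bool" where
  "is_reduction R J I \<longleftrightarrow> ideal J R \<and> ideal I R \<and> J \<subseteq> I \<and>
     (\<exists>m. ideal_prod R J (ideal_power R I m) = ideal_power R I (Suc m))"

definition graded_hom ::
    "'a graded_ring \<Rightarrow> ('a, 'b) graded_module \<Rightarrow> ('a, 'c) graded_module \<Rightarrow> ('b \<Rightarrow> 'c) set" where
  "graded_hom R M N = {h \<in> carrier M \<rightarrow> carrier N.
     (\<forall>x\<in>carrier M. \<forall>y\<in>carrier M. h (x \<oplus>\<^bsub>M\<^esub> y) = h x \<oplus>\<^bsub>N\<^esub> h y) \<and>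
     (\<forall>a\<in>carrier R. \<forall>x\<in>carrier M. h (a \<odot>\<^bsub>M\<^esub> x) = a \<odot>\<^bsub>N\<^esub> h x) \<and>
     (\<forall>n. h ` grade M n \<subseteq> grade N n)}"


section \<open>Quotients, free modules and tensor products\<close>

text \<open>The \<open>mult\<close> and \<open>one\<close> fields of a module record carry no information.\<close>

definition with_grade :: "('a, 'b) module \<Rightarrow> (int \<Rightarrow> 'b set) \<Rightarrow> ('a, 'b) graded_module" where
  "with_grade M g = \<lparr>carrier = carrier M, monoid.mult = monoid.mult M, one = one M,
     ring.zero = ring.zero M, ring.add = ring.add M, smult = smult M, grade = g\<rparr>"

definition quot_module :: "('a, 'b, 'c) module_scheme \<Rightarrow> 'b set \<Rightarrow> ('a, 'b set) module" where
  "quot_module M N = \<lparr>carrier = a_rcosets\<^bsub>M\<^esub> N, monoid.mult = undefined, one = undefined,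
     ring.zero = N, ring.add = set_add M, smult = (\<lambda>a U. \<Union>x\<in>U. N +>\<^bsub>M\<^esub> (a \<odot>\<^bsub>M\<^esub> x))\<rparr>"

definition quot_graded :: "('a, 'b) graded_module \<Rightarrow> 'b set \<Rightarrow> ('a, 'b set) graded_module" where
  "quot_graded M N = with_grade (quot_module M N) (\<lambda>n. (\<lambda>x. N +>\<^bsub>M\<^esub> x) ` grade M n)"

definition sub_graded :: "('a, 'b) graded_module \<Rightarrow> 'b set \<Rightarrow> ('a, 'b) graded_module" where
  "sub_graded M Z = M\<lparr>carrier := Z, grade := (\<lambda>n. grade M n \<inter> Z)\<rparr>"

definition free_module :: "('a, 'c) ring_scheme \<Rightarrow> 's set \<Rightarrow> ('a, 's \<Rightarrow> 'a) module" where
  "free_module R S = \<lparr>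
     carrier = {f. (\<forall>s. f s \<in> carrier R) \<and> (\<forall>s. s \<notin> S \<longrightarrow> f s = \<zero>\<^bsub>R\<^esub>) \<and> finite {s. f s \<noteq> \<zero>\<^bsub>R\<^esub>}},
     monoid.mult = undefined, one = undefined, ring.zero = (\<lambda>_. \<zero>\<^bsub>R\<^esub>),
     ring.add = (\<lambda>f g s. f s \<oplus>\<^bsub>R\<^esub> g s), smult = (\<lambda>a f s. a \<otimes>\<^bsub>R\<^esub> f s)\<rparr>"

definition unit_vec :: "('a, 'c) ring_scheme \<Rightarrow> 's \<Rightarrow> 's \<Rightarrow> 'a" where
  "unit_vec R s = (\<lambda>t. if t = s then \<one>\<^bsub>R\<^esub> else \<zero>\<^bsub>R\<^esub>)"

text \<open>The graded free module \<open>\<Oplus>\<^sub>s R(- \<delta> s)\<close>: the basis vector \<open>s\<close> has degree \<open>\<delta> s\<close>.\<close>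

definition graded_free :: "'a graded_ring \<Rightarrow> 's set \<Rightarrow> ('s \<Rightarrow> int) \<Rightarrow> ('a, 's \<Rightarrow> 'a) graded_module" where
  "graded_free R S \<delta> = with_grade (free_module R S)
     (\<lambda>n. {f \<in> carrier (free_module R S). \<forall>s\<in>S.
        if \<delta> s \<le> n then f s \<in> rgrade R (nat (n - \<delta> s)) else f s = \<zero>\<^bsub>R\<^esub>})"

definition tensor_relations ::
    "('a, 'c) ring_scheme \<Rightarrow> ('a, 'b, 'd) module_scheme \<Rightarrow> ('a, 'e, 'f) module_scheme \<Rightarrow>
     ('b \<times> 'e \<Rightarrow> 'a) set" where
  "tensor_relations R A B =
     (let F = free_module R (carrier A \<times> carrier B); \<epsilon> = unit_vec R in
      module_span R F
       ({\<epsilon> (a \<oplus>\<^bsub>A\<^esub> a', b) \<ominus>\<^bsub>F\<^esub> (\<epsilon> (a, b) \<oplus>\<^bsub>F\<^esub> \<epsilon> (a', b)) | a a' b.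
           a \<in> carrier A \<and> a' \<in> carrier A \<and> b \<in> carrier B} \<union>
        {\<epsilon> (a, b \<oplus>\<^bsub>B\<^esub> b') \<ominus>\<^bsub>F\<^esub> (\<epsilon> (a, b) \<oplus>\<^bsub>F\<^esub> \<epsilon> (a, b')) | a b b'.
           a \<in> carrier A \<and> b \<in> carrier B \<and> b' \<in> carrier B} \<union>
        {\<epsilon> (r \<odot>\<^bsub>A\<^esub> a, b) \<ominus>\<^bsub>F\<^esub> (r \<odot>\<^bsub>F\<^esub> \<epsilon> (a, b)) | r a b.
           r \<in> carrier R \<and> a \<in> carrier A \<and> b \<in> carrier B} \<union>
        {\<epsilon> (a, r \<odot>\<^bsub>B\<^esub> b) \<ominus>\<^bsub>F\<^esub> (r \<odot>\<^bsub>F\<^esub> \<epsilon> (a, b)) | r a b.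
           r \<in> carrier R \<and> a \<in> carrier A \<and> b \<in> carrier B}))"

definition tensor_module ::
    "('a, 'c) ring_scheme \<Rightarrow> ('a, 'b, 'd) module_scheme \<Rightarrow> ('a, 'e, 'f) module_scheme \<Rightarrow>
     ('a, ('b \<times> 'e \<Rightarrow> 'a) set) module" where
  "tensor_module R A B =
     quot_module (free_module R (carrier A \<times> carrier B)) (tensor_relations R A B)"

definition pure_tensor ::
    "('a, 'c) ring_scheme \<Rightarrow> ('a, 'b, 'd) module_scheme \<Rightarrow> ('a, 'e, 'f) module_scheme \<Rightarrow>
     'b \<Rightarrow> 'e \<Rightarrow> ('b \<times> 'e \<Rightarrow> 'a) set" where
  "pure_tensor R A B a b =
     tensor_relations R A B +>\<^bsub>free_module R (carrier A \<times> carrier B)\<^esub> unit_vec R (a, b)"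

definition tensor_graded ::
    "'a graded_ring \<Rightarrow> ('a, 'b) graded_module \<Rightarrow> ('a, 'e) graded_module \<Rightarrow>
     ('a, ('b \<times> 'e \<Rightarrow> 'a) set) graded_module" where
  "tensor_graded R A B = with_grade (tensor_module R A B)
     (\<lambda>n. generate (add_monoid (tensor_module R A B))
        {pure_tensor R A B a b | a b i j. a \<in> grade A i \<and> b \<in> grade B j \<and> i + j = n})"

text \<open>\<open>tensor_map R A A' B h\<close> is \<open>h \<otimes> id : A \<otimes> B \<rightarrow> A' \<otimes> B\<close>. An element of \<open>A \<otimes> B\<close> is a coset
  \<open>U\<close> of formal combinations \<open>f = \<Sum> f(a,b) (a,b)\<close>; the expression \<open>\<Sum> f(a,b) (h a \<otimes> b)\<close>
  does not depend on \<open>f \<in> U\<close> when \<open>h\<close> is linear.\<close>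

definition tensor_map ::
    "('a, 'c) ring_scheme \<Rightarrow> ('a, 'b, 'd) module_scheme \<Rightarrow> ('a, 'b2, 'd2) module_scheme \<Rightarrow>
     ('a, 'e, 'f) module_scheme \<Rightarrow> ('b \<Rightarrow> 'b2) \<Rightarrow>
     ('b \<times> 'e \<Rightarrow> 'a) set \<Rightarrow> ('b2 \<times> 'e \<Rightarrow> 'a) set" where
  "tensor_map R A A' B h U = the_elem
     ((\<lambda>f. \<Oplus>\<^bsub>tensor_module R A' B\<^esub>p\<in>{p. f p \<noteq> \<zero>\<^bsub>R\<^esub>}.
         f p \<odot>\<^bsub>tensor_module R A' B\<^esub> pure_tensor R A' B (h (fst p)) (snd p)) ` U)"


section \<open>Graded free resolutions and Tor\<close>

text \<open>Data of a complex \<open>\<cdots> \<rightarrow> F\<^sub>2 \<rightarrow> F\<^sub>1 \<rightarrow> F\<^sub>0 \<rightarrow> L\<close> with \<open>F\<^sub>i = \<Oplus>\<^sub>j R(- shift i j)\<close>, \<open>j < rank i\<close>;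
  \<open>diff i\<close> is the map \<open>F\<^sub>i\<^sub>+\<^sub>1 \<rightarrow> F\<^sub>i\<close>.\<close>

record ('a, 'b) free_complex =
  rank :: "nat \<Rightarrow> nat"
  shift :: "nat \<Rightarrow> nat \<Rightarrow> int"
  diff :: "nat \<Rightarrow> (nat \<Rightarrow> 'a) \<Rightarrow> (nat \<Rightarrow> 'a)"
  aug :: "(nat \<Rightarrow> 'a) \<Rightarrow> 'b"

definition res_term ::
    "'a graded_ring \<Rightarrow> ('a, 'b) free_complex \<Rightarrow> nat \<Rightarrow> ('a, nat \<Rightarrow> 'a) graded_module" where
  "res_term R F i = graded_free R {..<rank F i} (shift F i)"

definition graded_free_resolution ::
    "'a graded_ring \<Rightarrow> ('a, 'b) graded_module \<Rightarrow> ('a, 'b) free_complex \<Rightarrow> bool" where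
  "graded_free_resolution R L F \<longleftrightarrow>
     aug F \<in> graded_hom R (res_term R F 0) L \<and>
     (\<forall>i. diff F i \<in> graded_hom R (res_term R F (Suc i)) (res_term R F i)) \<and>
     aug F ` carrier (res_term R F 0) = carrier L \<and>
     diff F 0 ` carrier (res_term R F 1) = a_kernel (res_term R F 0) L (aug F) \<and>
     (\<forall>i. diff F (Suc i) ` carrier (res_term R F (Suc (Suc i))) =
        a_kernel (res_term R F (Suc i)) (res_term R F i) (diff F i))"

text \<open>If \<open>R\<close> is Noetherian and \<open>L\<close> is finitely generated and graded, then \<open>L\<close> has a resolution by
  graded free modules of finite rank, and the homology below is independent of the resolution up
  to isomorphism of graded modules.\<close>

definition some_resolution ::
    "'a graded_ring \<Rightarrow> ('a, 'b) graded_module \<Rightarrow> ('a, 'b) free_complex" where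
  "some_resolution R L = (SOME F. graded_free_resolution R L F)"

definition Tor ::
    "'a graded_ring \<Rightarrow> nat \<Rightarrow> ('a, 'b) graded_module \<Rightarrow> ('a, 'e) graded_module \<Rightarrow>
     ('a, ((nat \<Rightarrow> 'a) \<times> 'e \<Rightarrow> 'a) set set) graded_module" where
  "Tor R k L E =
     (let F = some_resolution R L;
          C = (\<lambda>i. tensor_graded R (res_term R F i) E);
          \<delta> = (\<lambda>i. tensor_map R (res_term R F (Suc i)) (res_term R F i) E (diff F i));
          Z = (case k of 0 \<Rightarrow> carrier (C 0) | Suc i \<Rightarrow> a_kernel (C (Suc i)) (C i) (\<delta> i));
          B = \<delta> k ` carrier (C (Suc k))
      in quot_graded (sub_graded (C k) Z) B)"


section \<open>Associated primes and v-numbers\<close>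

definition annihilator ::
    "('a, 'c) ring_scheme \<Rightarrow> ('a, 'b, 'd) module_scheme \<Rightarrow> 'b \<Rightarrow> 'a set" where
  "annihilator R E x = {a \<in> carrier R. a \<odot>\<^bsub>E\<^esub> x = \<zero>\<^bsub>E\<^esub>}"

definition torsion_by :: "('a, 'b, 'd) module_scheme \<Rightarrow> 'a set \<Rightarrow> 'b set" where
  "torsion_by E I = {x \<in> carrier E. \<forall>a\<in>I. a \<odot>\<^bsub>E\<^esub> x = \<zero>\<^bsub>E\<^esub>}"

definition Ass :: "('a, 'c) ring_scheme \<Rightarrow> ('a, 'b, 'd) module_scheme \<Rightarrow> 'a set set" where
  "Ass R E = {\<pp>. primeideal \<pp> R \<and> (\<exists>x\<in>carrier E. \<pp> = annihilator R E x)}"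

text \<open>Both infima are taken in the extended reals, so that the infimum of the empty set is \<open>\<infinity>\<close>.\<close>

definition local_v_number :: "'a graded_ring \<Rightarrow> ('a, 'b) graded_module \<Rightarrow> 'a set \<Rightarrow> ereal" where
  "local_v_number R E \<pp> =
     Inf {ereal (of_int n) | n. \<exists>x\<in>grade E n. \<pp> = annihilator R E x}"

definition v_number :: "'a graded_ring \<Rightarrow> ('a, 'b) graded_module \<Rightarrow> ereal" where
  "v_number R E = (INF \<pp>\<in>Ass R E. local_v_number R E \<pp>)"

end

theory Submission
  imports Defs
begin

text \<open>Let \<open>F\<close> be the free resolution of \<open>L\<close>, let \<open>h\<close> be the \<open>k\<close>-th differential of \<open>F \<otimes> M\<close>, and
  let \<open>B\<close> be the image of the next one. Then \<open>Tor\<^sub>k(L, M / I\<^sup>n N)\<close> is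
  \<open>{z. h z \<in> I\<^sup>n V} / (B + I\<^sup>n U)\<close>, where \<open>z\<close> ranges over one fixed Noetherian graded module
  \<open>T = M\<^sup>r\<close> and \<open>U\<close>, \<open>V\<close> are finite powers of \<open>N\<close>. By Artin--Rees and \<open>(0 :\<^sub>H I) = 0\<close>, every \<open>z\<close> whose
  class is killed by \<open>J\<close> lies in \<open>B + J\<^sup>n\<^sup>-\<^sup>g T\<close> for a constant \<open>g\<close>. So for a prime \<open>\<pp> \<supseteq> I\<close> the classes
  killed by \<open>\<pp>\<close> come from a finitely generated module \<open>P\<close> over the Rees algebra of \<open>J\<close>, and those with
  annihilator exactly \<open>\<pp>\<close> from \<open>P \<setminus> Q\<close>, where \<open>Q\<close> is the \<open>R/\<pp>\<close>-torsion; thus the local v-number is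
  the initial degree of \<open>(P/Q)\<^sub>n\<close>. Split \<open>P/Q\<close> by its \<open>y\<^sub>1\<close>-power torsion: on the torsion-free part the
  initial degree grows by exactly \<open>d\<^sub>1\<close> because all other \<open>d\<^sub>i\<close> are at least \<open>d\<^sub>1\<close>, and the torsion part is
  finitely generated over \<open>y\<^sub>2, \<dots>, y\<^sub>c\<close> alone. Finally only finitely many primes \<open>\<pp>\<close> occur, and a minimum
  of finitely many eventually linear functions is eventually linear.\<close>

section \<open>Chain conditions and submodules\<close>

text \<open>The obstacle is that the submodules \<open>{z. h z \<in> I^n V}\<close> together need
  not form a finitely generated module over the Rees algebra of \<open>J\<close>: every one of them
  contains all cycles of \<open>F \<otimes> M\<close>. Finiteness holds only inside a shift of the
  Rees module of \<open>T\<close>, and this is where \<open>I \<subseteq> \<pp>\<close> matters: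
  classes killed by \<open>\<pp>\<close> are then killed by \<open>J\<close>. A graded module over
  the Rees algebra is never built as one object. It is represented by the sequence of its
  components, all of them submodules of one Noetherian module, and the chain condition is proved for
  such sequences under the pointwise order. The linearity argument takes an arbitrary prime
  \<open>\<pp>\<close>, for which \<open>P\<close> and \<open>Q\<close> are not known to be
  homogeneous; they are replaced by their largest homogeneous subfamilies, which have the same
  homogeneous elements. That an associated prime is the annihilator of a homogeneous element enters
  separately, to exclude an infinite local v-number.\<close>

definition acc :: "'o::order set \<Rightarrow> bool" where
  "acc C \<longleftrightarrow> (\<forall>W::nat \<Rightarrow> 'o. range W \<subseteq> C \<and> mono W \<longrightarrow> (\<exists>j0. \<forall>j\<ge>j0. W j = W j0))"

lemma accD:
  assumes "acc C" "\<And>j::nat. W j \<in> C" "\<And>j. W j \<le> W (Suc j)"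
  obtains j0 where "\<And>j. j \<ge> j0 \<Longrightarrow> W j = W j0"
proof -
  have "mono W" using assms(3) by (simp add: mono_iff_le_Suc)
  then show ?thesis using assms(1,2) that unfolding acc_def by blast
qed

text \<open>Without a maximal element, dependent choice would produce a strictly increasing
  sequence. The order is arbitrary because the result is applied to submodules, to ideals and to
  families of submodules ordered pointwise.\<close>

lemma acc_maximal:

  assumes "acc (C :: 'o::order set)" "D \<subseteq> C" "D \<noteq> {}"
  obtains U where "U \<in> D" "\<And>Y. Y \<in> D \<Longrightarrow> U \<le> Y \<Longrightarrow> Y = U"
proof (rule ccontr)
  assume "\<not> thesis"
  then have ex: "\<exists>Y. Y \<in> D \<and> U < Y" if "U \<in> D" for U
    using that \<open>\<And>U. \<lbrakk>U \<in> D; \<And>Y. \<lbrakk>Y \<in> D; U \<le> Y\<rbrakk> \<Longrightarrow> Y = U\<rbrakk> \<Longrightarrow> thesis\<close> by (metis order_le_imp_less_or_eq)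
  obtain U0 where "U0 \<in> D" using assms(3) by blast
  obtain W :: "nat \<Rightarrow> 'o" where W: "\<And>n. W n \<in> D \<and> W n < W (Suc n)"
    using dependent_nat_choice[of "\<lambda>_ x. x \<in> D" "\<lambda>_ x y. x < y"] ex \<open>U0 \<in> D\<close> by metis
  obtain j0 where "\<And>j. j \<ge> j0 \<Longrightarrow> W j = W j0"
    by (rule accD[OF assms(1), of W]) (use W assms(2) order_less_imp_le in blast)+
  then show False using W[of j0] by (metis le_Suc_eq less_irrefl order_refl)
qed

definition noetherian_module :: "('a, 'c) ring_scheme \<Rightarrow> ('a, 'b, 'd) module_scheme \<Rightarrow> bool" where
  "noetherian_module R M \<longleftrightarrow> acc {W. submodule W R M}"

definition linear_map ::
    "('a, 'c) ring_scheme \<Rightarrow> ('a, 'b, 'd) module_scheme \<Rightarrow> ('a, 'e, 'f) module_scheme \<Rightarrow> ('b \<Rightarrow> 'e) \<Rightarrow> bool" where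
  "linear_map R M N h \<longleftrightarrow> h \<in> carrier M \<rightarrow> carrier N \<and>
     (\<forall>x\<in>carrier M. \<forall>y\<in>carrier M. h (x \<oplus>\<^bsub>M\<^esub> y) = h x \<oplus>\<^bsub>N\<^esub> h y) \<and>
     (\<forall>a\<in>carrier R. \<forall>x\<in>carrier M. h (a \<odot>\<^bsub>M\<^esub> x) = a \<odot>\<^bsub>N\<^esub> h x)"

text \<open>For a submodule \<open>U\<close> this is the product of \<open>U\<close> with the ideal
  generated by the list: \<open>U\<close> absorbs scalars, so one summand per generator suffices.
  The recursion on the list is what later allows generators to be discarded one at a time.\<close>

primrec list_smult :: "('a, 'b, 'd) module_scheme \<Rightarrow> 'a list \<Rightarrow> 'b set \<Rightarrow> 'b set" where
  "list_smult M [] U = {\<zero>\<^bsub>M\<^esub>}"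
| "list_smult M (y # ys) U = {y \<odot>\<^bsub>M\<^esub> x \<oplus>\<^bsub>M\<^esub> w | x w. x \<in> U \<and> w \<in> list_smult M ys U}"

primrec list_pow_smult :: "('a, 'b, 'd) module_scheme \<Rightarrow> 'a list \<Rightarrow> nat \<Rightarrow> 'b set \<Rightarrow> 'b set" where
  "list_pow_smult M ys 0 U = U"
| "list_pow_smult M ys (Suc n) U = list_smult M ys (list_pow_smult M ys n U)"

lemma in_set_add: fixes M (structure) shows "x \<in> A <+>\<^bsub>M\<^esub> B \<longleftrightarrow> (\<exists>a\<in>A. \<exists>b\<in>B. x = a \<oplus>\<^bsub>M\<^esub> b)"
  by (auto simp: set_add_def set_mult_def)

context module
begin

lemma module_axioms': "module R M" by unfold_locales

lemma uminus_eq_smult: "x \<in> carrier M \<Longrightarrow> \<ominus>\<^bsub>M\<^esub> x = (\<ominus> \<one>) \<odot>\<^bsub>M\<^esub> x"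
  by (simp add: smult_l_minus)

lemma submodule_iff:
  "submodule W R M \<longleftrightarrow> W \<subseteq> carrier M \<and> \<zero>\<^bsub>M\<^esub> \<in> W \<and> (\<forall>x\<in>W. \<forall>y\<in>W. x \<oplus>\<^bsub>M\<^esub> y \<in> W) \<and>
     (\<forall>a\<in>carrier R. \<forall>x\<in>W. a \<odot>\<^bsub>M\<^esub> x \<in> W)"
proof
  assume W: "submodule W R M"
  then have "\<zero>\<^bsub>M\<^esub> \<in> W" using subgroup.one_closed[OF submodule.axioms(1)] by fastforce
  then show "W \<subseteq> carrier M \<and> \<zero>\<^bsub>M\<^esub> \<in> W \<and> (\<forall>x\<in>W. \<forall>y\<in>W. x \<oplus>\<^bsub>M\<^esub> y \<in> W) \<and>
     (\<forall>a\<in>carrier R. \<forall>x\<in>W. a \<odot>\<^bsub>M\<^esub> x \<in> W)"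
    using submoduleE[OF W] by blast
qed (rule submoduleI; auto simp: uminus_eq_smult subset_iff)

lemma submodule_zero: "submodule W R M \<Longrightarrow> \<zero>\<^bsub>M\<^esub> \<in> W"
  and submodule_add: "submodule W R M \<Longrightarrow> x \<in> W \<Longrightarrow> y \<in> W \<Longrightarrow> x \<oplus>\<^bsub>M\<^esub> y \<in> W"
  and submodule_smult: "submodule W R M \<Longrightarrow> a \<in> carrier R \<Longrightarrow> x \<in> W \<Longrightarrow> a \<odot>\<^bsub>M\<^esub> x \<in> W"
  and submodule_carrier: "submodule W R M \<Longrightarrow> x \<in> W \<Longrightarrow> x \<in> carrier M"
  and submodule_subset: "submodule W R M \<Longrightarrow> W \<subseteq> carrier M"
  by (auto simp: submodule_iff)

lemma submodule_uminus: "submodule W R M \<Longrightarrow> x \<in> W \<Longrightarrow> \<ominus>\<^bsub>M\<^esub> x \<in> W"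
  using submoduleE(3) by blast

lemma submodule_minus: "submodule W R M \<Longrightarrow> x \<in> W \<Longrightarrow> y \<in> W \<Longrightarrow> x \<ominus>\<^bsub>M\<^esub> y \<in> W"
  by (simp add: M.minus_eq submodule_add submodule_uminus)

lemma minus_add_cancel: "x \<in> carrier M \<Longrightarrow> y \<in> carrier M \<Longrightarrow> (x \<ominus>\<^bsub>M\<^esub> y) \<oplus>\<^bsub>M\<^esub> y = x"
  by (simp add: M.minus_eq M.a_assoc M.l_neg)

lemma add_minus_cancel: "x \<in> carrier M \<Longrightarrow> y \<in> carrier M \<Longrightarrow> (x \<oplus>\<^bsub>M\<^esub> y) \<ominus>\<^bsub>M\<^esub> y = x"
  by (simp add: M.minus_eq M.a_assoc M.r_neg)

lemma add_diff_cancel_left: "x \<in> carrier M \<Longrightarrow> y \<in> carrier M \<Longrightarrow> (x \<oplus>\<^bsub>M\<^esub> y) \<ominus>\<^bsub>M\<^esub> x = y"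
  by (metis M.a_comm add_minus_cancel)

lemma smult_left_commute:
  "a \<in> carrier R \<Longrightarrow> b \<in> carrier R \<Longrightarrow> x \<in> carrier M \<Longrightarrow> a \<odot>\<^bsub>M\<^esub> (b \<odot>\<^bsub>M\<^esub> x) = b \<odot>\<^bsub>M\<^esub> (a \<odot>\<^bsub>M\<^esub> x)"
  by (metis smult_assoc1 R.m_comm)

lemma submodule_diffD: 
  assumes "submodule W R M" "x \<ominus>\<^bsub>M\<^esub> y \<in> W" "y \<in> W" "x \<in> carrier M"
  shows "x \<in> W"
  by (metis assms minus_add_cancel submodule_add submodule_carrier)

lemma submodule_diffD': 
  assumes "submodule W R M" "x \<oplus>\<^bsub>M\<^esub> y \<in> W" "y \<in> W" "x \<in> carrier M"
  shows "x \<in> W"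
  by (metis add_minus_cancel assms submodule_minus submodule_carrier)

lemma submodule_singleton_zero: "submodule {\<zero>\<^bsub>M\<^esub>} R M"
  by (simp add: submodule_iff)

lemma submodule_Int: "submodule A R M \<Longrightarrow> submodule B R M \<Longrightarrow> submodule (A \<inter> B) R M"
  by (auto simp: submodule_iff)

lemma add_ac_swap:
  assumes "a \<in> carrier M" "b \<in> carrier M" "c \<in> carrier M" "d \<in> carrier M"
  shows "(a \<oplus>\<^bsub>M\<^esub> b) \<oplus>\<^bsub>M\<^esub> (c \<oplus>\<^bsub>M\<^esub> d) = (a \<oplus>\<^bsub>M\<^esub> c) \<oplus>\<^bsub>M\<^esub> (b \<oplus>\<^bsub>M\<^esub> d)"
  using assms by (simp add: M.a_ac)

lemma submodule_set_add:
  assumes "submodule A R M" "submodule B R M"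
  shows "submodule (A <+>\<^bsub>M\<^esub> B) R M"
  unfolding submodule_iff
proof (intro conjI ballI subsetI)
  note c = submodule_carrier[OF assms(1)] submodule_carrier[OF assms(2)]
  show "\<zero>\<^bsub>M\<^esub> \<in> A <+>\<^bsub>M\<^esub> B"
    using submodule_zero assms unfolding in_set_add by (metis M.l_zero M.zero_closed)
  fix x assume x: "x \<in> A <+>\<^bsub>M\<^esub> B"
  then obtain a b where ab: "a \<in> A" "b \<in> B" "x = a \<oplus>\<^bsub>M\<^esub> b" by (auto simp: in_set_add)
  then show "x \<in> carrier M" using c by blast
  { fix y assume "y \<in> A <+>\<^bsub>M\<^esub> B"
    then obtain a' b' where ab': "a' \<in> A" "b' \<in> B" "y = a' \<oplus>\<^bsub>M\<^esub> b'" by (auto simp: in_set_add)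
    have "x \<oplus>\<^bsub>M\<^esub> y = (a \<oplus>\<^bsub>M\<^esub> a') \<oplus>\<^bsub>M\<^esub> (b \<oplus>\<^bsub>M\<^esub> b')" using ab ab' c by (simp add: add_ac_swap)
    then show "x \<oplus>\<^bsub>M\<^esub> y \<in> A <+>\<^bsub>M\<^esub> B" unfolding in_set_add using ab ab' assms submodule_add by metis }
  fix r assume "r \<in> carrier R"
  then show "r \<odot>\<^bsub>M\<^esub> x \<in> A <+>\<^bsub>M\<^esub> B" unfolding in_set_add
    using ab c assms submodule_smult smult_r_distr by metis
qed

lemma set_add_upper1: 
  assumes "submodule B R M" "A \<subseteq> carrier M"
  shows "A \<subseteq> A <+>\<^bsub>M\<^esub> B"
proof
  fix x assume "x \<in> A"
  moreover have "x = x \<oplus>\<^bsub>M\<^esub> \<zero>\<^bsub>M\<^esub>" using calculation assms(2) by auto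
  ultimately show "x \<in> A <+>\<^bsub>M\<^esub> B" using submodule_zero[OF assms(1)] unfolding in_set_add by blast
qed

lemma set_add_upper2: 
  assumes "submodule A R M" "B \<subseteq> carrier M"
  shows "B \<subseteq> A <+>\<^bsub>M\<^esub> B"
proof
  fix x assume "x \<in> B"
  moreover have "x = \<zero>\<^bsub>M\<^esub> \<oplus>\<^bsub>M\<^esub> x" using calculation assms(2) by auto
  ultimately show "x \<in> A <+>\<^bsub>M\<^esub> B" using submodule_zero[OF assms(1)] unfolding in_set_add by blast
qed

lemma list_smult_closed:
  assumes "set ys \<subseteq> carrier R" "U \<subseteq> carrier M"
  shows "list_smult M ys U \<subseteq> carrier M"
  using assms by (induction ys) auto

lemma submodule_list_smult:
  assumes "set ys \<subseteq> carrier R" "submodule U R M"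
  shows "submodule (list_smult M ys U) R M"
  using assms(1)
proof (induction ys)
  case Nil
  then show ?case by (simp add: submodule_singleton_zero)
next
  case (Cons y ys)
  have y: "y \<in> carrier R" using Cons.prems by simp
  note U = submodule_zero[OF assms(2)] submodule_add[OF assms(2)] submodule_smult[OF assms(2)]
    submodule_carrier[OF assms(2)]
  have "submodule ((\<lambda>x. y \<odot>\<^bsub>M\<^esub> x) ` U) R M"
    unfolding submodule_iff
  proof (intro conjI ballI)
    show "(\<lambda>x. y \<odot>\<^bsub>M\<^esub> x) ` U \<subseteq> carrier M" using y U(4) by blast
    show "\<zero>\<^bsub>M\<^esub> \<in> (\<lambda>x. y \<odot>\<^bsub>M\<^esub> x) ` U" using y U(1) by (metis image_eqI smult_r_null)
    fix u assume "u \<in> (\<lambda>x. y \<odot>\<^bsub>M\<^esub> x) ` U"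
    then obtain x where x: "x \<in> U" "u = y \<odot>\<^bsub>M\<^esub> x" by blast
    { fix v assume "v \<in> (\<lambda>x. y \<odot>\<^bsub>M\<^esub> x) ` U"
      then obtain x' where x': "x' \<in> U" "v = y \<odot>\<^bsub>M\<^esub> x'" by blast
      have "u \<oplus>\<^bsub>M\<^esub> v = y \<odot>\<^bsub>M\<^esub> (x \<oplus>\<^bsub>M\<^esub> x')" using x x' y U(4) smult_r_distr by simp
      then show "u \<oplus>\<^bsub>M\<^esub> v \<in> (\<lambda>x. y \<odot>\<^bsub>M\<^esub> x) ` U" using U(2) x x' by blast }
    fix a assume a: "a \<in> carrier R"
    have "a \<odot>\<^bsub>M\<^esub> u = y \<odot>\<^bsub>M\<^esub> (a \<odot>\<^bsub>M\<^esub> x)" using x y a U(4) smult_left_commute by simp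
    then show "a \<odot>\<^bsub>M\<^esub> u \<in> (\<lambda>x. y \<odot>\<^bsub>M\<^esub> x) ` U" using U(3) x a by blast
  qed
  moreover have "list_smult M (y # ys) U = (\<lambda>x. y \<odot>\<^bsub>M\<^esub> x) ` U <+>\<^bsub>M\<^esub> list_smult M ys U"
    by (auto simp: in_set_add) blast+
  ultimately show ?case using Cons submodule_set_add by simp
qed

lemma list_smult_incl:
  assumes "set ys \<subseteq> carrier R" "submodule U R M" "y \<in> set ys" "x \<in> U"
  shows "y \<odot>\<^bsub>M\<^esub> x \<in> list_smult M ys U"
  using assms(1,3)
proof (induction ys)
  case (Cons a ys)
  note x = submodule_carrier[OF assms(2,4)]
  have s: "submodule (list_smult M ys U) R M" using Cons submodule_list_smult assms(2) by simp
  show ?case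
  proof (cases "y = a")
    case True
    have "y \<odot>\<^bsub>M\<^esub> x = a \<odot>\<^bsub>M\<^esub> x \<oplus>\<^bsub>M\<^esub> \<zero>\<^bsub>M\<^esub>" using x True Cons.prems by simp
    then show ?thesis using submodule_zero[OF s] assms(4) by auto
  next
    case False
    then have "y \<odot>\<^bsub>M\<^esub> x \<in> list_smult M ys U" using Cons by simp
    moreover have "y \<odot>\<^bsub>M\<^esub> x = a \<odot>\<^bsub>M\<^esub> \<zero>\<^bsub>M\<^esub> \<oplus>\<^bsub>M\<^esub> y \<odot>\<^bsub>M\<^esub> x" using x Cons.prems by auto
    ultimately show ?thesis using submodule_zero[OF assms(2)] by auto
  qed
qed simp

lemma list_smult_least:
  assumes "\<zero>\<^bsub>M\<^esub> \<in> W" "\<And>x y. x \<in> W \<Longrightarrow> y \<in> W \<Longrightarrow> x \<oplus>\<^bsub>M\<^esub> y \<in> W"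
    "\<And>y x. y \<in> set ys \<Longrightarrow> x \<in> U \<Longrightarrow> y \<odot>\<^bsub>M\<^esub> x \<in> W"
  shows "list_smult M ys U \<subseteq> W"
  using assms(3) by (induction ys) (auto simp: assms(1) intro!: assms(2))

lemma list_smult_mono: "U \<subseteq> Y \<Longrightarrow> list_smult M ys U \<subseteq> list_smult M ys Y"
  by (induction ys) auto

lemma submodule_list_pow:
  assumes "set ys \<subseteq> carrier R" "submodule U R M"
  shows "submodule (list_pow_smult M ys n U) R M"
  by (induction n) (simp_all add: assms submodule_list_smult)

lemma list_pow_mono: "U \<subseteq> Y \<Longrightarrow> list_pow_smult M ys n U \<subseteq> list_pow_smult M ys n Y"
  by (induction n) (simp_all add: list_smult_mono)

lemma list_pow_add: "list_pow_smult M ys (m + n) U = list_pow_smult M ys m (list_pow_smult M ys n U)"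
  by (induction m) auto

lemma nat_pow_smult_Suc:
  "y \<in> carrier R \<Longrightarrow> x \<in> carrier M \<Longrightarrow> (y [^] Suc i) \<odot>\<^bsub>M\<^esub> x = y \<odot>\<^bsub>M\<^esub> ((y [^] i) \<odot>\<^bsub>M\<^esub> x)"
  by (metis R.nat_pow_Suc2 smult_assoc1 R.nat_pow_closed)

end

section \<open>Linear maps: images and preimages of submodules\<close>

locale module_map = M: module R M + N: module R N
  for R :: "('a, 'c) ring_scheme" (structure) and M :: "('a, 'b, 'd) module_scheme"
    and N :: "('a, 'e, 'f) module_scheme" +
  fixes h
  assumes linear: "linear_map R M N h"
begin

lemma closed [simp, intro]: "x \<in> carrier M \<Longrightarrow> h x \<in> carrier N"
  and add: "x \<in> carrier M \<Longrightarrow> y \<in> carrier M \<Longrightarrow> h (x \<oplus>\<^bsub>M\<^esub> y) = h x \<oplus>\<^bsub>N\<^esub> h y"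
  and smult: "a \<in> carrier R \<Longrightarrow> x \<in> carrier M \<Longrightarrow> h (a \<odot>\<^bsub>M\<^esub> x) = a \<odot>\<^bsub>N\<^esub> h x"
  using linear unfolding linear_map_def by auto

lemma zero [simp]: "h \<zero>\<^bsub>M\<^esub> = \<zero>\<^bsub>N\<^esub>"
  by (metis M.zero_closed M.smult_l_null N.smult_l_null M.R.zero_closed closed smult)

lemma uminus: "x \<in> carrier M \<Longrightarrow> h (\<ominus>\<^bsub>M\<^esub> x) = \<ominus>\<^bsub>N\<^esub> h x"
  by (simp add: M.uminus_eq_smult N.uminus_eq_smult smult)

lemma minus: "x \<in> carrier M \<Longrightarrow> y \<in> carrier M \<Longrightarrow> h (x \<ominus>\<^bsub>M\<^esub> y) = h x \<ominus>\<^bsub>N\<^esub> h y"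
  by (simp add: M.M.minus_eq N.M.minus_eq add uminus)

lemma submodule_image:
  assumes "submodule W R M"
  shows "submodule (h ` W) R N"
proof -
  note U = M.submodule_zero[OF assms] M.submodule_add[OF assms] M.submodule_smult[OF assms]
    M.submodule_carrier[OF assms]
  show ?thesis unfolding N.submodule_iff
  proof (intro conjI ballI)
    show "h ` W \<subseteq> carrier N" using U(4) by blast
    show "\<zero>\<^bsub>N\<^esub> \<in> h ` W" using U(1) by (metis image_eqI zero)
    fix u assume "u \<in> h ` W"
    then obtain x where x: "x \<in> W" "u = h x" by blast
    { fix v assume "v \<in> h ` W"
      then obtain x' where x': "x' \<in> W" "v = h x'" by blast
      have "u \<oplus>\<^bsub>N\<^esub> v = h (x \<oplus>\<^bsub>M\<^esub> x')" using x x' U(4) add by simp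
      then show "u \<oplus>\<^bsub>N\<^esub> v \<in> h ` W" using U(2) x x' by blast }
    fix a assume a: "a \<in> carrier R"
    have "a \<odot>\<^bsub>N\<^esub> u = h (a \<odot>\<^bsub>M\<^esub> x)" using x a U(4) smult by simp
    then show "a \<odot>\<^bsub>N\<^esub> u \<in> h ` W" using U(3) x a by blast
  qed
qed

lemma submodule_preimage:
  assumes "submodule W R N"
  shows "submodule {x \<in> carrier M. h x \<in> W} R M"
  using assms unfolding N.submodule_iff M.submodule_iff by (auto simp: add smult)

lemma image_list_smult:
  assumes "set ys \<subseteq> carrier R" "U \<subseteq> carrier M"
  shows "h ` list_smult M ys U = list_smult N ys (h ` U)"
  using assms(1)
proof (induction ys)
  case (Cons y ys)
  have c: "x \<in> carrier M" if "x \<in> list_smult M ys U" for x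
    using that subsetD[OF M.list_smult_closed[OF _ assms(2), of ys]] Cons.prems by simp
  have y: "y \<in> carrier R" using Cons.prems by simp
  have eq: "h (y \<odot>\<^bsub>M\<^esub> x \<oplus>\<^bsub>M\<^esub> w) = y \<odot>\<^bsub>N\<^esub> h x \<oplus>\<^bsub>N\<^esub> h w" if "x \<in> U" "w \<in> list_smult M ys U" for x w
    using add[of "y \<odot>\<^bsub>M\<^esub> x" w] smult[of y x] that y c[OF that(2)] assms(2) by auto
  have IH: "h ` list_smult M ys U = list_smult N ys (h ` U)" using Cons by simp
  show ?case unfolding list_smult.simps IH[symmetric] using eq by (auto simp: image_iff) metis+
qed simp

lemma image_list_pow:
  assumes "set ys \<subseteq> carrier R" "submodule U R M"
  shows "h ` list_pow_smult M ys n U = list_pow_smult N ys n (h ` U)"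
  by (induction n)
    (simp_all add: image_list_smult[OF assms(1) M.submodule_subset[OF M.submodule_list_pow[OF assms]]])

end

text \<open>A chain is pulled back along \<open>h\<close>; as \<open>h\<close> is onto, each member
  is the image of its preimage, so the chain is stationary when the preimages are.\<close>

lemma noetherian_module_surj:
  assumes "module_map R M N h" "h ` carrier M = carrier N" "noetherian_module R M"
  shows "noetherian_module R N"
  unfolding noetherian_module_def acc_def
proof (intro allI impI)
  interpret module_map R M N h by fact
  fix W :: "nat \<Rightarrow> _" assume W: "range W \<subseteq> {W. submodule W R N} \<and> mono W"
  define V where "V j = {x \<in> carrier M. h x \<in> W j}" for j
  have sub: "submodule (W j) R N" for j using W by (simp add: image_subset_iff)
  have V: "V j \<in> {W. submodule W R M}" for j
    unfolding V_def using submodule_preimage[OF sub] by simp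
  have "W j \<subseteq> W (Suc j)" for j using W by (simp add: mono_iff_le_Suc)
  then have "V j \<subseteq> V (Suc j)" for j unfolding V_def by blast
  then obtain j0 where j0: "\<And>j. j \<ge> j0 \<Longrightarrow> V j = V j0"
    using accD[of _ V, OF assms(3)[unfolded noetherian_module_def] V] by blast
  have "h ` V j = W j" for j
  proof -
    have "W j \<subseteq> h ` carrier M" using N.submodule_subset[OF sub] assms(2) by simp
    then show ?thesis unfolding V_def by blast
  qed
  then show "\<exists>j0. \<forall>j\<ge>j0. W j = W j0" using j0 by metis
qed

text \<open>The two records may carry different extra fields and so have different types; they can
  only be compared through the fields on which the notion depends.\<close>

lemma submodule_cong:
  fixes M :: "('a, 'b, 'd) module_scheme" and N :: "('a, 'b, 'f) module_scheme"
  assumes "module R M" "module R N" "carrier M = carrier N" "\<zero>\<^bsub>M\<^esub> = \<zero>\<^bsub>N\<^esub>" "add M = add N" "smult M = smult N"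
  shows "submodule W R M \<longleftrightarrow> submodule W R N"
  by (simp add: module.submodule_iff[OF assms(1)] module.submodule_iff[OF assms(2)] assms(3-))

lemma module_cong:
  fixes M :: "('a, 'b, 'd) module_scheme" and N :: "('a, 'b, 'f) module_scheme"
  assumes "module R M" "carrier M = carrier N" "\<zero>\<^bsub>M\<^esub> = \<zero>\<^bsub>N\<^esub>" "add M = add N" "smult M = smult N"
  shows "module R N"
proof -
  interpret module R M by fact
  note e = assms(2-)[symmetric]
  have "abelian_group N"
    by (rule abelian_groupI; unfold e) (blast intro: M.a_assoc M.a_comm M.l_zero M.add.l_inv_ex M.add.m_closed M.zero_closed)+
  then show ?thesis
    by (intro moduleI)
      (auto simp flip: assms(2-) simp: R.is_cring smult_l_distr smult_r_distr smult_assoc1)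
qed

section \<open>Finite products\<close>

text \<open>Outside \<open>S\<close> the components are forced to be zero, so that for finite \<open>S\<close> the module
  \<open>graded_free R S \<delta>\<close> is literally a product of shifted copies of \<open>R\<close>.\<close>

definition self_module :: "'a graded_ring \<Rightarrow> ('a, 'a) graded_module" where
  "self_module R = \<lparr>carrier = carrier R, monoid.mult = undefined, one = undefined,
     ring.zero = ring.zero R, ring.add = ring.add R, smult = monoid.mult R,
     grade = (\<lambda>n. if 0 \<le> n then rgrade R (nat n) else {\<zero>\<^bsub>R\<^esub>})\<rparr>"

definition shift_module :: "int \<Rightarrow> ('a, 'b) graded_module \<Rightarrow> ('a, 'b) graded_module" where
  "shift_module d M = M\<lparr>grade := \<lambda>n. grade M (n - d)\<rparr>"

definition prod_module :: "'s set \<Rightarrow> ('s \<Rightarrow> ('a, 'b) graded_module) \<Rightarrow> ('a, 's \<Rightarrow> 'b) graded_module" where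
  "prod_module S A = \<lparr>
     carrier = {f. (\<forall>s\<in>S. f s \<in> carrier (A s)) \<and> (\<forall>s. s \<notin> S \<longrightarrow> f s = \<zero>\<^bsub>A s\<^esub>)},
     monoid.mult = undefined, one = undefined, ring.zero = (\<lambda>s. \<zero>\<^bsub>A s\<^esub>),
     ring.add = (\<lambda>f g s. f s \<oplus>\<^bsub>A s\<^esub> g s), smult = (\<lambda>a f s. a \<odot>\<^bsub>A s\<^esub> f s),
     grade = (\<lambda>n. {f. (\<forall>s\<in>S. f s \<in> carrier (A s)) \<and> (\<forall>s. s \<notin> S \<longrightarrow> f s = \<zero>\<^bsub>A s\<^esub>) \<and>
       (\<forall>s\<in>S. f s \<in> grade (A s) n)})\<rparr>"

lemma self_module_simps [simp]:
  "carrier (self_module R) = carrier R" "\<zero>\<^bsub>self_module R\<^esub> = \<zero>\<^bsub>R\<^esub>"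
  "add (self_module R) = add R" "smult (self_module R) = monoid.mult R"
  by (simp_all add: self_module_def)

lemma shift_module_simps [simp]:
  "carrier (shift_module d M) = carrier M" "\<zero>\<^bsub>shift_module d M\<^esub> = \<zero>\<^bsub>M\<^esub>"
  "add (shift_module d M) = add M" "smult (shift_module d M) = smult M"
  "grade (shift_module d M) n = grade M (n - d)"
  by (simp_all add: shift_module_def)

lemma prod_module_simps [simp]:
  "\<zero>\<^bsub>prod_module S A\<^esub> = (\<lambda>s. \<zero>\<^bsub>A s\<^esub>)"
  "add (prod_module S A) = (\<lambda>f g s. f s \<oplus>\<^bsub>A s\<^esub> g s)"
  "smult (prod_module S A) = (\<lambda>a f s. a \<odot>\<^bsub>A s\<^esub> f s)"
  by (simp_all add: prod_module_def)

lemma prod_module_carrier: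
  "f \<in> carrier (prod_module S A) \<longleftrightarrow> (\<forall>s\<in>S. f s \<in> carrier (A s)) \<and> (\<forall>s. s \<notin> S \<longrightarrow> f s = \<zero>\<^bsub>A s\<^esub>)"
  by (simp add: prod_module_def)

lemma prod_module_grade:
  "f \<in> grade (prod_module S A) n \<longleftrightarrow> f \<in> carrier (prod_module S A) \<and> (\<forall>s\<in>S. f s \<in> grade (A s) n)"
  by (auto simp add: prod_module_def)

lemma with_grade_simps [simp]:
  "carrier (with_grade M g) = carrier M" "\<zero>\<^bsub>with_grade M g\<^esub> = \<zero>\<^bsub>M\<^esub>"
  "add (with_grade M g) = add M" "smult (with_grade M g) = smult M"
  "grade (with_grade M g) = g"
  by (simp_all add: with_grade_def)

text \<open>For finite \<open>S\<close> the condition of finite support is automatic, and the case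
  distinction on \<open>\<delta> s \<le> n\<close> matches the zero components of
  \<open>self_module\<close> in negative degrees. The two sides are equal as records, so facts on
  products reach the terms of a resolution by rewriting.\<close>

lemma graded_free_eq_prod:
  fixes R :: "'a graded_ring"
  assumes "finite S" "\<And>n. rgrade R n \<subseteq> carrier R" "\<zero>\<^bsub>R\<^esub> \<in> carrier R"
  shows "graded_free R S \<delta> = prod_module S (\<lambda>s. shift_module (\<delta> s) (self_module R))"
proof -
  have fin: "finite {s. f s \<noteq> \<zero>\<^bsub>R\<^esub>}" if "\<forall>s. s \<notin> S \<longrightarrow> f s = \<zero>\<^bsub>R\<^esub>" for f
    by (rule finite_subset[OF _ assms(1)]) (use that in auto)
  have c: "(\<forall>s. f s \<in> carrier R) \<and> (\<forall>s. s \<notin> S \<longrightarrow> f s = \<zero>\<^bsub>R\<^esub>) \<and> finite {s. f s \<noteq> \<zero>\<^bsub>R\<^esub>} \<longleftrightarrow>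
    (\<forall>s\<in>S. f s \<in> carrier R) \<and> (\<forall>s. s \<notin> S \<longrightarrow> f s = \<zero>\<^bsub>R\<^esub>)" for f
    using fin assms(3) by metis
  have C: "carrier (free_module R S) = {f. (\<forall>s\<in>S. f s \<in> carrier R) \<and> (\<forall>s. s \<notin> S \<longrightarrow> f s = \<zero>\<^bsub>R\<^esub>)}"
    by (simp add: free_module_def c)
  have G: "{f \<in> carrier (free_module R S). \<forall>s\<in>S.
        if \<delta> s \<le> n then f s \<in> rgrade R (nat (n - \<delta> s)) else f s = \<zero>\<^bsub>R\<^esub>} =
     {f. (\<forall>s\<in>S. f s \<in> carrier R) \<and> (\<forall>s. s \<notin> S \<longrightarrow> f s = \<zero>\<^bsub>R\<^esub>) \<and>
        (\<forall>s\<in>S. f s \<in> grade (shift_module (\<delta> s) (self_module R)) n)}" for n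
    unfolding C by (auto simp: self_module_def split: if_splits)
  show ?thesis
    unfolding graded_free_def with_grade_def prod_module_def G
    by (simp add: C) (simp add: free_module_def)
qed


lemma module_shift_module: "module R M \<Longrightarrow> module R (shift_module d M)"
  by (erule module_cong) simp_all

lemma module_with_grade: "module R M \<Longrightarrow> module R (with_grade M g)"
  by (erule module_cong) simp_all

lemma module_self:
  fixes R :: "'a graded_ring"
  assumes "cring R"
  shows "module R (self_module R)"
proof -
  interpret cring R by fact
  have "abelian_group (self_module R)"
    by (rule abelian_groupI) (auto simp: a_ac intro: add.l_inv_ex)
  then show ?thesis
    by (intro moduleI) (auto simp: l_distr r_distr m_assoc assms)
qed

lemma submodule_self_iff:
  fixes R :: "'a graded_ring"
  assumes "cring R"
  shows "submodule W R (self_module R) \<longleftrightarrow> ideal W R"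
proof -
  interpret cring R by fact
  interpret S: module R "self_module R" using module_self assms .
  show ?thesis
  proof
    assume "submodule W R (self_module R)"
    then have W: "W \<subseteq> carrier R" "\<zero>\<^bsub>R\<^esub> \<in> W" "\<And>x y. x \<in> W \<Longrightarrow> y \<in> W \<Longrightarrow> x \<oplus>\<^bsub>R\<^esub> y \<in> W"
      "\<And>a x. a \<in> carrier R \<Longrightarrow> x \<in> W \<Longrightarrow> a \<otimes>\<^bsub>R\<^esub> x \<in> W"
      by (auto simp: S.submodule_iff)
    have "\<ominus>\<^bsub>R\<^esub> x \<in> W" if "x \<in> W" for x
      using W(4)[of "\<ominus>\<^bsub>R\<^esub> \<one>\<^bsub>R\<^esub>" x] that W(1) by (auto simp: l_minus)
    then have "subgroup W (add_monoid R)"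
      using W by (intro add.subgroupI) (auto simp: a_inv_def)
    moreover have "x \<otimes>\<^bsub>R\<^esub> a \<in> W" if "x \<in> W" "a \<in> carrier R" for x a
      using W(4)[OF that(2,1)] m_comm[OF that(2)] subsetD[OF W(1) that(1)] by simp
    ultimately show "ideal W R" using W(4) ring_axioms by (intro idealI) auto
  next
    assume "ideal W R"
    then interpret I: ideal W R .
    show "submodule W R (self_module R)"
      unfolding S.submodule_iff using I.a_subset I.I_l_closed by (auto simp: I.zero_closed)
  qed
qed

text \<open>In a Noetherian ring a nonempty chain of ideals contains its union; the member equal to
  the union is where the chain stops.\<close>

lemma noetherian_self_module:
  fixes R :: "'a graded_ring"
  assumes "cring R" "noetherian_ring R"
  shows "noetherian_module R (self_module R)"
  unfolding noetherian_module_def acc_def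
proof (intro allI impI)
  fix W :: "nat \<Rightarrow> 'a set" assume W: "range W \<subseteq> {W. submodule W R (self_module R)} \<and> mono W"
  then have "range W \<subseteq> {I. ideal I R}" using submodule_self_iff[OF assms(1)] by auto
  moreover have "subset.chain {I. ideal I R} (range W)"
    unfolding subset_chain_def
  proof (intro conjI ballI)
    fix A B assume "A \<in> range W" "B \<in> range W"
    then obtain i j where "A = W i" "B = W j" by blast
    then show "A \<subseteq> B \<or> B \<subseteq> A" using W nat_le_linear[of i j] unfolding mono_def by metis
  qed (rule calculation)
  ultimately have "\<Union>(range W) \<in> range W"
    using noetherian_ring.ideal_chain_is_trivial[OF assms(2), of "range W"] by blast
  then obtain j0 where "\<Union>(range W) = W j0" by auto
  then have "W j = W j0" if "j \<ge> j0" for j using that W unfolding mono_def by blast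
  then show "\<exists>j0. \<forall>j\<ge>j0. W j = W j0" by blast
qed

lemma prod_module_abelian_group:
  assumes "\<And>s. abelian_group (A s)"
  shows "abelian_group (prod_module S A)"
proof (rule abelian_groupI)
  interpret A: abelian_group "A s" for s by (rule assms)
  show "x \<oplus>\<^bsub>prod_module S A\<^esub> y \<in> carrier (prod_module S A)"
    if "x \<in> carrier (prod_module S A)" "y \<in> carrier (prod_module S A)" for x y
    using that by (simp add: prod_module_carrier)
  show "\<zero>\<^bsub>prod_module S A\<^esub> \<in> carrier (prod_module S A)" by (simp add: prod_module_carrier)
  have c: "x s \<in> carrier (A s)" if "x \<in> carrier (prod_module S A)" for x s
    using that unfolding prod_module_carrier by (cases "s \<in> S") auto
  show "x \<oplus>\<^bsub>prod_module S A\<^esub> y \<oplus>\<^bsub>prod_module S A\<^esub> z =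
    x \<oplus>\<^bsub>prod_module S A\<^esub> (y \<oplus>\<^bsub>prod_module S A\<^esub> z)"
    if "x \<in> carrier (prod_module S A)" "y \<in> carrier (prod_module S A)" "z \<in> carrier (prod_module S A)" for x y z
    using that[THEN c] by (simp add: A.a_assoc)
  show "x \<oplus>\<^bsub>prod_module S A\<^esub> y = y \<oplus>\<^bsub>prod_module S A\<^esub> x"
    if "x \<in> carrier (prod_module S A)" "y \<in> carrier (prod_module S A)" for x y
    using that[THEN c] by (simp add: A.a_comm)
  show "\<zero>\<^bsub>prod_module S A\<^esub> \<oplus>\<^bsub>prod_module S A\<^esub> x = x" if "x \<in> carrier (prod_module S A)" for x
    using that[THEN c] by simp
  show "\<exists>y\<in>carrier (prod_module S A). y \<oplus>\<^bsub>prod_module S A\<^esub> x = \<zero>\<^bsub>prod_module S A\<^esub>"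
    if "x \<in> carrier (prod_module S A)" for x
    by (rule bexI[of _ "\<lambda>s. \<ominus>\<^bsub>A s\<^esub> x s"]) (use that c[OF that] in \<open>auto simp: A.l_neg prod_module_carrier\<close>)
qed

lemma module_prod:
  fixes R :: "('a, 'c) ring_scheme"
  assumes "\<And>s. module R (A s)"
  shows "module R (prod_module S A)"
proof -
  interpret A: module R "A s" for s by (rule assms)
  have c: "x s \<in> carrier (A s)" if "x \<in> carrier (prod_module S A)" for x s
    using that unfolding prod_module_carrier by (cases "s \<in> S") auto
  show ?thesis
  proof (rule moduleI)
    show "cring R" by (rule A.R.is_cring)
    show "abelian_group (prod_module S A)" using prod_module_abelian_group A.abelian_group_axioms by blast
    show "a \<odot>\<^bsub>prod_module S A\<^esub> x \<in> carrier (prod_module S A)"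
      if "a \<in> carrier R" "x \<in> carrier (prod_module S A)" for a x
      using that by (simp add: prod_module_carrier A.smult_r_null)
  qed (auto simp: A.smult_l_distr A.smult_r_distr A.smult_assoc1 c)
qed

lemma prod_module_component:
  assumes "\<And>s. module R (A s)" "f \<in> carrier (prod_module S A)"
  shows "f s \<in> carrier (A s)"
proof -
  interpret module R "A s" by (rule assms)
  show ?thesis using assms(2) unfolding prod_module_carrier by (cases "s \<in> S") auto
qed

text \<open>The abstract form of the argument for extensions: if two monotone invariants satisfy the
  chain condition and jointly detect equality of comparable elements, a chain stops once both
  invariants have stopped.\<close>

lemma acc_sandwich:
  assumes "acc C1" "acc C2" "mono f" "mono g" "\<And>w. w \<in> C \<Longrightarrow> f w \<in> C1 \<and> g w \<in> C2"
    and eq: "\<And>v w. v \<in> C \<Longrightarrow> w \<in> C \<Longrightarrow> v \<le> w \<Longrightarrow> f v = f w \<Longrightarrow> g v = g w \<Longrightarrow> v = w"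
  shows "acc C"
  unfolding acc_def
proof (intro allI impI)
  fix W :: "nat \<Rightarrow> _" assume W: "range W \<subseteq> C \<and> mono W"
  then have WC: "W j \<in> C" for j by blast
  have le: "W j \<le> W (Suc j)" for j using W by (simp add: mono_iff_le_Suc)
  obtain a where a: "\<And>j. j \<ge> a \<Longrightarrow> f (W j) = f (W a)"
    by (rule accD[OF assms(1), of "\<lambda>j. f (W j)"]) (use WC le assms monoD in blast)+
  obtain b where b: "\<And>j. j \<ge> b \<Longrightarrow> g (W j) = g (W b)"
    by (rule accD[OF assms(2), of "\<lambda>j. g (W j)"]) (use WC le assms monoD in blast)+
  have "W (max a b) = W j" if "j \<ge> max a b" for j
    using that a[of j] b[of j] a[of "max a b"] b[of "max a b"] W
    by (intro eq WC) (auto simp: mono_def)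
  then show "\<exists>j0. \<forall>j\<ge>j0. W j = W j0" by metis
qed

lemma acc_subset_singleton: "C \<subseteq> {a} \<Longrightarrow> acc C"
  unfolding acc_def by (metis rangeI singletonD subsetD)

text \<open>Adding an index \<open>s0\<close> gives an extension of \<open>A s0\<close> by the
  smaller product, which is literally the kernel of evaluation at \<open>s0\<close> because absent
  coordinates are zero. A submodule inside a larger one is then recognised by its part in the kernel
  and its image.\<close>

lemma noetherian_prod_module:
  assumes "finite (S :: 's set)" "\<And>s. module R (A s :: ('a, 'b) graded_module)" "\<And>s. s \<in> S \<Longrightarrow> noetherian_module R (A s)"
  shows "noetherian_module R (prod_module S A)"
  using assms(1,3)
proof (induction S)
  case empty
  interpret P: module R "prod_module {} A" using assms(2) by (rule module_prod)
  have eq: "W = {\<zero>\<^bsub>prod_module {} A\<^esub>}" if "submodule W R (prod_module {} A)" for W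
    using P.submodule_zero[OF that] P.submodule_subset[OF that] by (auto simp: prod_module_def)
  have "{W. submodule W R (prod_module {} A)} \<subseteq> {{\<zero>\<^bsub>prod_module {} A\<^esub>}}"
  proof
    fix W assume "W \<in> {W. submodule W R (prod_module {} A)}"
    then show "W \<in> {{\<zero>\<^bsub>prod_module {} A\<^esub>}}" unfolding mem_Collect_eq by (subst eq[of W]) simp_all
  qed
  then show ?case unfolding noetherian_module_def by (rule acc_subset_singleton)
next
  case (insert s0 S)
  interpret A: module R "A s" for s by (rule assms)
  interpret P: module R "prod_module S A" using assms(2) by (rule module_prod)
  interpret P': module R "prod_module (insert s0 S) A" using assms(2) by (rule module_prod)
  note comp = prod_module_component[OF assms(2)]
  define f1 :: "('s \<Rightarrow> 'b) set \<Rightarrow> _" where "f1 W = {f \<in> W. f s0 = \<zero>\<^bsub>A s0\<^esub>}" for W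
  define f2 :: "('s \<Rightarrow> 'b) set \<Rightarrow> _" where "f2 W = (\<lambda>f. f s0) ` W" for W
  have m: "module_map R (prod_module (insert s0 S) A) (A s0) (\<lambda>f. f s0)"
    by (intro module_map.intro module_map_axioms.intro P'.module_axioms' A.module_axioms')
      (auto simp: linear_map_def intro: comp)
  have iff: "f \<in> carrier (prod_module S A) \<longleftrightarrow> f \<in> carrier (prod_module (insert s0 S) A) \<and> f s0 = \<zero>\<^bsub>A s0\<^esub>" for f
    using insert.hyps by (auto simp: prod_module_carrier)
  have "acc {W. submodule W R (prod_module (insert s0 S) A)}"
  proof (rule acc_sandwich)
    show "acc {W. submodule W R (prod_module S A)}" using insert unfolding noetherian_module_def by blast
    show "acc {W. submodule W R (A s0)}" using insert unfolding noetherian_module_def by blast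
    show "mono f1" "mono f2" unfolding f1_def f2_def mono_def by auto
  next
    fix W assume "W \<in> {W. submodule W R (prod_module (insert s0 S) A)}"
    then have W: "submodule W R (prod_module (insert s0 S) A)" by simp
    have "submodule (f1 W) R (prod_module S A)"
      using W unfolding P.submodule_iff P'.submodule_iff f1_def by (auto simp: iff subset_iff)
    then show "f1 W \<in> {W. submodule W R (prod_module S A)} \<and> f2 W \<in> {W. submodule W R (A s0)}"
      using module_map.submodule_image[OF m W] unfolding f2_def by simp
  next
    fix V W assume "V \<in> {W. submodule W R (prod_module (insert s0 S) A)}"
      "W \<in> {W. submodule W R (prod_module (insert s0 S) A)}" and VW: "V \<subseteq> W" "f1 V = f1 W" "f2 V = f2 W"
    then have V: "submodule V R (prod_module (insert s0 S) A)" and W: "submodule W R (prod_module (insert s0 S) A)" by auto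
    interpret m: module_map R "prod_module (insert s0 S) A" "A s0" "\<lambda>f. f s0" by (rule m)
    have "f \<in> V" if f: "f \<in> W" for f
    proof -
      have "f s0 \<in> f2 V" using VW f unfolding f2_def by blast
      then obtain g where g: "g \<in> V" "g s0 = f s0" unfolding f2_def by (metis imageE)
      have c: "f \<in> carrier (prod_module (insert s0 S) A)" "g \<in> carrier (prod_module (insert s0 S) A)"
        using f g V W P'.submodule_carrier by blast+
      have "f \<ominus>\<^bsub>prod_module (insert s0 S) A\<^esub> g \<in> W" using P'.submodule_minus[OF W] f g VW by blast
      moreover have "(f \<ominus>\<^bsub>prod_module (insert s0 S) A\<^esub> g) s0 = \<zero>\<^bsub>A s0\<^esub>"
        using m.minus[OF c] g m.closed[OF c(1)] by (simp add: A.M.minus_eq A.M.r_neg)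
      ultimately have "f \<ominus>\<^bsub>prod_module (insert s0 S) A\<^esub> g \<in> V" using VW unfolding f1_def by blast
      then show ?thesis using P'.submodule_diffD[OF V _ g(1) c(1)] by blast
    qed
    then show "V = W" using VW by blast
  qed
  then show ?case unfolding noetherian_module_def .
qed

section \<open>The Hilbert basis theorem for families of submodules\<close>

context module
begin

text \<open>A family of submodules \<open>W n\<close> with \<open>y (W n) \<subseteq> W (n + 1)\<close> for all \<open>y\<close> in \<open>ys\<close> plays the role
  of a graded submodule of the polynomial module over \<open>M\<close> in the variables \<open>ys\<close>.\<close>

definition rees_family :: "'a list \<Rightarrow> (nat \<Rightarrow> 'c set) \<Rightarrow> bool" where
  "rees_family ys W \<longleftrightarrow> (\<forall>n. submodule (W n) R M) \<and>
     (\<forall>y\<in>set ys. \<forall>n. \<forall>x\<in>W n. y \<odot>\<^bsub>M\<^esub> x \<in> W (Suc n))"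

text \<open>\<open>deg_le G y i m = \<Sum>\<^sub>j\<^sub>\<le>\<^sub>i y\<^sup>j G (m + i - j)\<close>: the forms of degree \<open>m + i\<close> that have degree at
  most \<open>i\<close> in the last variable \<open>y\<close>.\<close>

primrec deg_le :: "(nat \<Rightarrow> 'c set) \<Rightarrow> 'a \<Rightarrow> nat \<Rightarrow> nat \<Rightarrow> 'c set" where
  "deg_le G y 0 m = G m"
| "deg_le G y (Suc i) m = {(y [^] Suc i) \<odot>\<^bsub>M\<^esub> g \<oplus>\<^bsub>M\<^esub> r | g r. g \<in> G m \<and> r \<in> deg_le G y i (Suc m)}"

text \<open>Forms of degree \<open>n\<close> in \<open>ys\<close> with coefficients in
  \<open>M\<close>, evaluated in \<open>M\<close>. Without variables there are only constants, hence
  zero in positive degree. Containment in \<open>forms\<close> replaces containment in the Rees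
  module.\<close>

primrec forms :: "'a list \<Rightarrow> nat \<Rightarrow> 'c set" where
  "forms [] n = (if n = 0 then carrier M else {\<zero>\<^bsub>M\<^esub>})"
| "forms (y # ys) n = deg_le (forms ys) y n 0"

text \<open>Forms of total degree \<open>m + i\<close> whose degree in \<open>y\<close> is strictly
  below \<open>i\<close>: the possible remainders after a term in \<open>y [^] i\<close>. For
  \<open>i = 0\<close> nothing lies below, hence the separate case.\<close>

definition low_deg :: "(nat \<Rightarrow> 'c set) \<Rightarrow> 'a \<Rightarrow> nat \<Rightarrow> nat \<Rightarrow> 'c set" where
  "low_deg G y i m = (case i of 0 \<Rightarrow> {\<zero>\<^bsub>M\<^esub>} | Suc k \<Rightarrow> deg_le G y k (Suc m))"

lemma rees_familyD:
  "rees_family ys W \<Longrightarrow> submodule (W n) R M"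
  "rees_family ys W \<Longrightarrow> y \<in> set ys \<Longrightarrow> x \<in> W n \<Longrightarrow> y \<odot>\<^bsub>M\<^esub> x \<in> W (Suc n)"
  by (auto simp: rees_family_def)

lemma submodule_smult_image:
  assumes "y \<in> carrier R" "submodule U R M"
  shows "submodule ((\<lambda>x. y \<odot>\<^bsub>M\<^esub> x) ` U) R M"
proof -
  have "module_map R M M (\<lambda>x. y \<odot>\<^bsub>M\<^esub> x)"
    by unfold_locales (use assms in \<open>auto simp: linear_map_def smult_r_distr smult_left_commute\<close>)
  then show ?thesis using module_map.submodule_image assms(2) by blast
qed

lemma submodule_deg_le:
  assumes "y \<in> carrier R" "\<And>m. submodule (G m) R M"
  shows "submodule (deg_le G y i m) R M"
proof (induction i arbitrary: m)
  case (Suc i)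
  have "deg_le G y (Suc i) m = (\<lambda>x. (y [^] Suc i) \<odot>\<^bsub>M\<^esub> x) ` G m <+>\<^bsub>M\<^esub> deg_le G y i (Suc m)"
    by (auto simp: in_set_add) blast+
  then show ?case using submodule_set_add[OF submodule_smult_image Suc] assms by simp
qed (simp add: assms)

lemma deg_le_mult_last:
  assumes "y \<in> carrier R" "\<And>m. submodule (G m) R M" "x \<in> deg_le G y i m"
  shows "y \<odot>\<^bsub>M\<^esub> x \<in> deg_le G y (Suc i) m"
  using assms(3)
proof (induction i arbitrary: m x)
  case 0
  have "y \<odot>\<^bsub>M\<^esub> x = (y [^] Suc 0) \<odot>\<^bsub>M\<^esub> x \<oplus>\<^bsub>M\<^esub> \<zero>\<^bsub>M\<^esub>"
    using assms(1) 0 submodule_carrier[OF assms(2)] by simp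
  then show ?case using 0 submodule_zero[OF assms(2)] by auto
next
  case (Suc i)
  then obtain g r where gr: "g \<in> G m" "r \<in> deg_le G y i (Suc m)" "x = (y [^] Suc i) \<odot>\<^bsub>M\<^esub> g \<oplus>\<^bsub>M\<^esub> r" by auto
  have c: "g \<in> carrier M" "r \<in> carrier M"
    using gr submodule_carrier submodule_deg_le[of y G] assms by blast+
  have "y \<odot>\<^bsub>M\<^esub> x = (y [^] Suc (Suc i)) \<odot>\<^bsub>M\<^esub> g \<oplus>\<^bsub>M\<^esub> y \<odot>\<^bsub>M\<^esub> r"
    unfolding gr(3) using c assms(1) nat_pow_smult_Suc[of y g "Suc i"]
    by (simp add: smult_r_distr del: R.nat_pow_Suc)
  then show ?case using Suc.IH[OF gr(2)] gr(1) by auto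
qed

lemma deg_le_mult:
  assumes "y \<in> carrier R" "z \<in> carrier R" "\<And>m. submodule (G m) R M"
    "\<And>m x. x \<in> G m \<Longrightarrow> z \<odot>\<^bsub>M\<^esub> x \<in> G (Suc m)" "x \<in> deg_le G y i m"
  shows "z \<odot>\<^bsub>M\<^esub> x \<in> deg_le G y i (Suc m)"
  using assms(5)
proof (induction i arbitrary: m x)
  case (Suc i)
  then obtain g r where gr: "g \<in> G m" "r \<in> deg_le G y i (Suc m)" "x = (y [^] Suc i) \<odot>\<^bsub>M\<^esub> g \<oplus>\<^bsub>M\<^esub> r" by auto
  have c: "g \<in> carrier M" "r \<in> carrier M"
    using gr submodule_carrier submodule_deg_le[of y G] assms by blast+
  have "z \<odot>\<^bsub>M\<^esub> x = (y [^] Suc i) \<odot>\<^bsub>M\<^esub> (z \<odot>\<^bsub>M\<^esub> g) \<oplus>\<^bsub>M\<^esub> z \<odot>\<^bsub>M\<^esub> r"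
    unfolding gr(3) using c assms(1,2) smult_left_commute[of z "y [^] Suc i" g] by (simp add: smult_r_distr)
  then show ?case using Suc.IH[OF gr(2)] assms(4)[OF gr(1)] by auto
qed (simp add: assms)

text \<open>A form of degree at most \<open>i\<close> in \<open>y\<close> also has degree at most
  \<open>i + 1\<close>, with leading coefficient zero; the total degree
  \<open>Suc m + i = m + Suc i\<close> is unchanged.\<close>

lemma deg_le_Suc_m:
  assumes "y \<in> carrier R" "\<And>m. submodule (G m) R M" "x \<in> deg_le G y i (Suc m)"
  shows "x \<in> deg_le G y (Suc i) m"
proof -
  have "x = (y [^] Suc i) \<odot>\<^bsub>M\<^esub> \<zero>\<^bsub>M\<^esub> \<oplus>\<^bsub>M\<^esub> x"
    using submodule_carrier[OF submodule_deg_le[OF assms(1,2)] assms(3)] assms(1) by simp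
  then show ?thesis using submodule_zero[OF assms(2)] assms(3) by auto
qed

lemma rees_family_forms:
  assumes "set ys \<subseteq> carrier R"
  shows "rees_family ys (forms ys)"
  using assms
proof (induction ys)
  case Nil
  then show ?case by (simp add: rees_family_def submodule_singleton_zero carrier_is_submodule)
next
  case (Cons y ys)
  then have G: "rees_family ys (forms ys)" and y: "y \<in> carrier R" by auto
  note s = rees_familyD(1)[OF G]
  show ?case unfolding rees_family_def
  proof (intro conjI allI ballI)
    fix n show "submodule (forms (y # ys) n) R M" using submodule_deg_le y s by simp
  next
    fix z n x assume z: "z \<in> set (y # ys)" and x: "x \<in> forms (y # ys) n"
    show "z \<odot>\<^bsub>M\<^esub> x \<in> forms (y # ys) (Suc n)"
    proof (cases "z = y")
      case True
      then show ?thesis using deg_le_mult_last[of y "forms ys"] y s x by simp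
    next
      case False
      then have z: "z \<in> set ys" "z \<in> carrier R" using z Cons.prems by auto
      \<comment> \<open>Multiplying by another variable raises the total degree but not the degree
        in \<open>y\<close>; the bound on the latter is relaxed afterwards.\<close>
      have "z \<odot>\<^bsub>M\<^esub> x \<in> deg_le (forms ys) y n (Suc 0)"
        by (rule deg_le_mult) (use y z s x rees_familyD(2)[OF G] in auto)
      then show ?thesis using deg_le_Suc_m[of y "forms ys" "z \<odot>\<^bsub>M\<^esub> x" n 0] y s by (simp del: deg_le.simps)
    qed
  qed
qed

lemma list_pow_subset_forms:
  assumes "set ys \<subseteq> carrier R"
  shows "list_pow_smult M ys n (carrier M) \<subseteq> forms ys n"
proof (induction n)
  case 0
  have "forms ys 0 = carrier M" by (induction ys) auto
  then show ?case by simp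
next
  case (Suc n)
  note F = rees_family_forms[OF assms]
  show ?case unfolding list_pow_smult.simps
    by (rule list_smult_least)
      (use rees_familyD[OF F] Suc in \<open>auto intro: submodule_zero submodule_add\<close>)
qed

section \<open>Leading coefficients and the chain condition\<close>

definition lead :: "(nat \<Rightarrow> 'c set) \<Rightarrow> 'a \<Rightarrow> (nat \<Rightarrow> 'c set) \<Rightarrow> nat \<Rightarrow> nat \<Rightarrow> 'c set" where
  "lead G y W i m = {g \<in> G m. \<exists>r\<in>low_deg G y i m. (y [^] i) \<odot>\<^bsub>M\<^esub> g \<oplus>\<^bsub>M\<^esub> r \<in> W (m + i)}"

lemma submodule_low_deg:
  assumes "y \<in> carrier R" "\<And>m. submodule (G m) R M"
  shows "submodule (low_deg G y i m) R M"
  using assms submodule_deg_le submodule_singleton_zero by (simp add: low_deg_def split: nat.split)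

text \<open>Adding forms or multiplying one by a scalar or a variable of \<open>ys\<close> does the
  same to its leading coefficient and keeps the remainder low. For each \<open>i\<close> this yields
  a family in one variable fewer, to which induction applies.\<close>

lemma rees_family_lead:
  assumes y: "y \<in> carrier R" and ys: "set ys \<subseteq> carrier R" and G: "rees_family ys G"
    and W: "rees_family (y # ys) W"
  shows "rees_family ys (lead G y W i)"
  unfolding rees_family_def
proof (intro conjI allI ballI)
  note Gs = rees_familyD(1)[OF G] and Ws = rees_familyD(1)[OF W]
  note L = submodule_low_deg[OF y Gs]
  have yi: "y [^] i \<in> carrier R" using y by simp
  fix m
  show "submodule (lead G y W i m) R M" unfolding submodule_iff
  proof (intro conjI ballI)
    show "lead G y W i m \<subseteq> carrier M" using submodule_subset[OF Gs] unfolding lead_def by auto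
    show "\<zero>\<^bsub>M\<^esub> \<in> lead G y W i m" unfolding lead_def
      using submodule_zero[OF Gs] submodule_zero[OF L] submodule_zero[OF Ws] yi
      by (auto intro!: bexI[of _ "\<zero>\<^bsub>M\<^esub>"])
    fix g assume "g \<in> lead G y W i m"
    then obtain r where g: "g \<in> G m" "r \<in> low_deg G y i m" "(y [^] i) \<odot>\<^bsub>M\<^esub> g \<oplus>\<^bsub>M\<^esub> r \<in> W (m + i)"
      unfolding lead_def by auto
    have c: "g \<in> carrier M" "r \<in> carrier M" using submodule_carrier[OF Gs g(1)] submodule_carrier[OF L g(2)] by blast+
    { fix g' assume "g' \<in> lead G y W i m"
      then obtain r' where g': "g' \<in> G m" "r' \<in> low_deg G y i m" "(y [^] i) \<odot>\<^bsub>M\<^esub> g' \<oplus>\<^bsub>M\<^esub> r' \<in> W (m + i)"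
        unfolding lead_def by auto
      have c': "g' \<in> carrier M" "r' \<in> carrier M" using submodule_carrier[OF Gs g'(1)] submodule_carrier[OF L g'(2)] by blast+
      have "(y [^] i) \<odot>\<^bsub>M\<^esub> (g \<oplus>\<^bsub>M\<^esub> g') \<oplus>\<^bsub>M\<^esub> (r \<oplus>\<^bsub>M\<^esub> r') =
         ((y [^] i) \<odot>\<^bsub>M\<^esub> g \<oplus>\<^bsub>M\<^esub> r) \<oplus>\<^bsub>M\<^esub> ((y [^] i) \<odot>\<^bsub>M\<^esub> g' \<oplus>\<^bsub>M\<^esub> r')"
        using c c' yi by (simp add: smult_r_distr add_ac_swap)
      then show "g \<oplus>\<^bsub>M\<^esub> g' \<in> lead G y W i m" unfolding lead_def
        using g g' submodule_add[OF Gs] submodule_add[OF L] submodule_add[OF Ws]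
        by (auto intro!: bexI[of _ "r \<oplus>\<^bsub>M\<^esub> r'"]) }
    fix a assume a: "a \<in> carrier R"
    have "(y [^] i) \<odot>\<^bsub>M\<^esub> (a \<odot>\<^bsub>M\<^esub> g) \<oplus>\<^bsub>M\<^esub> a \<odot>\<^bsub>M\<^esub> r = a \<odot>\<^bsub>M\<^esub> ((y [^] i) \<odot>\<^bsub>M\<^esub> g \<oplus>\<^bsub>M\<^esub> r)"
      using c yi a smult_left_commute[of a "y [^] i" g] by (simp add: smult_r_distr)
    then show "a \<odot>\<^bsub>M\<^esub> g \<in> lead G y W i m" unfolding lead_def
      using g submodule_smult[OF Gs a] submodule_smult[OF L a] submodule_smult[OF Ws a]
      by (auto intro!: bexI[of _ "a \<odot>\<^bsub>M\<^esub> r"])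
  qed
  fix z g assume z: "z \<in> set ys" and "g \<in> lead G y W i m"
  then obtain r where g: "g \<in> G m" "r \<in> low_deg G y i m" "(y [^] i) \<odot>\<^bsub>M\<^esub> g \<oplus>\<^bsub>M\<^esub> r \<in> W (m + i)"
    unfolding lead_def by auto
  have c: "g \<in> carrier M" "r \<in> carrier M" using submodule_carrier[OF Gs g(1)] submodule_carrier[OF L g(2)] by blast+
  have zc: "z \<in> carrier R" using z ys by blast
  have "(y [^] i) \<odot>\<^bsub>M\<^esub> (z \<odot>\<^bsub>M\<^esub> g) \<oplus>\<^bsub>M\<^esub> z \<odot>\<^bsub>M\<^esub> r = z \<odot>\<^bsub>M\<^esub> ((y [^] i) \<odot>\<^bsub>M\<^esub> g \<oplus>\<^bsub>M\<^esub> r)"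
    using c yi zc smult_left_commute[of z "y [^] i" g] by (simp add: smult_r_distr)
  moreover have "z \<odot>\<^bsub>M\<^esub> r \<in> low_deg G y i (Suc m)"
  proof (cases i)
    case 0
    then show ?thesis using g(2) zc by (simp add: low_deg_def)
  next
    case (Suc k)
    then show ?thesis using g(2) deg_le_mult[where G = G, OF y zc Gs rees_familyD(2)[OF G z]] by (simp add: low_deg_def)
  qed
  ultimately show "z \<odot>\<^bsub>M\<^esub> g \<in> lead G y W i (Suc m)" unfolding lead_def
    using rees_familyD(2)[OF G z g(1)] rees_familyD(2)[OF W _ g(3), of z] z
    by (auto intro!: bexI[of _ "z \<odot>\<^bsub>M\<^esub> r"])
qed

text \<open>Multiplication by \<open>y\<close> keeps the leading coefficient and raises its
  exponent, so the leading families ascend in \<open>i\<close>.\<close>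

lemma lead_Suc:
  assumes y: "y \<in> carrier R" and G: "\<And>m. submodule (G m) R M" and W: "rees_family (y # ys) W"
  shows "lead G y W i m \<subseteq> lead G y W (Suc i) m"
proof
  fix g assume "g \<in> lead G y W i m"
  then obtain r where g: "g \<in> G m" "r \<in> low_deg G y i m" "(y [^] i) \<odot>\<^bsub>M\<^esub> g \<oplus>\<^bsub>M\<^esub> r \<in> W (m + i)"
    unfolding lead_def by auto
  have c: "g \<in> carrier M" "r \<in> carrier M"
    using submodule_carrier[OF G g(1)] submodule_carrier[OF submodule_low_deg g(2)] y G by blast+
  have "(y [^] Suc i) \<odot>\<^bsub>M\<^esub> g \<oplus>\<^bsub>M\<^esub> y \<odot>\<^bsub>M\<^esub> r = y \<odot>\<^bsub>M\<^esub> ((y [^] i) \<odot>\<^bsub>M\<^esub> g \<oplus>\<^bsub>M\<^esub> r)"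
    using c y nat_pow_smult_Suc[of y g i] by (simp add: smult_r_distr del: R.nat_pow_Suc)
  moreover have "y \<odot>\<^bsub>M\<^esub> r \<in> low_deg G y (Suc i) m"
  proof (cases i)
    case 0
    then show ?thesis using g(2) y submodule_zero[OF G] by (simp add: low_deg_def)
  next
    case (Suc k)
    then show ?thesis using g(2) deg_le_mult_last[of y G r k "Suc m"] y G by (simp add: low_deg_def del: deg_le.simps)
  qed
  ultimately show "g \<in> lead G y W (Suc i) m" unfolding lead_def
    using g(1) rees_familyD(2)[OF W _ g(3), of y]
    by (auto intro!: bexI[of _ "y \<odot>\<^bsub>M\<^esub> r"] simp del: R.nat_pow_Suc)
qed

lemma lead_mono: "(\<And>n. W n \<subseteq> W' n) \<Longrightarrow> lead G y W i m \<subseteq> lead G y W' i m"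
  unfolding lead_def by blast

text \<open>Induction on the degree in \<open>y\<close>: an element of \<open>W'\<close> shares its
  leading coefficient with some element of \<open>W\<close>, and their difference has lower degree
  in \<open>y\<close> and is again in \<open>W'\<close>.\<close>

lemma rees_family_eq_if_lead_eq:
  assumes y: "y \<in> carrier R" and ys: "set ys \<subseteq> carrier R"
    and W: "rees_family (y # ys) W" "rees_family (y # ys) W'"
    and le: "\<And>n. W n \<subseteq> W' n" "\<And>n. W' n \<subseteq> forms (y # ys) n"
    and eq: "\<And>i m. lead (forms ys) y W i m = lead (forms ys) y W' i m"
  shows "W n = W' n"
proof -
  note Gs = rees_familyD(1)[OF rees_family_forms[OF ys]]
  have *: "x \<in> W (m + i)" if "x \<in> W' (m + i)" "x \<in> deg_le (forms ys) y i m" for x i m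
    using that
  proof (induction i arbitrary: m x)
    case 0
    have c: "x \<in> carrier M" using 0 submodule_carrier[OF Gs] by simp
    have "x \<in> lead (forms ys) y W' 0 m" using 0 c by (simp add: lead_def low_deg_def)
    then show ?case using c by (simp add: eq[symmetric]) (simp add: lead_def low_deg_def)
  next
    case (Suc i)
    then obtain g r where gr: "g \<in> forms ys m" "r \<in> deg_le (forms ys) y i (Suc m)"
      "x = (y [^] Suc i) \<odot>\<^bsub>M\<^esub> g \<oplus>\<^bsub>M\<^esub> r" by auto
    have "g \<in> lead (forms ys) y W' (Suc i) m"
      using gr Suc.prems(1) by (auto simp: lead_def low_deg_def simp del: R.nat_pow_Suc)
    then obtain r' where r': "r' \<in> deg_le (forms ys) y i (Suc m)"
      "(y [^] Suc i) \<odot>\<^bsub>M\<^esub> g \<oplus>\<^bsub>M\<^esub> r' \<in> W (m + Suc i)"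
      by (auto simp: eq[symmetric] simp del: R.nat_pow_Suc)
        (auto simp: lead_def low_deg_def simp del: R.nat_pow_Suc)
    note D = submodule_deg_le[OF y Gs]
    have c: "g \<in> carrier M" "r \<in> carrier M" "r' \<in> carrier M"
      using submodule_carrier[OF Gs gr(1)] submodule_carrier[OF D gr(2)] submodule_carrier[OF D r'(1)] by blast+
    have u: "(y [^] Suc i) \<odot>\<^bsub>M\<^esub> g \<in> carrier M" using y c by (simp del: R.nat_pow_Suc)
    define v where "v = (y [^] Suc i) \<odot>\<^bsub>M\<^esub> g \<oplus>\<^bsub>M\<^esub> r'"
    have "x \<ominus>\<^bsub>M\<^esub> v = r \<ominus>\<^bsub>M\<^esub> r'" unfolding v_def gr(3)
      using u c by (simp add: M.minus_eq M.minus_add M.a_ac M.r_neg1 M.r_neg2 M.r_neg)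
    moreover have "v \<in> W' (m + Suc i)" using r' le(1) unfolding v_def by blast
    ultimately have "r \<ominus>\<^bsub>M\<^esub> r' \<in> W' (Suc m + i)"
      using submodule_minus[OF rees_familyD(1)[OF W(2)] Suc.prems(1)] by (metis add_Suc_shift)
    then have "r \<ominus>\<^bsub>M\<^esub> r' \<in> W (Suc m + i)" using Suc.IH submodule_minus[OF D gr(2) r'(1)] by blast
    then have "x \<ominus>\<^bsub>M\<^esub> v \<in> W (m + Suc i)" using \<open>x \<ominus>\<^bsub>M\<^esub> v = r \<ominus>\<^bsub>M\<^esub> r'\<close> by (metis add_Suc_shift)
    then show ?case
      using submodule_diffD[OF rees_familyD(1)[OF W(1)] _ r'(2)] u c gr(3) unfolding v_def by auto
  qed
  show ?thesis using *[of _ 0 n] le[of n] by (auto simp: subset_iff)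
qed

text \<open>The stabilisation is first obtained along the diagonal, which leaves finitely many rows.\<close>

lemma double_chain_stable:
  fixes L :: "nat \<Rightarrow> nat \<Rightarrow> 'o::order"
  assumes "acc C" "\<And>i j. L i j \<in> C" "\<And>i j. L i j \<le> L (Suc i) j" "\<And>i j. L i j \<le> L i (Suc j)"
  shows "\<exists>j0. \<forall>i. \<forall>j\<ge>j0. L i j = L i j0"
proof -
  have m: "L i j \<le> L i' j'" if "i \<le> i'" "j \<le> j'" for i j i' j'
    using lift_Suc_mono_le[of "\<lambda>i. L i j" i i'] lift_Suc_mono_le[of "L i'" j j'] assms that
    by (meson order_trans)
  obtain k where k: "\<And>j. j \<ge> k \<Longrightarrow> L j j = L k k"
    using accD[of C "\<lambda>j. L j j"] assms m by (metis le_SucI order_refl)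
  have diag: "L i j = L k k" if "i \<ge> k" "j \<ge> k" for i j
    using that k[of "max i j"] m[of i "max i j" j "max i j"] m[of k i k j] by simp
  have "\<exists>s. \<forall>j\<ge>s. L i j = L i s" for i using accD[of C "L i"] assms by metis
  then obtain s where s: "\<And>i j. j \<ge> s i \<Longrightarrow> L i j = L i (s i)" by metis
  define j0 where "j0 = Max (insert k (s ` {..k}))"
  have j0: "k \<le> j0" "\<And>i. i \<le> k \<Longrightarrow> s i \<le> j0" unfolding j0_def by (intro Max_ge; simp)+
  have "L i j = L i j0" if "j \<ge> j0" for i j
  proof (cases "i \<le> k")
    case True
    then show ?thesis using s[of i j] s[of i j0] j0 that by (metis order_trans)
  next
    case False
    then show ?thesis using diag[of i j] diag[of i j0] j0 that by simp
  qed
  then show ?thesis by blast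
qed

text \<open>Hilbert's argument by induction on the variables. Without variables only the component
  of degree zero can be nonzero, and it is a submodule of \<open>M\<close>. In the step a chain of
  families gives a double chain of leading families, indexed by the exponent \<open>i\<close> and
  the position \<open>j\<close>; a position of stabilisation uniform in \<open>i\<close> makes all
  leading families agree, hence the families themselves.\<close>

theorem acc_rees_families:
  assumes noeth: "noetherian_module R M" and ys: "set ys \<subseteq> carrier R"
  shows "acc {W. rees_family ys W \<and> (\<forall>n. W n \<subseteq> forms ys n)}"
  using ys
proof (induction ys)
  case Nil
  show ?case
  proof (rule acc_sandwich[where f = "\<lambda>W. W 0" and g = "\<lambda>W. W 0"])
    show "acc {W. submodule W R M}" "acc {W. submodule W R M}"
      using noeth unfolding noetherian_module_def by auto
    fix V W :: "nat \<Rightarrow> 'c set"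
    assume "V \<in> {W. rees_family [] W \<and> (\<forall>n. W n \<subseteq> forms [] n)}"
      "W \<in> {W. rees_family [] W \<and> (\<forall>n. W n \<subseteq> forms [] n)}" and eq: "V 0 = W 0"
    then have "V (Suc n) = {\<zero>\<^bsub>M\<^esub>}" "W (Suc n) = {\<zero>\<^bsub>M\<^esub>}" for n
      using submodule_zero[OF rees_familyD(1), of "[]" _ "Suc n"]
      by (force simp: subset_singleton_iff dest!: spec[of _ "Suc n"])+
    then have "V n = W n" for n using eq by (cases n) auto
    then show "V = W" by auto
  qed (auto simp: mono_def le_fun_def rees_family_def)
next
  case (Cons y ys)
  then have y: "y \<in> carrier R" and ys: "set ys \<subseteq> carrier R" by auto
  note F = rees_family_forms[OF ys]
  note Fs = rees_familyD(1)[OF F]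
  show ?case unfolding acc_def
  proof (intro allI impI)
    fix W :: "nat \<Rightarrow> nat \<Rightarrow> 'c set"
    assume "range W \<subseteq> {W. rees_family (y # ys) W \<and> (\<forall>n. W n \<subseteq> forms (y # ys) n)} \<and> mono W"
    then have W: "\<And>j. rees_family (y # ys) (W j)" "\<And>j n. W j n \<subseteq> forms (y # ys) n" 
      and mono: "\<And>j j' n. j \<le> j' \<Longrightarrow> W j n \<subseteq> W j' n"
      by (auto simp: mono_def le_fun_def image_subset_iff)
    have "\<exists>j0. \<forall>i. \<forall>j\<ge>j0. lead (forms ys) y (W j) i = lead (forms ys) y (W j0) i"
    proof (rule double_chain_stable[where L = "\<lambda>i j. lead (forms ys) y (W j) i"])
      show "acc {W. rees_family ys W \<and> (\<forall>n. W n \<subseteq> forms ys n)}" using Cons ys by blast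
      fix i j
      show "lead (forms ys) y (W j) i \<in> {W. rees_family ys W \<and> (\<forall>n. W n \<subseteq> forms ys n)}"
        using rees_family_lead[OF y ys F W(1)] by (auto simp: lead_def)
      show "lead (forms ys) y (W j) i \<le> lead (forms ys) y (W j) (Suc i)"
        using lead_Suc[OF y Fs W(1)] by (simp add: le_fun_def)
      show "lead (forms ys) y (W j) i \<le> lead (forms ys) y (W (Suc j)) i"
        using lead_mono[of "W j" "W (Suc j)"] mono by (simp add: le_fun_def)
    qed
    then obtain j0 where j0: "\<And>i j. j \<ge> j0 \<Longrightarrow> lead (forms ys) y (W j) i = lead (forms ys) y (W j0) i"
      by blast
    have "W j = W j0" if "j \<ge> j0" for j
      using rees_family_eq_if_lead_eq[OF y ys W(1) W(1) mono[OF that] W(2)] j0[OF that] by (metis ext)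
    then show "\<exists>j0. \<forall>j\<ge>j0. W j = W j0" by blast
  qed
qed

end

section \<open>Homogeneous components\<close>

definition component :: "('a, 'c) ring_scheme \<Rightarrow> ('i \<Rightarrow> 'a set) \<Rightarrow> 'a \<Rightarrow> 'i \<Rightarrow> 'a" where
  "component G C x = (THE f. (\<forall>i. f i \<in> C i) \<and> finite {i. f i \<noteq> \<zero>\<^bsub>G\<^esub>} \<and>
        x = (\<Oplus>\<^bsub>G\<^esub>i\<in>{i. f i \<noteq> \<zero>\<^bsub>G\<^esub>}. f i))"

lemma (in abelian_group) finsum_in_subset:
  assumes "W \<subseteq> carrier G" "\<zero> \<in> W" "\<And>x y. x \<in> W \<Longrightarrow> y \<in> W \<Longrightarrow> x \<oplus> y \<in> W" "\<And>i. i \<in> A \<Longrightarrow> f i \<in> W"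
  shows "finsum G f A \<in> W"
proof (cases "finite A")
  case True
  then show ?thesis using assms(4)
  proof (induction A)
    case (insert a A)
    then have "f \<in> A \<rightarrow> carrier G" "f a \<in> carrier G" using assms(1) by auto
    then show ?case using insert assms(3) by simp
  qed (simp add: assms(2))
qed (simp add: assms(2))

locale direct_sum = abelian_group G for G (structure) + fixes C :: "'i \<Rightarrow> 'a set"
  assumes ids: "internal_direct_sum G C"
begin

lemma part_subgroup: "additive_subgroup (C i) G"
  using ids unfolding internal_direct_sum_def by blast

lemma part_carrier: "x \<in> C i \<Longrightarrow> x \<in> carrier G"
  using additive_subgroup.a_subset[OF part_subgroup] by blast

lemma part_zero: "\<zero> \<in> C i"
  using additive_subgroup.zero_closed[OF part_subgroup] .

lemma part_add: "x \<in> C i \<Longrightarrow> y \<in> C i \<Longrightarrow> x \<oplus> y \<in> C i"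
  using additive_subgroup.a_closed[OF part_subgroup] .

lemma component_ex1:
  "x \<in> carrier G \<Longrightarrow> \<exists>!f. (\<forall>i. f i \<in> C i) \<and> finite {i. f i \<noteq> \<zero>} \<and> x = (\<Oplus>i\<in>{i. f i \<noteq> \<zero>}. f i)"
  using ids unfolding internal_direct_sum_def by blast

lemma component:
  assumes "x \<in> carrier G"
  shows "component G C x i \<in> C i" "finite {i. component G C x i \<noteq> \<zero>}"
    "x = (\<Oplus>i\<in>{i. component G C x i \<noteq> \<zero>}. component G C x i)"
  using theI'[OF component_ex1[OF assms]] unfolding component_def[symmetric] by auto

lemma component_unique:
  assumes "\<And>i. f i \<in> C i" "finite A" "{i. f i \<noteq> \<zero>} \<subseteq> A"
  shows "component G C (finsum G f A) = f"
proof -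
  have f: "f i \<in> carrier G" for i using assms(1) part_carrier by blast
  have fin: "finite {i. f i \<noteq> \<zero>}" using assms finite_subset by blast
  have "finsum G f A = finsum G f {i. f i \<noteq> \<zero>}"
    by (rule add.finprod_mono_neutral_cong_right) (use assms f in auto)
  then have "(\<forall>i. f i \<in> C i) \<and> finite {i. f i \<noteq> \<zero>} \<and> finsum G f A = (\<Oplus>i\<in>{i. f i \<noteq> \<zero>}. f i)"
    using assms(1) fin by auto
  moreover have "finsum G f A \<in> carrier G" using f by (intro finsum_closed) auto
  ultimately show ?thesis unfolding component_def by (intro the1_equality component_ex1)
qed

lemma component_add:
  assumes "x \<in> carrier G" "y \<in> carrier G"
  shows "component G C (x \<oplus> y) i = component G C x i \<oplus> component G C y i"
proof -
  let ?f = "component G C x" and ?g = "component G C y"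
  let ?A = "{i. ?f i \<noteq> \<zero>} \<union> {i. ?g i \<noteq> \<zero>}"
  note x = component[OF assms(1)] and y = component[OF assms(2)]
  have c: "?f i \<in> carrier G" "?g i \<in> carrier G" for i using x y part_carrier by blast+
  have "x = finsum G ?f ?A"
    by (subst x(3), rule add.finprod_mono_neutral_cong_left) (use x y c in auto)
  moreover have "y = finsum G ?g ?A"
    by (subst y(3), rule add.finprod_mono_neutral_cong_left) (use x y c in auto)
  ultimately have "x \<oplus> y = finsum G (\<lambda>i. ?f i \<oplus> ?g i) ?A"
    using finsum_addf[of ?f ?A ?g] c by auto
  moreover have "component G C (finsum G (\<lambda>i. ?f i \<oplus> ?g i) ?A) = (\<lambda>i. ?f i \<oplus> ?g i)"
    by (rule component_unique) (use x y part_add in auto)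
  ultimately show ?thesis by simp
qed

lemma component_part:
  assumes "x \<in> C i"
  shows "component G C x j = (if j = i then x else \<zero>)"
proof -
  let ?f = "\<lambda>j. if j = i then x else \<zero>"
  have "finsum G ?f {i} = x" using part_carrier[OF assms] by simp
  moreover have "component G C (finsum G ?f {i}) = ?f"
    by (rule component_unique) (use assms part_zero in auto)
  ultimately show ?thesis by metis
qed

lemma direct_sum_induct:
  assumes "x \<in> carrier G" "W \<subseteq> carrier G" "\<zero> \<in> W" "\<And>x y. x \<in> W \<Longrightarrow> y \<in> W \<Longrightarrow> x \<oplus> y \<in> W" "\<And>i. C i \<subseteq> W"
  shows "x \<in> W"
  by (subst component(3)[OF assms(1)], rule finsum_in_subset) (use assms subsetD[OF assms(5) component(1)[OF assms(1)]] in auto)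

end

section \<open>Gradings described by projections\<close>

text \<open>Projections onto the components replace unique decompositions as finite sums: all axioms
  are pointwise identities or finiteness statements, so they pass directly to shifts and finite
  products.\<close>

locale proj_graded = graded_ring R + module R M
  for R :: "'a graded_ring" (structure) and M :: "('a, 'b) graded_module" (structure) +
  fixes \<pi> :: "int \<Rightarrow> 'b \<Rightarrow> 'b"
  assumes proj_closed [simp, intro]: "x \<in> carrier M \<Longrightarrow> \<pi> e x \<in> carrier M"
    and proj_add: "x \<in> carrier M \<Longrightarrow> y \<in> carrier M \<Longrightarrow> \<pi> e (x \<oplus>\<^bsub>M\<^esub> y) = \<pi> e x \<oplus>\<^bsub>M\<^esub> \<pi> e y"
    and proj_proj: "x \<in> carrier M \<Longrightarrow> \<pi> e (\<pi> e' x) = (if e = e' then \<pi> e x else \<zero>\<^bsub>M\<^esub>)"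
    and proj_finite: "x \<in> carrier M \<Longrightarrow> finite {e. \<pi> e x \<noteq> \<zero>\<^bsub>M\<^esub>}"
    and proj_separating: "x \<in> carrier M \<Longrightarrow> (\<And>e. \<pi> e x = \<zero>\<^bsub>M\<^esub>) \<Longrightarrow> x = \<zero>\<^bsub>M\<^esub>"
    and grade_iff: "x \<in> grade M e \<longleftrightarrow> x \<in> carrier M \<and> \<pi> e x = x"
    and proj_smult: "a \<in> rgrade R i \<Longrightarrow> x \<in> carrier M \<Longrightarrow> \<pi> (e + int i) (a \<odot>\<^bsub>M\<^esub> x) = a \<odot>\<^bsub>M\<^esub> \<pi> e x"

context graded_ring
begin

lemma ring_direct_sum': "direct_sum R (rgrade R)"
  by (intro direct_sum.intro direct_sum_axioms.intro ring_direct_sum abelian_group_axioms)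

lemma rgrade_carrier: "a \<in> rgrade R i \<Longrightarrow> a \<in> carrier R"
  using direct_sum.part_carrier[OF ring_direct_sum'] .

lemma ring_homogeneous_induct:
  assumes "a \<in> carrier R" "W \<subseteq> carrier R" "\<zero> \<in> W" "\<And>x y. x \<in> W \<Longrightarrow> y \<in> W \<Longrightarrow> x \<oplus> y \<in> W"
    "\<And>i. rgrade R i \<subseteq> W"
  shows "a \<in> W"
  using direct_sum.direct_sum_induct[OF ring_direct_sum' assms] .

text \<open>The \<open>nat\<close>-grading of \<open>R\<close> is extended by zero to negative
  degrees, so that \<open>R\<close> can be treated as one more \<open>int\<close>-graded
  module.\<close>

definition ring_proj :: "int \<Rightarrow> 'a \<Rightarrow> 'a" where
  "ring_proj e x = (if 0 \<le> e then component R (rgrade R) x (nat e) else \<zero>)"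

lemma proj_graded_self: "proj_graded R (self_module R) ring_proj"
proof -
  interpret D: direct_sum R "rgrade R" by (rule ring_direct_sum')
  interpret S: module R "self_module R" by (rule module_self) (rule R.is_cring)
  show ?thesis
  proof (unfold_locales, unfold self_module_simps)
    fix x y e e' assume x: "x \<in> carrier R"
    show c: "ring_proj e x \<in> carrier R" for e
      using D.component(1)[OF x] D.part_carrier unfolding ring_proj_def by auto
    show "ring_proj e (x \<oplus> y) = ring_proj e x \<oplus> ring_proj e y" if "y \<in> carrier R"
      using D.component_add[OF x that] by (simp add: ring_proj_def)
    show "ring_proj e (ring_proj e' x) = (if e = e' then ring_proj e x else \<zero>)"
      using D.component_part[OF D.component(1)[OF x]] D.component_part[OF D.part_zero]
      by (auto simp: ring_proj_def)
    have "{e. ring_proj e x \<noteq> \<zero>} \<subseteq> int ` {i. component R (rgrade R) x i \<noteq> \<zero>}"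
      by (force simp: ring_proj_def image_iff split: if_splits)
    then show "finite {e. ring_proj e x \<noteq> \<zero>}"
      using D.component(2)[OF x] finite_subset finite_imageI by blast
    show "x = \<zero>" if "\<And>e. ring_proj e x = \<zero>"
    proof -
      have "component R (rgrade R) x i = \<zero>" for i using that[of "int i"] by (simp add: ring_proj_def)
      then show ?thesis using D.component(3)[OF x] by simp
    qed
  next
    fix x e
    show "x \<in> grade (self_module R) e \<longleftrightarrow> x \<in> carrier R \<and> ring_proj e x = x"
      using D.part_carrier D.component_part D.component(1) D.part_zero
      by (auto simp: ring_proj_def self_module_def) metis+
  next
    fix a i x e assume a: "a \<in> rgrade R i" and x: "x \<in> carrier R"
    have ac: "a \<in> carrier R" using a rgrade_carrier by blast
    let ?W = "{x \<in> carrier R. \<forall>e. ring_proj (e + int i) (a \<otimes> x) = a \<otimes> ring_proj e x}"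
    have c: "ring_proj e x \<in> carrier R" if "x \<in> carrier R" for e x
      using D.component(1)[OF that] D.part_carrier unfolding ring_proj_def by auto
    have add: "ring_proj e (x \<oplus> y) = ring_proj e x \<oplus> ring_proj e y" if "x \<in> carrier R" "y \<in> carrier R" for e x y
      using D.component_add[OF that] by (simp add: ring_proj_def)
    have hom: "ring_proj e x = (if e = int j then x else \<zero>)" if "x \<in> rgrade R j" for e x j
      using D.component_part[OF that] by (auto simp: ring_proj_def)
    have "x \<in> ?W"
    proof (rule ring_homogeneous_induct[OF x])
      show "\<zero> \<in> ?W" using ac hom[OF D.part_zero] by simp
      show "u \<oplus> v \<in> ?W" if "u \<in> ?W" "v \<in> ?W" for u v
        using that ac add c by (auto simp: R.r_distr)
      show "rgrade R j \<subseteq> ?W" for j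
      proof
        fix u assume u: "u \<in> rgrade R j"
        then show "u \<in> ?W" using hom[OF u] hom[OF rgrade_mult[OF a u]] rgrade_carrier[OF u] ac by auto
      qed
    qed simp
    then show "ring_proj (e + int i) (a \<otimes> x) = a \<otimes> ring_proj e x" by blast
  qed
qed

end

text \<open>Compatibility with a homogeneous scalar is immediate on homogeneous \<open>x\<close>
  from \<open>grade_smult\<close>, and both sides are additive in \<open>x\<close>.\<close>

lemma (in graded_module) proj_graded_component:
  "proj_graded R M (\<lambda>e x. component M (grade M) x e)"
proof -
  interpret D: direct_sum M "grade M"
    by (intro direct_sum.intro direct_sum_axioms.intro module_direct_sum M.abelian_group_axioms)
  show ?thesis
  proof (unfold_locales)
    fix x y e e' assume x: "x \<in> carrier M"
    show "component M (grade M) x e \<in> carrier M" using D.component(1)[OF x] D.part_carrier by blast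
    show "component M (grade M) (x \<oplus>\<^bsub>M\<^esub> y) e = component M (grade M) x e \<oplus>\<^bsub>M\<^esub> component M (grade M) y e"
      if "y \<in> carrier M" using D.component_add[OF x that] .
    show "component M (grade M) (component M (grade M) x e') e =
      (if e = e' then component M (grade M) x e else \<zero>\<^bsub>M\<^esub>)"
      using D.component_part[OF D.component(1)[OF x]] by auto
    show "finite {e. component M (grade M) x e \<noteq> \<zero>\<^bsub>M\<^esub>}" using D.component(2)[OF x] .
    show "x = \<zero>\<^bsub>M\<^esub>" if "\<And>e. component M (grade M) x e = \<zero>\<^bsub>M\<^esub>" using D.component(3)[OF x] that by simp
  next
    fix x e
    show "x \<in> grade M e \<longleftrightarrow> x \<in> carrier M \<and> component M (grade M) x e = x"
      using D.part_carrier D.component_part D.component(1) by metis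
  next
    fix a i x e assume a: "a \<in> rgrade R i" and x: "x \<in> carrier M"
    have ac: "a \<in> carrier R" using a rgrade_carrier by blast
    let ?W = "{x \<in> carrier M. \<forall>e. component M (grade M) (a \<odot>\<^bsub>M\<^esub> x) (e + int i) = a \<odot>\<^bsub>M\<^esub> component M (grade M) x e}"
    have c: "component M (grade M) x e \<in> carrier M" if "x \<in> carrier M" for e x
      using D.component(1)[OF that] D.part_carrier by blast
    have "x \<in> ?W"
    proof (rule D.direct_sum_induct[OF x])
      show "\<zero>\<^bsub>M\<^esub> \<in> ?W" using ac D.component_part[OF D.part_zero] by simp
      show "u \<oplus>\<^bsub>M\<^esub> v \<in> ?W" if "u \<in> ?W" "v \<in> ?W" for u v
        using that ac D.component_add c by (auto simp: smult_r_distr)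
      show "grade M j \<subseteq> ?W" for j
      proof
        fix u assume u: "u \<in> grade M j"
        then show "u \<in> ?W"
          using D.component_part[OF u] D.component_part[OF grade_smult[OF a u]] D.part_carrier[OF u] ac by auto
      qed
    qed simp
    then show "component M (grade M) (a \<odot>\<^bsub>M\<^esub> x) (e + int i) = a \<odot>\<^bsub>M\<^esub> component M (grade M) x e" by blast
  qed
qed

lemma proj_graded_shift:
  assumes "proj_graded R M \<pi>"
  shows "proj_graded R (shift_module d M) (\<lambda>e. \<pi> (e - d))"
proof -
  interpret proj_graded R M \<pi> by fact
  have [simp]: "{e. \<pi> (e - d) x \<noteq> \<zero>\<^bsub>M\<^esub>} = (\<lambda>e. e + d) ` {e. \<pi> e x \<noteq> \<zero>\<^bsub>M\<^esub>}" for x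
    by (force simp: image_iff)
  show ?thesis
  proof (intro proj_graded.intro proj_graded_axioms.intro, unfold shift_module_simps)
    show "module R (shift_module d M)" using module_axioms' by (rule module_shift_module)
    show "x = \<zero>\<^bsub>M\<^esub>" if "x \<in> carrier M" "\<And>e. \<pi> (e - d) x = \<zero>\<^bsub>M\<^esub>" for x
      using proj_separating[OF that(1)] that(2)[of "_ + d"] by simp
    show "\<pi> (e + int i - d) (a \<odot>\<^bsub>M\<^esub> x) = a \<odot>\<^bsub>M\<^esub> \<pi> (e - d) x" if "a \<in> rgrade R i" "x \<in> carrier M" for a i x e
      using proj_smult[OF that, of "e - d"] by (simp add: algebra_simps)
  qed (auto simp: proj_add proj_proj proj_finite grade_iff graded_ring_axioms)
qed

definition prod_proj :: "'s set \<Rightarrow> ('s \<Rightarrow> ('a, 'b) graded_module) \<Rightarrow> ('s \<Rightarrow> int \<Rightarrow> 'b \<Rightarrow> 'b) \<Rightarrow> int \<Rightarrow> ('s \<Rightarrow> 'b) \<Rightarrow> 's \<Rightarrow> 'b" where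
  "prod_proj S A p e f = (\<lambda>s. if s \<in> S then p s e (f s) else \<zero>\<^bsub>A s\<^esub>)"

lemma proj_graded_prod:
  assumes "finite S" "\<And>s. proj_graded R (A s) (p s)"
  shows "proj_graded R (prod_module S A) (prod_proj S A p)"
proof -
  interpret A: proj_graded R "A s" "p s" for s by (rule assms)
  have m: "module R (A s)" for s by (rule A.module_axioms')
  note c = prod_module_component[OF m]
  show ?thesis
  proof (intro proj_graded.intro proj_graded_axioms.intro)
    show "graded_ring R" by (rule A.graded_ring_axioms)
    show "module R (prod_module S A)" using m by (rule module_prod)
    fix x y e e' assume x: "x \<in> carrier (prod_module S A)"
    show "prod_proj S A p e x \<in> carrier (prod_module S A)"
      unfolding prod_module_carrier prod_proj_def using c[OF x] by simp
    show "prod_proj S A p e (x \<oplus>\<^bsub>prod_module S A\<^esub> y) =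
      prod_proj S A p e x \<oplus>\<^bsub>prod_module S A\<^esub> prod_proj S A p e y" if y: "y \<in> carrier (prod_module S A)"
      using c[OF x] c[OF y] by (auto simp: prod_proj_def A.proj_add)
    show "prod_proj S A p e (prod_proj S A p e' x) =
      (if e = e' then prod_proj S A p e x else \<zero>\<^bsub>prod_module S A\<^esub>)"
      using c[OF x] by (auto simp: prod_proj_def A.proj_proj)
    have "{e. prod_proj S A p e x \<noteq> \<zero>\<^bsub>prod_module S A\<^esub>} \<subseteq> (\<Union>s\<in>S. {e. p s e (x s) \<noteq> \<zero>\<^bsub>A s\<^esub>})"
      by (auto simp: prod_proj_def fun_eq_iff split: if_splits)
    then show "finite {e. prod_proj S A p e x \<noteq> \<zero>\<^bsub>prod_module S A\<^esub>}"
      using assms(1) A.proj_finite[OF c[OF x]] by (meson finite_UN_I finite_subset)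
    show "x = \<zero>\<^bsub>prod_module S A\<^esub>" if "\<And>e. prod_proj S A p e x = \<zero>\<^bsub>prod_module S A\<^esub>"
    proof -
      have "x s = \<zero>\<^bsub>A s\<^esub>" for s
      proof (cases "s \<in> S")
        case True
        then have "p s e (x s) = \<zero>\<^bsub>A s\<^esub>" for e
          using fun_cong[OF that[of e], of s] by (simp add: prod_proj_def)
        then show ?thesis using A.proj_separating[OF c[OF x]] by blast
      qed (use x in \<open>simp add: prod_module_carrier\<close>)
      then show ?thesis by auto
    qed
  next
    fix x e
    show "x \<in> grade (prod_module S A) e \<longleftrightarrow> x \<in> carrier (prod_module S A) \<and> prod_proj S A p e x = x"
      unfolding prod_module_grade prod_module_carrier A.grade_iff prod_proj_def fun_eq_iff by auto
  next
    fix a i x e assume "a \<in> rgrade R i" and x: "x \<in> carrier (prod_module S A)"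
    then show "prod_proj S A p (e + int i) (a \<odot>\<^bsub>prod_module S A\<^esub> x) = a \<odot>\<^bsub>prod_module S A\<^esub> prod_proj S A p e x"
      using A.proj_smult[OF _ c[OF x]] A.smult_r_null[OF A.rgrade_carrier] by (auto simp: prod_proj_def)
  qed
qed

section \<open>Homogeneous submodules and homogeneous cores\<close>

context proj_graded
begin

definition homog :: "'b set \<Rightarrow> bool" where
  "homog W \<longleftrightarrow> (\<forall>x\<in>W. \<forall>e. \<pi> e x \<in> W)"

text \<open>For a submodule \<open>W\<close> this is the largest homogeneous submodule contained in
  it. It has the same homogeneous elements as \<open>W\<close>, so replacing \<open>W\<close> by its
  core does not affect degrees.\<close>

definition core :: "'b set \<Rightarrow> 'b set" where
  "core W = {x \<in> carrier M. \<forall>e. \<pi> e x \<in> W}"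

lemma proj_zero [simp]: "\<pi> e \<zero>\<^bsub>M\<^esub> = \<zero>\<^bsub>M\<^esub>"
  by (metis M.add.l_cancel_one M.zero_closed M.r_zero proj_add proj_closed)

lemma proj_uminus: "x \<in> carrier M \<Longrightarrow> \<pi> e (\<ominus>\<^bsub>M\<^esub> x) = \<ominus>\<^bsub>M\<^esub> \<pi> e x"
  by (metis M.a_inv_closed M.l_neg M.minus_equality proj_add proj_closed proj_zero)

lemma proj_minus: "x \<in> carrier M \<Longrightarrow> y \<in> carrier M \<Longrightarrow> \<pi> e (x \<ominus>\<^bsub>M\<^esub> y) = \<pi> e x \<ominus>\<^bsub>M\<^esub> \<pi> e y"
  by (simp add: M.minus_eq proj_add proj_uminus)

lemma proj_smult': "a \<in> rgrade R i \<Longrightarrow> x \<in> carrier M \<Longrightarrow> \<pi> e (a \<odot>\<^bsub>M\<^esub> x) = a \<odot>\<^bsub>M\<^esub> \<pi> (e - int i) x"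
  using proj_smult[of a i x "e - int i"] by simp

text \<open>Induction on the number of nonzero components, subtracting one of them at each step.
  \<open>W\<close> need only be additively closed.\<close>

lemma homogeneous_induct:
  assumes "x \<in> carrier M" "\<And>e. \<pi> e x \<in> W" "\<zero>\<^bsub>M\<^esub> \<in> W" "\<And>u v. u \<in> W \<Longrightarrow> v \<in> W \<Longrightarrow> u \<oplus>\<^bsub>M\<^esub> v \<in> W"
  shows "x \<in> W"
  using assms(1,2)
proof (induction "card {e. \<pi> e x \<noteq> \<zero>\<^bsub>M\<^esub>}" arbitrary: x)
  case 0
  then have "\<pi> e x = \<zero>\<^bsub>M\<^esub>" for e using proj_finite[OF 0(2)] by auto
  then show ?case using proj_separating[OF 0(2)] assms(3) by simp
next
  case (Suc n)
  then obtain e where e: "\<pi> e x \<noteq> \<zero>\<^bsub>M\<^esub>" by fastforce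
  let ?x = "x \<ominus>\<^bsub>M\<^esub> \<pi> e x"
  have c: "?x \<in> carrier M" using Suc.prems by simp
  have p: "\<pi> e' ?x = (if e' = e then \<zero>\<^bsub>M\<^esub> else \<pi> e' x)" for e'
    using Suc.prems(1) unfolding proj_minus[OF Suc.prems(1) proj_closed[OF Suc.prems(1)]] proj_proj[OF Suc.prems(1)]
    by (auto simp: M.minus_eq M.r_neg)
  have "{e'. \<pi> e' ?x \<noteq> \<zero>\<^bsub>M\<^esub>} = {e'. \<pi> e' x \<noteq> \<zero>\<^bsub>M\<^esub>} - {e}" using p by auto
  then have "card {e'. \<pi> e' ?x \<noteq> \<zero>\<^bsub>M\<^esub>} = n" using Suc(2) e proj_finite[OF Suc.prems(1)] by simp
  moreover have "\<pi> e' ?x \<in> W" for e' using p Suc.prems(2) assms(3) by simp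
  ultimately have "?x \<in> W" using Suc(1) c by blast
  then have "?x \<oplus>\<^bsub>M\<^esub> \<pi> e x \<in> W" using assms(4) Suc.prems(2) by blast
  then show ?case using Suc.prems(1) minus_add_cancel by simp
qed

lemma core_subset:
  assumes "submodule W R M"
  shows "core W \<subseteq> W"
proof
  fix x assume "x \<in> core W"
  then show "x \<in> W"
    using homogeneous_induct[of x W] submodule_zero[OF assms] submodule_add[OF assms] unfolding core_def by blast
qed

lemma proj_homogeneous: "x \<in> carrier M \<Longrightarrow> \<pi> e x = x \<Longrightarrow> \<pi> e' x = (if e' = e then x else \<zero>\<^bsub>M\<^esub>)"
  by (metis proj_proj)

lemma core_homogeneous_iff:
  assumes "x \<in> carrier M" "\<pi> e x = x" "submodule W R M"
  shows "x \<in> core W \<longleftrightarrow> x \<in> W"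
  unfolding core_def using proj_homogeneous[OF assms(1,2)] submodule_zero[OF assms(3)] assms(1) by auto

lemma homog_core: "submodule W R M \<Longrightarrow> homog (core W)"
  unfolding homog_def core_def by (auto simp: proj_proj submodule_zero)

lemma homogD: "homog W \<Longrightarrow> x \<in> W \<Longrightarrow> \<pi> e x \<in> W"
  unfolding homog_def by blast

lemma homog_Int: "homog A \<Longrightarrow> homog B \<Longrightarrow> homog (A \<inter> B)"
  unfolding homog_def by blast

lemma submodule_core:
  assumes "submodule W R M"
  shows "submodule (core W) R M"
  unfolding submodule_iff
proof (intro conjI ballI)
  show "core W \<subseteq> carrier M" "\<zero>\<^bsub>M\<^esub> \<in> core W"
    unfolding core_def using submodule_zero[OF assms] by auto
  fix x assume x: "x \<in> core W"
  then have xc: "x \<in> carrier M" unfolding core_def by blast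
  show add: "x \<oplus>\<^bsub>M\<^esub> y \<in> core W" if "y \<in> core W" for y
    using that x submodule_add[OF assms] unfolding core_def by (auto simp: proj_add)
  fix a assume a: "a \<in> carrier R"
  have "a \<in> {a \<in> carrier R. a \<odot>\<^bsub>M\<^esub> x \<in> core W}"
  proof (rule ring_homogeneous_induct[OF a])
    show "\<zero> \<in> {a \<in> carrier R. a \<odot>\<^bsub>M\<^esub> x \<in> core W}"
      using xc submodule_zero[OF assms] by (simp add: core_def)
    fix i
    show "rgrade R i \<subseteq> {a \<in> carrier R. a \<odot>\<^bsub>M\<^esub> x \<in> core W}"
      using x submodule_smult[OF assms] rgrade_carrier unfolding core_def by (auto simp: proj_smult')
  next
    fix a b assume "a \<in> {a \<in> carrier R. a \<odot>\<^bsub>M\<^esub> x \<in> core W}" "b \<in> {a \<in> carrier R. a \<odot>\<^bsub>M\<^esub> x \<in> core W}"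
    then show "a \<oplus> b \<in> {a \<in> carrier R. a \<odot>\<^bsub>M\<^esub> x \<in> core W}"
      using submodule_add[OF assms] xc unfolding core_def by (auto simp: smult_l_distr proj_add)
  qed simp
  then show "a \<odot>\<^bsub>M\<^esub> x \<in> core W" by blast
qed

lemma rees_family_core:
  assumes "rees_family ys W" "\<And>y. y \<in> set ys \<Longrightarrow> \<exists>d. y \<in> rgrade R d"
  shows "rees_family ys (\<lambda>n. core (W n))"
  unfolding rees_family_def
proof (intro conjI allI ballI)
  show "submodule (core (W n)) R M" for n using submodule_core rees_familyD(1)[OF assms(1)] by blast
  fix y n x assume y: "y \<in> set ys" and x: "x \<in> core (W n)"
  obtain d where d: "y \<in> rgrade R d" using assms(2) y by blast
  show "y \<odot>\<^bsub>M\<^esub> x \<in> core (W (Suc n))"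
    using x rgrade_carrier[OF d] rees_familyD(2)[OF assms(1) y] unfolding core_def by (auto simp: proj_smult'[OF d])
qed

lemma homog_list_smult:
  assumes "\<And>y. y \<in> set ys \<Longrightarrow> \<exists>d. y \<in> rgrade R d" "submodule W R M" "homog W"
  shows "homog (list_smult M ys W)"
proof -
  have ys: "set ys \<subseteq> carrier R" using assms(1) rgrade_carrier by blast
  note s = submodule_list_smult[OF ys assms(2)]
  have "list_smult M ys W \<subseteq> {x \<in> carrier M. \<forall>e. \<pi> e x \<in> list_smult M ys W}"
  proof (rule list_smult_least)
    show "\<zero>\<^bsub>M\<^esub> \<in> {x \<in> carrier M. \<forall>e. \<pi> e x \<in> list_smult M ys W}" using submodule_zero[OF s] by simp
    show "x \<oplus>\<^bsub>M\<^esub> y \<in> {x \<in> carrier M. \<forall>e. \<pi> e x \<in> list_smult M ys W}"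
      if "x \<in> {x \<in> carrier M. \<forall>e. \<pi> e x \<in> list_smult M ys W}" "y \<in> {x \<in> carrier M. \<forall>e. \<pi> e x \<in> list_smult M ys W}" for x y
      using that submodule_add[OF s] by (auto simp: proj_add)
    fix y x assume y: "y \<in> set ys" and x: "x \<in> W"
    obtain d where d: "y \<in> rgrade R d" using assms(1) y by blast
    have xc: "x \<in> carrier M" using x submodule_carrier[OF assms(2)] by blast
    show "y \<odot>\<^bsub>M\<^esub> x \<in> {x \<in> carrier M. \<forall>e. \<pi> e x \<in> list_smult M ys W}"
      using list_smult_incl[OF ys assms(2) y] homogD[OF assms(3) x] rgrade_carrier[OF d] xc
      by (auto simp: proj_smult'[OF d])
  qed
  then show ?thesis unfolding homog_def by blast
qed

lemma homog_list_pow: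
  assumes "\<And>y. y \<in> set ys \<Longrightarrow> \<exists>d. y \<in> rgrade R d"
  shows "homog (list_pow_smult M ys n (carrier M))"
proof (induction n)
  case (Suc n)
  have "set ys \<subseteq> carrier R" using assms rgrade_carrier by blast
  then show ?case using homog_list_smult[OF assms submodule_list_pow[OF _ carrier_is_submodule] Suc] by simp
qed (simp add: homog_def)

end

section \<open>Consequences of Noetherianity\<close>

context module
begin

lemma list_smult_in_rees_family:
  assumes "set ys \<subseteq> carrier R" "rees_family ys W"
  shows "list_smult M ys (W n) \<subseteq> W (Suc n)"
  by (rule list_smult_least)
    (use assms rees_familyD submodule_zero submodule_add in blast)+

lemma list_pow_in_rees_family:
  assumes "set ys \<subseteq> carrier R" "rees_family ys W"
  shows "list_pow_smult M ys k (W n) \<subseteq> W (n + k)"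
proof (induction k)
  case (Suc k)
  then have "list_smult M ys (list_pow_smult M ys k (W n)) \<subseteq> list_smult M ys (W (n + k))"
    by (rule list_smult_mono)
  then show ?case using list_smult_in_rees_family[OF assms, of "n + k"] by simp
qed simp

lemma list_pow_Suc_right: "list_pow_smult M ys (Suc k) U = list_pow_smult M ys k (list_smult M ys U)"
  using list_pow_add[of ys k 1 U] by simp

text \<open>The chain condition yields finite generation: the subfamilies generated in degrees at
  most \<open>j\<close> ascend with \<open>j\<close> and become stationary, and in every degree
  \<open>n\<close> they agree with \<open>W\<close> as soon as \<open>j \<ge> n\<close>.\<close>

lemma rees_family_eventually_good:
  assumes noeth: "noetherian_module R M" and ys: "set ys \<subseteq> carrier R"
    and W: "rees_family ys W" "\<And>n. W n \<subseteq> forms ys n"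
  obtains n0 where "\<And>n. n \<ge> n0 \<Longrightarrow> W (Suc n) = list_smult M ys (W n)"
proof -
  \<comment> \<open>\<open>V j\<close> keeps \<open>W\<close> up to degree \<open>j\<close> and from
    there on contains only what \<open>W j\<close> generates.\<close>
  define V where "V j n = (if n \<le> j then W n else list_pow_smult M ys (n - j) (W j))" for j n
  note Ws = rees_familyD(1)[OF W(1)]
  note LW = list_pow_in_rees_family[OF ys W(1)]
  have sub: "submodule (V j n) R M" for j n
    unfolding V_def using Ws submodule_list_pow[OF ys Ws] by simp
  have V: "V j \<in> {W. rees_family ys W \<and> (\<forall>n. W n \<subseteq> forms ys n)}" for j
  proof -
    have "y \<odot>\<^bsub>M\<^esub> x \<in> V j (Suc n)" if "y \<in> set ys" "x \<in> V j n" for y n x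
    proof (cases "Suc n \<le> j")
      case True
      then show ?thesis using that rees_familyD(2)[OF W(1)] unfolding V_def by simp
    next
      case False
      then have *: "V j n = list_pow_smult M ys (n - j) (W j)" "V j (Suc n) = list_smult M ys (V j n)"
        unfolding V_def by (auto simp: Suc_diff_le le_Suc_eq not_le less_Suc_eq_le)
      show ?thesis unfolding *(2) using list_smult_incl[OF ys sub that] .
    qed
    moreover have "V j n \<subseteq> forms ys n" for n
      using order_trans[OF LW[of "n - j" j]] W(2)[of n] unfolding V_def by auto
    ultimately show ?thesis using sub unfolding rees_family_def by blast
  qed
  have "V j n \<subseteq> V (Suc j) n" for j n
  proof (cases "n \<le> j")
    case False
    then obtain k where n: "n = Suc j + k" by (metis not_le less_iff_Suc_add add_Suc)
    have "V j n = list_pow_smult M ys k (list_smult M ys (W j))"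
      unfolding V_def n using list_pow_Suc_right by simp
    also have "\<dots> \<subseteq> list_pow_smult M ys k (W (Suc j))"
      by (rule list_pow_mono, rule list_smult_in_rees_family[OF ys W(1)])
    also have "\<dots> = V (Suc j) n" unfolding V_def n by (cases k) auto
    finally show ?thesis .
  qed (simp add: V_def)
  then have "V j \<le> V (Suc j)" for j by (simp add: le_fun_def)
  then obtain j0 where j0: "\<And>j. j \<ge> j0 \<Longrightarrow> V j = V j0"
    using accD[of _ V, OF acc_rees_families[OF noeth ys] V] by blast
  show thesis
  proof (rule that[of j0])
    fix n assume n: "n \<ge> j0"
    have 1: "W m = V j0 m" if "m \<ge> j0" for m using fun_cong[OF j0[OF that], of m] by (simp add: V_def)
    have 2: "V j0 m = list_pow_smult M ys (m - j0) (W j0)" if "m \<ge> j0" for m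
      using that by (auto simp: V_def)
    have "W (Suc n) = list_pow_smult M ys (Suc n - j0) (W j0)" using 1[of "Suc n"] 2[of "Suc n"] n by simp
    also have "\<dots> = list_smult M ys (W n)" using 1[OF n] 2[OF n] n by (simp add: Suc_diff_le)
    finally show "W (Suc n) = list_smult M ys (W n)" .
  qed
qed

lemma rees_family_list_pow:
  assumes "set ys \<subseteq> carrier R" "submodule U R M"
  shows "rees_family ys (\<lambda>n. list_pow_smult M ys n U)"
  using submodule_list_pow[OF assms] list_smult_incl[OF assms(1) submodule_list_pow[OF assms]]
  by (simp add: rees_family_def)

lemma rees_family_Int: "rees_family ys V \<Longrightarrow> rees_family ys W \<Longrightarrow> rees_family ys (\<lambda>n. V n \<inter> W n)"
  unfolding rees_family_def by (auto intro: submodule_Int)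

lemma rees_family_const: 
  "set ys \<subseteq> carrier R \<Longrightarrow> submodule U R M \<Longrightarrow> rees_family ys (\<lambda>n. U)"
  unfolding rees_family_def using submodule_smult by blast

lemma rees_family_set_add:
  assumes "set ys \<subseteq> carrier R" "rees_family ys V" "rees_family ys W"
  shows "rees_family ys (\<lambda>n. V n <+>\<^bsub>M\<^esub> W n)"
  unfolding rees_family_def
proof (intro conjI allI ballI)
  note v = rees_familyD[OF assms(2)] and w = rees_familyD[OF assms(3)]
  show "submodule (V n <+>\<^bsub>M\<^esub> W n) R M" for n using submodule_set_add v w by blast
  fix y n x assume y: "y \<in> set ys" and "x \<in> V n <+>\<^bsub>M\<^esub> W n"
  then obtain a b where ab: "a \<in> V n" "b \<in> W n" "x = a \<oplus>\<^bsub>M\<^esub> b" by (auto simp: in_set_add)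
  then have "y \<odot>\<^bsub>M\<^esub> x = y \<odot>\<^bsub>M\<^esub> a \<oplus>\<^bsub>M\<^esub> y \<odot>\<^bsub>M\<^esub> b"
    using y assms(1) submodule_carrier[OF v(1)] submodule_carrier[OF w(1)] by (auto simp: smult_r_distr)
  then show "y \<odot>\<^bsub>M\<^esub> x \<in> V (Suc n) <+>\<^bsub>M\<^esub> W (Suc n)"
    unfolding in_set_add using ab v(2)[OF y] w(2)[OF y] by blast
qed

text \<open>The intersections of \<open>U\<close> with the powers form a family inside
  \<open>forms\<close>, so beyond some degree \<open>h\<close> each is obtained from the previous
  one by multiplication with \<open>ys\<close>. The power of degree \<open>h + k\<close> thus meets
  \<open>U\<close> inside the \<open>k\<close>-fold multiple of \<open>U\<close>.\<close>

lemma artin_rees: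
  assumes noeth: "noetherian_module R M" and ys: "set ys \<subseteq> carrier R" and U: "submodule U R M"
  obtains h where "\<And>q. q \<ge> h \<Longrightarrow>
    list_pow_smult M ys q (carrier M) \<inter> U \<subseteq> list_pow_smult M ys (q - h) U"
proof -
  let ?W = "\<lambda>n. list_pow_smult M ys n (carrier M) \<inter> U"
  have W: "rees_family ys ?W"
    by (intro rees_family_Int rees_family_list_pow rees_family_const ys U carrier_is_submodule)
  have "?W n \<subseteq> forms ys n" for n using list_pow_subset_forms[OF ys] by blast
  then obtain h where h: "\<And>n. n \<ge> h \<Longrightarrow> ?W (Suc n) = list_smult M ys (?W n)"
    using rees_family_eventually_good[OF noeth ys W] by blast
  have "?W (h + k) \<subseteq> list_pow_smult M ys k U" for k
  proof (induction k)
    case (Suc k)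
    have "?W (h + Suc k) = list_smult M ys (?W (h + k))" using h[of "h + k"] by simp
    also have "\<dots> \<subseteq> list_smult M ys (list_pow_smult M ys k U)" using Suc by (rule list_smult_mono)
    finally show ?case by simp
  qed simp
  then have "?W q \<subseteq> list_pow_smult M ys (q - h) U" if "q \<ge> h" for q
    using that by (metis le_add_diff_inverse)
  then show thesis by (rule that)
qed

lemma list_pow_set_add:
  assumes "set ys \<subseteq> carrier R" "submodule A R M" "submodule B R M"
  shows "list_pow_smult M ys k (A <+>\<^bsub>M\<^esub> B) \<subseteq> list_pow_smult M ys k A <+>\<^bsub>M\<^esub> B"
proof (induction k)
  case (Suc k)
  note F = rees_family_set_add[OF assms(1) rees_family_list_pow[OF assms(1,2)] rees_family_const[OF assms(1,3)]]
  have "list_smult M ys (list_pow_smult M ys k (A <+>\<^bsub>M\<^esub> B)) \<subseteq> list_smult M ys (list_pow_smult M ys k A <+>\<^bsub>M\<^esub> B)"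
    using Suc by (rule list_smult_mono)
  also have "\<dots> \<subseteq> list_pow_smult M ys (Suc k) A <+>\<^bsub>M\<^esub> B"
    using list_smult_in_rees_family[OF assms(1) F] .
  finally show ?case by simp
qed simp

subsection \<open>Dropping variables that act nilpotently\<close>

text \<open>Finite generation of \<open>P\<close> modulo \<open>T\<close> over the variables
  \<open>ys\<close>, as it shows in large degrees. \<open>T\<close> need not be contained in
  \<open>P\<close>.\<close>

definition good_mod :: "'a list \<Rightarrow> (nat \<Rightarrow> 'c set) \<Rightarrow> (nat \<Rightarrow> 'c set) \<Rightarrow> bool" where
  "good_mod ys P T \<longleftrightarrow> (\<exists>q0. \<forall>q\<ge>q0. P (Suc q) \<subseteq> list_smult M ys (P q) <+>\<^bsub>M\<^esub> T (Suc q))"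

text \<open>One exponent \<open>s\<close> serves all degrees \<open>q\<close>; the target degree
  \<open>q + s\<close> accounts for \<open>y\<close> being a variable of degree one in the
  family.\<close>

definition nilpotent_mod :: "'a \<Rightarrow> (nat \<Rightarrow> 'c set) \<Rightarrow> (nat \<Rightarrow> 'c set) \<Rightarrow> bool" where
  "nilpotent_mod y P T \<longleftrightarrow> (\<exists>s. \<forall>q. \<forall>x\<in>P q. (y [^] s) \<odot>\<^bsub>M\<^esub> x \<in> T (q + s))"

lemma list_smult_commute:
  assumes "set ys \<subseteq> carrier R" "z \<in> carrier R" "submodule A R M" "submodule B R M"
    "\<And>x. x \<in> A \<Longrightarrow> z \<odot>\<^bsub>M\<^esub> x \<in> B" "w \<in> list_smult M ys A"
  shows "z \<odot>\<^bsub>M\<^esub> w \<in> list_smult M ys B"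
proof -
  note s = submodule_list_smult[OF assms(1,4)]
  have "list_smult M ys A \<subseteq> {w \<in> carrier M. z \<odot>\<^bsub>M\<^esub> w \<in> list_smult M ys B}"
  proof (rule list_smult_least)
    show "\<zero>\<^bsub>M\<^esub> \<in> {w \<in> carrier M. z \<odot>\<^bsub>M\<^esub> w \<in> list_smult M ys B}"
      using submodule_zero[OF s] assms(2) by simp
    show "x \<oplus>\<^bsub>M\<^esub> y \<in> {w \<in> carrier M. z \<odot>\<^bsub>M\<^esub> w \<in> list_smult M ys B}"
      if "x \<in> {w \<in> carrier M. z \<odot>\<^bsub>M\<^esub> w \<in> list_smult M ys B}" "y \<in> {w \<in> carrier M. z \<odot>\<^bsub>M\<^esub> w \<in> list_smult M ys B}" for x y
      using that submodule_add[OF s] assms(2) by (auto simp: smult_r_distr)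
    fix y x assume y: "y \<in> set ys" and x: "x \<in> A"
    have "y \<in> carrier R" "x \<in> carrier M" using y x assms(1) submodule_carrier[OF assms(3)] by auto
    then show "y \<odot>\<^bsub>M\<^esub> x \<in> {w \<in> carrier M. z \<odot>\<^bsub>M\<^esub> w \<in> list_smult M ys B}"
      using list_smult_incl[OF assms(1,4) y assms(5)[OF x]] smult_left_commute[of z y x] assms(2) by simp
  qed
  then show ?thesis using assms(6) by blast
qed

text \<open>The relation \<open>P (Suc q) \<subseteq> y P q + ys P q + T\<close> is substituted into
  its own first summand until \<open>y\<close> occurs with exponent \<open>s + 1\<close>. That
  summand then falls into \<open>T\<close>, and only the variables \<open>ys\<close> remain.\<close>

lemma good_mod_drop:
  assumes good: "good_mod (y # ys) P T" and nil: "nilpotent_mod y P T"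
    and ys: "set (y # ys) \<subseteq> carrier R" and P: "rees_family (y # ys) P" and T: "rees_family (y # ys) T"
  shows "good_mod ys P T"
proof -
  obtain q0 where q0: "\<And>q. q \<ge> q0 \<Longrightarrow> P (Suc q) \<subseteq> list_smult M (y # ys) (P q) <+>\<^bsub>M\<^esub> T (Suc q)"
    using good unfolding good_mod_def by blast
  obtain s where s: "\<And>q x. x \<in> P q \<Longrightarrow> (y [^] s) \<odot>\<^bsub>M\<^esub> x \<in> T (q + s)"
    using nil unfolding nilpotent_mod_def by blast
  have y: "y \<in> carrier R" and ys': "set ys \<subseteq> carrier R" using ys by auto
  note Ps = rees_familyD(1)[OF P] and Ts = rees_familyD(1)[OF T]
  note LP = submodule_list_smult[OF ys' Ps]
  \<comment> \<open>The substitution carried out \<open>t + 1\<close> times. Since \<open>y\<close>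
    commutes with the other variables, terms already containing one of them stay in
    \<open>list_smult M ys (P (q + t))\<close>.\<close>
  have step: "\<exists>p\<in>P q. \<exists>w\<in>list_smult M ys (P (q + t)). \<exists>v\<in>T (Suc (q + t)).
      x = (y [^] Suc t) \<odot>\<^bsub>M\<^esub> p \<oplus>\<^bsub>M\<^esub> (w \<oplus>\<^bsub>M\<^esub> v)" if "q \<ge> q0" "x \<in> P (Suc (q + t))" for q t x
    using that(2)
  proof (induction t arbitrary: x)
    case 0
    then have "x \<in> list_smult M (y # ys) (P q) <+>\<^bsub>M\<^esub> T (Suc q)" using q0[OF that(1)] by auto
    then obtain p w v where pwv: "p \<in> P q" "w \<in> list_smult M ys (P q)" "v \<in> T (Suc q)"
      "x = (y \<odot>\<^bsub>M\<^esub> p \<oplus>\<^bsub>M\<^esub> w) \<oplus>\<^bsub>M\<^esub> v" by (auto simp: in_set_add)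
    then have "x = (y [^] Suc 0) \<odot>\<^bsub>M\<^esub> p \<oplus>\<^bsub>M\<^esub> (w \<oplus>\<^bsub>M\<^esub> v)"
      using y submodule_carrier[OF Ps] submodule_carrier[OF LP] submodule_carrier[OF Ts] by (simp add: M.a_assoc)
    then show ?case using pwv by auto
  next
    case (Suc t)
    have "x \<in> list_smult M (y # ys) (P (Suc (q + t))) <+>\<^bsub>M\<^esub> T (Suc (Suc (q + t)))"
      using q0[of "Suc (q + t)"] that(1) Suc.prems by auto
    then obtain p w v where pwv: "p \<in> P (Suc (q + t))" "w \<in> list_smult M ys (P (Suc (q + t)))"
      "v \<in> T (Suc (Suc (q + t)))" "x = (y \<odot>\<^bsub>M\<^esub> p \<oplus>\<^bsub>M\<^esub> w) \<oplus>\<^bsub>M\<^esub> v" by (auto simp: in_set_add)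
    obtain p' w' v' where pwv': "p' \<in> P q" "w' \<in> list_smult M ys (P (q + t))" "v' \<in> T (Suc (q + t))"
      "p = (y [^] Suc t) \<odot>\<^bsub>M\<^esub> p' \<oplus>\<^bsub>M\<^esub> (w' \<oplus>\<^bsub>M\<^esub> v')" using Suc.IH[OF pwv(1)] by blast
    have c: "p' \<in> carrier M" "w' \<in> carrier M" "v' \<in> carrier M" "w \<in> carrier M" "v \<in> carrier M"
      using pwv pwv' submodule_carrier[OF Ps] submodule_carrier[OF LP] submodule_carrier[OF Ts] by blast+
    have yw: "y \<odot>\<^bsub>M\<^esub> w' \<in> list_smult M ys (P (Suc (q + t)))"
      using list_smult_commute[OF ys' y Ps Ps _ pwv'(2)] rees_familyD(2)[OF P, of y] by simp
    have yv: "y \<odot>\<^bsub>M\<^esub> v' \<in> T (Suc (Suc (q + t)))" using rees_familyD(2)[OF T, of y] pwv'(3) by simp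
    have yp: "y \<odot>\<^bsub>M\<^esub> p = (y [^] Suc (Suc t)) \<odot>\<^bsub>M\<^esub> p' \<oplus>\<^bsub>M\<^esub> (y \<odot>\<^bsub>M\<^esub> w' \<oplus>\<^bsub>M\<^esub> y \<odot>\<^bsub>M\<^esub> v')"
      unfolding pwv'(4) using c y nat_pow_smult_Suc[of y p' "Suc t"]
      by (simp add: smult_r_distr del: R.nat_pow_Suc)
    have "(y [^] Suc (Suc t)) \<odot>\<^bsub>M\<^esub> p' \<in> carrier M" using c y by (simp del: R.nat_pow_Suc)
    then have "x = (y [^] Suc (Suc t)) \<odot>\<^bsub>M\<^esub> p' \<oplus>\<^bsub>M\<^esub> ((y \<odot>\<^bsub>M\<^esub> w' \<oplus>\<^bsub>M\<^esub> w) \<oplus>\<^bsub>M\<^esub> (y \<odot>\<^bsub>M\<^esub> v' \<oplus>\<^bsub>M\<^esub> v))"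
      unfolding pwv(4) yp using c y by (simp add: M.a_ac del: R.nat_pow_Suc)
    then show ?case using pwv'(1) submodule_add[OF LP yw pwv(2)] submodule_add[OF Ts yv pwv(3)] by auto
  qed
  have "P (Suc q) \<subseteq> list_smult M ys (P q) <+>\<^bsub>M\<^esub> T (Suc q)" if q: "q \<ge> q0 + s" for q
  proof
    fix x assume x: "x \<in> P (Suc q)"
    define r where "r = q - s"
    then have r: "q = r + s" "r \<ge> q0" using q by auto
    obtain p w v where pwv: "p \<in> P r" "w \<in> list_smult M ys (P q)" "v \<in> T (Suc q)"
      "x = (y [^] Suc s) \<odot>\<^bsub>M\<^esub> p \<oplus>\<^bsub>M\<^esub> (w \<oplus>\<^bsub>M\<^esub> v)" using step[OF r(2), of x s] x r(1) by auto
    have c: "p \<in> carrier M" "w \<in> carrier M" "v \<in> carrier M"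
      using pwv submodule_carrier[OF Ps] submodule_carrier[OF LP] submodule_carrier[OF Ts] by blast+
    have t: "(y [^] Suc s) \<odot>\<^bsub>M\<^esub> p \<in> T (Suc q)"
      using rees_familyD(2)[OF T _ s[OF pwv(1)], of y] nat_pow_smult_Suc[OF y c(1), of s] r(1) by (simp del: R.nat_pow_Suc)
    have tc: "(y [^] Suc s) \<odot>\<^bsub>M\<^esub> p \<in> carrier M" using submodule_carrier[OF Ts t] .
    have "x = w \<oplus>\<^bsub>M\<^esub> ((y [^] Suc s) \<odot>\<^bsub>M\<^esub> p \<oplus>\<^bsub>M\<^esub> v)"
      unfolding pwv(4) using c tc by (simp add: M.a_ac del: R.nat_pow_Suc)
    then show "x \<in> list_smult M ys (P q) <+>\<^bsub>M\<^esub> T (Suc q)"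
      unfolding in_set_add using pwv(2) submodule_add[OF Ts t pwv(3)] by blast
  qed
  then show ?thesis unfolding good_mod_def by blast
qed

lemma rees_family_subset: "rees_family ys W \<Longrightarrow> set zs \<subseteq> set ys \<Longrightarrow> rees_family zs W"
  unfolding rees_family_def by blast

lemma good_mod_drop_list:
  assumes "good_mod (pre @ zs) P T" "\<And>y. y \<in> set pre \<Longrightarrow> nilpotent_mod y P T"
    "set (pre @ zs) \<subseteq> carrier R" "rees_family (pre @ zs) P" "rees_family (pre @ zs) T"
  shows "good_mod zs P T"
  using assms
proof (induction pre)
  case (Cons y pre)
  have "good_mod (pre @ zs) P T"
    by (rule good_mod_drop[of y]) (use Cons.prems in auto)
  moreover have "rees_family (pre @ zs) P" "rees_family (pre @ zs) T"
    by (rule rees_family_subset[OF Cons.prems(4)], force) (rule rees_family_subset[OF Cons.prems(5)], force)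
  ultimately show ?case using Cons by simp
qed simp

subsection \<open>Finiteness of associated primes\<close>

definition colon :: "'c set \<Rightarrow> 'c \<Rightarrow> 'a set" where
  "colon W z = {a \<in> carrier R. a \<odot>\<^bsub>M\<^esub> z \<in> W}"

text \<open>Primes annihilating an element of some \<open>W q\<close> modulo \<open>B q\<close>, all
  degrees collected in one set, so that its finiteness is a bound uniform in
  \<open>q\<close>.\<close>

definition ass_family :: "(nat \<Rightarrow> 'c set) \<Rightarrow> (nat \<Rightarrow> 'c set) \<Rightarrow> 'a set set" where
  "ass_family W B = {\<pp>. primeideal \<pp> R \<and> (\<exists>q. \<exists>z\<in>W q. \<pp> = colon (B q) z)}"

lemma ideal_colon:
  assumes "submodule W R M" "z \<in> carrier M"
  shows "ideal (colon W z) R"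
proof (rule idealI)
  show "ring R" by (rule R.ring_axioms)
  show "subgroup (colon W z) (add_monoid R)"
  proof (rule R.add.subgroupI)
    show "colon W z \<subseteq> carrier R" "colon W z \<noteq> {}"
      unfolding colon_def using submodule_zero[OF assms(1)] assms(2) by (auto intro!: exI[of _ \<zero>])
    show "\<ominus> a \<in> colon W z" if "a \<in> colon W z" for a
      using that submodule_uminus[OF assms(1)] assms(2) unfolding colon_def by (simp add: smult_l_minus)
    show "a \<oplus> b \<in> colon W z" if "a \<in> colon W z" "b \<in> colon W z" for a b
      using that submodule_add[OF assms(1)] assms(2) unfolding colon_def by (simp add: smult_l_distr)
  qed
  show l: "x \<otimes> a \<in> colon W z" if "a \<in> colon W z" "x \<in> carrier R" for a x
    using that submodule_smult[OF assms(1)] assms(2) unfolding colon_def by (simp add: smult_assoc1)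
  show "a \<otimes> x \<in> colon W z" if "a \<in> colon W z" "x \<in> carrier R" for a x
    using l[OF that] that R.m_comm[of a x] unfolding colon_def by auto
qed

lemma colon_eq_carrier: "z \<in> W \<Longrightarrow> submodule W R M \<Longrightarrow> colon W z = carrier R"
  unfolding colon_def using submodule_smult by blast

text \<open>Take a maximal intermediate family \<open>W\<close> with finitely many primes. If
  \<open>W\<close> differed from \<open>Q\<close>, choose a maximal ideal \<open>p\<close> among the
  annihilators of elements of \<open>Q\<close> modulo \<open>W\<close>. The elements of
  \<open>Q\<close> that \<open>p\<close> multiplies into \<open>W\<close> form a strictly larger
  family, and it contributes no new prime except possibly \<open>p\<close>.\<close>

lemma finite_ass_family:
  assumes noeth: "noetherian_module R M" and ys: "set ys \<subseteq> carrier R"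
    and ideals: "acc {I. ideal I R}"
    and Q: "rees_family ys Q" "\<And>n. Q n \<subseteq> forms ys n"
    and B: "rees_family ys B" "\<And>n. B n \<subseteq> Q n"
  shows "finite (ass_family Q B)"
proof -
  note Qs = rees_familyD(1)[OF Q(1)] and Bs = rees_familyD(1)[OF B(1)]
  define D where "D = {W. rees_family ys W \<and> B \<le> W \<and> W \<le> Q \<and> finite (ass_family W B)}"
  have "ass_family B B = {}"
    using colon_eq_carrier[OF _ Bs] primeideal.I_notcarr unfolding ass_family_def by blast
  then have "B \<in> D" using B unfolding D_def by (simp add: le_fun_def)
  moreover have "D \<subseteq> {W. rees_family ys W \<and> (\<forall>n. W n \<subseteq> forms ys n)}"
    unfolding D_def le_fun_def using Q(2) by blast
  ultimately obtain W where W: "W \<in> D" and max: "\<And>V. V \<in> D \<Longrightarrow> W \<le> V \<Longrightarrow> V = W"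
    using acc_maximal[OF acc_rees_families[OF noeth ys], of D] by blast
  have Wf: "rees_family ys W" and BW: "\<And>n. B n \<subseteq> W n" and WQ: "\<And>n. W n \<subseteq> Q n" 
    and fin: "finite (ass_family W B)"
    using W unfolding D_def le_fun_def by auto
  note Ws = rees_familyD(1)[OF Wf]
  show ?thesis
  proof (cases "W = Q")
    case True
    then show ?thesis using fin by simp
  next
    case False
    define C where "C = {colon (W q) z | q z. z \<in> Q q \<and> z \<notin> W q}"
    have "C \<noteq> {}"
    proof -
      obtain q where "W q \<noteq> Q q" using False by (meson ext)
      then show ?thesis using WQ[of q] unfolding C_def by blast
    qed
    moreover have "C \<subseteq> {I. ideal I R}"
      unfolding C_def using ideal_colon[OF Ws] submodule_carrier[OF Qs] by blast
    ultimately obtain p where p: "p \<in> C" and pmax: "\<And>I. I \<in> C \<Longrightarrow> p \<subseteq> I \<Longrightarrow> I = p"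
      using acc_maximal[OF ideals, of C] by blast
    obtain q z where z: "z \<in> Q q" "z \<notin> W q" "p = colon (W q) z" using p unfolding C_def by blast
    have zc: "z \<in> carrier M" using z submodule_carrier[OF Qs] by blast
    have pc: "p \<subseteq> carrier R" using z(3) unfolding colon_def by blast
    define V where "V n = {x \<in> Q n. \<forall>a\<in>p. a \<odot>\<^bsub>M\<^esub> x \<in> W n}" for n
    have VQ: "V n \<subseteq> Q n" for n unfolding V_def by blast
    have Vf: "rees_family ys V" unfolding rees_family_def
    proof (intro conjI allI ballI)
      fix n
      show "submodule (V n) R M" unfolding submodule_iff
      proof (intro conjI ballI)
        show "V n \<subseteq> carrier M" using VQ submodule_subset[OF Qs] by blast
        show "\<zero>\<^bsub>M\<^esub> \<in> V n" using submodule_zero[OF Qs] submodule_zero[OF Ws] pc unfolding V_def by auto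
        show "x \<oplus>\<^bsub>M\<^esub> y \<in> V n" if "x \<in> V n" "y \<in> V n" for x y
          using that submodule_add[OF Qs] submodule_add[OF Ws] pc submodule_carrier[OF Qs]
          unfolding V_def by (auto simp: smult_r_distr subset_iff)
        show "a \<odot>\<^bsub>M\<^esub> x \<in> V n" if a: "a \<in> carrier R" and x: "x \<in> V n" for a x
        proof -
          have "b \<odot>\<^bsub>M\<^esub> (a \<odot>\<^bsub>M\<^esub> x) \<in> W n" if "b \<in> p" for b
            using x that pc a smult_left_commute[of b a x] submodule_smult[OF Ws a] submodule_carrier[OF Qs]
            unfolding V_def by auto
          then show ?thesis using submodule_smult[OF Qs a] x unfolding V_def by blast
        qed
      qed
      fix y x assume y: "y \<in> set ys" and x: "x \<in> V n"
      have "b \<odot>\<^bsub>M\<^esub> (y \<odot>\<^bsub>M\<^esub> x) \<in> W (Suc n)" if "b \<in> p" for b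
        using x that pc y ys smult_left_commute[of b y x] rees_familyD(2)[OF Wf y] submodule_carrier[OF Qs]
        unfolding V_def by (auto simp: subset_iff)
      then show "y \<odot>\<^bsub>M\<^esub> x \<in> V (Suc n)" using rees_familyD(2)[OF Q(1) y] x unfolding V_def by blast
    qed
    have WV: "W n \<subseteq> V n" for n
      using WQ submodule_smult[OF Ws] pc unfolding V_def by blast
    have "ass_family V B \<subseteq> insert p (ass_family W B)"
    proof
      fix p' assume "p' \<in> ass_family V B"
      then obtain n u where pr: "primeideal p' R" and u: "u \<in> V n" "p' = colon (B n) u"
        unfolding ass_family_def by blast
      interpret p': primeideal p' R by (rule pr)
      have uc: "u \<in> carrier M" using u(1) VQ submodule_carrier[OF Qs] by blast
      show "p' \<in> insert p (ass_family W B)"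
      proof (cases "\<exists>a\<in>carrier R. a \<odot>\<^bsub>M\<^esub> u \<in> W n \<and> a \<notin> p'")
        case True
        \<comment> \<open>As \<open>p'\<close> is prime, multiplying \<open>u\<close> by an element
          outside \<open>p'\<close> does not change its annihilator, so \<open>p'\<close> already
          comes from \<open>W\<close>.\<close>
        then obtain a where a: "a \<in> carrier R" "a \<odot>\<^bsub>M\<^esub> u \<in> W n" "a \<notin> p'" by blast
        have "b \<odot>\<^bsub>M\<^esub> (a \<odot>\<^bsub>M\<^esub> u) \<in> B n \<longleftrightarrow> b \<in> p'" if b: "b \<in> carrier R" for b
        proof -
          have "b \<odot>\<^bsub>M\<^esub> (a \<odot>\<^bsub>M\<^esub> u) \<in> B n \<longleftrightarrow> b \<otimes> a \<in> p'"
            unfolding u(2) colon_def using a(1) b uc by (simp add: smult_assoc1)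
          also have "\<dots> \<longleftrightarrow> b \<in> p'" using p'.I_prime[OF b a(1)] a p'.I_r_closed[of b a] by blast
          finally show ?thesis .
        qed
        then have "p' = colon (B n) (a \<odot>\<^bsub>M\<^esub> u)" unfolding colon_def using p'.Icarr by blast
        then show ?thesis using pr a(2) unfolding ass_family_def by blast
      next
        case False
        \<comment> \<open>Here the annihilator of \<open>u\<close> modulo \<open>W\<close> is
          \<open>p'\<close> itself. It contains \<open>p\<close> by the choice of \<open>V\<close>,
          and maximality of \<open>p\<close> gives equality.\<close>
        then have le: "colon (W n) u \<subseteq> p'" unfolding colon_def by blast
        have "p' \<subseteq> colon (W n) u" using u(2) BW unfolding colon_def by blast
        then have eq: "colon (W n) u = p'" using le by blast
        have "u \<notin> W n" using colon_eq_carrier[OF _ Ws] eq p'.I_notcarr by blast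
        then have "colon (W n) u \<in> C" using u(1) VQ unfolding C_def by blast
        moreover have "p \<subseteq> colon (W n) u" using u(1) pc unfolding V_def colon_def by blast
        ultimately show ?thesis using pmax eq by blast
      qed
    qed
    then have "finite (ass_family V B)" using fin finite_subset by blast
    moreover have "B n \<subseteq> V n" for n using BW[of n] WV[of n] by blast
    ultimately have "V \<in> D" using Vf VQ unfolding D_def le_fun_def by blast
    then have "V = W" using max WV by (simp add: le_fun_def)
    moreover have "z \<in> V q" using z unfolding V_def colon_def by blast
    ultimately show ?thesis using z(2) by simp
  qed
qed

end

section \<open>Initial degrees\<close>

definition is_least :: "int \<Rightarrow> int set \<Rightarrow> bool" where
  "is_least m S \<longleftrightarrow> m \<in> S \<and> (\<forall>e\<in>S. m \<le> e)"

text \<open>Eventual linearity of the least element of \<open>D q\<close>, with slope in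
  \<open>A\<close>. Emptiness is a separate alternative since the minimum is then infinite; it is
  what makes the notion stable under unions.\<close>

definition ev_linear :: "nat set \<Rightarrow> (nat \<Rightarrow> int set) \<Rightarrow> bool" where
  "ev_linear A D \<longleftrightarrow> (\<forall>\<^sub>F q in sequentially. D q = {}) \<or>
     (\<exists>a\<in>A. \<exists>b. \<forall>\<^sub>F q in sequentially. is_least (int a * int q + b) (D q))"

lemma ev_linear_mono: "ev_linear A D \<Longrightarrow> A \<subseteq> B \<Longrightarrow> ev_linear B D"
  unfolding ev_linear_def by blast

lemma is_least_union: "is_least m S \<Longrightarrow> is_least n T \<Longrightarrow> is_least (min m n) (S \<union> T)"
  unfolding is_least_def min_def by force

text \<open>The smaller slope wins in the long run; for equal slopes the smaller constant
  does.\<close>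

lemma eventually_min_linear:
  fixes b b' :: int
  shows "\<exists>c. (c = a \<or> c = a') \<and> (\<exists>d. \<forall>\<^sub>F q in sequentially. min (int a * int q + b) (int a' * int q + b') = int c * int q + d)"
proof -
  have *: "\<exists>d. \<forall>\<^sub>F q in sequentially. min (int a * int q + b) (int a' * int q + b') = int a * int q + d"
    if "a \<le> a'" for a a' b b'
  proof (cases "a = a'")
    case True
    then show ?thesis by (intro exI[of _ "min b b'"]) (auto simp: min_def)
  next
    case False
    then have "int a + 1 \<le> int a'" using that by simp
    \<comment> \<open>Distinct integer slopes differ by at least one, so after
      \<open>\<bar>b - b'\<bar>\<close> steps the difference of the constants is made up.\<close>
    have "min (int a * int q + b) (int a' * int q + b') = int a * int q + b" if "q \<ge> nat \<bar>b - b'\<bar>" for q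
    proof -
      have "(int a + 1) * int q \<le> int a' * int q" using \<open>int a + 1 \<le> int a'\<close> by (intro mult_right_mono) auto
      moreover have "int q \<ge> b - b'" using that by linarith
      ultimately show ?thesis by (simp add: algebra_simps)
    qed
    then show ?thesis unfolding eventually_sequentially by blast
  qed
  show ?thesis
  proof (cases "a \<le> a'")
    case True
    then show ?thesis using *[OF True] by blast
  next
    case False
    then show ?thesis using *[of a' a b' b] by (auto simp: min.commute intro!: exI[of _ a'])
  qed
qed

lemma ev_linear_cong:
  assumes "\<forall>\<^sub>F q in sequentially. D q = E q" "ev_linear A D"
  shows "ev_linear A E"
proof -
  have "\<forall>\<^sub>F q in sequentially. E q = {}" if "\<forall>\<^sub>F q in sequentially. D q = {}"
    using that assms(1) by eventually_elim simp
  moreover have "\<forall>\<^sub>F q in sequentially. is_least (int a * int q + b) (E q)"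
    if "\<forall>\<^sub>F q in sequentially. is_least (int a * int q + b) (D q)" for a b
    using that assms(1) by eventually_elim simp
  ultimately show ?thesis using assms(2) unfolding ev_linear_def by blast
qed

lemma ev_linear_union:
  assumes "ev_linear A D" "ev_linear A E"
  shows "ev_linear A (\<lambda>q. D q \<union> E q)"
proof (cases "(\<forall>\<^sub>F q in sequentially. D q = {}) \<or> (\<forall>\<^sub>F q in sequentially. E q = {})")
  case True
  then show ?thesis
  proof
    assume e: "\<forall>\<^sub>F q in sequentially. D q = {}"
    then have "\<forall>\<^sub>F q in sequentially. E q = D q \<union> E q" by eventually_elim simp
    then show ?thesis by (rule ev_linear_cong) (rule assms(2))
  next
    assume e: "\<forall>\<^sub>F q in sequentially. E q = {}"
    then have "\<forall>\<^sub>F q in sequentially. D q = D q \<union> E q" by eventually_elim simp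
    then show ?thesis by (rule ev_linear_cong) (rule assms(1))
  qed
next
  case False
  then obtain a b a' b' where 1: "a \<in> A" "\<forall>\<^sub>F q in sequentially. is_least (int a * int q + b) (D q)"
    and 2: "a' \<in> A" "\<forall>\<^sub>F q in sequentially. is_least (int a' * int q + b') (E q)"
    using assms unfolding ev_linear_def by blast
  obtain c d where c: "c = a \<or> c = a'"
    "\<forall>\<^sub>F q in sequentially. min (int a * int q + b) (int a' * int q + b') = int c * int q + d"
    using eventually_min_linear[of a a' b b'] by blast
  have "\<forall>\<^sub>F q in sequentially. is_least (int c * int q + d) (D q \<union> E q)"
    using 1(2) 2(2) c(2) by eventually_elim (use is_least_union in metis)
  then show ?thesis using c(1) 1(1) 2(1) unfolding ev_linear_def by blast
qed

lemma int_least_ex: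
  fixes S :: "int set"
  assumes "S \<noteq> {}" "\<And>e. e \<in> S \<Longrightarrow> e0 \<le> e"
  shows "\<exists>m. is_least m S"
proof -
  define m where "m = (LEAST k. k \<in> (\<lambda>e. nat (e - e0)) ` S)"
  have "\<exists>k. k \<in> (\<lambda>e. nat (e - e0)) ` S" using assms(1) by blast
  then have m: "m \<in> (\<lambda>e. nat (e - e0)) ` S" "\<And>k. k \<in> (\<lambda>e. nat (e - e0)) ` S \<Longrightarrow> m \<le> k"
    unfolding m_def by (rule LeastI_ex, simp add: Least_le)
  then obtain e where e: "e \<in> S" "m = nat (e - e0)" by blast
  have "e \<le> e'" if "e' \<in> S" for e'
    using m(2)[of "nat (e' - e0)"] that e assms(2)[OF that] assms(2)[OF e(1)] by auto
  then show ?thesis using e(1) unfolding is_least_def by blast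
qed

text \<open>\<open>up\<close> lets the minimum grow by at most \<open>d\<close>, and
  \<open>down\<close> forces it to grow by at least \<open>d\<close>. If \<open>D q0\<close> is
  empty, \<open>down\<close> propagates emptiness to all later degrees. The lower bound provides the
  first minimum.\<close>

lemma ev_linear_step:
  assumes up: "\<And>q e. q \<ge> q0 \<Longrightarrow> e \<in> D q \<Longrightarrow> e + int d \<in> D (Suc q)"
    and down: "\<And>q e. q \<ge> q0 \<Longrightarrow> e \<in> D (Suc q) \<Longrightarrow> \<exists>e'\<in>D q. e' + int d \<le> e"
    and bound: "\<And>q e. e \<in> D q \<Longrightarrow> e0 \<le> e"
  shows "ev_linear {d} D"
proof (cases "D q0 = {}")
  case True
  have "D (q0 + k) = {}" for k
    by (induction k) (use True down in \<open>auto dest!: down[rotated]\<close>)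
  then have "\<forall>q\<ge>q0. D q = {}" by (metis le_add_diff_inverse)
  then show ?thesis unfolding ev_linear_def eventually_sequentially by blast
next
  case False
  obtain m where m: "is_least m (D q0)" using int_least_ex[OF False, of e0] bound by blast
  have k: "is_least (m + int d * int k) (D (q0 + k))" for k
  proof (induction k)
    case (Suc k)
    then have "m + int d * int k \<in> D (q0 + k)" "\<And>e. e \<in> D (q0 + k) \<Longrightarrow> m + int d * int k \<le> e"
      unfolding is_least_def by auto
    then have least: "m + int d * int k \<in> D (q0 + k)" "\<And>e. e \<in> D (q0 + k) \<Longrightarrow> m + int d * int k \<le> e" .
    have eq: "m + int d * int (Suc k) = m + int d * int k + int d" by (simp add: algebra_simps)
    show ?case unfolding is_least_def eq
    proof (intro conjI ballI)
      show "m + int d * int k + int d \<in> D (q0 + Suc k)" using up[of "q0 + k"] least(1) by simp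
      fix e assume "e \<in> D (q0 + Suc k)"
      then obtain e' where "e' \<in> D (q0 + k)" "e' + int d \<le> e" using down[of "q0 + k" e] by auto
      then show "m + int d * int k + int d \<le> e" using least(2) by force
    qed
  qed (simp add: m)
  have "is_least (int d * int q + (m - int d * int q0)) (D q)" if "q \<ge> q0" for q
    using k[of "q - q0"] that by (simp add: algebra_simps of_nat_diff)
  then show ?thesis unfolding ev_linear_def eventually_sequentially by blast
qed

text \<open>The slope survives and the constant changes by \<open>- a g\<close>. This undoes the
  reindexing that Artin--Rees causes.\<close>

lemma ev_linear_shift:
  assumes "ev_linear A (\<lambda>q. D (q + g))"
  shows "ev_linear A D"
proof -
  have s: "(\<forall>\<^sub>F q in sequentially. P (q + g)) \<longleftrightarrow> (\<forall>\<^sub>F q in sequentially. P q)" for P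
    by (rule eventually_sequentially_seg)
  show ?thesis
    using assms unfolding ev_linear_def
  proof (elim disjE bexE exE)
    assume "\<forall>\<^sub>F q in sequentially. D (q + g) = {}"
    then show "(\<forall>\<^sub>F q in sequentially. D q = {}) \<or>
      (\<exists>a\<in>A. \<exists>b. \<forall>\<^sub>F q in sequentially. is_least (int a * int q + b) (D q))"
      using s[of "\<lambda>q. D q = {}"] by simp
  next
    fix a b assume a: "a \<in> A" "\<forall>\<^sub>F q in sequentially. is_least (int a * int q + b) (D (q + g))"
    then have "\<forall>\<^sub>F q in sequentially. is_least (int a * int (q + g) + (b - int a * int g)) (D (q + g))"
      by (simp add: algebra_simps)
    then have "\<forall>\<^sub>F q in sequentially. is_least (int a * int q + (b - int a * int g)) (D q)"
      using s[of "\<lambda>q. is_least (int a * int q + (b - int a * int g)) (D q)"] by simp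
    then show "(\<forall>\<^sub>F q in sequentially. D q = {}) \<or>
      (\<exists>a\<in>A. \<exists>b. \<forall>\<^sub>F q in sequentially. is_least (int a * int q + b) (D q))"
      using a(1) by blast
  qed
qed

context module
begin

lemma uminus_zero [simp]: "\<ominus>\<^bsub>M\<^esub> \<zero>\<^bsub>M\<^esub> = \<zero>\<^bsub>M\<^esub>"
  by (metis M.l_neg M.r_zero M.a_inv_closed M.zero_closed)

lemma nat_pow_smult_add:
  "y \<in> carrier R \<Longrightarrow> x \<in> carrier M \<Longrightarrow> (y [^] (s::nat)) \<odot>\<^bsub>M\<^esub> (y \<odot>\<^bsub>M\<^esub> x) = (y [^] Suc s) \<odot>\<^bsub>M\<^esub> x"
  by (metis R.nat_pow_Suc R.nat_pow_closed smult_assoc1)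

lemma submodule_colon_elem:
  assumes "a \<in> carrier R" "submodule W R M"
  shows "submodule {x \<in> carrier M. a \<odot>\<^bsub>M\<^esub> x \<in> W} R M"
proof -
  have "module_map R M M (\<lambda>x. a \<odot>\<^bsub>M\<^esub> x)"
    by unfold_locales (use assms in \<open>auto simp: linear_map_def smult_r_distr smult_left_commute\<close>)
  then show ?thesis using module_map.submodule_preimage assms(2) by blast
qed

end

section \<open>Linear growth of initial degrees\<close>

context proj_graded
begin

text \<open>When \<open>A\<close> and \<open>B\<close> are homogeneous and
  \<open>B q \<subseteq> A q\<close>, these are the degrees in which the quotient is nonzero.
  Neither is required, so \<open>B\<close> may stick out of \<open>A\<close>.\<close>

definition degs :: "(nat \<Rightarrow> 'b set) \<Rightarrow> (nat \<Rightarrow> 'b set) \<Rightarrow> nat \<Rightarrow> int set" where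
  "degs A B q = {e. \<exists>x\<in>A q. \<pi> e x = x \<and> x \<notin> B q}"

text \<open>On homogeneous elements of \<open>P\<close>, multiplication by \<open>y\<close> is
  injective modulo \<open>G\<close>, so degrees move up by \<open>d\<close>. Conversely, up to
  \<open>T\<close>, an element of \<open>P (Suc q)\<close> is a sum of products \<open>z u\<close>
  with \<open>z\<close> of degree at least \<open>d\<close>. If all homogeneous elements of
  \<open>P q\<close> of degree at most \<open>e - d\<close> were in \<open>G\<close>, the part of
  degree \<open>e\<close> of each product would be in \<open>G\<close> too.\<close>

lemma initial_degrees_step:
  assumes y: "y \<in> rgrade R d" and zs: "\<And>z d'. (z, d') \<in> set zs \<Longrightarrow> z \<in> rgrade R d' \<and> d \<le> d'"
    and good: "good_mod (map fst zs) P T"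
    and P: "\<And>q. submodule (P q) R M" "\<And>q. homog (P q)" "\<And>q x. x \<in> P q \<Longrightarrow> y \<odot>\<^bsub>M\<^esub> x \<in> P (Suc q)"
    and T: "\<And>q. submodule (T q) R M" "\<And>q. homog (T q)"
    and G: "rees_family (map fst zs) G" "\<And>q. T q \<subseteq> G q" "\<And>q. homog (G q)"
    and inj: "\<And>q x e. x \<in> P q \<Longrightarrow> \<pi> e x = x \<Longrightarrow> y \<odot>\<^bsub>M\<^esub> x \<in> G (Suc q) \<Longrightarrow> x \<in> G q"
    and bound: "\<And>e x. e < e0 \<Longrightarrow> x \<in> carrier M \<Longrightarrow> \<pi> e x = \<zero>\<^bsub>M\<^esub>"
  shows "ev_linear {d} (degs P G)"
proof -
  note Ps = P(1) and Gs = rees_familyD(1)[OF G(1)]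
  obtain q0 where q0: "\<And>q. q \<ge> q0 \<Longrightarrow> P (Suc q) \<subseteq> list_smult M (map fst zs) (P q) <+>\<^bsub>M\<^esub> T (Suc q)"
    using good unfolding good_mod_def by blast
  show ?thesis
  proof (rule ev_linear_step[of q0 _ d e0])
    fix q e assume "e \<in> degs P G q"
    then obtain x where x: "x \<in> P q" "\<pi> e x = x" "x \<notin> G q" unfolding degs_def by blast
    then have "\<pi> (e + int d) (y \<odot>\<^bsub>M\<^esub> x) = y \<odot>\<^bsub>M\<^esub> x"
      using proj_smult[OF y submodule_carrier[OF Ps]] by metis
    then show "e + int d \<in> degs P G (Suc q)" using x P(3) inj unfolding degs_def by blast
  next
    fix q e assume "e \<in> degs P G q"
    then obtain x where x: "x \<in> P q" "\<pi> e x = x" "x \<notin> G q" unfolding degs_def by blast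
    then show "e0 \<le> e" using bound[of e x] submodule_carrier[OF Ps] submodule_zero[OF Gs] by (metis not_le)
  next
    fix q e assume q: "q0 \<le> q" and e: "e \<in> degs P G (Suc q)"
    then obtain x where x: "x \<in> P (Suc q)" "\<pi> e x = x" "x \<notin> G (Suc q)" unfolding degs_def by blast
    show "\<exists>e'\<in>degs P G q. e' + int d \<le> e"
    proof (rule ccontr)
      assume no: "\<not> (\<exists>e'\<in>degs P G q. e' + int d \<le> e)"
      \<comment> \<open>Membership tests only the component of degree \<open>e\<close>; this set is
        additively closed, which suffices for \<open>list_smult_least\<close>.\<close>
      let ?W = "{u \<in> carrier M. \<pi> e u \<in> G (Suc q)}"
      have add: "u \<oplus>\<^bsub>M\<^esub> v \<in> ?W" if "u \<in> ?W" "v \<in> ?W" for u v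
        using that submodule_add[OF Gs] by (auto simp: proj_add)
      have "list_smult M (map fst zs) (P q) \<subseteq> ?W"
      proof (rule list_smult_least)
        show "\<zero>\<^bsub>M\<^esub> \<in> ?W" using submodule_zero[OF Gs] by simp
        show "u \<oplus>\<^bsub>M\<^esub> v \<in> ?W" if "u \<in> ?W" "v \<in> ?W" for u v using add that .
        fix z u assume z: "z \<in> set (map fst zs)" and u: "u \<in> P q"
        then obtain d' where "(z, d') \<in> set zs" by auto
        then have d': "z \<in> rgrade R d'" "d \<le> d'" using zs by blast+
        have uc: "u \<in> carrier M" using u submodule_carrier[OF Ps] by blast
        have "\<pi> (e - int d') u \<in> P q" "\<pi> (e - int d') (\<pi> (e - int d') u) = \<pi> (e - int d') u"
          using homogD[OF P(2) u] proj_proj[OF uc] by auto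
        moreover have "e - int d' \<notin> degs P G q" using no d' by force
        ultimately have "\<pi> (e - int d') u \<in> G q" unfolding degs_def by blast
        then show "z \<odot>\<^bsub>M\<^esub> u \<in> ?W"
          using rees_familyD(2)[OF G(1) z] proj_smult'[OF d'(1) uc] uc rgrade_carrier[OF d'(1)] by auto
      qed
      moreover have "T (Suc q) \<subseteq> ?W"
        using homogD[OF T(2)] G(2) submodule_carrier[OF T(1)] by blast
      moreover obtain u v where "u \<in> list_smult M (map fst zs) (P q)" "v \<in> T (Suc q)" "x = u \<oplus>\<^bsub>M\<^esub> v"
        using q0[OF q] x(1) unfolding in_set_add[of _ M] by (meson in_set_add subsetD)
      ultimately have "x \<in> ?W" using add[of u v] by blast
      then show False using x by simp
    qed
  qed
qed

text \<open>The list \<open>pre\<close> holds the variables already treated. They act nilpotently on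
  \<open>P\<close> modulo \<open>T\<close>, so \<open>zs\<close> alone generates in large degrees,
  while the chain condition is still applied with all variables. When \<open>zs\<close> is
  exhausted, \<open>P\<close> lies in \<open>T\<close> in large degrees and no degree
  remains.\<close>

theorem ev_linear_degs_aux:
  assumes noeth: "noetherian_module R M"
    and bound: "\<And>e x. e < e0 \<Longrightarrow> x \<in> carrier M \<Longrightarrow> \<pi> e x = \<zero>\<^bsub>M\<^esub>"
    and hom: "\<And>y d. (y, d) \<in> set (pre @ zs) \<Longrightarrow> y \<in> rgrade R d"
    and T: "rees_family (map fst (pre @ zs)) T" "\<And>q. homog (T q)"
    and P: "rees_family (map fst (pre @ zs)) P" "\<And>q. P q \<subseteq> forms (map fst (pre @ zs)) q" "\<And>q. homog (P q)"
    and nil: "\<And>y. y \<in> set (map fst pre) \<Longrightarrow> nilpotent_mod y P T"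
    and sorted: "sorted (map snd zs)"
  shows "ev_linear (snd ` set zs) (degs P T)"
  using hom T P nil sorted
proof (induction zs arbitrary: pre P)
  case Nil
  let ?ys = "map fst (pre @ [])"
  have ys: "set ?ys \<subseteq> carrier R" using Nil.prems(1) rgrade_carrier by fastforce
  note Ps = rees_familyD(1)[OF Nil.prems(4)] and Ts = rees_familyD(1)[OF Nil.prems(2)]
  obtain n0 where n0: "\<And>n. n \<ge> n0 \<Longrightarrow> P (Suc n) = list_smult M ?ys (P n)"
    using rees_family_eventually_good[OF noeth ys Nil.prems(4,5)] by blast
  have "good_mod ?ys P T" unfolding good_mod_def
    using n0 set_add_upper1[OF Ts submodule_subset[OF submodule_list_smult[OF ys Ps]]] by blast
  then have "good_mod [] P T"
    using good_mod_drop_list[of "map fst pre" "[]" P T] Nil.prems ys by simp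
  then obtain q0 where q0: "\<And>q. q \<ge> q0 \<Longrightarrow> P (Suc q) \<subseteq> {\<zero>\<^bsub>M\<^esub>} <+>\<^bsub>M\<^esub> T (Suc q)"
    unfolding good_mod_def by auto
  have "P q \<subseteq> T q" if "q \<ge> Suc q0" for q
  proof -
    obtain r where r: "q = Suc r" "r \<ge> q0" using \<open>q \<ge> Suc q0\<close> by (metis Suc_le_D Suc_le_mono)
    then show ?thesis using q0[OF r(2)] submodule_carrier[OF Ts] by (force simp: in_set_add)
  qed
  then have "degs P T q = {}" if "q \<ge> Suc q0" for q using that unfolding degs_def by blast
  then show ?case unfolding ev_linear_def eventually_sequentially by blast
next
  case (Cons yd zs)
  obtain y d where yd: "yd = (y, d)" by force
  let ?zs = "(y, d) # zs"
  let ?ys = "map fst (pre @ ?zs)"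
  note prems = Cons.prems[unfolded yd]
  have y: "y \<in> rgrade R d" using prems(1) by simp
  have yc: "y \<in> carrier R" using rgrade_carrier[OF y] .
  have ysh: "\<exists>d. z \<in> rgrade R d" if "z \<in> set ?ys" for z using prems(1) that by fastforce
  have ys: "set ?ys \<subseteq> carrier R" using ysh rgrade_carrier by blast
  have yin: "y \<in> set ?ys" by simp
  note Pf = prems(4) and Tf = prems(2)
  note Ps = rees_familyD(1)[OF Pf] and Ts = rees_familyD(1)[OF Tf]
  \<comment> \<open>\<open>G s\<close> is the part of \<open>P\<close> that the power
    \<open>y [^] s\<close> sends into \<open>T\<close>, with the index of \<open>T\<close> raised by
    \<open>s\<close> accordingly. The use of \<open>core\<close> makes it homogeneous by
    construction. These families ascend with \<open>s\<close> and stop at some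
    \<open>s0\<close>.\<close>
  define K where "K s q = {x \<in> carrier M. (y [^] s) \<odot>\<^bsub>M\<^esub> x \<in> T (q + s)}" for s :: nat and q
  define G where "G s q = P q \<inter> core (K s q)" for s q
  have Kf: "rees_family ?ys (K s)" for s
    unfolding rees_family_def
  proof (intro conjI allI ballI)
    show "submodule (K s q) R M" for q unfolding K_def by (rule submodule_colon_elem) (use yc Ts in auto)
    fix z q x assume z: "z \<in> set ?ys" and x: "x \<in> K s q"
    have zc: "z \<in> carrier R" using z ys by blast
    have "(y [^] s) \<odot>\<^bsub>M\<^esub> (z \<odot>\<^bsub>M\<^esub> x) = z \<odot>\<^bsub>M\<^esub> ((y [^] s) \<odot>\<^bsub>M\<^esub> x)"
      using x zc yc smult_left_commute unfolding K_def by simp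
    then show "z \<odot>\<^bsub>M\<^esub> x \<in> K s (Suc q)" using x zc rees_familyD(2)[OF Tf z] unfolding K_def by simp
  qed
  note Ks = rees_familyD(1)[OF Kf]
  have Gf: "rees_family ?ys (G s)" for s
    unfolding G_def by (intro rees_family_Int Pf rees_family_core Kf ysh)
  note Gs = rees_familyD(1)[OF Gf]
  have GP: "G s q \<subseteq> P q" for s q unfolding G_def by blast
  have Ghom: "homog (G s q)" for s q
    unfolding G_def by (intro homog_Int prems(6) homog_core Ks)
  have Giff: "x \<in> G s q \<longleftrightarrow> (y [^] s) \<odot>\<^bsub>M\<^esub> x \<in> T (q + s)" if "x \<in> P q" "\<pi> e x = x" for x s q e
    using that core_homogeneous_iff[OF submodule_carrier[OF Ps] _ Ks] submodule_carrier[OF Ps]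
    unfolding G_def K_def by auto
  have KSuc: "K s q \<subseteq> K (Suc s) q" for s q
  proof
    fix x assume x: "x \<in> K s q"
    then have "y \<odot>\<^bsub>M\<^esub> ((y [^] s) \<odot>\<^bsub>M\<^esub> x) \<in> T (Suc (q + s))"
      using rees_familyD(2)[OF Tf yin] unfolding K_def by blast
    then show "x \<in> K (Suc s) q"
      using x nat_pow_smult_Suc[OF yc, of x s] unfolding K_def by (simp del: R.nat_pow_Suc)
  qed
  have "G s \<le> G (Suc s)" for s
    using KSuc unfolding G_def core_def le_fun_def by blast
  moreover have "G s \<in> {W. rees_family ?ys W \<and> (\<forall>n. W n \<subseteq> forms ?ys n)}" for s
    using Gf GP prems(5) by blast
  ultimately obtain s0 where s0: "\<And>s. s \<ge> s0 \<Longrightarrow> G s = G s0"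
    using accD[OF acc_rees_families[OF noeth ys], of G] by blast
  have GK: "G s0 q \<subseteq> K s0 q" for q using core_subset[OF Ks] unfolding G_def by blast
  have TG: "x \<in> G s0 q" if "x \<in> T q" "x \<in> P q" "\<pi> e x = x" for x q e
    unfolding Giff[OF that(2,3)]
  proof (induction s0)
    case 0
    then show ?case using that submodule_carrier[OF Ps] by simp
  next
    case (Suc s)
    then show ?case
      using rees_familyD(2)[OF Tf yin] nat_pow_smult_Suc[OF yc submodule_carrier[OF Ps that(2)], of s]
      by (simp del: R.nat_pow_Suc)
  qed
  \<comment> \<open>A homogeneous element of \<open>P\<close> in \<open>T\<close> is also in
    \<open>G s0\<close>, so one outside \<open>T\<close> either avoids \<open>G s0\<close> or lies
    in \<open>G s0\<close> and avoids \<open>T\<close>.\<close>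
  have split: "degs P T q = degs P (G s0) q \<union> degs (G s0) T q" for q
    using TG GP unfolding degs_def by blast
  \<comment> \<open>On the torsion part \<open>y\<close> joins the nilpotent variables, which
    shortens \<open>zs\<close>.\<close>
  have 1: "ev_linear (snd ` set zs) (degs (G s0) T)"
  proof (rule Cons.IH[of "pre @ [(y, d)]"])
    show "\<And>y' d'. (y', d') \<in> set ((pre @ [(y, d)]) @ zs) \<Longrightarrow> y' \<in> rgrade R d'"
      "rees_family (map fst ((pre @ [(y, d)]) @ zs)) T" "\<And>q. homog (T q)"
      "rees_family (map fst ((pre @ [(y, d)]) @ zs)) (G s0)"
      "sorted (map snd zs)" "\<And>q. homog (G s0 q)"
      using prems Gf Ghom by auto
    show "G s0 q \<subseteq> forms (map fst ((pre @ [(y, d)]) @ zs)) q" for q using prems(5)[of q] GP[of s0 q] by simp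
    fix z assume z: "z \<in> set (map fst (pre @ [(y, d)]))"
    show "nilpotent_mod z (G s0) T"
    proof (cases "z \<in> set (map fst pre)")
      case True
      then show ?thesis using prems(7) GP unfolding nilpotent_mod_def by blast
    next
      case False
      then have "z = y" using z by auto
      then show ?thesis using GK unfolding nilpotent_mod_def K_def by blast
    qed
  qed
  have 2: "ev_linear {d} (degs P (G s0))"
  proof -
    obtain n0 where n0: "\<And>n. n \<ge> n0 \<Longrightarrow> P (Suc n) = list_smult M ?ys (P n)"
      using rees_family_eventually_good[OF noeth ys prems(4,5)] by blast
    have "good_mod ?ys P T" unfolding good_mod_def
      using n0 set_add_upper1[OF Ts submodule_subset[OF submodule_list_smult[OF ys Ps]]] by blast
    then have good: "good_mod (map fst ?zs) P T"
      using good_mod_drop_list[of "map fst pre" "map fst ?zs" P T] prems ys by simp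
    \<comment> \<open>The estimate needs a modulus containing \<open>T\<close>, whereas
      \<open>G s0\<close> lies in \<open>P\<close> and need not contain \<open>T\<close>.
      \<open>TP\<close> contains \<open>T\<close> and meets \<open>P\<close> exactly in
      \<open>G s0\<close>. Injectivity of \<open>y\<close> modulo \<open>TP\<close> is the equality
      of \<open>G (Suc s0)\<close> and \<open>G s0\<close>.\<close>
    define TP where "TP q = core (K s0 q)" for q
    have coreK: "degs P (G s0) q = degs P TP q" for q unfolding degs_def G_def TP_def by blast
    have TPf: "rees_family ?ys TP" unfolding TP_def by (intro rees_family_core Kf ysh)
    have "ev_linear {d} (degs P TP)"
    proof (rule initial_degrees_step[OF y, of ?zs P T])
      show "\<And>z d'. (z, d') \<in> set ?zs \<Longrightarrow> z \<in> rgrade R d' \<and> d \<le> d'" using prems(1,8) by fastforce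
      show "good_mod (map fst ?zs) P T" by (rule good)
      show "\<And>q x. x \<in> P q \<Longrightarrow> y \<odot>\<^bsub>M\<^esub> x \<in> P (Suc q)" using rees_familyD(2)[OF Pf yin] .
      show "rees_family (map fst ?zs) TP" by (rule rees_family_subset[OF TPf]) auto
      show "homog (TP q)" for q unfolding TP_def using homog_core Ks .
      show "T q \<subseteq> TP q" for q
      proof
        fix x assume x: "x \<in> T q"
        have "(y [^] s) \<odot>\<^bsub>M\<^esub> \<pi> e x \<in> T (q + s)" for e s
        proof (induction s)
          case 0
          then show ?case using homogD[OF prems(3) x, of e] submodule_carrier[OF Ts, of "\<pi> e x"] by simp
        next
          case (Suc s)
          then show ?case
            using rees_familyD(2)[OF Tf yin] nat_pow_smult_Suc[OF yc submodule_carrier[OF Ts homogD[OF prems(3) x]], of s e]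
            by (simp del: R.nat_pow_Suc)
        qed
        then show "x \<in> TP q" using submodule_carrier[OF Ts] x unfolding TP_def core_def K_def by auto
      qed
      fix q x e assume x: "x \<in> P q" "\<pi> e x = x" "y \<odot>\<^bsub>M\<^esub> x \<in> TP (Suc q)"
      have xc: "x \<in> carrier M" using x submodule_carrier[OF Ps] by blast
      have "y \<odot>\<^bsub>M\<^esub> x \<in> K s0 (Suc q)" using x(3) core_subset[OF Ks] unfolding TP_def by blast
      then have "(y [^] Suc s0) \<odot>\<^bsub>M\<^esub> x \<in> T (q + Suc s0)"
        using nat_pow_smult_add[OF yc xc, of s0] unfolding K_def by (simp del: R.nat_pow_Suc)
      then have "x \<in> G (Suc s0) q" using Giff[OF x(1,2)] by blast
      then have "x \<in> G s0 q" using s0[of "Suc s0"] by simp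
      then show "x \<in> TP q" unfolding G_def TP_def by blast
    qed (use prems(6) Ps Ts prems(3) bound in auto)
    then show ?thesis unfolding coreK .
  qed
  have "ev_linear (snd ` set ?zs) (\<lambda>q. degs P (G s0) q \<union> degs (G s0) T q)"
    by (rule ev_linear_union; rule ev_linear_mono, (rule 1 | rule 2)) auto
  then show ?case unfolding yd by (simp add: split[abs_def])
qed

text \<open>Homogeneity of the families is removed by passing to cores, which leaves the homogeneous
  elements, hence \<open>degs\<close>, unchanged. This is what admits families defined by an
  arbitrary prime.\<close>

theorem ev_linear_degs:
  assumes "noetherian_module R M" "\<And>e x. e < e0 \<Longrightarrow> x \<in> carrier M \<Longrightarrow> \<pi> e x = \<zero>\<^bsub>M\<^esub>"
    and "\<And>y d. (y, d) \<in> set zs \<Longrightarrow> y \<in> rgrade R d" "sorted (map snd zs)"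
    and T: "rees_family (map fst zs) T"
    and P: "rees_family (map fst zs) P" "\<And>q. P q \<subseteq> forms (map fst zs) q"
  shows "ev_linear (snd ` set zs) (degs P T)"
proof -
  have zs: "\<exists>d. y \<in> rgrade R d" if "y \<in> set (map fst zs)" for y using assms(3) that by fastforce
  note Ts = rees_familyD(1)[OF T] and Ps = rees_familyD(1)[OF P(1)]
  have "ev_linear (snd ` set zs) (degs (\<lambda>q. core (P q)) (\<lambda>q. core (T q)))"
    by (rule ev_linear_degs_aux[where pre = "[]" and ?e0.0 = e0])
      (use assms rees_family_core[OF T zs] rees_family_core[OF P(1) zs] homog_core[OF Ts] homog_core[OF Ps]
        order_trans[OF core_subset[OF Ps] P(2)] in auto)
  moreover have "degs (\<lambda>q. core (P q)) (\<lambda>q. core (T q)) = degs P T"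
    using core_homogeneous_iff[OF _ _ Ts] core_homogeneous_iff[OF _ _ Ps] core_subset[OF Ps] submodule_carrier[OF Ps]
    unfolding degs_def by (intro ext) blast
  ultimately show ?thesis by simp
qed

section \<open>Associated primes are annihilators of homogeneous elements\<close>

lemma prime_pow:
  assumes "primeideal \<pp> R" "a \<in> carrier R" "a [^] (n::nat) \<in> \<pp>"
  shows "a \<in> \<pp>"
  using assms(3)
proof (induction n)
  case 0
  then show ?case using primeideal.I_notcarr[OF assms(1)] ideal.one_imp_carrier[OF primeideal.axioms(1)[OF assms(1)]] by simp
next
  case (Suc n)
  then show ?case using primeideal.I_prime[OF assms(1), of "a [^] n" a] assms(2) by auto
qed

text \<open>Suppose not; let \<open>a_i\<close> be the lowest component of \<open>a\<close> outside
  the prime and \<open>z_k\<close> the lowest component of \<open>z\<close> that no power of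
  \<open>a_i\<close> moves into \<open>W\<close>. It exists since no power of \<open>a_i\<close>
  lies in the prime. Up to such torsion the part of degree \<open>i + k\<close> of
  \<open>a z\<close> is \<open>a_i z_k\<close>; as \<open>a z\<close> is in the homogeneous
  \<open>W\<close>, \<open>z_k\<close> would be torsion as well.\<close>

lemma homogeneous_prime_components:
  assumes bound: "\<And>e x. e < e0 \<Longrightarrow> x \<in> carrier M \<Longrightarrow> \<pi> e x = \<zero>\<^bsub>M\<^esub>"
    and W: "submodule W R M" "homog W" and z: "z \<in> carrier M"
    and \<pp>: "primeideal (colon W z) R" and a: "a \<in> colon W z"
  shows "ring_proj e a \<in> colon W z"
proof (rule ccontr)
  interpret S: proj_graded R "self_module R" ring_proj by (rule proj_graded_self)
  interpret p: primeideal "colon W z" R by (rule \<pp>)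
  have ac: "a \<in> carrier R" using a p.Icarr by blast
  have rc: "ring_proj j b \<in> carrier R" if "b \<in> carrier R" for j b
    using S.proj_closed that by simp
  have rh: "ring_proj j b \<in> rgrade R (nat j)" if "b \<in> carrier R" "0 \<le> j" for j b
    using direct_sum.component(1)[OF ring_direct_sum' that(1)] that(2) by (simp add: ring_proj_def)
  assume "ring_proj e a \<notin> colon W z"
  then have "{j. ring_proj j a \<notin> colon W z} \<noteq> {}" by blast
  moreover have "0 \<le> j" if "j \<in> {j. ring_proj j a \<notin> colon W z}" for j
    using that p.zero_closed by (auto simp: ring_proj_def split: if_splits)
  ultimately obtain i where "is_least i {j. ring_proj j a \<notin> colon W z}"
    using int_least_ex[of "{j. ring_proj j a \<notin> colon W z}" 0] by blast
  then have i: "ring_proj i a \<notin> colon W z" "\<And>j. j < i \<Longrightarrow> ring_proj j a \<in> colon W z"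
    unfolding is_least_def by force+
  have i0: "0 \<le> i" using i(1) p.zero_closed by (auto simp: ring_proj_def split: if_splits)
  define c where "c = ring_proj i a"
  have cc: "c \<in> carrier R" and ch: "c \<in> rgrade R (nat i)" using rc rh ac i0 unfolding c_def by auto
  \<comment> \<open>The saturation of \<open>W\<close> with respect to \<open>c\<close>. Working
    modulo \<open>G\<close> instead of \<open>W\<close> allows division by \<open>c\<close>.\<close>
  define G where "G = {x \<in> carrier M. \<exists>s::nat. (c [^] s) \<odot>\<^bsub>M\<^esub> x \<in> W}"
  have lift: "(c [^] (s + t)) \<odot>\<^bsub>M\<^esub> x \<in> W" if "(c [^] s) \<odot>\<^bsub>M\<^esub> x \<in> W" "x \<in> carrier M" for s t :: nat and x
  proof -
    have "(c [^] (s + t)) \<odot>\<^bsub>M\<^esub> x = (c [^] t) \<odot>\<^bsub>M\<^esub> ((c [^] s) \<odot>\<^bsub>M\<^esub> x)"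
      using cc that(2) by (simp add: smult_assoc1[symmetric] R.nat_pow_mult add.commute)
    then show ?thesis using submodule_smult[OF W(1) _ that(1)] cc by simp
  qed
  have Gs: "submodule G R M" unfolding submodule_iff
  proof (intro conjI ballI)
    show "G \<subseteq> carrier M" unfolding G_def by blast
    show "\<zero>\<^bsub>M\<^esub> \<in> G" unfolding G_def using submodule_zero[OF W(1)] cc by auto
    fix x assume x: "x \<in> G"
    then obtain s :: nat where s: "(c [^] s) \<odot>\<^bsub>M\<^esub> x \<in> W" "x \<in> carrier M" unfolding G_def by blast
    { fix y assume "y \<in> G"
      then obtain t :: nat where t: "(c [^] t) \<odot>\<^bsub>M\<^esub> y \<in> W" "y \<in> carrier M" unfolding G_def by blast
      have "(c [^] (s + t)) \<odot>\<^bsub>M\<^esub> (x \<oplus>\<^bsub>M\<^esub> y) \<in> W"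
        using lift[OF s, of t] lift[OF t, of s] submodule_add[OF W(1)] s(2) t(2) cc
        by (simp add: smult_r_distr add.commute)
      then show "x \<oplus>\<^bsub>M\<^esub> y \<in> G" using s t unfolding G_def by blast }
    fix b assume b: "b \<in> carrier R"
    have "(c [^] s) \<odot>\<^bsub>M\<^esub> (b \<odot>\<^bsub>M\<^esub> x) = b \<odot>\<^bsub>M\<^esub> ((c [^] s) \<odot>\<^bsub>M\<^esub> x)" using cc b s(2) smult_left_commute by simp
    then have "(c [^] s) \<odot>\<^bsub>M\<^esub> (b \<odot>\<^bsub>M\<^esub> x) \<in> W" using submodule_smult[OF W(1) b s(1)] by simp
    then show "b \<odot>\<^bsub>M\<^esub> x \<in> G" using s(2) b unfolding G_def by blast
  qed
  have WG: "W \<subseteq> G"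
  proof
    fix x assume "x \<in> W"
    then show "x \<in> G" using submodule_carrier[OF W(1)] unfolding G_def by (auto intro!: exI[of _ "0::nat"])
  qed
  have "z \<notin> G"
  proof
    assume "z \<in> G"
    then obtain s :: nat where "(c [^] s) \<odot>\<^bsub>M\<^esub> z \<in> W" unfolding G_def by blast
    then have "c [^] s \<in> colon W z" using cc unfolding colon_def by simp
    then show False using prime_pow[OF \<pp> cc] i(1) unfolding c_def by blast
  qed
  then have "{k. \<pi> k z \<notin> G} \<noteq> {}"
    using homogeneous_induct[OF z] submodule_zero[OF Gs] submodule_add[OF Gs] by blast
  moreover have "e0 \<le> k" if "k \<in> {k. \<pi> k z \<notin> G}" for k
    using that bound[OF _ z] submodule_zero[OF Gs] by (metis mem_Collect_eq not_le)
  ultimately obtain k where "is_least k {k. \<pi> k z \<notin> G}"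
    using int_least_ex[of "{k. \<pi> k z \<notin> G}" e0] by blast
  then have k: "\<pi> k z \<notin> G" "\<And>j. j < k \<Longrightarrow> \<pi> j z \<in> G"
    unfolding is_least_def by force+
  \<comment> \<open>Shown for every component \<open>a_j\<close> separately, then summed. For
    \<open>j < i\<close> the product \<open>a_j z\<close> is in \<open>W\<close>; for
    \<open>j > i\<close> the component of \<open>z\<close> involved has degree below
    \<open>k\<close> and is in \<open>G\<close>; only \<open>j = i\<close> survives.\<close>
  let ?V = "{b \<in> carrier R. \<pi> (i + k) (b \<odot>\<^bsub>M\<^esub> z) \<ominus>\<^bsub>M\<^esub> ring_proj i b \<odot>\<^bsub>M\<^esub> \<pi> k z \<in> G}"
  have "a \<in> ?V"
  proof (rule S.homogeneous_induct)
    show "a \<in> carrier (self_module R)" using ac by simp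
    show "\<zero>\<^bsub>self_module R\<^esub> \<in> ?V" using z S.proj_zero submodule_zero[OF Gs] by (simp add: M.minus_eq)
  next
    fix u v assume u: "u \<in> ?V" and v: "v \<in> ?V"
    have rp: "ring_proj i (u \<oplus> v) = ring_proj i u \<oplus> ring_proj i v" using S.proj_add u v by simp
    have c: "u \<in> carrier R" "v \<in> carrier R" "\<pi> k z \<in> carrier M" using u v z by auto
    have "\<pi> (i + k) ((u \<oplus> v) \<odot>\<^bsub>M\<^esub> z) \<ominus>\<^bsub>M\<^esub> ring_proj i (u \<oplus> v) \<odot>\<^bsub>M\<^esub> \<pi> k z =
      (\<pi> (i + k) (u \<odot>\<^bsub>M\<^esub> z) \<ominus>\<^bsub>M\<^esub> ring_proj i u \<odot>\<^bsub>M\<^esub> \<pi> k z) \<oplus>\<^bsub>M\<^esub> (\<pi> (i + k) (v \<odot>\<^bsub>M\<^esub> z) \<ominus>\<^bsub>M\<^esub> ring_proj i v \<odot>\<^bsub>M\<^esub> \<pi> k z)"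
      unfolding rp using c z rc[of u i] rc[of v i]
      by (simp add: smult_l_distr proj_add M.minus_eq M.minus_add M.a_ac)
    then show "u \<oplus>\<^bsub>self_module R\<^esub> v \<in> ?V" using submodule_add[OF Gs] u v by auto
  next
    fix j
    have c: "ring_proj j a \<in> carrier R" using rc[OF ac] .
    have rp: "ring_proj i (ring_proj j a) = (if i = j then ring_proj i a else \<zero>)"
      using S.proj_proj[of a i j] ac by simp
    have kz: "\<pi> k z \<in> carrier M" using z by simp
    show "ring_proj j a \<in> ?V"
    proof (cases "j < 0")
      case True
      then have "ring_proj j a = \<zero>" by (simp add: ring_proj_def)
      then show ?thesis using rp i0 True z submodule_zero[OF Gs] kz by (simp add: M.minus_eq)
    next
      case False
      have eq: "\<pi> (i + k) (ring_proj j a \<odot>\<^bsub>M\<^esub> z) = ring_proj j a \<odot>\<^bsub>M\<^esub> \<pi> (i + k - j) z"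
        using proj_smult'[OF rh[OF ac, of j] z, of "i + k"] False by simp
      consider "j = i" | "j < i" | "j > i" by linarith
      then show ?thesis
      proof cases
        case 1
        then show ?thesis using c rp kz eq submodule_zero[OF Gs] by (simp add: M.minus_eq M.r_neg)
      next
        case 2
        then have "\<pi> (i + k) (ring_proj j a \<odot>\<^bsub>M\<^esub> z) \<in> G"
          using i(2)[of j] homogD[OF W(2)] WG unfolding colon_def by blast
        then show ?thesis using 2 c rp kz submodule_carrier[OF Gs] by (simp add: M.minus_eq)
      next
        case 3
        then have "\<pi> (i + k) (ring_proj j a \<odot>\<^bsub>M\<^esub> z) \<in> G"
          unfolding eq using k(2)[of "i + k - j"] submodule_smult[OF Gs c] by simp
        then show ?thesis using 3 c rp kz submodule_carrier[OF Gs] by (simp add: M.minus_eq)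
      qed
    qed
  qed
  then have "\<pi> (i + k) (a \<odot>\<^bsub>M\<^esub> z) \<ominus>\<^bsub>M\<^esub> c \<odot>\<^bsub>M\<^esub> \<pi> k z \<in> G" unfolding c_def by blast
  moreover have az: "\<pi> (i + k) (a \<odot>\<^bsub>M\<^esub> z) \<in> G"
    using homogD[OF W(2)] WG a unfolding colon_def by blast
  ultimately have "\<pi> (i + k) (a \<odot>\<^bsub>M\<^esub> z) \<ominus>\<^bsub>M\<^esub> (\<pi> (i + k) (a \<odot>\<^bsub>M\<^esub> z) \<ominus>\<^bsub>M\<^esub> c \<odot>\<^bsub>M\<^esub> \<pi> k z) \<in> G"
    using submodule_minus[OF Gs] by blast
  moreover have "x \<ominus>\<^bsub>M\<^esub> (x \<ominus>\<^bsub>M\<^esub> y) = y" if "x \<in> carrier M" "y \<in> carrier M" for x y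
    using that by (simp add: M.minus_eq M.minus_add M.r_neg2)
  ultimately have "c \<odot>\<^bsub>M\<^esub> \<pi> k z \<in> G" using submodule_carrier[OF Gs az] cc z by simp
  then obtain s :: nat where "(c [^] s) \<odot>\<^bsub>M\<^esub> (c \<odot>\<^bsub>M\<^esub> \<pi> k z) \<in> W" unfolding G_def by blast
  then have "(c [^] Suc s) \<odot>\<^bsub>M\<^esub> \<pi> k z \<in> W" using nat_pow_smult_add[OF cc proj_closed[OF z]] by simp
  then show False using k(1) z unfolding G_def by blast
qed

text \<open>By homogeneity of the prime it is contained in the annihilator of each component of
  \<open>z\<close>. The intersection of these finitely many annihilators kills \<open>z\<close>, so
  it lies in the prime, and a prime containing a finite intersection contains one of its
  members.\<close>

theorem homogeneous_prime:
  assumes bound: "\<And>e x. e < e0 \<Longrightarrow> x \<in> carrier M \<Longrightarrow> \<pi> e x = \<zero>\<^bsub>M\<^esub>"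
    and W: "submodule W R M" "homog W" and z: "z \<in> carrier M" and \<pp>: "primeideal (colon W z) R"
  obtains e where "colon W z = colon W (\<pi> e z)"
proof -
  interpret S: proj_graded R "self_module R" ring_proj by (rule proj_graded_self)
  interpret p: primeideal "colon W z" R by (rule \<pp>)
  have le: "colon W z \<subseteq> colon W (\<pi> e z)" for e
  proof
    fix a assume a: "a \<in> colon W z"
    let ?V = "{b \<in> carrier R. b \<odot>\<^bsub>M\<^esub> \<pi> e z \<in> W}"
    have ac: "a \<in> carrier R" using a p.Icarr by blast
    have "a \<in> ?V"
    proof (rule S.homogeneous_induct)
      show "a \<in> carrier (self_module R)" using ac by simp
      show "\<zero>\<^bsub>self_module R\<^esub> \<in> ?V" using z submodule_zero[OF W(1)] by simp
      show "u \<oplus>\<^bsub>self_module R\<^esub> v \<in> ?V" if "u \<in> ?V" "v \<in> ?V" for u v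
        using that submodule_add[OF W(1)] z by (auto simp: smult_l_distr)
      fix j
      show "ring_proj j a \<in> ?V"
      proof (cases "j < 0")
        case True
        then show ?thesis using z submodule_zero[OF W(1)] by (simp add: ring_proj_def)
      next
        case False
        have rh: "ring_proj j a \<in> rgrade R (nat j)"
          using direct_sum.component(1)[OF ring_direct_sum' ac] False by (simp add: ring_proj_def)
        have "ring_proj j a \<odot>\<^bsub>M\<^esub> z \<in> W"
          using homogeneous_prime_components[OF bound W z \<pp> a, of e0 j] unfolding colon_def by blast
        then have "\<pi> (e + j) (ring_proj j a \<odot>\<^bsub>M\<^esub> z) \<in> W" using homogD[OF W(2)] by blast
        then show ?thesis using proj_smult[OF rh z, of e] rgrade_carrier[OF rh] False by simp
      qed
    qed
    then show "a \<in> colon W (\<pi> e z)" unfolding colon_def .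
  qed
  have "\<exists>e. colon W (\<pi> e z) \<subseteq> colon W z"
  proof (rule ccontr)
    assume "\<not> (\<exists>e. colon W (\<pi> e z) \<subseteq> colon W z)"
    then have ex: "\<exists>a\<in>carrier R. a \<notin> colon W z \<and> a \<odot>\<^bsub>M\<^esub> \<pi> e z \<in> W" for e
      unfolding colon_def by blast
    \<comment> \<open>The product of witnesses for the single components stays outside the prime and
      sends all chosen components into \<open>W\<close>.\<close>
    have "\<exists>a\<in>carrier R. a \<notin> colon W z \<and> (\<forall>e\<in>A. a \<odot>\<^bsub>M\<^esub> \<pi> e z \<in> W)" if "finite A" for A
      using that
    proof (induction A)
      case empty
      then show ?case using p.I_notcarr p.Icarr by blast
    next
      case (insert e A)
      then obtain a where a: "a \<in> carrier R" "a \<notin> colon W z" "\<forall>e\<in>A. a \<odot>\<^bsub>M\<^esub> \<pi> e z \<in> W" by blast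
      obtain b where b: "b \<in> carrier R" "b \<notin> colon W z" "b \<odot>\<^bsub>M\<^esub> \<pi> e z \<in> W" using ex by blast
      have "a \<otimes> b \<notin> colon W z" using p.I_prime a b by blast
      moreover have "(a \<otimes> b) \<odot>\<^bsub>M\<^esub> \<pi> f z \<in> W" if f: "f \<in> insert e A" for f
      proof (cases "f = e")
        case True
        then show ?thesis using smult_assoc1[OF a(1) b(1)] submodule_smult[OF W(1) a(1) b(3)] z by simp
      next
        case False
        then have "a \<odot>\<^bsub>M\<^esub> \<pi> f z \<in> W" using f a(3) by blast
        then have "b \<odot>\<^bsub>M\<^esub> (a \<odot>\<^bsub>M\<^esub> \<pi> f z) \<in> W" by (rule submodule_smult[OF W(1) b(1)])
        then show ?thesis using smult_assoc1[OF a(1) b(1)] smult_left_commute[OF a(1) b(1)] z by simp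
      qed
      ultimately show ?case using a(1) b(1) by (intro bexI[of _ "a \<otimes> b"]) auto
    qed
    from this[OF proj_finite[OF z]] obtain a where a: "a \<in> carrier R" "a \<notin> colon W z"
      "\<And>e. \<pi> e z \<noteq> \<zero>\<^bsub>M\<^esub> \<Longrightarrow> a \<odot>\<^bsub>M\<^esub> \<pi> e z \<in> W" by blast
    have "z \<in> {x \<in> carrier M. a \<odot>\<^bsub>M\<^esub> x \<in> W}"
    proof (rule homogeneous_induct[OF z])
      show "\<pi> e z \<in> {x \<in> carrier M. a \<odot>\<^bsub>M\<^esub> x \<in> W}" for e
        using a(3)[of e] a(1) z submodule_zero[OF W(1)] by (cases "\<pi> e z = \<zero>\<^bsub>M\<^esub>") auto
    qed (use submodule_zero[OF submodule_colon_elem[OF a(1) W(1)]] submodule_add[OF submodule_colon_elem[OF a(1) W(1)]] in auto)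
    then show False using a(1,2) unfolding colon_def by blast
  qed
  then show thesis using le that by blast
qed

end

section \<open>The families of subquotients\<close>

text \<open>Each coordinate enters the product through a linear embedding, which maps powers into
  powers; \<open>f\<close> is the sum of its embedded coordinates.\<close>

lemma prod_list_pow:
  assumes A: "\<And>s. module R (A s)" and S: "finite S" and ys: "set ys \<subseteq> carrier R"
    and f: "f \<in> carrier (prod_module S A)" "\<And>s. s \<in> S \<Longrightarrow> f s \<in> list_pow_smult (A s) ys q (carrier (A s))"
  shows "f \<in> list_pow_smult (prod_module S A) ys q (carrier (prod_module S A))"
proof -
  interpret A: module R "A s" for s by (rule A)
  interpret P: module R "prod_module S A" using A by (rule module_prod)
  let ?L = "list_pow_smult (prod_module S A) ys q (carrier (prod_module S A))"
  have L: "submodule ?L R (prod_module S A)" using P.submodule_list_pow[OF ys P.carrier_is_submodule] .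
  have single: "(\<lambda>t. if t = s then f s else \<zero>\<^bsub>A t\<^esub>) \<in> ?L" if s: "s \<in> S" for s
  proof -
    let ?i = "\<lambda>x t. if t = s then x else \<zero>\<^bsub>A t\<^esub>"
    interpret i: module_map R "A s" "prod_module S A" ?i
      by (intro module_map.intro module_map_axioms.intro P.module_axioms' A.module_axioms')
        (use s in \<open>auto simp: linear_map_def prod_module_carrier\<close>)
    have "?i (f s) \<in> ?i ` list_pow_smult (A s) ys q (carrier (A s))" using f(2)[OF s] by blast
    also have "\<dots> = list_pow_smult (prod_module S A) ys q (?i ` carrier (A s))"
      using i.image_list_pow[OF ys A.carrier_is_submodule] .
    also have "\<dots> \<subseteq> ?L" by (rule P.list_pow_mono) blast
    finally show ?thesis .
  qed
  have "(\<lambda>t. if t \<in> F then f t else \<zero>\<^bsub>A t\<^esub>) \<in> ?L" if "finite F" "F \<subseteq> S" for F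
    using that
  proof (induction F)
    case empty
    then show ?case using P.submodule_zero[OF L] by simp
  next
    case (insert s F)
    have c: "f t \<in> carrier (A t)" for t using prod_module_component[OF A f(1)] .
    have "(\<lambda>t. if t \<in> insert s F then f t else \<zero>\<^bsub>A t\<^esub>) =
      (\<lambda>t. if t = s then f s else \<zero>\<^bsub>A t\<^esub>) \<oplus>\<^bsub>prod_module S A\<^esub> (\<lambda>t. if t \<in> F then f t else \<zero>\<^bsub>A t\<^esub>)"
      using insert.hyps c by (auto simp: fun_eq_iff)
    then show ?case using P.submodule_add[OF L single] insert by simp
  qed
  from this[OF S order_refl] have "(\<lambda>t. if t \<in> S then f t else \<zero>\<^bsub>A t\<^esub>) \<in> ?L" .
  moreover have "(\<lambda>t. if t \<in> S then f t else \<zero>\<^bsub>A t\<^esub>) = f" using f(1) by (auto simp: prod_module_carrier)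
  ultimately show ?thesis by simp
qed

text \<open>The common shape of the modules \<open>Tor\<^sub>k(L, M / I\<^sup>n N)\<close>: writing \<open>h\<close> for the \<open>k\<close>-th differential
  of \<open>F \<otimes> M\<close> and \<open>B\<close> for the image of the next one, they are
  \<open>{z. h z \<in> V n} / (B + U n)\<close>, where \<open>U n\<close> and \<open>V n\<close> come from \<open>F \<otimes> I\<^sup>n N\<close>.\<close>

locale tor_family = proj_graded R M \<pi> + h: module_map R M M' h
  for R :: "'a graded_ring" (structure) and M :: "('a, 'b) graded_module" (structure) and \<pi>
    and M' :: "('a, 'b) graded_module" and h +
  fixes B :: "'b set" and U V :: "nat \<Rightarrow> 'b set" and zs :: "('a \<times> nat) list" and e0 :: int and m :: nat
  assumes noeth: "noetherian_module R M" and noeth': "noetherian_module R M'"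
    and ideals: "acc {I. ideal I R}"
    and bound: "\<And>e x. e < e0 \<Longrightarrow> x \<in> carrier M \<Longrightarrow> \<pi> e x = \<zero>\<^bsub>M\<^esub>"
    and zs: "\<And>y d. (y, d) \<in> set zs \<Longrightarrow> y \<in> rgrade R d" "sorted (map snd zs)"
    and B: "submodule B R M" "homog B" "\<And>x. x \<in> B \<Longrightarrow> h x = \<zero>\<^bsub>M'\<^esub>"
    and U: "rees_family (map fst zs) U"
      "\<And>n. m \<le> n \<Longrightarrow> U n \<subseteq> list_pow_smult M (map fst zs) (n - m) (carrier M)"
    and V: "h.N.rees_family (map fst zs) V"
      "\<And>n. m \<le> n \<Longrightarrow> V n \<subseteq> list_pow_smult M' (map fst zs) (n - m) (carrier M')"
    and torsion_free: "\<And>z. z \<in> carrier M \<Longrightarrow> h z = \<zero>\<^bsub>M'\<^esub> \<Longrightarrow>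
      (\<And>y. y \<in> set (map fst zs) \<Longrightarrow> y \<odot>\<^bsub>M\<^esub> z \<in> B) \<Longrightarrow> z \<in> B"
begin

abbreviation "ys \<equiv> map fst zs"

definition "Z n = {z \<in> carrier M. h z \<in> V n}"
definition "BU n = B <+>\<^bsub>M\<^esub> U n"

lemma ys_carrier: "set ys \<subseteq> carrier R"
  using zs(1) rgrade_carrier by fastforce

lemma ys_homogeneous: "y \<in> set ys \<Longrightarrow> \<exists>d. y \<in> rgrade R d"
  using zs(1) by fastforce

lemma BU_family: "rees_family ys BU"
  unfolding BU_def[abs_def] by (intro rees_family_set_add rees_family_const ys_carrier B U)

lemma Z_family: "rees_family ys Z"
  unfolding rees_family_def
proof (intro conjI allI ballI)
  show "submodule (Z n) R M" for n
    unfolding Z_def using h.submodule_preimage[OF h.N.rees_familyD(1)[OF V(1)]] .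
  fix y n x assume y: "y \<in> set ys" and "x \<in> Z n"
  then have x: "x \<in> carrier M" "h x \<in> V n" unfolding Z_def by auto
  have yc: "y \<in> carrier R" using y ys_carrier by blast
  then show "y \<odot>\<^bsub>M\<^esub> x \<in> Z (Suc n)"
    using h.N.rees_familyD(2)[OF V(1) y x(2)] h.smult[OF yc x(1)] x(1) unfolding Z_def by simp
qed

lemmas Zs = rees_familyD(1)[OF Z_family] and BUs = rees_familyD(1)[OF BU_family]

lemma B_subset_BU: "B \<subseteq> BU n"
  unfolding BU_def by (rule set_add_upper1[OF rees_familyD(1)[OF U(1)] submodule_subset[OF B(1)]])

lemma B_subset_Z: "B \<subseteq> Z n"
  using B(3) submodule_carrier[OF B(1)] h.N.submodule_zero[OF h.N.rees_familyD(1)[OF V(1)]]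
  unfolding Z_def by auto

text \<open>A single application of Artin--Rees, to the image of \<open>z \<mapsto> (h z, (y z)\<^sub>y)\<close> enlarged by
  \<open>0 \<times> B\<^sup>c\<close>. Torsion-freeness says that this map has kernel contained in \<open>B\<close> modulo \<open>0 \<times> B\<^sup>c\<close>.\<close>

lemma annihilated_subset:
  obtains g where "\<And>n z. n \<ge> g \<Longrightarrow> z \<in> Z n \<Longrightarrow> (\<And>y. y \<in> set ys \<Longrightarrow> y \<odot>\<^bsub>M\<^esub> z \<in> BU n) \<Longrightarrow>
    z \<in> B <+>\<^bsub>M\<^esub> list_pow_smult M ys (n - g) (carrier M)"
proof -
  define c where "c = length ys"
  \<comment> \<open>Slot \<open>0\<close> receives \<open>h z\<close> in \<open>M'\<close> and slot
    \<open>j + 1\<close> receives the product of \<open>z\<close> with the \<open>j\<close>-th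
    generator, so one ambient module carries all the data.\<close>
  define A where "A s = (case s of 0 \<Rightarrow> M' | Suc _ \<Rightarrow> M)" for s :: nat
  let ?S = "{..c}"
  let ?P = "prod_module ?S A"
  have A: "module R (A s)" for s unfolding A_def using h.N.module_axioms' module_axioms' by (auto split: nat.split)
  interpret P: module R ?P using A by (rule module_prod)
  have noethP: "noetherian_module R ?P"
    by (rule noetherian_prod_module) (use A noeth noeth' in \<open>auto simp: A_def split: nat.split\<close>)
  define \<Phi> where "\<Phi> z s = (case s of 0 \<Rightarrow> h z | Suc j \<Rightarrow> if j < c then ys ! j \<odot>\<^bsub>M\<^esub> z else \<zero>\<^bsub>M\<^esub>)" for z and s :: nat
  have ysj: "ys ! j \<in> carrier R" "ys ! j \<in> set ys" if "j < c" for j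
    using ys_carrier nth_mem[of j ys] that unfolding c_def by auto
  interpret F: module_map R M ?P \<Phi>
  proof (intro module_map.intro module_map_axioms.intro P.module_axioms' module_axioms')
    show "linear_map R M ?P \<Phi>" unfolding linear_map_def
    proof (intro conjI ballI Pi_I)
      show "\<Phi> x \<in> carrier ?P" if "x \<in> carrier M" for x
        using that ysj by (auto simp: prod_module_carrier \<Phi>_def A_def split: nat.split)
      show "\<Phi> (x \<oplus>\<^bsub>M\<^esub> y) = \<Phi> x \<oplus>\<^bsub>?P\<^esub> \<Phi> y" if "x \<in> carrier M" "y \<in> carrier M" for x y
        using that ysj by (auto simp: fun_eq_iff \<Phi>_def A_def h.add smult_r_distr split: nat.split)
      show "\<Phi> (a \<odot>\<^bsub>M\<^esub> x) = a \<odot>\<^bsub>?P\<^esub> \<Phi> x" if "a \<in> carrier R" "x \<in> carrier M" for a x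
        using that ysj smult_left_commute by (auto simp: fun_eq_iff \<Phi>_def A_def h.smult split: nat.split)
    qed
  qed
  define B' where "B' = {f \<in> carrier ?P. f 0 = \<zero>\<^bsub>M'\<^esub> \<and> (\<forall>j. f (Suc j) \<in> B)}"
  have B': "submodule B' R ?P" unfolding P.submodule_iff
  proof (intro conjI ballI)
    show "B' \<subseteq> carrier ?P" unfolding B'_def by blast
    show "\<zero>\<^bsub>?P\<^esub> \<in> B'" unfolding B'_def using P.M.zero_closed submodule_zero[OF B(1)] by (simp add: A_def)
    show "x \<oplus>\<^bsub>?P\<^esub> y \<in> B'" if "x \<in> B'" "y \<in> B'" for x y
      using that P.M.add.m_closed[of x y] submodule_add[OF B(1)] unfolding B'_def by (auto simp: A_def)
    show "a \<odot>\<^bsub>?P\<^esub> x \<in> B'" if "a \<in> carrier R" "x \<in> B'" for a x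
      using that P.smult_closed[of a x] submodule_smult[OF B(1)] unfolding B'_def by (auto simp: A_def)
  qed
  define D where "D = \<Phi> ` carrier M <+>\<^bsub>?P\<^esub> B'"
  note FM = F.submodule_image[OF carrier_is_submodule]
  have D: "submodule D R ?P" unfolding D_def by (rule P.submodule_set_add[OF FM B'])
  obtain k where k: "\<And>q. q \<ge> k \<Longrightarrow>
    list_pow_smult ?P ys q (carrier ?P) \<inter> D \<subseteq> list_pow_smult ?P ys (q - k) D"
    using P.artin_rees[OF noethP ys_carrier D] by blast
  \<comment> \<open>\<open>m\<close> is the loss in comparing \<open>U\<close> and \<open>V\<close>
    with the powers of \<open>ys\<close>, and \<open>k\<close> is the Artin--Rees number of
    \<open>D\<close>.\<close>
  show thesis
  proof (rule that[of "m + k"])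
    fix n z assume n: "m + k \<le> n" and z: "z \<in> Z n" and yz: "\<And>y. y \<in> set ys \<Longrightarrow> y \<odot>\<^bsub>M\<^esub> z \<in> BU n"
    have zc: "z \<in> carrier M" using z unfolding Z_def by blast
    have "\<exists>b u. b \<in> B \<and> u \<in> U n \<and> ys ! j \<odot>\<^bsub>M\<^esub> z = b \<oplus>\<^bsub>M\<^esub> u" if "j < c" for j
      using yz[OF ysj(2)[OF that]] unfolding BU_def by (auto simp: in_set_add)
    then obtain b u where bu: "\<And>j. j < c \<Longrightarrow> b j \<in> B" "\<And>j. j < c \<Longrightarrow> u j \<in> U n"
      "\<And>j. j < c \<Longrightarrow> ys ! j \<odot>\<^bsub>M\<^esub> z = b j \<oplus>\<^bsub>M\<^esub> u j" by metis
    define \<beta> where "\<beta> s = (case s of 0 \<Rightarrow> \<zero>\<^bsub>M'\<^esub> | Suc j \<Rightarrow> if j < c then b j else \<zero>\<^bsub>M\<^esub>)" for s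
    \<comment> \<open>\<open>\<Phi> z\<close> corrected by \<open>\<beta> \<in> B'\<close>: now
      every coordinate lies in the power of exponent \<open>n - m\<close>, while the vector still
      belongs to \<open>D\<close>.\<close>
    define t where "t s = (case s of 0 \<Rightarrow> h z | Suc j \<Rightarrow> if j < c then u j else \<zero>\<^bsub>M\<^esub>)" for s
    have uc: "u j \<in> carrier M" "b j \<in> carrier M" if "j < c" for j
      using bu(1,2)[OF that] submodule_carrier B(1) rees_familyD(1)[OF U(1)] by blast+
    have \<beta>: "\<beta> \<in> B'" unfolding B'_def
      using bu(1) uc submodule_zero[OF B(1)] by (auto simp: prod_module_carrier \<beta>_def A_def split: nat.split)
    have \<beta>c: "\<beta> \<in> carrier ?P" using \<beta> P.submodule_carrier[OF B'] by blast
    have tc: "t \<in> carrier ?P"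
      using uc zc by (auto simp: prod_module_carrier t_def A_def split: nat.split)
    have eq: "\<Phi> z = t \<oplus>\<^bsub>?P\<^esub> \<beta>"
      using bu(3) uc zc by (auto simp: fun_eq_iff \<Phi>_def t_def \<beta>_def A_def M.a_comm split: nat.split)
    have "t \<in> list_pow_smult ?P ys (n - m) (carrier ?P)"
    proof (rule prod_list_pow[OF A _ ys_carrier tc])
      fix s assume "s \<in> ?S"
      then show "t s \<in> list_pow_smult (A s) ys (n - m) (carrier (A s))"
        using V(2)[of n] U(2)[of n] n z bu(2) unfolding t_def A_def Z_def
        by (auto split: nat.split)
    qed simp
    moreover have "t \<in> D"
    proof (rule P.submodule_diffD'[OF D _ _ tc])
      show "t \<oplus>\<^bsub>?P\<^esub> \<beta> \<in> D" unfolding eq[symmetric] D_def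
        using P.set_add_upper1[OF B' P.submodule_subset[OF FM]] zc by blast
      show "\<beta> \<in> D" unfolding D_def using P.set_add_upper2[OF FM P.submodule_subset[OF B']] \<beta> by blast
    qed
    moreover have "k \<le> n - m" using n by simp
    ultimately have "t \<in> list_pow_smult ?P ys (n - m - k) D" using k by blast
    then have "t \<in> list_pow_smult ?P ys (n - m - k) (\<Phi> ` carrier M) <+>\<^bsub>?P\<^esub> B'"
      unfolding D_def using P.list_pow_set_add[OF ys_carrier FM B'] by blast
    then have "t \<in> \<Phi> ` list_pow_smult M ys (n - m - k) (carrier M) <+>\<^bsub>?P\<^esub> B'"
      using F.image_list_pow[OF ys_carrier carrier_is_submodule] by simp
    then obtain w \<beta>' where w: "w \<in> list_pow_smult M ys (n - m - k) (carrier M)" "\<beta>' \<in> B'" "t = \<Phi> w \<oplus>\<^bsub>?P\<^esub> \<beta>'"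
      by (auto simp: in_set_add)
    have wc: "w \<in> carrier M"
      using w(1) submodule_carrier[OF submodule_list_pow[OF ys_carrier carrier_is_submodule]] by blast
    have \<beta>'c: "\<beta>' \<in> carrier ?P" using w(2) P.submodule_carrier[OF B'] by blast
    \<comment> \<open>The difference \<open>z - w\<close> is a cycle whose products with all
      generators lie in \<open>B\<close>, which is the situation of
      \<open>torsion_free\<close>.\<close>
    have "\<Phi> (z \<ominus>\<^bsub>M\<^esub> w) = (\<Phi> w \<oplus>\<^bsub>?P\<^esub> (\<beta>' \<oplus>\<^bsub>?P\<^esub> \<beta>)) \<ominus>\<^bsub>?P\<^esub> \<Phi> w"
      unfolding F.minus[OF zc wc] eq w(3) using P.M.a_assoc[OF F.closed[OF wc] \<beta>'c \<beta>c] by simp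
    also have "\<dots> = \<beta>' \<oplus>\<^bsub>?P\<^esub> \<beta>"
      by (rule P.add_diff_cancel_left) (use F.closed[OF wc] \<beta>'c \<beta>c P.M.add.m_closed in blast)+
    finally have "\<Phi> (z \<ominus>\<^bsub>M\<^esub> w) \<in> B'" using P.submodule_add[OF B' w(2) \<beta>] by simp
    then have "h (z \<ominus>\<^bsub>M\<^esub> w) = \<zero>\<^bsub>M'\<^esub>" and "\<And>j. \<Phi> (z \<ominus>\<^bsub>M\<^esub> w) (Suc j) \<in> B"
      unfolding B'_def by (auto simp: \<Phi>_def)
    then have hz: "h (z \<ominus>\<^bsub>M\<^esub> w) = \<zero>\<^bsub>M'\<^esub>" and "\<And>j. j < c \<Longrightarrow> ys ! j \<odot>\<^bsub>M\<^esub> (z \<ominus>\<^bsub>M\<^esub> w) \<in> B"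
      unfolding \<Phi>_def by (auto split: if_splits) metis
    then have "y \<odot>\<^bsub>M\<^esub> (z \<ominus>\<^bsub>M\<^esub> w) \<in> B" if "y \<in> set ys" for y
      using that unfolding in_set_conv_nth c_def by auto
    then have "z \<ominus>\<^bsub>M\<^esub> w \<in> B" using torsion_free[OF _ hz] zc wc by simp
    moreover have "z = (z \<ominus>\<^bsub>M\<^esub> w) \<oplus>\<^bsub>M\<^esub> w" using minus_add_cancel[OF zc wc] by simp
    ultimately show "z \<in> B <+>\<^bsub>M\<^esub> list_pow_smult M ys (n - (m + k)) (carrier M)"
      unfolding in_set_add using w(1) by (metis diff_diff_left)
  qed
qed

lemma colon_BU_cong:
  assumes "b \<in> B" "z \<in> carrier M"
  shows "colon (BU n) (b \<oplus>\<^bsub>M\<^esub> z) = colon (BU n) z"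
proof -
  have bc: "b \<in> carrier M" using assms(1) submodule_carrier[OF B(1)] by blast
  have "a \<odot>\<^bsub>M\<^esub> (b \<oplus>\<^bsub>M\<^esub> z) \<in> BU n \<longleftrightarrow> a \<odot>\<^bsub>M\<^esub> z \<in> BU n" if a: "a \<in> carrier R" for a
  proof -
    have ab: "a \<odot>\<^bsub>M\<^esub> b \<in> BU n" using submodule_smult[OF B(1) a assms(1)] B_subset_BU by blast
    have e: "a \<odot>\<^bsub>M\<^esub> (b \<oplus>\<^bsub>M\<^esub> z) = a \<odot>\<^bsub>M\<^esub> z \<oplus>\<^bsub>M\<^esub> a \<odot>\<^bsub>M\<^esub> b"
      using a bc assms(2) by (simp add: smult_r_distr M.a_comm)
    show ?thesis unfolding e
      using submodule_diffD'[OF BUs _ ab] submodule_add[OF BUs _ ab] a assms(2) by blast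
  qed
  then show ?thesis unfolding colon_def by blast
qed

definition prime_degs :: "'a set \<Rightarrow> nat \<Rightarrow> int set" where
  "prime_degs \<pp> n = {e. \<exists>z\<in>Z n. \<pi> e z = z \<and> \<pp> = colon (BU n) z}"

text \<open>A class has annihilator exactly \<open>\<pp>\<close> when \<open>\<pp>\<close> kills it
  and nothing outside \<open>\<pp>\<close> does, that is, when it lies in \<open>P\<close> but not
  in \<open>T\<close>. Since \<open>ys\<close> is contained in \<open>\<pp>\<close>, such a class
  has a representative in the power of exponent \<open>n - g\<close>, and \<open>q = n - g\<close>
  is the natural index.\<close>

theorem ev_linear_prime_degs:
  assumes \<pp>: "primeideal \<pp> R" and y\<pp>: "set ys \<subseteq> \<pp>"
  shows "ev_linear (snd ` set zs) (prime_degs \<pp>)"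
proof -
  interpret p: primeideal \<pp> R by (rule \<pp>)
  obtain g where g: "\<And>n z. n \<ge> g \<Longrightarrow> z \<in> Z n \<Longrightarrow> (\<And>y. y \<in> set ys \<Longrightarrow> y \<odot>\<^bsub>M\<^esub> z \<in> BU n) \<Longrightarrow>
    z \<in> B <+>\<^bsub>M\<^esub> list_pow_smult M ys (n - g) (carrier M)" using annihilated_subset by blast
  let ?L = "\<lambda>q. list_pow_smult M ys q (carrier M)"
  have L: "rees_family ys ?L" by (rule rees_family_list_pow[OF ys_carrier carrier_is_submodule])
  note Ls = rees_familyD(1)[OF L]
  have shift: "rees_family ys (\<lambda>q. W (q + g))" if "rees_family ys W" for W
    using that unfolding rees_family_def by simp
  define K where "K q = {z \<in> carrier M. \<forall>a\<in>\<pp>. a \<odot>\<^bsub>M\<^esub> z \<in> BU (q + g)}" for q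
  \<comment> \<open>Intersecting with the power \<open>?L q\<close> puts the family inside
    \<open>forms\<close>, where the chain condition applies; \<open>Z\<close> alone is too
    large.\<close>
  define P where "P q = (Z (q + g) \<inter> ?L q) \<inter> K q" for q
  define T where "T q = {z \<in> carrier M. \<exists>a\<in>carrier R - \<pp>. a \<odot>\<^bsub>M\<^esub> z \<in> BU (q + g)}" for q
  have pc: "a \<in> carrier R" if "a \<in> \<pp>" for a using that p.Icarr by blast
  have K: "rees_family ys K" unfolding rees_family_def
  proof (intro conjI allI ballI)
    fix q
    have 1: "a \<odot>\<^bsub>M\<^esub> (b \<odot>\<^bsub>M\<^esub> z) \<in> BU (q + g)" if "a \<in> \<pp>" "b \<in> carrier R" "z \<in> K q" for a b z
      using that submodule_smult[OF BUs that(2)] smult_left_commute[OF pc that(2)] unfolding K_def by auto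
    show "submodule (K q) R M" unfolding submodule_iff
      using submodule_zero[OF BUs] submodule_add[OF BUs] 1 pc unfolding K_def by (auto simp: smult_r_distr)
    fix y z assume y: "y \<in> set ys" and z: "z \<in> K q"
    have "a \<odot>\<^bsub>M\<^esub> (y \<odot>\<^bsub>M\<^esub> z) \<in> BU (Suc q + g)" if "a \<in> \<pp>" for a
      using that z rees_familyD(2)[OF BU_family y] smult_left_commute[OF pc] y ys_carrier unfolding K_def by auto
    then show "y \<odot>\<^bsub>M\<^esub> z \<in> K (Suc q)" using z y ys_carrier unfolding K_def by auto
  qed
  have Pf: "rees_family ys P" unfolding P_def[abs_def] by (intro rees_family_Int shift Z_family L K)
  note Ps = rees_familyD(1)[OF Pf]
  have Tf: "rees_family ys T" unfolding rees_family_def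
  proof (intro conjI allI ballI)
    fix q
    show "submodule (T q) R M" unfolding submodule_iff
    proof (intro conjI ballI)
      show "T q \<subseteq> carrier M" unfolding T_def by blast
      show "\<zero>\<^bsub>M\<^esub> \<in> T q" using submodule_zero[OF BUs] p.I_notcarr p.a_subset unfolding T_def by fastforce
      fix x assume "x \<in> T q"
      then obtain a where a: "a \<in> carrier R" "a \<notin> \<pp>" "a \<odot>\<^bsub>M\<^esub> x \<in> BU (q + g)" "x \<in> carrier M"
        unfolding T_def by blast
      { fix y assume "y \<in> T q"
        then obtain b where b: "b \<in> carrier R" "b \<notin> \<pp>" "b \<odot>\<^bsub>M\<^esub> y \<in> BU (q + g)" "y \<in> carrier M"
          unfolding T_def by blast
        have "a \<otimes> b \<notin> \<pp>" using p.I_prime a b by blast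
        moreover have "(a \<otimes> b) \<odot>\<^bsub>M\<^esub> (x \<oplus>\<^bsub>M\<^esub> y) = b \<odot>\<^bsub>M\<^esub> (a \<odot>\<^bsub>M\<^esub> x) \<oplus>\<^bsub>M\<^esub> a \<odot>\<^bsub>M\<^esub> (b \<odot>\<^bsub>M\<^esub> y)"
          using a b smult_left_commute[of a b x] by (simp add: smult_r_distr smult_assoc1)
        then have "(a \<otimes> b) \<odot>\<^bsub>M\<^esub> (x \<oplus>\<^bsub>M\<^esub> y) \<in> BU (q + g)"
          using submodule_add[OF BUs submodule_smult[OF BUs b(1) a(3)] submodule_smult[OF BUs a(1) b(3)]] by simp
        ultimately show "x \<oplus>\<^bsub>M\<^esub> y \<in> T q" using a b unfolding T_def by blast }
      fix r assume r: "r \<in> carrier R"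
      have "a \<odot>\<^bsub>M\<^esub> (r \<odot>\<^bsub>M\<^esub> x) \<in> BU (q + g)"
        using submodule_smult[OF BUs r a(3)] smult_left_commute[OF a(1) r a(4)] by simp
      then show "r \<odot>\<^bsub>M\<^esub> x \<in> T q" using a r unfolding T_def by blast
    qed
    fix y x assume y: "y \<in> set ys" and "x \<in> T q"
    then obtain a where a: "a \<in> carrier R" "a \<notin> \<pp>" "a \<odot>\<^bsub>M\<^esub> x \<in> BU (q + g)" "x \<in> carrier M"
      unfolding T_def by blast
    have yc: "y \<in> carrier R" using y ys_carrier by blast
    have "a \<odot>\<^bsub>M\<^esub> (y \<odot>\<^bsub>M\<^esub> x) \<in> BU (Suc q + g)"
      using rees_familyD(2)[OF BU_family y a(3)] smult_left_commute[OF a(1) yc a(4)] by simp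
    then show "y \<odot>\<^bsub>M\<^esub> x \<in> T (Suc q)" using a yc unfolding T_def by blast
  qed
  have "P q \<subseteq> forms ys q" for q using list_pow_subset_forms[OF ys_carrier] unfolding P_def by blast
  then have "ev_linear (snd ` set zs) (degs P T)"
    using ev_linear_degs[OF noeth bound zs Tf Pf] by blast
  moreover have "degs P T q = prime_degs \<pp> (q + g)" for q
  proof (intro equalityI subsetI)
    fix e assume "e \<in> degs P T q"
    then obtain z where z: "z \<in> P q" "\<pi> e z = z" "z \<notin> T q" unfolding degs_def by blast
    have "z \<in> carrier M" using z(1) submodule_carrier[OF Ps] by blast
    then have "\<pp> = colon (BU (q + g)) z"
      using z pc unfolding P_def K_def T_def colon_def by blast
    then show "e \<in> prime_degs \<pp> (q + g)" using z unfolding prime_degs_def P_def by blast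
  next
    fix e assume "e \<in> prime_degs \<pp> (q + g)"
    then obtain z where z: "z \<in> Z (q + g)" "\<pi> e z = z" "\<pp> = colon (BU (q + g)) z"
      unfolding prime_degs_def by blast
    have "y \<odot>\<^bsub>M\<^esub> z \<in> BU (q + g)" if "y \<in> set ys" for y using y\<pp> z(3) that unfolding colon_def by blast
    then have "z \<in> B <+>\<^bsub>M\<^esub> ?L q" using g[of "q + g" z] z(1) by simp
    then obtain b w where bw: "b \<in> B" "w \<in> ?L q" "z = b \<oplus>\<^bsub>M\<^esub> w" by (auto simp: in_set_add)
    have c: "b \<in> carrier M" "w \<in> carrier M" using bw submodule_carrier[OF B(1)] submodule_carrier[OF Ls] by blast+
    \<comment> \<open>The decomposition of the homogeneous \<open>z\<close> is projected to degree
      \<open>e\<close>. The part in \<open>B\<close> does not influence the annihilator, and the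
      other part is a homogeneous representative inside the power.\<close>
    define b' where "b' = \<pi> e b"
    define w' where "w' = \<pi> e w"
    have z': "z = b' \<oplus>\<^bsub>M\<^esub> w'" using z(2) c unfolding bw(3) b'_def w'_def by (simp add: proj_add)
    have b': "b' \<in> B" unfolding b'_def using homogD[OF B(2) bw(1)] .
    have w': "w' \<in> ?L q" unfolding w'_def using homogD[OF homog_list_pow[OF ys_homogeneous] bw(2)] .
    have c': "b' \<in> carrier M" "w' \<in> carrier M" unfolding b'_def w'_def using c by auto
    have col: "\<pp> = colon (BU (q + g)) w'" using colon_BU_cong[OF b' c'(2)] z' z(3) by simp
    have "w' \<oplus>\<^bsub>M\<^esub> b' \<in> Z (q + g)" using z(1) z' M.a_comm[OF c'] by simp
    then have "w' \<in> Z (q + g)" using submodule_diffD'[OF Zs _ _ c'(2)] b' B_subset_Z by blast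
    moreover have "w' \<in> K q" using col c'(2) unfolding K_def colon_def by blast
    moreover have "w' \<notin> T q" using col unfolding T_def colon_def by blast
    moreover have "\<pi> e w' = w'" unfolding w'_def using proj_proj[OF c(2)] by simp
    ultimately show "e \<in> degs P T q" using w' unfolding degs_def P_def by blast
  qed
  then have "degs P T = (\<lambda>q. prime_degs \<pp> (q + g))" by (rule ext)
  ultimately have "ev_linear (snd ` set zs) (\<lambda>q. prime_degs \<pp> (q + g))" by simp
  then show ?thesis by (rule ev_linear_shift)
qed

text \<open>Replacing an element by its representative in the power of exponent \<open>n - g\<close>
  realises its annihilator in one family that does not depend on \<open>n\<close>, so finiteness for
  that family bounds all large \<open>n\<close> at once.\<close>

theorem finite_primes:
  obtains g \<Lambda> where "finite \<Lambda>"
    "\<And>n z. n \<ge> g \<Longrightarrow> z \<in> Z n \<Longrightarrow> primeideal (colon (BU n) z) R \<Longrightarrow> set ys \<subseteq> colon (BU n) z \<Longrightarrow> colon (BU n) z \<in> \<Lambda>"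
proof -
  obtain g where g: "\<And>n z. n \<ge> g \<Longrightarrow> z \<in> Z n \<Longrightarrow> (\<And>y. y \<in> set ys \<Longrightarrow> y \<odot>\<^bsub>M\<^esub> z \<in> BU n) \<Longrightarrow>
    z \<in> B <+>\<^bsub>M\<^esub> list_pow_smult M ys (n - g) (carrier M)" using annihilated_subset by blast
  let ?L = "\<lambda>q. list_pow_smult M ys q (carrier M)"
  have L: "rees_family ys ?L" by (rule rees_family_list_pow[OF ys_carrier carrier_is_submodule])
  note Ls = rees_familyD(1)[OF L]
  have shift: "rees_family ys (\<lambda>q. W (q + g))" if "rees_family ys W" for W
    using that unfolding rees_family_def by simp
  define Q where "Q q = Z (q + g) \<inter> ?L q" for q
  \<comment> \<open>Cut down to \<open>Q\<close> because \<open>finite_ass_family\<close> compares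
    nested families. For elements of \<open>Q\<close> the annihilator is not affected.\<close>
  define Bq where "Bq q = Q q \<inter> BU (q + g)" for q
  have Qf: "rees_family ys Q" unfolding Q_def[abs_def] by (intro rees_family_Int shift Z_family L)
  have Bqf: "rees_family ys Bq" unfolding Bq_def[abs_def] by (intro rees_family_Int shift Qf BU_family)
  have "finite (ass_family Q Bq)"
    using finite_ass_family[OF noeth ys_carrier ideals Qf _ Bqf] list_pow_subset_forms[OF ys_carrier]
    unfolding Q_def Bq_def by blast
  moreover have "colon (BU n) z \<in> ass_family Q Bq" if n: "n \<ge> g" and z: "z \<in> Z n"
    and pr: "primeideal (colon (BU n) z) R" "set ys \<subseteq> colon (BU n) z" for n z
  proof -
    define q where "q = n - g"
    have nq: "n = q + g" using n unfolding q_def by simp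
    have "y \<odot>\<^bsub>M\<^esub> z \<in> BU n" if "y \<in> set ys" for y using pr(2) that unfolding colon_def by blast
    then have "z \<in> B <+>\<^bsub>M\<^esub> ?L q" using g[OF n z] unfolding q_def by blast
    then obtain b w where bw: "b \<in> B" "w \<in> ?L q" "z = b \<oplus>\<^bsub>M\<^esub> w" by (auto simp: in_set_add)
    have c: "b \<in> carrier M" "w \<in> carrier M" using bw submodule_carrier[OF B(1)] submodule_carrier[OF Ls] by blast+
    have "w \<oplus>\<^bsub>M\<^esub> b \<in> Z n" using z bw(3) M.a_comm[OF c] by simp
    then have "w \<in> Z n" using submodule_diffD'[OF Zs _ _ c(2)] bw(1) B_subset_Z by blast
    then have wQ: "w \<in> Q q" using bw(2) unfolding Q_def nq by blast
    have "colon (BU n) z = colon (BU n) w" using colon_BU_cong[OF bw(1) c(2)] bw(3) by simp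
    also have "\<dots> = colon (Bq q) w"
      using submodule_smult[OF rees_familyD(1)[OF Qf] _ wQ] unfolding colon_def Bq_def nq by blast
    finally show ?thesis using pr(1) wQ unfolding ass_family_def by blast
  qed
  ultimately show thesis using that by blast
qed

end

section \<open>Quotients and generated submodules\<close>

text \<open>All axioms are checked on representatives, so \<open>N\<close> need only be a record
  whose operations are compatible with a surjection from a module. Quotients arise in this
  way.\<close>

lemma module_image:
  fixes N :: "('a, 'e, 'f) module_scheme"
  assumes M: "module R M" and surj: "c ` carrier M = carrier N"
    and add: "\<And>x y. x \<in> carrier M \<Longrightarrow> y \<in> carrier M \<Longrightarrow> c x \<oplus>\<^bsub>N\<^esub> c y = c (x \<oplus>\<^bsub>M\<^esub> y)"
    and smult: "\<And>a x. a \<in> carrier R \<Longrightarrow> x \<in> carrier M \<Longrightarrow> a \<odot>\<^bsub>N\<^esub> c x = c (a \<odot>\<^bsub>M\<^esub> x)"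
    and c0: "c \<zero>\<^bsub>M\<^esub> = \<zero>\<^bsub>N\<^esub>"
  shows "module R N" "linear_map R M N c"
proof -
  interpret module R M by fact
  have rep: "\<exists>x\<in>carrier M. u = c x" if "u \<in> carrier N" for u using that surj by blast
  have cl: "c x \<in> carrier N" if "x \<in> carrier M" for x using that surj by blast
  have "abelian_group N"
  proof (rule abelian_groupI)
    show "\<zero>\<^bsub>N\<^esub> \<in> carrier N" using cl[OF M.zero_closed] c0 by simp
    fix u assume "u \<in> carrier N"
    then obtain x where x: "x \<in> carrier M" "u = c x" using rep by blast
    show "\<zero>\<^bsub>N\<^esub> \<oplus>\<^bsub>N\<^esub> u = u" using add[OF M.zero_closed x(1)] x c0 by simp
    show "\<exists>y\<in>carrier N. y \<oplus>\<^bsub>N\<^esub> u = \<zero>\<^bsub>N\<^esub>"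
      by (rule bexI[of _ "c (\<ominus>\<^bsub>M\<^esub> x)"]) (use x add cl c0 M.l_neg in auto)
    fix v assume "v \<in> carrier N"
    then obtain y where y: "y \<in> carrier M" "v = c y" using rep by blast
    show "u \<oplus>\<^bsub>N\<^esub> v \<in> carrier N" using x y add cl by simp
    show "u \<oplus>\<^bsub>N\<^esub> v = v \<oplus>\<^bsub>N\<^esub> u" using x y add by (simp add: M.a_comm)
    fix w assume "w \<in> carrier N"
    then obtain z where z: "z \<in> carrier M" "w = c z" using rep by blast
    show "u \<oplus>\<^bsub>N\<^esub> v \<oplus>\<^bsub>N\<^esub> w = u \<oplus>\<^bsub>N\<^esub> (v \<oplus>\<^bsub>N\<^esub> w)" using x y z add by (simp add: M.a_assoc)
  qed
  then show "module R N"
  proof (intro moduleI)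
    fix a u assume a: "a \<in> carrier R" and "u \<in> carrier N"
    then obtain x where x: "x \<in> carrier M" "u = c x" using rep by blast
    show "a \<odot>\<^bsub>N\<^esub> u \<in> carrier N" using x a smult cl by simp
    show "(a \<oplus>\<^bsub>R\<^esub> b) \<odot>\<^bsub>N\<^esub> u = a \<odot>\<^bsub>N\<^esub> u \<oplus>\<^bsub>N\<^esub> b \<odot>\<^bsub>N\<^esub> u" if "b \<in> carrier R" for b
      using x a that smult add by (simp add: smult_l_distr)
    show "(a \<otimes>\<^bsub>R\<^esub> b) \<odot>\<^bsub>N\<^esub> u = a \<odot>\<^bsub>N\<^esub> (b \<odot>\<^bsub>N\<^esub> u)" if "b \<in> carrier R" for b
      using x a that smult by (simp add: smult_assoc1)
    show "a \<odot>\<^bsub>N\<^esub> (u \<oplus>\<^bsub>N\<^esub> v) = a \<odot>\<^bsub>N\<^esub> u \<oplus>\<^bsub>N\<^esub> a \<odot>\<^bsub>N\<^esub> v" if "v \<in> carrier N" for v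
    proof -
      obtain y where y: "y \<in> carrier M" "v = c y" using rep \<open>v \<in> carrier N\<close> by blast
      show ?thesis using x y a smult add by (simp add: smult_r_distr)
    qed
  next
    fix u assume "u \<in> carrier N"
    then obtain x where "x \<in> carrier M" "u = c x" using rep by blast
    then show "\<one>\<^bsub>R\<^esub> \<odot>\<^bsub>N\<^esub> u = u" using smult by simp
  qed (rule R.is_cring)
  show "linear_map R M N c" unfolding linear_map_def using cl add smult by auto
qed

context module
begin

lemma abelian_subgroup_submodule: "submodule W R M \<Longrightarrow> abelian_subgroup W M"
  by (rule abelian_subgroupI3)
    (auto simp: additive_subgroup_def M.abelian_group_axioms dest: submodule.axioms(1))

lemma coset_eq_iff:
  assumes "submodule W R M" "x \<in> carrier M" "y \<in> carrier M"
  shows "W +>\<^bsub>M\<^esub> x = W +>\<^bsub>M\<^esub> y \<longleftrightarrow> x \<ominus>\<^bsub>M\<^esub> y \<in> W"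
proof -
  interpret W: abelian_subgroup W M using abelian_subgroup_submodule assms(1) .
  have iff: "x \<in> W +>\<^bsub>M\<^esub> y \<longleftrightarrow> x \<ominus>\<^bsub>M\<^esub> y \<in> W"
  proof
    assume "x \<in> W +>\<^bsub>M\<^esub> y"
    then obtain w where "w \<in> W" "x = w \<oplus>\<^bsub>M\<^esub> y" by (auto simp: a_r_coset_def')
    then show "x \<ominus>\<^bsub>M\<^esub> y \<in> W" using add_minus_cancel[of w y] assms submodule_carrier by simp
  next
    assume "x \<ominus>\<^bsub>M\<^esub> y \<in> W"
    then show "x \<in> W +>\<^bsub>M\<^esub> y" using minus_add_cancel[OF assms(2,3)] by (force simp: a_r_coset_def')
  qed
  show ?thesis using iff W.a_repr_independence' W.a_rcos_self assms by metis
qed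

lemma quot_module_simps:
  "\<zero>\<^bsub>quot_module M W\<^esub> = W" "carrier (quot_module M W) = (\<lambda>x. W +>\<^bsub>M\<^esub> x) ` carrier M"
  by (auto simp: quot_module_def A_RCOSETS_def')

lemma quot_module:
  assumes W: "submodule W R M"
  shows "module R (quot_module M W)" "linear_map R M (quot_module M W) (\<lambda>x. W +>\<^bsub>M\<^esub> x)"
    "\<And>x. x \<in> carrier M \<Longrightarrow> W +>\<^bsub>M\<^esub> x = W \<longleftrightarrow> x \<in> W"
proof -
  interpret W: abelian_subgroup W M using abelian_subgroup_submodule W .
  have z: "W +>\<^bsub>M\<^esub> \<zero>\<^bsub>M\<^esub> = W" using W.a_rcos_const submodule_zero[OF W] by blast
  have add: "(W +>\<^bsub>M\<^esub> x) \<oplus>\<^bsub>quot_module M W\<^esub> (W +>\<^bsub>M\<^esub> y) = W +>\<^bsub>M\<^esub> (x \<oplus>\<^bsub>M\<^esub> y)"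
    if "x \<in> carrier M" "y \<in> carrier M" for x y
    using W.a_rcos_sum[OF that] by (simp add: quot_module_def)
  have smult: "a \<odot>\<^bsub>quot_module M W\<^esub> (W +>\<^bsub>M\<^esub> x) = W +>\<^bsub>M\<^esub> (a \<odot>\<^bsub>M\<^esub> x)"
    if a: "a \<in> carrier R" and x: "x \<in> carrier M" for a x
  proof -
    have "W +>\<^bsub>M\<^esub> (a \<odot>\<^bsub>M\<^esub> u) = W +>\<^bsub>M\<^esub> (a \<odot>\<^bsub>M\<^esub> x)" if u: "u \<in> W +>\<^bsub>M\<^esub> x" for u
    proof -
      obtain w where w: "w \<in> W" "u = w \<oplus>\<^bsub>M\<^esub> x" using u by (auto simp: a_r_coset_def')
      have wc: "w \<in> carrier M" using w submodule_carrier[OF W] by blast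
      have "a \<odot>\<^bsub>M\<^esub> u \<ominus>\<^bsub>M\<^esub> a \<odot>\<^bsub>M\<^esub> x = a \<odot>\<^bsub>M\<^esub> w"
        unfolding w(2) using a x wc add_minus_cancel by (simp add: smult_r_distr)
      then show ?thesis using coset_eq_iff[OF W] submodule_smult[OF W a w(1)] a x wc w(2) by simp
    qed
    moreover have "x \<in> W +>\<^bsub>M\<^esub> x" using W.a_rcos_self[OF x] .
    \<comment> \<open>The scalar action on a coset is defined as a union over representatives; all
      cosets in it coincide.\<close>
    ultimately have "(\<Union>u\<in>W +>\<^bsub>M\<^esub> x. W +>\<^bsub>M\<^esub> (a \<odot>\<^bsub>M\<^esub> u)) = W +>\<^bsub>M\<^esub> (a \<odot>\<^bsub>M\<^esub> x)"
      using UN_constant_eq by blast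
    then show ?thesis by (simp add: quot_module_def)
  qed
  note q = module_image[OF module_axioms', of "\<lambda>x. W +>\<^bsub>M\<^esub> x" "quot_module M W", OF _ add smult]
  show "module R (quot_module M W)" "linear_map R M (quot_module M W) (\<lambda>x. W +>\<^bsub>M\<^esub> x)"
    using q z by (auto simp: quot_module_simps)
  show "W +>\<^bsub>M\<^esub> x = W \<longleftrightarrow> x \<in> W" if "x \<in> carrier M" for x
    using coset_eq_iff[OF W that M.zero_closed] that z by (simp add: M.minus_eq)
qed

lemma generate_least:
  assumes "submodule W R M" "G \<subseteq> W"
  shows "generate (add_monoid M) G \<subseteq> W"
proof
  fix x assume "x \<in> generate (add_monoid M) G"
  then show "x \<in> W"
  proof induction
    case one
    then show ?case using submodule_zero[OF assms(1)] by simp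
  next
    case (inv g)
    then show ?case using submodule_uminus[OF assms(1)] assms(2) by (auto simp: a_inv_def)
  next
    case (eng g g')
    then show ?case using submodule_add[OF assms(1)] by simp
  qed (use assms(2) in blast)
qed

lemma submodule_ideal_smult:
  assumes I: "ideal I R" and N: "N \<subseteq> carrier M"
  shows "submodule (ideal_smult M I N) R M"
proof -
  interpret ideal I R by fact
  let ?G = "{a \<odot>\<^bsub>M\<^esub> x | a x. a \<in> I \<and> x \<in> N}"
  have G: "?G \<subseteq> carrier M" using Icarr N by blast
  have sg: "subgroup (generate (add_monoid M) ?G) (add_monoid M)"
    by (rule M.add.generate_is_subgroup) (use G in simp)
  have sub: "generate (add_monoid M) ?G \<subseteq> carrier M" using subgroup.subset[OF sg] by simp
  have "r \<odot>\<^bsub>M\<^esub> u \<in> generate (add_monoid M) ?G" if r: "r \<in> carrier R" and u: "u \<in> generate (add_monoid M) ?G" for r u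
    using u
  proof induction
    case one
    then show ?case using r generate.one[of "add_monoid M"] by simp
  next
    case (incl g)
    then obtain a x where ax: "a \<in> I" "x \<in> N" "g = a \<odot>\<^bsub>M\<^esub> x" by blast
    then have "r \<odot>\<^bsub>M\<^esub> g = (r \<otimes> a) \<odot>\<^bsub>M\<^esub> x" using r Icarr N by (auto simp: smult_assoc1)
    then have "r \<odot>\<^bsub>M\<^esub> g \<in> ?G" using I_l_closed[OF ax(1) r] ax(2) by blast
    then show ?case by (rule generate.incl)
  next
    case (inv g)
    then obtain a x where ax: "a \<in> I" "x \<in> N" "g = a \<odot>\<^bsub>M\<^esub> x" by blast
    then have "r \<odot>\<^bsub>M\<^esub> g = (r \<otimes> a) \<odot>\<^bsub>M\<^esub> x" using r Icarr N by (auto simp: smult_assoc1)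
    then have g: "r \<odot>\<^bsub>M\<^esub> g \<in> ?G" using I_l_closed[OF ax(1) r] ax(2) by blast
    have "g \<in> carrier M" using ax Icarr N by blast
    then have "r \<odot>\<^bsub>M\<^esub> inv\<^bsub>add_monoid M\<^esub> g = inv\<^bsub>add_monoid M\<^esub> (r \<odot>\<^bsub>M\<^esub> g)"
      using smult_r_minus[OF r] unfolding a_inv_def by blast
    then show ?case using generate.inv[OF g] by simp
  next
    case (eng g g')
    then show ?case using r sub generate.eng[OF eng.IH] smult_r_distr[OF r, of g g'] by (simp add: subset_iff)
  qed
  then show ?thesis unfolding ideal_smult_def submodule_def submodule_axioms_def using sg by blast
qed

lemma ideal_smult_incl: "a \<in> I \<Longrightarrow> x \<in> N \<Longrightarrow> a \<odot>\<^bsub>M\<^esub> x \<in> ideal_smult M I N"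
  unfolding ideal_smult_def by (rule generate.incl) blast

lemma ideal_smult_least:
  assumes "submodule W R M" "\<And>a x. a \<in> I \<Longrightarrow> x \<in> N \<Longrightarrow> a \<odot>\<^bsub>M\<^esub> x \<in> W"
  shows "ideal_smult M I N \<subseteq> W"
  unfolding ideal_smult_def by (rule generate_least) (use assms in auto)

lemma carrier_ideal: "ideal (carrier R) R"
  by (rule R.oneideal)

lemma submodule_module_span: "G \<subseteq> carrier M \<Longrightarrow> submodule (module_span R M G) R M"
  unfolding module_span_def by (rule submodule_ideal_smult[OF carrier_ideal])

lemma module_span_incl: "G \<subseteq> carrier M \<Longrightarrow> x \<in> G \<Longrightarrow> x \<in> module_span R M G"
  unfolding module_span_def using ideal_smult_incl[of \<one> "carrier R" x G] by auto

lemma module_span_least: "submodule W R M \<Longrightarrow> G \<subseteq> W \<Longrightarrow> module_span R M G \<subseteq> W"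
  unfolding module_span_def by (rule ideal_smult_least) (auto intro: submodule_smult)

lemma submodule_finsum:
  assumes "submodule W R M" "\<And>i. i \<in> A \<Longrightarrow> f i \<in> W"
  shows "finsum M f A \<in> W"
  by (rule M.finsum_in_subset) (use assms submodule_subset submodule_zero submodule_add in auto)

end

text \<open>This turns equality of two linear maps into a check on generators: an equalizer
  containing them is everything.\<close>

lemma (in module) submodule_equalizer:
  assumes "module R N" "linear_map R M N f" "linear_map R M N g"
  shows "submodule {x \<in> carrier M. f x = g x} R M"
proof -
  interpret f: module_map R M N f
    by (intro module_map.intro module_map_axioms.intro module_axioms' assms)
  interpret g: module_map R M N g
    by (intro module_map.intro module_map_axioms.intro module_axioms' assms)
  show ?thesis unfolding submodule_iff by (auto simp: f.add g.add f.smult g.smult)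
qed

section \<open>Linear maps on free modules\<close>

lemma free_module_simps [simp]:
  "\<zero>\<^bsub>free_module R S\<^esub> = (\<lambda>_. \<zero>\<^bsub>R\<^esub>)" "add (free_module R S) = (\<lambda>f g s. f s \<oplus>\<^bsub>R\<^esub> g s)"
  "smult (free_module R S) = (\<lambda>a f s. a \<otimes>\<^bsub>R\<^esub> f s)"
  by (simp_all add: free_module_def)

lemma free_module_carrier:
  "f \<in> carrier (free_module R S) \<longleftrightarrow>
    (\<forall>s. f s \<in> carrier R) \<and> (\<forall>s. s \<notin> S \<longrightarrow> f s = \<zero>\<^bsub>R\<^esub>) \<and> finite {s. f s \<noteq> \<zero>\<^bsub>R\<^esub>}"
  by (simp add: free_module_def)

text \<open>Linear extension of \<open>g\<close> from the standard basis. Summing over the support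
  repeats the sum inside \<open>tensor_map\<close>, so both unfold to the same term.\<close>

definition lift :: "('a, 'c) ring_scheme \<Rightarrow> ('a, 'b, 'd) module_scheme \<Rightarrow> ('s \<Rightarrow> 'b) \<Rightarrow> ('s \<Rightarrow> 'a) \<Rightarrow> 'b" where
  "lift R E g f = (\<Oplus>\<^bsub>E\<^esub>p\<in>{p. f p \<noteq> \<zero>\<^bsub>R\<^esub>}. f p \<odot>\<^bsub>E\<^esub> g p)"

context cring
begin

lemma module_free: "module R (free_module R S)"
proof -
  have add: "(\<lambda>s. f s \<oplus> g s) \<in> carrier (free_module R S)"
    if "f \<in> carrier (free_module R S)" "g \<in> carrier (free_module R S)" for f g
  proof -
    have "finite {s. f s \<oplus> g s \<noteq> \<zero>}"
      by (rule finite_subset[of _ "{s. f s \<noteq> \<zero>} \<union> {s. g s \<noteq> \<zero>}"])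
        (use that in \<open>auto simp: free_module_carrier\<close>)
    then show ?thesis using that by (auto simp: free_module_carrier)
  qed
  have smult: "(\<lambda>s. a \<otimes> f s) \<in> carrier (free_module R S)"
    if "a \<in> carrier R" "f \<in> carrier (free_module R S)" for a f
  proof -
    have "finite {s. a \<otimes> f s \<noteq> \<zero>}"
      by (rule finite_subset[of _ "{s. f s \<noteq> \<zero>}"]) (use that in \<open>auto simp: free_module_carrier\<close>)
    then show ?thesis using that by (auto simp: free_module_carrier)
  qed
  have c: "f s \<in> carrier R" if "f \<in> carrier (free_module R S)" for f s
    using that by (simp add: free_module_carrier)
  have "abelian_group (free_module R S)"
  proof (rule abelian_groupI)
    show "\<exists>g\<in>carrier (free_module R S). g \<oplus>\<^bsub>free_module R S\<^esub> f = \<zero>\<^bsub>free_module R S\<^esub>"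
      if "f \<in> carrier (free_module R S)" for f
      by (rule bexI[OF _ smult[OF a_inv_closed[OF one_closed] that]])
        (use c[OF that] in \<open>auto simp: l_minus l_neg\<close>)
  qed (use add c in \<open>auto simp: a_assoc a_comm a_lcomm free_module_carrier\<close>)
  then show ?thesis
    by (intro moduleI) (use smult c in \<open>auto simp: l_distr r_distr m_assoc is_cring\<close>)
qed

lemma unit_vec_closed: "s \<in> S \<Longrightarrow> unit_vec R s \<in> carrier (free_module R S)"
proof -
  assume "s \<in> S"
  have "finite {t. unit_vec R s t \<noteq> \<zero>}"
    by (rule finite_subset[of _ "{s}"]) (auto simp: unit_vec_def)
  then show ?thesis using \<open>s \<in> S\<close> by (auto simp: free_module_carrier unit_vec_def)
qed

lemma free_module_induct:
  assumes W: "submodule W R (free_module R S)" and u: "\<And>s. s \<in> S \<Longrightarrow> unit_vec R s \<in> W"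
    and f: "f \<in> carrier (free_module R S)"
  shows "f \<in> W"
proof -
  interpret F: module R "free_module R S" by (rule module_free)
  have fc: "f s \<in> carrier R" for s using f by (simp add: free_module_carrier)
  have "(\<lambda>s. if s \<in> A then f s else \<zero>) \<in> W" if "finite A" "A \<subseteq> S" for A
    using that
  proof (induction A)
    case empty
    then show ?case using F.submodule_zero[OF W] by simp
  next
    case (insert s A)
    have "(\<lambda>t. if t \<in> insert s A then f t else \<zero>) =
      (f s \<odot>\<^bsub>free_module R S\<^esub> unit_vec R s) \<oplus>\<^bsub>free_module R S\<^esub> (\<lambda>s. if s \<in> A then f s else \<zero>)"
      using insert.hyps fc by (auto simp: unit_vec_def fun_eq_iff)
    then show ?case using insert F.submodule_add[OF W F.submodule_smult[OF W fc u]] by simp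
  qed
  moreover have "{s. f s \<noteq> \<zero>} \<subseteq> S" "finite {s. f s \<noteq> \<zero>}" using f by (auto simp: free_module_carrier)
  ultimately have "(\<lambda>s. if s \<in> {s. f s \<noteq> \<zero>} then f s else \<zero>) \<in> W" by blast
  moreover have "(\<lambda>s. if s \<in> {s. f s \<noteq> \<zero>} then f s else \<zero>) = f" by auto
  ultimately show ?thesis by simp
qed

end

context module
begin

lemma lift_eq:
  assumes "g \<in> S \<rightarrow> carrier M" "f \<in> carrier (free_module R S)" "finite A" "A \<subseteq> S" "{s. f s \<noteq> \<zero>} \<subseteq> A"
  shows "lift R M g f = (\<Oplus>\<^bsub>M\<^esub>p\<in>A. f p \<odot>\<^bsub>M\<^esub> g p)"
  unfolding lift_def
  by (rule M.add.finprod_mono_neutral_cong_left) (use assms in \<open>auto simp: free_module_carrier Pi_def subset_iff\<close>)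

lemma linear_lift:
  assumes g: "g \<in> S \<rightarrow> carrier M"
  shows "linear_map R (free_module R S) M (lift R M g)"
  unfolding linear_map_def
proof (intro conjI ballI Pi_I)
  interpret F: module R "free_module R S" by (rule R.module_free)
  have supp: "{s. f s \<noteq> \<zero>} \<subseteq> S" "finite {s. f s \<noteq> \<zero>}" "\<And>s. f s \<in> carrier R"
    if "f \<in> carrier (free_module R S)" for f
    using that by (auto simp: free_module_carrier)
  fix f assume f: "f \<in> carrier (free_module R S)"
  have tc: "(\<lambda>p. f p \<odot>\<^bsub>M\<^esub> g p) \<in> A \<rightarrow> carrier M" if "A \<subseteq> S" "f \<in> carrier (free_module R S)" for A f
  proof
    fix p assume "p \<in> A"
    then have "g p \<in> carrier M" using that(1) g by blast
    then show "f p \<odot>\<^bsub>M\<^esub> g p \<in> carrier M" using supp(3)[OF that(2)] by simp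
  qed
  show "lift R M g f \<in> carrier M" unfolding lift_def
    by (rule M.finsum_closed[OF tc[OF supp(1)[OF f] f]])
  { fix f' assume f': "f' \<in> carrier (free_module R S)"
    let ?A = "{s. f s \<noteq> \<zero>} \<union> {s. f' s \<noteq> \<zero>}"
    have A: "finite ?A" "?A \<subseteq> S" using supp[OF f] supp[OF f'] by auto
    have sum: "f \<oplus>\<^bsub>free_module R S\<^esub> f' \<in> carrier (free_module R S)" using f f' by (rule F.M.add.m_closed)
    have sub: "{s. (f \<oplus>\<^bsub>free_module R S\<^esub> f') s \<noteq> \<zero>} \<subseteq> ?A" by auto
    have "lift R M g (f \<oplus>\<^bsub>free_module R S\<^esub> f') = (\<Oplus>\<^bsub>M\<^esub>p\<in>?A. (f p \<oplus> f' p) \<odot>\<^bsub>M\<^esub> g p)"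
      using lift_eq[OF g sum A sub] by simp
    also have "\<dots> = (\<Oplus>\<^bsub>M\<^esub>p\<in>?A. f p \<odot>\<^bsub>M\<^esub> g p \<oplus>\<^bsub>M\<^esub> f' p \<odot>\<^bsub>M\<^esub> g p)"
    proof (rule M.finsum_cong')
      fix p assume "p \<in> ?A"
      then have "g p \<in> carrier M" using A(2) g by blast
      then show "(f p \<oplus> f' p) \<odot>\<^bsub>M\<^esub> g p = f p \<odot>\<^bsub>M\<^esub> g p \<oplus>\<^bsub>M\<^esub> f' p \<odot>\<^bsub>M\<^esub> g p"
        using supp(3)[OF f] supp(3)[OF f'] smult_l_distr by blast
    qed (use tc[OF A(2) f] tc[OF A(2) f'] in auto)
    also have "\<dots> = (\<Oplus>\<^bsub>M\<^esub>p\<in>?A. f p \<odot>\<^bsub>M\<^esub> g p) \<oplus>\<^bsub>M\<^esub> (\<Oplus>\<^bsub>M\<^esub>p\<in>?A. f' p \<odot>\<^bsub>M\<^esub> g p)"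
      by (rule M.finsum_addf[OF tc[OF A(2) f] tc[OF A(2) f']])
    also have "\<dots> = lift R M g f \<oplus>\<^bsub>M\<^esub> lift R M g f'"
      using lift_eq[OF g f A] lift_eq[OF g f' A] by auto
    finally show "lift R M g (f \<oplus>\<^bsub>free_module R S\<^esub> f') = lift R M g f \<oplus>\<^bsub>M\<^esub> lift R M g f'" . }
  fix a assume a: "a \<in> carrier R"
  let ?A = "{s. f s \<noteq> \<zero>}"
  note A = supp(2,1)[OF f]
  have af: "a \<odot>\<^bsub>free_module R S\<^esub> f \<in> carrier (free_module R S)" using a f by (rule F.smult_closed)
  have sub: "{s. (a \<odot>\<^bsub>free_module R S\<^esub> f) s \<noteq> \<zero>} \<subseteq> ?A" using a by auto
  have "lift R M g (a \<odot>\<^bsub>free_module R S\<^esub> f) = (\<Oplus>\<^bsub>M\<^esub>p\<in>?A. (a \<otimes> f p) \<odot>\<^bsub>M\<^esub> g p)"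
    using lift_eq[OF g af A sub] by simp
  also have "\<dots> = (\<Oplus>\<^bsub>M\<^esub>p\<in>?A. a \<odot>\<^bsub>M\<^esub> (f p \<odot>\<^bsub>M\<^esub> g p))"
  proof (rule M.finsum_cong')
    fix p assume "p \<in> ?A"
    then have "g p \<in> carrier M" using A(2) g by blast
    then show "(a \<otimes> f p) \<odot>\<^bsub>M\<^esub> g p = a \<odot>\<^bsub>M\<^esub> (f p \<odot>\<^bsub>M\<^esub> g p)"
      using supp(3)[OF f] a smult_assoc1 by blast
  qed (use tc[OF A(2) f] a in auto)
  also have "\<dots> = a \<odot>\<^bsub>M\<^esub> lift R M g f"
    using finsum_smult_ldistr[OF A(1) a tc[OF A(2) f]] unfolding lift_def by simp
  finally show "lift R M g (a \<odot>\<^bsub>free_module R S\<^esub> f) = a \<odot>\<^bsub>M\<^esub> lift R M g f" .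
qed

lemma lift_unit_vec:
  assumes g: "g \<in> S \<rightarrow> carrier M" and s: "s \<in> S"
  shows "lift R M g (unit_vec R s) = g s"
proof -
  have gs: "g s \<in> carrier M" using assms by blast
  have "lift R M g (unit_vec R s) = (\<Oplus>\<^bsub>M\<^esub>p\<in>{s}. unit_vec R s p \<odot>\<^bsub>M\<^esub> g p)"
    by (rule lift_eq[OF g R.unit_vec_closed[OF s]]) (use s in \<open>auto simp: unit_vec_def\<close>)
  then show ?thesis using gs by (simp add: unit_vec_def)
qed

lemma lift_in_submodule:
  assumes W: "submodule W R M" and g: "g \<in> S \<rightarrow> W" and f: "f \<in> carrier (free_module R S)"
  shows "lift R M g f \<in> W"
  unfolding lift_def
  by (rule submodule_finsum[OF W]) (use g f submodule_smult[OF W] in \<open>auto simp: free_module_carrier Pi_def\<close>)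

end

lemma linear_map_with_grade [simp]:
  "linear_map R (with_grade M g) N h = linear_map R M N h"
  "linear_map R M' (with_grade N' g') h' = linear_map R M' N' h'"
  by (simp_all add: linear_map_def)

lemma submodule_with_grade:
  assumes "module R M"
  shows "submodule W R (with_grade M g) \<longleftrightarrow> submodule W R M"
  by (rule submodule_cong) (use assms module_with_grade in auto)

section \<open>Noetherianity of finitely generated modules\<close>

context graded_ring
begin

lemma graded_free_eq_prod':
  assumes "finite S"
  shows "graded_free R S \<delta> = prod_module S (\<lambda>s. shift_module (\<delta> s) (self_module R))"
  using graded_free_eq_prod[OF assms, of R \<delta>] rgrade_carrier zero_closed by blast

lemma graded_free_carrier: "carrier (graded_free R S \<delta>) = carrier (free_module R S)"
  by (simp add: graded_free_def)

lemma module_graded_free: "module R (graded_free R S \<delta>)"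
  unfolding graded_free_def by (rule module_with_grade) (rule module_free)

lemma proj_graded_free:
  assumes "finite S"
  shows "proj_graded R (graded_free R S \<delta>) (prod_proj S (\<lambda>s. shift_module (\<delta> s) (self_module R)) (\<lambda>s e. ring_proj (e - \<delta> s)))"
  unfolding graded_free_eq_prod'[OF assms]
  by (rule proj_graded_prod[OF assms]) (rule proj_graded_shift[OF proj_graded_self])

lemma noetherian_shift:
  "noetherian_module R M \<Longrightarrow> module R M \<Longrightarrow> noetherian_module R (shift_module d M)"
  unfolding noetherian_module_def using submodule_cong[of R M "shift_module d M"] module_shift_module[of R M d] by simp

lemma noetherian_graded_free:
  assumes "noetherian_ring R" "finite S"
  shows "noetherian_module R (graded_free R S \<delta>)"
  unfolding graded_free_eq_prod'[OF assms(2)]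
  by (rule noetherian_prod_module[OF assms(2)])
    (auto intro!: noetherian_shift module_shift_module module_self noetherian_self_module assms(1) is_cring)

text \<open>A generating set indexes the basis of a free module of finite rank that maps onto
  \<open>M\<close>. The grading of that free module is irrelevant here, so all shifts are
  zero.\<close>

lemma noetherian_fin_gen:
  assumes "noetherian_ring R" and M: "module R M" and "fin_gen_module R M"
  shows "noetherian_module R M"
proof -
  interpret module R M by fact
  obtain S where S: "finite S" "S \<subseteq> carrier M" "module_span R M S = carrier M"
    using assms(3) unfolding fin_gen_module_def by blast
  let ?F = "graded_free R S (\<lambda>_. 0)"
  have g: "(\<lambda>s. s) \<in> S \<rightarrow> carrier M" using S by blast
  have "linear_map R ?F M (lift R M (\<lambda>s. s))"
    unfolding graded_free_def using linear_lift[OF g] by simp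
  then interpret l: module_map R ?F M "lift R M (\<lambda>s. s)"
    by (intro module_map.intro module_map_axioms.intro module_graded_free M)
  have "submodule (lift R M (\<lambda>s. s) ` carrier ?F) R M"
    by (rule l.submodule_image[OF l.M.carrier_is_submodule])
  moreover have "S \<subseteq> lift R M (\<lambda>s. s) ` carrier ?F"
    using lift_unit_vec[OF g] unit_vec_closed unfolding graded_free_carrier by (metis image_eqI subsetI)
  ultimately have "carrier M \<subseteq> lift R M (\<lambda>s. s) ` carrier ?F"
    using module_span_least S(3) by metis
  then have "lift R M (\<lambda>s. s) ` carrier ?F = carrier M" using l.closed by blast
  then show ?thesis
    by (rule noetherian_module_surj[OF l.module_map_axioms _ noetherian_graded_free[OF assms(1) S(1)]])
qed

end

section \<open>Existence of graded free resolutions\<close>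

context proj_graded
begin

lemma grade_zero: "\<zero>\<^bsub>M\<^esub> \<in> grade M n"
  and grade_add: "x \<in> grade M n \<Longrightarrow> y \<in> grade M n \<Longrightarrow> x \<oplus>\<^bsub>M\<^esub> y \<in> grade M n"
  and grade_carrier: "x \<in> grade M n \<Longrightarrow> x \<in> carrier M"
  by (auto simp: grade_iff proj_add)

lemma grade_finsum: "(\<And>i. i \<in> A \<Longrightarrow> f i \<in> grade M n) \<Longrightarrow> finsum M f A \<in> grade M n"
  by (rule M.finsum_in_subset) (use grade_zero grade_add grade_carrier in auto)

lemma smult_grade: "a \<in> rgrade R i \<Longrightarrow> x \<in> grade M n \<Longrightarrow> a \<odot>\<^bsub>M\<^esub> x \<in> grade M (n + int i)"
  using proj_smult rgrade_carrier by (auto simp: grade_iff)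

lemma smult_grade_self:
  "a \<in> grade (self_module R) i \<Longrightarrow> x \<in> grade M n \<Longrightarrow> a \<odot>\<^bsub>M\<^esub> x \<in> grade M (i + n)"
  using smult_grade[of a "nat i" x n] grade_zero grade_carrier[of x n]
  by (auto simp: self_module_def add.commute split: if_splits)

lemma free_grade:
  assumes "finite S"
  shows "f \<in> grade (graded_free R S \<delta>) n \<longleftrightarrow>
    f \<in> carrier (graded_free R S \<delta>) \<and> (\<forall>s\<in>S. f s \<in> grade (self_module R) (n - \<delta> s))"
  unfolding graded_free_eq_prod'[OF assms] by (simp add: prod_module_grade)

lemma graded_hom_lift:
  assumes S: "finite S" and g: "\<And>s. s \<in> S \<Longrightarrow> g s \<in> grade M (\<delta> s)"
  shows "lift R M g \<in> graded_hom R (graded_free R S \<delta>) M"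
proof -
  have gc: "g \<in> S \<rightarrow> carrier M" using g grade_carrier by blast
  have "linear_map R (graded_free R S \<delta>) M (lift R M g)"
    unfolding graded_free_def using linear_lift[OF gc] by simp
  moreover have "lift R M g f \<in> grade M n" if f: "f \<in> grade (graded_free R S \<delta>) n" for f n
    unfolding lift_def
  proof (rule grade_finsum)
    fix p assume "p \<in> {p. f p \<noteq> \<zero>}"
    moreover have fc: "f \<in> carrier (free_module R S)" using f free_grade[OF S] graded_free_carrier by blast
    ultimately have p: "p \<in> S" by (auto simp: free_module_carrier)
    then have "f p \<in> grade (self_module R) (n - \<delta> p)" using f free_grade[OF S] by blast
    then show "f p \<odot>\<^bsub>M\<^esub> g p \<in> grade M n" using smult_grade_self[OF _ g[OF p]] by fastforce
  qed
  ultimately show ?thesis unfolding graded_hom_def linear_map_def by blast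
qed

text \<open>Among the images of finite lists of homogeneous elements of \<open>K\<close>, recorded
  with their degrees, there is a maximal one. Appending a component of an element of
  \<open>K\<close> cannot enlarge it, so it contains all components and hence
  \<open>K\<close>.\<close>

lemma graded_cover:
  assumes noeth: "noetherian_module R M" and K: "submodule K R M" "homog K"
  obtains r :: nat and \<delta> h where "h \<in> graded_hom R (graded_free R {..<r} \<delta>) M"
    "h ` carrier (graded_free R {..<r} \<delta>) = K"
proof -
  define im where "im gs = lift R M (\<lambda>j. fst (gs ! j)) ` carrier (free_module R {..<length gs})"
    for gs :: "('b \<times> int) list"
  define D where "D = im ` {gs. \<forall>(g, d)\<in>set gs. g \<in> K \<and> g \<in> grade M d}"
  have Kc: "K \<subseteq> carrier M" using submodule_subset K(1) .
  have gens: "(\<lambda>j. fst (gs ! j)) \<in> {..<length gs} \<rightarrow> K" if "\<forall>(g, d)\<in>set gs. g \<in> K \<and> g \<in> grade M d" for gs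
    using that nth_mem by (fastforce simp: case_prod_beta)
  have im_sub: "submodule (im gs) R M" if "\<forall>(g, d)\<in>set gs. g \<in> K \<and> g \<in> grade M d" for gs
  proof -
    have g: "(\<lambda>j. fst (gs ! j)) \<in> {..<length gs} \<rightarrow> carrier M" using gens[OF that] Kc by blast
    interpret l: module_map R "free_module R {..<length gs}" M "lift R M (\<lambda>j. fst (gs ! j))"
      by (intro module_map.intro module_map_axioms.intro R.module_free module_axioms' linear_lift g)
    show ?thesis unfolding im_def by (rule l.submodule_image[OF l.M.carrier_is_submodule])
  qed
  have im_gen: "fst (gs ! j) \<in> im gs" if "\<forall>(g, d)\<in>set gs. g \<in> K \<and> g \<in> grade M d" "j < length gs" for gs j
  proof -
    have g: "(\<lambda>j. fst (gs ! j)) \<in> {..<length gs} \<rightarrow> carrier M" using gens[OF that(1)] Kc by blast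
    show ?thesis unfolding im_def
      using lift_unit_vec[OF g, of j] R.unit_vec_closed[of j "{..<length gs}"] that(2) by (metis imageI lessThan_iff)
  qed
  have "im [] \<in> D" unfolding D_def by simp
  moreover have "D \<subseteq> {W. submodule W R M}" unfolding D_def using im_sub by blast
  ultimately obtain W where W: "W \<in> D" and max: "\<And>V. V \<in> D \<Longrightarrow> W \<subseteq> V \<Longrightarrow> V = W"
    using acc_maximal[OF noeth[unfolded noetherian_module_def], of D] by blast
  obtain gs where gs: "\<forall>(g, d)\<in>set gs. g \<in> K \<and> g \<in> grade M d" "W = im gs" using W unfolding D_def by blast
  have WK: "W \<subseteq> K" unfolding gs(2) im_def using lift_in_submodule[OF K(1) gens[OF gs(1)]] by blast
  have "K \<subseteq> W"
  proof
    fix x assume x: "x \<in> K"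
    have xc: "x \<in> carrier M" using x Kc by blast
    have "\<pi> e x \<in> W" for e
    proof -
      let ?gs = "gs @ [(\<pi> e x, e)]"
      have gs': "\<forall>(g, d)\<in>set ?gs. g \<in> K \<and> g \<in> grade M d"
        using gs(1) homogD[OF K(2) x] proj_proj[OF xc] xc by (auto simp: grade_iff)
      have "fst (gs ! j) \<in> im ?gs" if "j < length gs" for j
        using im_gen[OF gs', of j] that by (simp add: nth_append)
      then have g: "(\<lambda>j. fst (gs ! j)) \<in> {..<length gs} \<rightarrow> im ?gs" by simp
      have "W \<subseteq> im ?gs" unfolding gs(2) im_def[of gs]
        by (intro image_subsetI lift_in_submodule[OF im_sub[OF gs'] g])
      moreover have "im ?gs \<in> D" unfolding D_def using gs' by blast
      ultimately have "im ?gs = W" using max by blast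
      then show ?thesis using im_gen[OF gs', of "length gs"] by simp
    qed
    then show "x \<in> W"
      using homogeneous_induct[OF xc] submodule_zero submodule_add im_sub[OF gs(1)] gs(2) by metis
  qed
  then have "W = K" using WK by blast
  define \<delta> where "\<delta> j = snd (gs ! j)" for j
  have "lift R M (\<lambda>j. fst (gs ! j)) \<in> graded_hom R (graded_free R {..<length gs} \<delta>) M"
  proof (rule graded_hom_lift)
    fix j assume "j \<in> {..<length gs}"
    then have "gs ! j \<in> set gs" by simp
    then show "fst (gs ! j) \<in> grade M (\<delta> j)" using gs(1) unfolding \<delta>_def by (auto simp: case_prod_beta)
  qed simp
  moreover have "lift R M (\<lambda>j. fst (gs ! j)) ` carrier (graded_free R {..<length gs} \<delta>) = K"
    using \<open>W = K\<close> gs(2) unfolding im_def graded_free_carrier by simp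
  ultimately show thesis by (rule that)
qed

end

lemma graded_hom_linear: "h \<in> graded_hom R M N \<Longrightarrow> linear_map R M N h"
  unfolding graded_hom_def linear_map_def by blast

text \<open>Both sides are additive in \<open>x\<close>, and on a homogeneous element the claim is
  preservation of degree.\<close>

lemma linear_commutes_proj:
  assumes M: "proj_graded R M \<pi>" and N: "proj_graded R N \<rho>" and h: "linear_map R M N h"
    and grade: "\<And>n x. x \<in> grade M n \<Longrightarrow> h x \<in> grade N n" and x: "x \<in> carrier M"
  shows "h (\<pi> e x) = \<rho> e (h x)"
proof -
  interpret M: proj_graded R M \<pi> by fact
  interpret N: proj_graded R N \<rho> by fact
  interpret h: module_map R M N h
    by (intro module_map.intro module_map_axioms.intro M.module_axioms' N.module_axioms' h)
  have "x \<in> {x \<in> carrier M. h (\<pi> e x) = \<rho> e (h x)}"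
  proof (rule M.homogeneous_induct[OF x])
    fix d
    have "h (\<pi> d x) \<in> grade N d" using grade M.grade_iff M.proj_proj[OF x] x by simp
    then have "\<rho> e (h (\<pi> d x)) = (if e = d then h (\<pi> d x) else \<zero>\<^bsub>N\<^esub>)"
      using N.proj_homogeneous N.grade_iff by blast
    then show "\<pi> d x \<in> {x \<in> carrier M. h (\<pi> e x) = \<rho> e (h x)}"
      using x by (simp add: M.proj_proj)
  qed (auto simp: M.proj_add N.proj_add h.add)
  then show ?thesis by blast
qed

lemma homog_kernel:
  assumes M: "proj_graded R M \<pi>" and N: "proj_graded R N \<rho>" and h: "h \<in> graded_hom R M N"
  shows "submodule (a_kernel M N h) R M" "proj_graded.homog \<pi> (a_kernel M N h)"
proof -
  interpret M: proj_graded R M \<pi> by fact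
  interpret N: proj_graded R N \<rho> by fact
  interpret h: module_map R M N h
    by (intro module_map.intro module_map_axioms.intro M.module_axioms' N.module_axioms' graded_hom_linear[OF h])
  have eq: "a_kernel M N h = {x \<in> carrier M. h x \<in> {\<zero>\<^bsub>N\<^esub>}}" by (simp add: a_kernel_def kernel_def)
  show "submodule (a_kernel M N h) R M" unfolding eq
    by (rule h.submodule_preimage[OF N.submodule_singleton_zero])
  have "h x \<in> grade N n" if "x \<in> grade M n" for n x using h that unfolding graded_hom_def by blast
  then have "h (\<pi> e x) = \<rho> e (h x)" if "x \<in> carrier M" for x e
    using linear_commutes_proj[OF M N graded_hom_linear[OF h]] that by blast
  then show "M.homog (a_kernel M N h)" unfolding M.homog_def eq by simp
qed

text \<open>\<open>some_resolution\<close> is a choice by \<open>SOME\<close>, so everything about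
  \<open>Tor\<close> rests on existence. Kernels of graded maps are homogeneous, and each is covered
  by a graded free module of finite rank, again Noetherian.\<close>

theorem graded_free_resolution_exists:
  assumes L: "proj_graded R L \<pi>" and noeth: "noetherian_ring R" and fg: "noetherian_module R L"
  shows "graded_free_resolution R L (some_resolution R L)"
proof -
  interpret L: proj_graded R L \<pi> by fact
  let ?F = "\<lambda>(r, \<delta>). graded_free R {..<r::nat} \<delta>"
  have free: "proj_graded R (graded_free R {..<r} \<delta>)
      (prod_proj {..<r} (\<lambda>s. shift_module (\<delta> s) (self_module R)) (\<lambda>s e. L.ring_proj (e - \<delta> s)))" for r :: nat and \<delta>
    by (rule L.proj_graded_free) simp
  have step: "\<exists>G h. h \<in> graded_hom R (?F G) (?F F) \<and> h ` carrier (?F G) = a_kernel (?F F) N f"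
    if "f \<in> graded_hom R (?F F) N" "proj_graded R N \<rho>" for F f \<rho> and N :: "('a, 'e) graded_module"
  proof -
    obtain r \<delta> where F: "F = (r, \<delta>)" by force
    interpret A: proj_graded R "graded_free R {..<r} \<delta>"
      "prod_proj {..<r} (\<lambda>s. shift_module (\<delta> s) (self_module R)) (\<lambda>s e. L.ring_proj (e - \<delta> s))" by (rule free)
    have f: "f \<in> graded_hom R (graded_free R {..<r} \<delta>) N" using that(1) F by simp
    show ?thesis unfolding F prod.case
      using A.graded_cover[OF L.noetherian_graded_free[OF noeth] homog_kernel[OF free that(2) f]]
      by (metis case_prod_conv finite_lessThan)
  qed
  obtain r0 \<delta>0 f0 where f0: "f0 \<in> graded_hom R (?F (r0, \<delta>0)) L" "f0 ` carrier (?F (r0, \<delta>0)) = carrier L"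
  proof -
    have "L.homog (carrier L)" by (simp add: L.homog_def)
    then show thesis using L.graded_cover[OF fg L.carrier_is_submodule] that unfolding prod.case by metis
  qed
  \<comment> \<open>A state consists of the target, the source and the differential between them,
    free modules being given by rank and shifts. The clause for \<open>n = 0\<close> attaches the
    first differential to the augmentation; \<open>?Q\<close> links consecutive ones.\<close>
  let ?P = "\<lambda>n (F, G, h). h \<in> graded_hom R (?F G) (?F F) \<and>
    (n = (0::nat) \<longrightarrow> F = (r0, \<delta>0) \<and> h ` carrier (?F G) = a_kernel (?F F) L f0)"
  let ?Q = "\<lambda>n (F, G, h) (F', G', h'). F' = G \<and> h' ` carrier (?F G') = a_kernel (?F G) (?F F) h"
  have "\<exists>s. \<forall>n. ?P n (s n) \<and> ?Q n (s n) (s (Suc n))"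
  proof (rule dependent_nat_choice)
    obtain G h where "h \<in> graded_hom R (?F G) (?F (r0, \<delta>0))" "h ` carrier (?F G) = a_kernel (?F (r0, \<delta>0)) L f0"
      using step[OF f0(1) L] by blast
    then show "\<exists>x. ?P 0 x" by (intro exI[of _ "((r0, \<delta>0), G, h)"]) auto
  next
    fix x n assume P: "?P n x"
    obtain F G h where x: "x = (F, G, h)" by (cases x)
    have h: "h \<in> graded_hom R (?F G) (?F F)" using P x by simp
    have "\<exists>\<rho>. proj_graded R (?F F) \<rho>" using free by (cases F) auto
    then obtain G' h' where "h' \<in> graded_hom R (?F G') (?F G)" "h' ` carrier (?F G') = a_kernel (?F G) (?F F) h"
      using step[OF h] by blast
    then show "\<exists>y. ?P (Suc n) y \<and> ?Q n x y" unfolding x by (intro exI[of _ "(G, G', h')"]) auto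
  qed
  then obtain s where s': "\<forall>n. ?P n (s n) \<and> ?Q n (s n) (s (Suc n))" ..
  note s = s'[THEN spec, THEN conjunct1] s'[THEN spec, THEN conjunct2]
  define Fr :: "('a, 'b) free_complex" where "Fr = \<lparr>rank = (\<lambda>i. fst (fst (s i))), shift = (\<lambda>i. snd (fst (s i))),
    diff = (\<lambda>i. snd (snd (s i))), aug = f0\<rparr>"
  have t: "res_term R Fr i = ?F (fst (s i))" for i by (simp add: Fr_def res_term_def case_prod_beta)
  have t': "fst (snd (s i)) = fst (s (Suc i))" for i using s(2)[of i] by (auto simp: case_prod_beta)
  have d: "diff Fr i = snd (snd (s i))" "aug Fr = f0" for i by (auto simp: Fr_def)
  have s0: "fst (s 0) = (r0, \<delta>0)" using s(1)[of 0] by (auto simp: case_prod_beta)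
  have "graded_free_resolution R L Fr"
    unfolding graded_free_resolution_def t d
  proof (intro conjI allI)
    show "f0 \<in> graded_hom R (?F (fst (s 0))) L" "f0 ` carrier (?F (fst (s 0))) = carrier L"
      using f0 unfolding s0 by auto
    show "snd (snd (s i)) \<in> graded_hom R (?F (fst (s (Suc i)))) (?F (fst (s i)))" for i
      using s(1)[of i] t'[of i] by (auto simp: case_prod_beta)
    show "snd (snd (s 0)) ` carrier (?F (fst (s 1))) = a_kernel (?F (fst (s 0))) L f0"
      using s(1)[of 0] t'[of 0] by (auto simp: case_prod_beta)
    show "snd (snd (s (Suc i))) ` carrier (?F (fst (s (Suc (Suc i))))) =
      a_kernel (?F (fst (s (Suc i)))) (?F (fst (s i))) (snd (snd (s i)))" for i
      using s(2)[of i] t'[of i] t'[of "Suc i"] by (auto simp: case_prod_beta)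
  qed
  then show ?thesis unfolding some_resolution_def by (rule someI)
qed

section \<open>Tensor products\<close>

locale tensor = A: module R A + E: module R E
  for R :: "('a, 'c) ring_scheme" (structure) and A :: "('a, 'b, 'd) module_scheme"
    and E :: "('a, 'e, 'f) module_scheme"
begin

abbreviation "FF \<equiv> free_module R (carrier A \<times> carrier E)"
abbreviation "TT \<equiv> tensor_module R A E"
abbreviation "pt \<equiv> pure_tensor R A E"

definition rels :: "('b \<times> 'e \<Rightarrow> 'a) set" where
  "rels = 
       ({unit_vec R (a \<oplus>\<^bsub>A\<^esub> a', b) \<ominus>\<^bsub>FF\<^esub> (unit_vec R (a, b) \<oplus>\<^bsub>FF\<^esub> unit_vec R (a', b)) | a a' b.
           a \<in> carrier A \<and> a' \<in> carrier A \<and> b \<in> carrier E} \<union>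
        {unit_vec R (a, b \<oplus>\<^bsub>E\<^esub> b') \<ominus>\<^bsub>FF\<^esub> (unit_vec R (a, b) \<oplus>\<^bsub>FF\<^esub> unit_vec R (a, b')) | a b b'.
           a \<in> carrier A \<and> b \<in> carrier E \<and> b' \<in> carrier E} \<union>
        {unit_vec R (r \<odot>\<^bsub>A\<^esub> a, b) \<ominus>\<^bsub>FF\<^esub> (r \<odot>\<^bsub>FF\<^esub> unit_vec R (a, b)) | r a b.
           r \<in> carrier R \<and> a \<in> carrier A \<and> b \<in> carrier E} \<union>
        {unit_vec R (a, r \<odot>\<^bsub>E\<^esub> b) \<ominus>\<^bsub>FF\<^esub> (r \<odot>\<^bsub>FF\<^esub> unit_vec R (a, b)) | r a b.
           r \<in> carrier R \<and> a \<in> carrier A \<and> b \<in> carrier E})"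

lemma tensor_relations_eq: "tensor_relations R A E = module_span R FF rels"
  unfolding tensor_relations_def rels_def Let_def ..

sublocale FF: module R FF by (rule A.R.module_free)

lemma unit_closed: "a \<in> carrier A \<Longrightarrow> b \<in> carrier E \<Longrightarrow> unit_vec R (a, b) \<in> carrier FF"
  by (rule A.R.unit_vec_closed) simp

lemma rels_closed: "rels \<subseteq> carrier FF"
  unfolding rels_def using unit_closed
  by (auto simp del: free_module_simps intro!: FF.M.minus_closed FF.M.add.m_closed FF.smult_closed)

abbreviation "rel \<equiv> tensor_relations R A E"

lemma submodule_rel: "submodule rel R FF"
  unfolding tensor_relations_eq by (rule FF.submodule_module_span[OF rels_closed])

lemma rels_in_rel: "x \<in> rels \<Longrightarrow> x \<in> rel"
  unfolding tensor_relations_eq by (rule FF.module_span_incl[OF rels_closed])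

abbreviation "cls \<equiv> \<lambda>f. rel +>\<^bsub>FF\<^esub> f"

lemma module_tensor: "module R TT"
  unfolding tensor_module_def by (rule FF.quot_module(1)[OF submodule_rel])

sublocale TT: module R TT by (rule module_tensor)

lemma linear_cls: "linear_map R FF TT cls"
  unfolding tensor_module_def by (rule FF.quot_module(2)[OF submodule_rel])

sublocale cls: module_map R FF TT cls
  by (intro module_map.intro module_map_axioms.intro FF.module_axioms' module_tensor linear_cls)

lemma tensor_carrier: "carrier TT = cls ` carrier FF"
  unfolding tensor_module_def by (rule FF.quot_module_simps)

lemma pure_tensor_closed [simp, intro]: "a \<in> carrier A \<Longrightarrow> b \<in> carrier E \<Longrightarrow> pt a b \<in> carrier TT"
  unfolding pure_tensor_def using cls.closed unit_closed by blast

lemma cls_eq: "f \<in> carrier FF \<Longrightarrow> g \<in> carrier FF \<Longrightarrow> f \<ominus>\<^bsub>FF\<^esub> g \<in> rels \<Longrightarrow> cls f = cls g"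
  using FF.coset_eq_iff[OF submodule_rel] rels_in_rel by blast

lemma pure_tensor_add_left:
  assumes "a \<in> carrier A" "a' \<in> carrier A" "b \<in> carrier E"
  shows "pt (a \<oplus>\<^bsub>A\<^esub> a') b = pt a b \<oplus>\<^bsub>TT\<^esub> pt a' b"
  unfolding pure_tensor_def cls.add[symmetric, OF unit_closed[OF assms(1,3)] unit_closed[OF assms(2,3)]]
  by (rule cls_eq) (use assms in \<open>auto simp del: free_module_simps simp: unit_closed rels_def intro!: FF.M.add.m_closed\<close>)

lemma pure_tensor_add_right:
  assumes "a \<in> carrier A" "b \<in> carrier E" "b' \<in> carrier E"
  shows "pt a (b \<oplus>\<^bsub>E\<^esub> b') = pt a b \<oplus>\<^bsub>TT\<^esub> pt a b'"
  unfolding pure_tensor_def cls.add[symmetric, OF unit_closed[OF assms(1,2)] unit_closed[OF assms(1,3)]]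
  by (rule cls_eq) (use assms in \<open>auto simp del: free_module_simps simp: unit_closed rels_def intro!: FF.M.add.m_closed\<close>)

lemma pure_tensor_smult_left:
  assumes "r \<in> carrier R" "a \<in> carrier A" "b \<in> carrier E"
  shows "pt (r \<odot>\<^bsub>A\<^esub> a) b = r \<odot>\<^bsub>TT\<^esub> pt a b"
  unfolding pure_tensor_def cls.smult[symmetric, OF assms(1) unit_closed[OF assms(2,3)]]
  by (rule cls_eq) (use assms in \<open>auto simp del: free_module_simps simp: unit_closed rels_def intro!: FF.smult_closed\<close>)

lemma pure_tensor_smult_right:
  assumes "r \<in> carrier R" "a \<in> carrier A" "b \<in> carrier E"
  shows "pt a (r \<odot>\<^bsub>E\<^esub> b) = r \<odot>\<^bsub>TT\<^esub> pt a b"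
  unfolding pure_tensor_def cls.smult[symmetric, OF assms(1) unit_closed[OF assms(2,3)]]
  by (rule cls_eq) (use assms in \<open>auto simp del: free_module_simps simp: unit_closed rels_def intro!: FF.smult_closed\<close>)

lemma linear_pure_tensor_left: "b \<in> carrier E \<Longrightarrow> linear_map R A TT (\<lambda>a. pt a b)"
  and linear_pure_tensor_right: "a \<in> carrier A \<Longrightarrow> linear_map R E TT (\<lambda>b. pt a b)"
  by (auto simp: linear_map_def pure_tensor_add_left pure_tensor_add_right pure_tensor_smult_left pure_tensor_smult_right)

lemma tensor_induct:
  assumes W: "submodule W R TT" and p: "\<And>a b. a \<in> carrier A \<Longrightarrow> b \<in> carrier E \<Longrightarrow> pt a b \<in> W" and x: "x \<in> carrier TT"
  shows "x \<in> W"
proof -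
  obtain f where f: "f \<in> carrier FF" "x = cls f" using x tensor_carrier by blast
  have "f \<in> {f \<in> carrier FF. cls f \<in> W}"
  proof (rule A.R.free_module_induct[OF cls.submodule_preimage[OF W] _ f(1)])
    fix s assume "s \<in> carrier A \<times> carrier E"
    then obtain a b where "s = (a, b)" "a \<in> carrier A" "b \<in> carrier E" by blast
    then show "unit_vec R s \<in> {f \<in> carrier FF. cls f \<in> W}"
      using p[of a b] unit_closed unfolding pure_tensor_def by blast
  qed
  then show ?thesis using f(2) by blast
qed

definition bilinear :: "('a, 'g, 'h) module_scheme \<Rightarrow> ('b \<times> 'e \<Rightarrow> 'g) \<Rightarrow> bool" where
  "bilinear Q g \<longleftrightarrow> (\<forall>b\<in>carrier E. linear_map R A Q (\<lambda>a. g (a, b))) \<and>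
     (\<forall>a\<in>carrier A. linear_map R E Q (\<lambda>b. g (a, b)))"

definition extend :: "('a, 'g, 'h) module_scheme \<Rightarrow> ('b \<times> 'e \<Rightarrow> 'g) \<Rightarrow> ('b \<times> 'e \<Rightarrow> 'a) set \<Rightarrow> 'g" where
  "extend Q g t = the_elem (lift R Q g ` t)"

text \<open>The universal property of the tensor product. By bilinearity the linear extension of
  \<open>g\<close> kills the four kinds of relations, so it is constant on each coset and
  \<open>the_elem\<close> picks that constant.\<close>

lemma extend:
  assumes Q: "module R Q" and g: "bilinear Q g"
  shows "linear_map R TT Q (extend Q g)"
    "\<And>a b. a \<in> carrier A \<Longrightarrow> b \<in> carrier E \<Longrightarrow> extend Q g (pt a b) = g (a, b)"
proof -
  interpret Q: module R Q by fact
  have gc: "g \<in> carrier A \<times> carrier E \<rightarrow> carrier Q"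
    using g unfolding bilinear_def linear_map_def by blast
  interpret l: module_map R FF Q "lift R Q g"
    by (intro module_map.intro module_map_axioms.intro FF.module_axioms' Q Q.linear_lift[OF gc])
  have u: "lift R Q g (unit_vec R (a, b)) = g (a, b)" if "a \<in> carrier A" "b \<in> carrier E" for a b
    by (rule Q.lift_unit_vec[OF gc]) (use that in simp)
  have g': "g (a, b) \<in> carrier Q" if "a \<in> carrier A" "b \<in> carrier E" for a b using gc that by blast
  have bil: "g (a \<oplus>\<^bsub>A\<^esub> a', b) = g (a, b) \<oplus>\<^bsub>Q\<^esub> g (a', b)" "g (r \<odot>\<^bsub>A\<^esub> a, b) = r \<odot>\<^bsub>Q\<^esub> g (a, b)"
    if "a \<in> carrier A" "a' \<in> carrier A" "b \<in> carrier E" "r \<in> carrier R" for a a' b r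
    using g that unfolding bilinear_def linear_map_def by auto
  have bir: "g (a, b \<oplus>\<^bsub>E\<^esub> b') = g (a, b) \<oplus>\<^bsub>Q\<^esub> g (a, b')" "g (a, r \<odot>\<^bsub>E\<^esub> b) = r \<odot>\<^bsub>Q\<^esub> g (a, b)"
    if "a \<in> carrier A" "b \<in> carrier E" "b' \<in> carrier E" "r \<in> carrier R" for a b b' r
    using g that unfolding bilinear_def linear_map_def by auto
  have ker: "submodule {f \<in> carrier FF. lift R Q g f \<in> {\<zero>\<^bsub>Q\<^esub>}} R FF"
    by (rule l.submodule_preimage[OF Q.submodule_singleton_zero])
  have d: "x \<ominus>\<^bsub>FF\<^esub> y \<in> {f \<in> carrier FF. lift R Q g f \<in> {\<zero>\<^bsub>Q\<^esub>}}"
    if "x \<in> carrier FF" "y \<in> carrier FF" "lift R Q g x = lift R Q g y" for x y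
    using that l.minus[OF that(1,2)] FF.M.minus_closed[OF that(1,2)] l.closed[OF that(2)]
    by (simp add: Q.M.minus_eq Q.M.r_neg del: free_module_simps)
  have "rels \<subseteq> {f \<in> carrier FF. lift R Q g f \<in> {\<zero>\<^bsub>Q\<^esub>}}"
  proof
    fix x assume x: "x \<in> rels"
    note c = A.M.add.m_closed E.M.add.m_closed A.smult_closed E.smult_closed FF.M.add.m_closed FF.smult_closed
    show "x \<in> {f \<in> carrier FF. lift R Q g f \<in> {\<zero>\<^bsub>Q\<^esub>}}"
      using x unfolding rels_def
    proof (elim UnE CollectE exE conjE; hypsubst)
      fix a a' b assume "a \<in> carrier A" "a' \<in> carrier A" "b \<in> carrier E"
      then show "unit_vec R (a \<oplus>\<^bsub>A\<^esub> a', b) \<ominus>\<^bsub>FF\<^esub> (unit_vec R (a, b) \<oplus>\<^bsub>FF\<^esub> unit_vec R (a', b)) \<in> {f \<in> carrier FF. lift R Q g f \<in> {\<zero>\<^bsub>Q\<^esub>}}"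
        by (intro d c unit_closed) (simp_all add: u bil[OF _ _ _ A.R.one_closed] l.add unit_closed del: free_module_simps)
    next
      fix a b b' assume "a \<in> carrier A" "b \<in> carrier E" "b' \<in> carrier E"
      then show "unit_vec R (a, b \<oplus>\<^bsub>E\<^esub> b') \<ominus>\<^bsub>FF\<^esub> (unit_vec R (a, b) \<oplus>\<^bsub>FF\<^esub> unit_vec R (a, b')) \<in> {f \<in> carrier FF. lift R Q g f \<in> {\<zero>\<^bsub>Q\<^esub>}}"
        by (intro d c unit_closed) (simp_all add: u bir[OF _ _ _ A.R.one_closed] l.add unit_closed del: free_module_simps)
    next
      fix r a b assume "r \<in> carrier R" "a \<in> carrier A" "b \<in> carrier E"
      then show "unit_vec R (r \<odot>\<^bsub>A\<^esub> a, b) \<ominus>\<^bsub>FF\<^esub> (r \<odot>\<^bsub>FF\<^esub> unit_vec R (a, b)) \<in> {f \<in> carrier FF. lift R Q g f \<in> {\<zero>\<^bsub>Q\<^esub>}}"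
        by (intro d c unit_closed) (simp_all add: u bil(2)[OF _ A.M.zero_closed] l.smult unit_closed del: free_module_simps)
    next
      fix r a b assume "r \<in> carrier R" "a \<in> carrier A" "b \<in> carrier E"
      then show "unit_vec R (a, r \<odot>\<^bsub>E\<^esub> b) \<ominus>\<^bsub>FF\<^esub> (r \<odot>\<^bsub>FF\<^esub> unit_vec R (a, b)) \<in> {f \<in> carrier FF. lift R Q g f \<in> {\<zero>\<^bsub>Q\<^esub>}}"
        by (intro d c unit_closed) (simp_all add: u bir(2)[OF _ _ E.M.zero_closed] l.smult unit_closed del: free_module_simps)
    qed
  qed
  then have rel0: "lift R Q g w = \<zero>\<^bsub>Q\<^esub>" "w \<in> carrier FF" if "w \<in> rel" for w
    using FF.module_span_least[OF ker] that unfolding tensor_relations_eq by blast+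
  have e: "extend Q g (cls f) = lift R Q g f" if f: "f \<in> carrier FF" for f
  proof -
    have "lift R Q g (w \<oplus>\<^bsub>FF\<^esub> f) = lift R Q g f" if "w \<in> rel" for w
      using l.add[OF rel0(2)[OF that] f] rel0(1)[OF that] l.closed[OF f] by simp
    then have "lift R Q g x = lift R Q g f" if "x \<in> cls f" for x
      using that unfolding a_r_coset_def' by blast
    moreover have "f \<in> cls f"
      using abelian_subgroup.a_rcos_self[OF FF.abelian_subgroup_submodule[OF submodule_rel] f] .
    ultimately have "lift R Q g ` cls f = {lift R Q g f}" by blast
    then show ?thesis unfolding extend_def by simp
  qed
  show "extend Q g (pt a b) = g (a, b)" if "a \<in> carrier A" "b \<in> carrier E" for a b
    unfolding pure_tensor_def using e[OF unit_closed[OF that]] u[OF that] by simp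
  show "linear_map R TT Q (extend Q g)" unfolding linear_map_def
  proof (intro conjI ballI Pi_I)
    fix x assume "x \<in> carrier TT"
    then obtain f where f: "f \<in> carrier FF" "x = cls f" using tensor_carrier by blast
    show "extend Q g x \<in> carrier Q" using f e l.closed by simp
    show "extend Q g (a \<odot>\<^bsub>TT\<^esub> x) = a \<odot>\<^bsub>Q\<^esub> extend Q g x" if a: "a \<in> carrier R" for a
      unfolding f(2) cls.smult[symmetric, OF a f(1)] e[OF f(1)] e[OF FF.smult_closed[OF a f(1)]]
      by (rule l.smult[OF a f(1)])
    fix y assume "y \<in> carrier TT"
    then obtain f' where f': "f' \<in> carrier FF" "y = cls f'" using tensor_carrier by blast
    show "extend Q g (x \<oplus>\<^bsub>TT\<^esub> y) = extend Q g x \<oplus>\<^bsub>Q\<^esub> extend Q g y"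
      unfolding f(2) f'(2) cls.add[symmetric, OF f(1) f'(1)] e[OF f(1)] e[OF f'(1)] e[OF FF.M.add.m_closed[OF f(1) f'(1)]]
      by (rule l.add[OF f(1) f'(1)])
  qed
qed

end

lemma linear_comp: "linear_map R M N f \<Longrightarrow> linear_map R N Q g \<Longrightarrow> linear_map R M Q (\<lambda>x. g (f x))"
  unfolding linear_map_def by (auto simp: Pi_def)

text \<open>The map sending \<open>(a, b)\<close> to the tensor of \<open>h a\<close> and
  \<open>b\<close> is bilinear, and \<open>tensor_map\<close> unfolds to its extension.\<close>

lemma tensor_map:
  fixes R :: "('a, 'c) ring_scheme"
  assumes A: "module R A" and A': "module R A'" and E: "module R E" and h: "linear_map R A A' h"
  shows "linear_map R (tensor_module R A E) (tensor_module R A' E) (tensor_map R A A' E h)"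
    "\<And>a b. a \<in> carrier A \<Longrightarrow> b \<in> carrier E \<Longrightarrow>
      tensor_map R A A' E h (pure_tensor R A E a b) = pure_tensor R A' E (h a) b"
proof -
  interpret T: tensor R A E by (intro tensor.intro A E)
  interpret T': tensor R A' E by (intro tensor.intro A' E)
  let ?g = "\<lambda>p. pure_tensor R A' E (h (fst p)) (snd p)"
  have "T.bilinear T'.TT ?g" unfolding T.bilinear_def fst_conv snd_conv
  proof (intro conjI ballI)
    show "linear_map R A T'.TT (\<lambda>a. pure_tensor R A' E (h a) b)" if "b \<in> carrier E" for b
      by (rule linear_comp[OF h T'.linear_pure_tensor_left[OF that]])
    show "linear_map R E T'.TT (\<lambda>b. pure_tensor R A' E (h a) b)" if "a \<in> carrier A" for a
      by (rule T'.linear_pure_tensor_right) (use h that in \<open>auto simp: linear_map_def\<close>)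
  qed
  note e = T.extend[OF T'.module_tensor this]
  have eq: "tensor_map R A A' E h = T.extend T'.TT ?g"
    unfolding tensor_map_def T.extend_def lift_def ..
  show "linear_map R T.TT T'.TT (tensor_map R A A' E h)" unfolding eq by (rule e(1))
  show "tensor_map R A A' E h (pure_tensor R A E a b) = pure_tensor R A' E (h a) b"
    if "a \<in> carrier A" "b \<in> carrier E" for a b
    unfolding eq using e(2)[OF that] by simp
qed

section \<open>Tensoring with a graded free module\<close>

definition single :: "('s \<Rightarrow> ('a, 'b) graded_module) \<Rightarrow> 's \<Rightarrow> 'b \<Rightarrow> 's \<Rightarrow> 'b" where
  "single A s x = (\<lambda>t. if t = s then x else \<zero>\<^bsub>A t\<^esub>)"

lemma linear_single:
  assumes "\<And>s. module R (A s)" "s \<in> S"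
  shows "linear_map R (A s) (prod_module S A) (single A s)"
proof -
  interpret A: module R "A s" for s by (rule assms)
  show ?thesis using assms(2) by (auto simp: linear_map_def single_def prod_module_carrier fun_eq_iff)
qed

lemma prod_module_induct:
  assumes A: "\<And>s. module R (A s)" and S: "finite S" and W: "submodule W R (prod_module S A)"
    and single: "\<And>s x. s \<in> S \<Longrightarrow> x \<in> carrier (A s) \<Longrightarrow> single A s x \<in> W"
    and f: "f \<in> carrier (prod_module S A)"
  shows "f \<in> W"
proof -
  interpret A: module R "A s" for s by (rule A)
  interpret P: module R "prod_module S A" using A by (rule module_prod)
  have c: "f t \<in> carrier (A t)" for t using prod_module_component[OF A f] .
  have "(\<lambda>t. if t \<in> F then f t else \<zero>\<^bsub>A t\<^esub>) \<in> W" if "finite F" "F \<subseteq> S" for F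
    using that
  proof (induction F)
    case empty
    then show ?case using P.submodule_zero[OF W] by simp
  next
    case (insert s F)
    have "(\<lambda>t. if t \<in> insert s F then f t else \<zero>\<^bsub>A t\<^esub>) =
      single A s (f s) \<oplus>\<^bsub>prod_module S A\<^esub> (\<lambda>t. if t \<in> F then f t else \<zero>\<^bsub>A t\<^esub>)"
      using insert.hyps c by (auto simp: fun_eq_iff single_def)
    then show ?case using P.submodule_add[OF W single[OF _ c]] insert by simp
  qed
  from this[OF S order_refl] have "(\<lambda>t. if t \<in> S then f t else \<zero>\<^bsub>A t\<^esub>) \<in> W" .
  moreover have "(\<lambda>t. if t \<in> S then f t else \<zero>\<^bsub>A t\<^esub>) = f" using f by (auto simp: prod_module_carrier)
  ultimately show ?thesis by simp
qed

lemma linear_eq_on_prod: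
  assumes A: "\<And>s. module R (A s)" and S: "finite S" and Q: "module R Q"
    and "linear_map R (prod_module S A) Q f" "linear_map R (prod_module S A) Q g"
    and "\<And>s x. s \<in> S \<Longrightarrow> x \<in> carrier (A s) \<Longrightarrow> f (single A s x) = g (single A s x)"
    and x: "x \<in> carrier (prod_module S A)"
  shows "f x = g x"
proof -
  interpret P: module R "prod_module S A" using A by (rule module_prod)
  have s: "single A s x \<in> carrier (prod_module S A)" if "s \<in> S" "x \<in> carrier (A s)" for s x
    using linear_single[of R A s S] A that unfolding linear_map_def by blast
  have "x \<in> {x \<in> carrier (prod_module S A). f x = g x}"
    by (rule prod_module_induct[OF A S P.submodule_equalizer[OF Q assms(4,5)] _ x]) (use assms(6) s in auto)
  then show ?thesis by blast
qed

abbreviation free_tensor :: "('a, 'b) graded_module \<Rightarrow> nat \<Rightarrow> (nat \<Rightarrow> int) \<Rightarrow> ('a, nat \<Rightarrow> 'b) graded_module" where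
  "free_tensor M r \<delta> \<equiv> prod_module {..<r} (\<lambda>s. shift_module (\<delta> s) M)"

lemma free_tensor_carrier:
  "f \<in> carrier (free_tensor M r \<delta>) \<longleftrightarrow> (\<forall>s<r. f s \<in> carrier M) \<and> (\<forall>s\<ge>r. f s = \<zero>\<^bsub>M\<^esub>)"
  by (auto simp: prod_module_carrier)

text \<open>The vector in \<open>M^r\<close> that corresponds to \<open>a \<otimes> x\<close> under
  the isomorphism of \<open>R^r \<otimes> M\<close> with \<open>M^r\<close>.\<close>

definition spread :: "('a, 'b) graded_module \<Rightarrow> nat \<Rightarrow> (nat \<Rightarrow> 'a) \<Rightarrow> 'b \<Rightarrow> nat \<Rightarrow> 'b" where
  "spread M r a x = (\<lambda>j. if j < r then a j \<odot>\<^bsub>M\<^esub> x else \<zero>\<^bsub>M\<^esub>)"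

definition sum_map :: "('a, 'e, 'f) module_scheme \<Rightarrow> nat \<Rightarrow> (nat \<Rightarrow> 'b \<Rightarrow> 'e) \<Rightarrow> (nat \<Rightarrow> 'b) \<Rightarrow> 'e" where
  "sum_map Q r \<phi> f = (\<Oplus>\<^bsub>Q\<^esub>j\<in>{..<r}. \<phi> j (f j))"

lemma linear_sum_map:
  fixes R :: "('a, 'c) ring_scheme" and M :: "('a, 'b) graded_module"
  assumes M: "module R M" and Q: "module R Q" and \<phi>: "\<And>j. j < r \<Longrightarrow> linear_map R M Q (\<phi> j)"
  shows "linear_map R (free_tensor M r \<delta>) Q (sum_map Q r \<phi>)"
proof -
  interpret M: module R M by fact
  interpret Q: module R Q by fact
  have f: "f j \<in> carrier M" if "f \<in> carrier (free_tensor M r \<delta>)" for f j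
    using that unfolding free_tensor_carrier by (cases "j < r") auto
  have \<phi>c: "\<phi> j x \<in> carrier Q" if "j < r" "x \<in> carrier M" for j x
    using \<phi>[OF that(1)] that(2) unfolding linear_map_def by blast
  have c: "(\<lambda>j. \<phi> j (f j)) \<in> {..<r} \<rightarrow> carrier Q" if "f \<in> carrier (free_tensor M r \<delta>)" for f
    using f[OF that] \<phi>c by blast
  show ?thesis unfolding linear_map_def
  proof (intro conjI ballI Pi_I)
    fix x assume x: "x \<in> carrier (free_tensor M r \<delta>)"
    show "sum_map Q r \<phi> x \<in> carrier Q" unfolding sum_map_def using c[OF x] by (rule Q.M.finsum_closed)
    show "sum_map Q r \<phi> (a \<odot>\<^bsub>free_tensor M r \<delta>\<^esub> x) = a \<odot>\<^bsub>Q\<^esub> sum_map Q r \<phi> x" if a: "a \<in> carrier R" for a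
    proof -
      have "a \<odot>\<^bsub>Q\<^esub> sum_map Q r \<phi> x = (\<Oplus>\<^bsub>Q\<^esub>j\<in>{..<r}. a \<odot>\<^bsub>Q\<^esub> \<phi> j (x j))"
        unfolding sum_map_def by (rule Q.finsum_smult_ldistr[OF _ a c[OF x]]) simp
      also have "\<dots> = sum_map Q r \<phi> (a \<odot>\<^bsub>free_tensor M r \<delta>\<^esub> x)"
        unfolding sum_map_def
        by (rule Q.M.finsum_cong') (use a f[OF x] \<phi>c \<phi> in \<open>auto simp: linear_map_def\<close>)
      finally show ?thesis by simp
    qed
    fix y assume y: "y \<in> carrier (free_tensor M r \<delta>)"
    have "sum_map Q r \<phi> x \<oplus>\<^bsub>Q\<^esub> sum_map Q r \<phi> y = (\<Oplus>\<^bsub>Q\<^esub>j\<in>{..<r}. \<phi> j (x j) \<oplus>\<^bsub>Q\<^esub> \<phi> j (y j))"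
      unfolding sum_map_def by (rule Q.M.finsum_addf[symmetric, OF c[OF x] c[OF y]])
    also have "\<dots> = sum_map Q r \<phi> (x \<oplus>\<^bsub>free_tensor M r \<delta>\<^esub> y)"
      unfolding sum_map_def
      by (rule Q.M.finsum_cong') (use f[OF x] f[OF y] \<phi>c \<phi> in \<open>auto simp: linear_map_def\<close>)
    finally show "sum_map Q r \<phi> (x \<oplus>\<^bsub>free_tensor M r \<delta>\<^esub> y) = sum_map Q r \<phi> x \<oplus>\<^bsub>Q\<^esub> sum_map Q r \<phi> y"
      by simp
  qed
qed

lemma sum_map_single:
  fixes R :: "('a, 'c) ring_scheme" and M :: "('a, 'b) graded_module"
  assumes M: "module R M" and Q: "module R Q" and \<phi>: "\<And>j. j < r \<Longrightarrow> linear_map R M Q (\<phi> j)"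
    and j: "j < r" "x \<in> carrier M"
  shows "sum_map Q r \<phi> (single (\<lambda>s. shift_module (\<delta> s) M) j x) = \<phi> j x"
proof -
  interpret M: module R M by fact
  interpret Q: module R Q by fact
  have z: "\<phi> i \<zero>\<^bsub>M\<^esub> = \<zero>\<^bsub>Q\<^esub>" if "i < r" for i
    using module_map.zero[OF module_map.intro[OF M Q module_map_axioms.intro[OF \<phi>[OF that]]]] .
  have \<phi>c: "\<phi> i x \<in> carrier Q" if "i < r" for i
    using \<phi>[OF that(1)] j(2) unfolding linear_map_def by blast
  have "sum_map Q r \<phi> (single (\<lambda>s. shift_module (\<delta> s) M) j x) =
    (\<Oplus>\<^bsub>Q\<^esub>i\<in>{..<r}. if j = i then \<phi> i x else \<zero>\<^bsub>Q\<^esub>)"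
    unfolding sum_map_def
    by (rule Q.M.finsum_cong') (use j z \<phi>c in \<open>auto simp: single_def\<close>)
  also have "\<dots> = \<phi> j x"
    by (rule Q.M.finsum_singleton) (use j \<phi>c in auto)
  finally show ?thesis .
qed

text \<open>The map from \<open>M^r\<close> to \<open>F \<otimes> E\<close> that sends
  \<open>f\<close> to the sum of the tensors of the basis vectors with \<open>q (f j)\<close>. It
  transports everything about \<open>F \<otimes> E\<close> to the fixed module
  \<open>M^r\<close>.\<close>

definition free_sum ::
    "'a graded_ring \<Rightarrow> nat \<Rightarrow> (nat \<Rightarrow> int) \<Rightarrow> ('a, 'e) graded_module \<Rightarrow> ('b \<Rightarrow> 'e) \<Rightarrow> (nat \<Rightarrow> 'b) \<Rightarrow>
     ((nat \<Rightarrow> 'a) \<times> 'e \<Rightarrow> 'a) set" where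
  "free_sum R r \<delta> E q = sum_map (tensor_module R (graded_free R {..<r} \<delta>) E) r
     (\<lambda>j x. pure_tensor R (graded_free R {..<r} \<delta>) E (unit_vec R j) (q x))"

text \<open>Instead of only \<open>E = M\<close> and \<open>E = M / K\<close> we allow any graded quotient \<open>q : M \<rightarrow> E\<close>, so that
  \<open>Tor(L, M)\<close> and \<open>Tor(L, M / K)\<close> are described simultaneously inside \<open>F \<otimes> M = M\<^sup>r\<close>.\<close>

locale graded_quotient = M: proj_graded R M \<pi> + q: module_map R M E q
  for R :: "'a graded_ring" (structure) and M :: "('a, 'b) graded_module" and \<pi>
    and E :: "('a, 'e) graded_module" and q +
  assumes surj: "q ` carrier M = carrier E" and grade_image: "\<And>n. grade E n = q ` grade M n"
begin

definition "ker = {x \<in> carrier M. q x = \<zero>\<^bsub>E\<^esub>}"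

abbreviation "Fr r \<delta> \<equiv> graded_free R {..<r::nat} \<delta>"
abbreviation "Tn r \<delta> \<equiv> tensor_module R (Fr r \<delta>) E"

lemma submodule_ker: "submodule ker R M"
  unfolding ker_def using q.submodule_preimage[OF q.N.submodule_singleton_zero] by simp

lemma module_free_tensor: "module R (free_tensor M r \<delta>)"
  by (rule module_prod) (rule module_shift_module[OF M.module_axioms'])

lemma tensor_free: "tensor R (Fr r \<delta>) E"
  by (intro tensor.intro M.module_graded_free q.N.module_axioms')

lemma module_Tn: "module R (Tn r \<delta>)"
  by (rule tensor.module_tensor[OF tensor_free])

lemma unit_vec_free: "j < r \<Longrightarrow> unit_vec R j \<in> carrier (Fr r \<delta>)"
  unfolding M.graded_free_carrier using M.unit_vec_closed[of j "{..<r}"] by simp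

lemma linear_pure_tensor_q:
  assumes "j < r"
  shows "linear_map R M (Tn r \<delta>) (\<lambda>x. pure_tensor R (Fr r \<delta>) E (unit_vec R j) (q x))"
  using linear_comp[OF q.linear tensor.linear_pure_tensor_right[OF tensor_free unit_vec_free[OF assms]]] .

lemma linear_free_sum: "linear_map R (free_tensor M r \<delta>) (Tn r \<delta>) (free_sum R r \<delta> E q)"
  unfolding free_sum_def by (rule linear_sum_map[OF M.module_axioms' module_Tn linear_pure_tensor_q])

lemma map_free_sum: "module_map R (free_tensor M r \<delta>) (Tn r \<delta>) (free_sum R r \<delta> E q)"
  by (intro module_map.intro module_map_axioms.intro module_free_tensor module_Tn linear_free_sum)

lemma free_sum_single:
  assumes "j < r" "x \<in> carrier M"
  shows "free_sum R r \<delta> E q (single (\<lambda>s. shift_module (\<delta> s) M) j x) =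
    pure_tensor R (Fr r \<delta>) E (unit_vec R j) (q x)"
  unfolding free_sum_def
  using sum_map_single[where \<phi> = "\<lambda>j x. pure_tensor R (Fr r \<delta>) E (unit_vec R j) (q x)",
      OF M.module_axioms' module_Tn linear_pure_tensor_q assms] .

lemma spread_closed:
  assumes "a \<in> carrier (Fr r \<delta>)" "x \<in> carrier M"
  shows "spread M r a x \<in> carrier (free_tensor M r \<delta>')"
  using assms unfolding M.graded_free_carrier by (auto simp: free_module_carrier free_tensor_carrier spread_def)

lemma linear_spread:
  "x \<in> carrier M \<Longrightarrow> linear_map R (Fr r \<delta>) (free_tensor M r \<delta>') (\<lambda>a. spread M r a x)"
  "a \<in> carrier (Fr r \<delta>) \<Longrightarrow> linear_map R M (free_tensor M r \<delta>') (\<lambda>x. spread M r a x)"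
proof -
  have c: "a j \<in> carrier R" if "a \<in> carrier (Fr r \<delta>)" for a j
    using that unfolding M.graded_free_carrier by (simp add: free_module_carrier)
  show "linear_map R (Fr r \<delta>) (free_tensor M r \<delta>') (\<lambda>a. spread M r a x)" if "x \<in> carrier M"
    unfolding linear_map_def using spread_closed[OF _ that] that c
    by (auto simp: spread_def fun_eq_iff graded_free_def M.smult_l_distr M.smult_assoc1)
  show "linear_map R M (free_tensor M r \<delta>') (\<lambda>x. spread M r a x)" if "a \<in> carrier (Fr r \<delta>)"
    unfolding linear_map_def using spread_closed[OF that] c[OF that]
    by (auto simp: spread_def fun_eq_iff M.smult_r_distr M.smult_left_commute)
qed

text \<open>Both sides are linear in \<open>a\<close>, and for a basis vector the spread has a
  single nonzero coordinate.\<close>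

lemma pure_tensor_eq_free_sum:
  assumes a: "a \<in> carrier (Fr r \<delta>)" and x: "x \<in> carrier M"
  shows "pure_tensor R (Fr r \<delta>) E a (q x) = free_sum R r \<delta> E q (spread M r a x)"
proof -
  interpret T: tensor R "Fr r \<delta>" E by (rule tensor_free)
  have "a \<in> {a \<in> carrier (Fr r \<delta>). T.pt a (q x) = free_sum R r \<delta> E q (spread M r a x)}"
  proof (rule M.free_module_induct)
    show "submodule {a \<in> carrier (Fr r \<delta>). T.pt a (q x) = free_sum R r \<delta> E q (spread M r a x)} R (free_module R {..<r})"
      using T.A.submodule_equalizer[OF T.module_tensor T.linear_pure_tensor_left[OF q.closed[OF x]] linear_comp[OF linear_spread(1)[OF x] linear_free_sum]]
        submodule_with_grade[OF M.module_free] unfolding graded_free_def by blast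
    show "a \<in> carrier (free_module R {..<r})" using a unfolding M.graded_free_carrier .
    fix j assume "j \<in> {..<r}"
    then have j: "j < r" by simp
    have "spread M r (unit_vec R j) x = single (\<lambda>s. shift_module (\<delta> s) M) j x"
      using x j by (auto simp: spread_def unit_vec_def single_def fun_eq_iff)
    then show "unit_vec R j \<in> {a \<in> carrier (Fr r \<delta>). T.pt a (q x) = free_sum R r \<delta> E q (spread M r a x)}"
      using free_sum_single[OF j x] unit_vec_free[OF j] by simp
  qed
  then show ?thesis by blast
qed

lemma free_sum_surj: "free_sum R r \<delta> E q ` carrier (free_tensor M r \<delta>) = carrier (Tn r \<delta>)"
proof -
  interpret T: tensor R "Fr r \<delta>" E by (rule tensor_free)
  interpret s: module_map R "free_tensor M r \<delta>" "Tn r \<delta>" "free_sum R r \<delta> E q" by (rule map_free_sum)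
  have "x \<in> free_sum R r \<delta> E q ` carrier (free_tensor M r \<delta>)" if "x \<in> carrier (Tn r \<delta>)" for x
  proof (rule T.tensor_induct[OF s.submodule_image[OF s.M.carrier_is_submodule] _ that])
    fix a b assume a: "a \<in> carrier (Fr r \<delta>)" and "b \<in> carrier E"
    then obtain m where m: "m \<in> carrier M" "b = q m" using surj by blast
    then show "T.pt a b \<in> free_sum R r \<delta> E q ` carrier (free_tensor M r \<delta>)"
      using pure_tensor_eq_free_sum[OF a m(1)] spread_closed[OF a m(1)] by blast
  qed
  then show ?thesis using s.closed by blast
qed

text \<open>The bilinear map sending \<open>(a, b)\<close> to the vector of all \<open>a j b\<close>
  induces a map from \<open>F \<otimes> E\<close> to \<open>E^r\<close>. Its composition with
  \<open>free_sum\<close> applies \<open>q\<close> to each coordinate, so nothing beyond vectors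
  over \<open>ker\<close> can be killed.\<close>

lemma free_sum_kernel:
  assumes f: "f \<in> carrier (free_tensor M r \<delta>)"
  shows "free_sum R r \<delta> E q f = \<zero>\<^bsub>Tn r \<delta>\<^esub> \<longleftrightarrow> (\<forall>j<r. f j \<in> ker)"
proof -
  interpret T: tensor R "Fr r \<delta>" E by (rule tensor_free)
  interpret s: module_map R "free_tensor M r \<delta>" "Tn r \<delta>" "free_sum R r \<delta> E q" by (rule map_free_sum)
  let ?P = "prod_module {..<r} (\<lambda>_::nat. E)"
  have P: "module R ?P" by (rule module_prod) (rule q.N.module_axioms')
  have fc: "f j \<in> carrier M" for j using f unfolding free_tensor_carrier by (cases "j < r") auto
  let ?g = "\<lambda>(a, b) j. if j < r then a j \<odot>\<^bsub>E\<^esub> b else \<zero>\<^bsub>E\<^esub>"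
  have c: "a j \<in> carrier R" if "a \<in> carrier (Fr r \<delta>)" for a j
    using that unfolding M.graded_free_carrier by (simp add: free_module_carrier)
  have "T.bilinear ?P ?g" unfolding T.bilinear_def linear_map_def
    using c by (auto simp: prod_module_carrier fun_eq_iff graded_free_def q.N.smult_l_distr q.N.smult_assoc1
      q.N.smult_r_distr q.N.smult_left_commute)
  note e = T.extend[OF P this]
  have lin_q: "linear_map R (free_tensor M r \<delta>) ?P (\<lambda>f j. if j < r then q (f j) else \<zero>\<^bsub>E\<^esub>)"
    unfolding linear_map_def by (auto simp: prod_module_carrier fun_eq_iff q.add q.smult)
  have "T.extend ?P ?g (free_sum R r \<delta> E q f) = (\<lambda>j. if j < r then q (f j) else \<zero>\<^bsub>E\<^esub>)"
  proof (rule linear_eq_on_prod[OF _ _ P linear_comp[OF linear_free_sum e(1)] lin_q _ f])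
    show "module R (shift_module (\<delta> s) M)" for s by (rule module_shift_module[OF M.module_axioms'])
    fix j x assume "j \<in> {..<r}" and x: "x \<in> carrier (shift_module (\<delta> j) M)"
    then have j: "j < r" and x: "x \<in> carrier M" by auto
    show "T.extend ?P ?g (free_sum R r \<delta> E q (single (\<lambda>s. shift_module (\<delta> s) M) j x)) =
      (\<lambda>i. if i < r then q (single (\<lambda>s. shift_module (\<delta> s) M) j x i) else \<zero>\<^bsub>E\<^esub>)"
      unfolding free_sum_single[OF j x] e(2)[OF unit_vec_free[OF j] q.closed[OF x]]
      using x q.closed[OF x] by (auto simp: fun_eq_iff unit_vec_def single_def)
  qed simp
  moreover have "T.extend ?P ?g \<zero>\<^bsub>Tn r \<delta>\<^esub> = \<zero>\<^bsub>?P\<^esub>"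
    using module_map.zero[OF module_map.intro[OF T.module_tensor P module_map_axioms.intro[OF e(1)]]] .
  ultimately have 1: "\<forall>j<r. f j \<in> ker" if "free_sum R r \<delta> E q f = \<zero>\<^bsub>Tn r \<delta>\<^esub>"
    using that fc unfolding ker_def by (auto simp: fun_eq_iff split: if_splits)
  have z: "T.pt (unit_vec R i) \<zero>\<^bsub>E\<^esub> = \<zero>\<^bsub>T.TT\<^esub>" if "i < r" for i
    using T.pure_tensor_smult_right[OF M.R.zero_closed unit_vec_free[OF that] q.N.M.zero_closed] unit_vec_free[OF that]
    by simp
  have 2: "free_sum R r \<delta> E q f = \<zero>\<^bsub>Tn r \<delta>\<^esub>" if "\<forall>j<r. f j \<in> ker"
  proof -
    have "free_sum R r \<delta> E q f = (\<Oplus>\<^bsub>T.TT\<^esub>j\<in>{..<r}. \<zero>\<^bsub>T.TT\<^esub>)"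
      unfolding free_sum_def sum_map_def by (rule T.TT.M.finsum_cong') (use that z in \<open>auto simp: ker_def\<close>)
    then show ?thesis by simp
  qed
  show ?thesis using 1 2 by blast
qed

lemma proj_graded_free_tensor:
  "proj_graded R (free_tensor M r \<delta>) (prod_proj {..<r} (\<lambda>s. shift_module (\<delta> s) M) (\<lambda>s e. \<pi> (e - \<delta> s)))"
  by (rule proj_graded_prod) (auto intro: proj_graded_shift M.proj_graded_axioms)

lemma free_tensor_grade:
  "f \<in> grade (free_tensor M r \<delta>) n \<longleftrightarrow> f \<in> carrier (free_tensor M r \<delta>) \<and> (\<forall>j<r. f j \<in> grade M (n - \<delta> j))"
  by (auto simp: prod_module_grade)

lemma unit_vec_grade:
  assumes "j < r"
  shows "unit_vec R j \<in> grade (Fr r \<delta>) (\<delta> j)"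
proof -
  interpret S: proj_graded R "self_module R" M.ring_proj by (rule M.proj_graded_self)
  \<comment> \<open>That the unit has degree zero is derived: its component \<open>u\<close> of
    degree zero satisfies \<open>b u = b\<close> for homogeneous \<open>b\<close>, hence for all
    \<open>b\<close>, and \<open>b = \<one>\<close> gives \<open>u = \<one>\<close>.\<close>
  have one: "\<one> \<in> grade (self_module R) 0"
  proof -
    let ?u = "M.ring_proj 0 \<one>"
    have uc: "?u \<in> carrier R" using S.proj_closed by simp
    have "\<one> \<in> {b \<in> carrier R. b \<otimes> ?u = b}"
    proof (rule M.ring_homogeneous_induct)
      fix j
      show "rgrade R j \<subseteq> {b \<in> carrier R. b \<otimes> ?u = b}"
      proof
        fix b assume b: "b \<in> rgrade R j"
        have bc: "b \<in> carrier R" using M.rgrade_carrier[OF b] .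
        have "M.ring_proj (int j) b = b" using S.grade_iff[of b "int j"] b by (simp add: self_module_def)
        then show "b \<in> {b \<in> carrier R. b \<otimes> ?u = b}" using S.proj_smult[OF b, of \<one> 0] bc by simp
      qed
    qed (use uc in \<open>auto simp: M.R.l_distr\<close>)
    then have "?u = \<one>" using uc by simp
    then show ?thesis using S.grade_iff by simp
  qed
  show ?thesis unfolding M.free_grade[OF finite_lessThan]
    using unit_vec_free[OF assms] one S.grade_zero by (auto simp: unit_vec_def)
qed

end

section \<open>Tor of a graded quotient\<close>

text \<open>For \<open>k = 0\<close> the differential goes to the zero module, encoded as a power of
  rank zero. The cycle condition is then vacuous and degree zero needs no argument of its own
  later.\<close>

definition tgt_rank :: "('a, 'l) free_complex \<Rightarrow> nat \<Rightarrow> nat" where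
  "tgt_rank F k = (case k of 0 \<Rightarrow> 0 | Suc i \<Rightarrow> rank F i)"

definition tgt_shift :: "('a, 'l) free_complex \<Rightarrow> nat \<Rightarrow> nat \<Rightarrow> int" where
  "tgt_shift F k = (case k of 0 \<Rightarrow> (\<lambda>_. 0) | Suc i \<Rightarrow> shift F i)"

definition bd :: "'a graded_ring \<Rightarrow> ('a, 'b) graded_module \<Rightarrow> ('a, 'l) free_complex \<Rightarrow> nat \<Rightarrow> (nat \<Rightarrow> 'b) \<Rightarrow> nat \<Rightarrow> 'b" where
  "bd R M F k = (case k of 0 \<Rightarrow> (\<lambda>_ _. \<zero>\<^bsub>M\<^esub>) | Suc i \<Rightarrow>
     sum_map (free_tensor M (rank F i) (shift F i)) (rank F (Suc i))
       (\<lambda>j. spread M (rank F i) (diff F i (unit_vec R j))))"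

abbreviation chain :: "('a, 'b) graded_module \<Rightarrow> ('a, 'l) free_complex \<Rightarrow> nat \<Rightarrow> ('a, nat \<Rightarrow> 'b) graded_module" where
  "chain M F k \<equiv> free_tensor M (rank F k) (shift F k)"

abbreviation tgt :: "('a, 'b) graded_module \<Rightarrow> ('a, 'l) free_complex \<Rightarrow> nat \<Rightarrow> ('a, nat \<Rightarrow> 'b) graded_module" where
  "tgt M F k \<equiv> free_tensor M (tgt_rank F k) (tgt_shift F k)"

text \<open>The power \<open>K^r\<close> inside \<open>M^r\<close>, with coordinates beyond
  \<open>r\<close> equal to zero; not the set of subsets.\<close>

definition power_set :: "('a, 'b) graded_module \<Rightarrow> nat \<Rightarrow> 'b set \<Rightarrow> (nat \<Rightarrow> 'b) set" where
  "power_set M r K = {f. (\<forall>s<r. f s \<in> K) \<and> (\<forall>s\<ge>r. f s = \<zero>\<^bsub>M\<^esub>)}"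

lemma submodule_power_set:
  fixes M :: "('a, 'b) graded_module"
  assumes "module R M" "submodule K R M"
  shows "submodule (power_set M r K) R (free_tensor M r \<delta>)"
proof -
  interpret M: module R M by fact
  interpret P: module R "free_tensor M r \<delta>" by (rule module_prod) (rule module_shift_module[OF assms(1)])
  note K = assms(2)
  show ?thesis unfolding P.submodule_iff
    using M.submodule_zero[OF K] M.submodule_add[OF K] M.submodule_smult[OF K] M.submodule_carrier[OF K]
    by (auto simp: power_set_def prod_module_carrier)
qed

section \<open>The homology of the tensored resolution, computed inside powers of the module\<close>

locale resolved_quotient = graded_quotient R M \<pi> E q
  for R :: "'a graded_ring" (structure) and M :: "('a, 'b) graded_module" and \<pi>
    and E :: "('a, 'e) graded_module" and q +
  fixes L :: "('a, 'l) graded_module" and F :: "('a, 'l) free_complex"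
  assumes res: "graded_free_resolution R L F"
begin

lemma diff_hom: "diff F i \<in> graded_hom R (Fr (rank F (Suc i)) (shift F (Suc i))) (Fr (rank F i) (shift F i))"
  using res unfolding graded_free_resolution_def res_term_def by blast

lemma diff_linear: "linear_map R (Fr (rank F (Suc i)) (shift F (Suc i))) (Fr (rank F i) (shift F i)) (diff F i)"
  using graded_hom_linear[OF diff_hom] .

lemma diff_diff:
  assumes "a \<in> carrier (Fr (rank F (Suc (Suc i))) (shift F (Suc (Suc i))))"
  shows "diff F i (diff F (Suc i) a) = \<zero>\<^bsub>Fr (rank F i) (shift F i)\<^esub>"
proof -
  have "diff F (Suc i) a \<in> a_kernel (res_term R F (Suc i)) (res_term R F i) (diff F i)"
    using res assms unfolding graded_free_resolution_def by (metis imageI res_term_def)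
  then show ?thesis by (simp add: a_kernel_def kernel_def res_term_def)
qed

lemma diff_unit_vec: "j < rank F (Suc i) \<Longrightarrow> diff F i (unit_vec R j) \<in> carrier (Fr (rank F i) (shift F i))"
  using diff_linear unit_vec_free unfolding linear_map_def by blast

lemma linear_spread_diff:
  "j < rank F (Suc i) \<Longrightarrow> linear_map R M (free_tensor M (rank F i) \<delta>) (spread M (rank F i) (diff F i (unit_vec R j)))"
  using linear_spread(2)[OF diff_unit_vec] by blast

lemma linear_bd: "linear_map R (chain M F k) (tgt M F k) (bd R M F k)"
proof (cases k)
  case 0
  then show ?thesis
    by (auto simp: linear_map_def bd_def tgt_rank_def prod_module_carrier fun_eq_iff)
next
  case (Suc i)
  then show ?thesis unfolding bd_def tgt_rank_def tgt_shift_def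
    using linear_sum_map[OF M.module_axioms' module_free_tensor linear_spread_diff] by simp
qed

lemma map_bd: "module_map R (chain M F k) (tgt M F k) (bd R M F k)"
  by (intro module_map.intro module_map_axioms.intro module_free_tensor linear_bd)

text \<open>The image of the \<open>j\<close>-th basis vector has degree \<open>shift F k j\<close>,
  so its \<open>s\<close>-th entry raises degrees by \<open>shift F k j - shift F i s\<close>,
  exactly the difference of the two shifts.\<close>

lemma bd_grade:
  assumes x: "x \<in> grade (chain M F k) n"
  shows "bd R M F k x \<in> grade (tgt M F k) n"
proof (cases k)
  case 0
  then show ?thesis unfolding free_tensor_grade free_tensor_carrier by (simp add: bd_def tgt_rank_def)
next
  case (Suc i)
  interpret T: proj_graded R "chain M F i" "prod_proj {..<rank F i} (\<lambda>s. shift_module (shift F i s) M) (\<lambda>s e. \<pi> (e - shift F i s))"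
    by (rule proj_graded_free_tensor)
  interpret S: proj_graded R "self_module R" M.ring_proj by (rule M.proj_graded_self)
  have "sum_map (chain M F i) (rank F (Suc i)) (\<lambda>j. spread M (rank F i) (diff F i (unit_vec R j))) x \<in> grade (chain M F i) n"
    unfolding sum_map_def
  proof (rule T.grade_finsum)
    fix j assume "j \<in> {..<rank F (Suc i)}"
    then have j: "j < rank F (Suc i)" by simp
    have xj: "x j \<in> grade M (n - shift F k j)" using x j unfolding Suc free_tensor_grade by blast
    have "diff F i (unit_vec R j) \<in> grade (Fr (rank F i) (shift F i)) (shift F k j)"
      using diff_hom[of i] unit_vec_grade[OF j, of "shift F k"] unfolding graded_hom_def Suc by blast
    then have d: "diff F i (unit_vec R j) s \<in> grade (self_module R) (shift F k j - shift F i s)" if "s < rank F i" for s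
      using M.free_grade[OF finite_lessThan] that by blast
    have "spread M (rank F i) (diff F i (unit_vec R j)) (x j) s \<in> grade M (n - shift F i s)" if "s < rank F i" for s
      using M.smult_grade_self[OF d[OF that] xj] that unfolding spread_def by simp
    moreover have "spread M (rank F i) (diff F i (unit_vec R j)) (x j) \<in> carrier (chain M F i)"
      using spread_closed[OF diff_unit_vec[OF j]] M.grade_carrier[OF xj] by blast
    ultimately show "spread M (rank F i) (diff F i (unit_vec R j)) (x j) \<in> grade (chain M F i) n"
      unfolding free_tensor_grade by blast
  qed
  then show ?thesis by (simp add: bd_def Suc tgt_rank_def tgt_shift_def)
qed

abbreviation "fs k \<equiv> free_sum R (rank F k) (shift F k) E q"
abbreviation "Ck k \<equiv> tensor_module R (res_term R F k) E"
abbreviation "dk i \<equiv> tensor_map R (res_term R F (Suc i)) (res_term R F i) E (diff F i)"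

lemma Ck_eq: "Ck k = Tn (rank F k) (shift F k)"
  by (simp add: res_term_def)

lemma map_fs: "module_map R (chain M F k) (Ck k) (fs k)"
  unfolding Ck_eq by (rule map_free_sum)

lemma fs_surj: "fs k ` carrier (chain M F k) = carrier (Ck k)"
  unfolding Ck_eq by (rule free_sum_surj)

lemma fs_kernel: "f \<in> carrier (chain M F k) \<Longrightarrow> fs k f = \<zero>\<^bsub>Ck k\<^esub> \<longleftrightarrow> f \<in> power_set M (rank F k) ker"
  using free_sum_kernel[of f "rank F k" "shift F k"] unfolding Ck_eq free_tensor_carrier power_set_def by simp

lemmas tensor_map_diff = tensor_map[OF M.module_graded_free M.module_graded_free q.N.module_axioms' diff_linear]

lemma linear_dk: "linear_map R (Ck (Suc i)) (Ck i) (dk i)"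
  unfolding res_term_def by (rule tensor_map_diff(1))

lemma dk_pure: "a \<in> carrier (res_term R F (Suc i)) \<Longrightarrow> b \<in> carrier E \<Longrightarrow>
    dk i (pure_tensor R (res_term R F (Suc i)) E a b) = pure_tensor R (res_term R F i) E (diff F i a) b"
  unfolding res_term_def by (rule tensor_map_diff(2))

text \<open>By linearity it suffices to take a vector with one nonzero coordinate \<open>m\<close>,
  where both paths give the tensor of the differential of a basis vector with
  \<open>q m\<close>.\<close>

lemma dk_fs:
  assumes x: "x \<in> carrier (chain M F (Suc i))"
  shows "dk i (fs (Suc i) x) = fs i (bd R M F (Suc i) x)"
proof (rule linear_eq_on_prod[OF _ _ module_Tn _ _ _ x])
  show "module R (shift_module (shift F (Suc i) s) M)" for s by (rule module_shift_module[OF M.module_axioms'])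
  show "linear_map R (chain M F (Suc i)) (Tn (rank F i) (shift F i)) (\<lambda>x. dk i (fs (Suc i) x))"
    using linear_comp[OF linear_free_sum linear_dk[unfolded Ck_eq]] .
  have "linear_map R (chain M F (Suc i)) (chain M F i) (bd R M F (Suc i))"
    using linear_bd[of "Suc i"] by (simp add: tgt_rank_def tgt_shift_def)
  then show "linear_map R (chain M F (Suc i)) (Tn (rank F i) (shift F i)) (\<lambda>x. fs i (bd R M F (Suc i) x))"
    using linear_comp[OF _ linear_free_sum] by blast
  fix j m assume "j \<in> {..<rank F (Suc i)}" and m: "m \<in> carrier (shift_module (shift F (Suc i) j) M)"
  then have j: "j < rank F (Suc i)" and m: "m \<in> carrier M" by auto
  have "dk i (fs (Suc i) (single (\<lambda>s. shift_module (shift F (Suc i) s) M) j m)) =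
    pure_tensor R (Fr (rank F i) (shift F i)) E (diff F i (unit_vec R j)) (q m)"
    unfolding free_sum_single[OF j m]
    using dk_pure[OF _ q.closed[OF m], of "unit_vec R j" i] unit_vec_free[OF j] unfolding res_term_def by blast
  also have "\<dots> = fs i (spread M (rank F i) (diff F i (unit_vec R j)) m)"
    by (rule pure_tensor_eq_free_sum[OF diff_unit_vec[OF j] m])
  also have "spread M (rank F i) (diff F i (unit_vec R j)) m = bd R M F (Suc i) (single (\<lambda>s. shift_module (shift F (Suc i) s) M) j m)"
    unfolding bd_def nat.case
    by (rule sum_map_single[OF M.module_axioms' module_free_tensor linear_spread_diff j m, symmetric])
  finally show "dk i (fs (Suc i) (single (\<lambda>s. shift_module (shift F (Suc i) s) M) j m)) =
    fs i (bd R M F (Suc i) (single (\<lambda>s. shift_module (shift F (Suc i) s) M) j m))" .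
qed simp

lemma dk_dk:
  assumes x: "x \<in> carrier (Ck (Suc (Suc i)))"
  shows "dk i (dk (Suc i) x) = \<zero>\<^bsub>Ck i\<^esub>"
proof -
  interpret T: tensor R "res_term R F (Suc (Suc i))" E unfolding res_term_def by (rule tensor_free)
  interpret T0: tensor R "res_term R F i" E unfolding res_term_def by (rule tensor_free)
  have "linear_map R (Ck (Suc (Suc i))) (Ck i) (\<lambda>x. \<zero>\<^bsub>Ck i\<^esub>)"
    by (auto simp: linear_map_def)
  note eq = T.TT.submodule_equalizer[OF T0.module_tensor linear_comp[OF linear_dk[of "Suc i"] linear_dk[of i]] this]
  have "x \<in> {x \<in> carrier (Ck (Suc (Suc i))). dk i (dk (Suc i) x) = \<zero>\<^bsub>Ck i\<^esub>}"
  proof (rule T.tensor_induct[OF eq _ x])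
    fix a b assume a: "a \<in> carrier (res_term R F (Suc (Suc i)))" and b: "b \<in> carrier E"
    have d: "diff F (Suc i) a \<in> carrier (res_term R F (Suc i))"
      using a diff_linear[of "Suc i"] unfolding linear_map_def res_term_def by blast
    have "pure_tensor R (res_term R F i) E \<zero>\<^bsub>res_term R F i\<^esub> b = \<zero>\<^bsub>Ck i\<^esub>"
      using T0.pure_tensor_smult_left[OF M.R.zero_closed T0.A.M.zero_closed b] T0.pure_tensor_closed[OF T0.A.M.zero_closed b] by simp
    moreover have "diff F i (diff F (Suc i) a) = \<zero>\<^bsub>res_term R F i\<^esub>"
      using diff_diff a unfolding res_term_def by blast
    ultimately show "pure_tensor R (res_term R F (Suc (Suc i))) E a b \<in> {x \<in> carrier (Ck (Suc (Suc i))). dk i (dk (Suc i) x) = \<zero>\<^bsub>Ck i\<^esub>}"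
      using dk_pure[OF a b] dk_pure[OF d b] T.pure_tensor_closed[OF a b] by simp
  qed
  then show ?thesis by blast
qed

text \<open>The spread of homogeneous \<open>a\<close> and \<open>m\<close> is homogeneous of the
  total degree. Conversely each summand of \<open>fs k f\<close> is a pure tensor of a basis vector
  and a homogeneous element, with degrees adding up to \<open>n\<close>.\<close>

lemma tensor_grade_eq: "grade (tensor_graded R (res_term R F k) E) n = fs k ` grade (chain M F k) n"
proof -
  let ?r = "rank F k" and ?\<delta> = "shift F k"
  interpret T: tensor R "Fr ?r ?\<delta>" E by (rule tensor_free)
  interpret G: proj_graded R "chain M F k" "prod_proj {..<?r} (\<lambda>s. shift_module (?\<delta> s) M) (\<lambda>s e. \<pi> (e - ?\<delta> s))"
    by (rule proj_graded_free_tensor)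
  interpret s: module_map R "chain M F k" T.TT "fs k" by (rule map_free_sum)
  let ?G = "{pure_tensor R (Fr ?r ?\<delta>) E a b | a b i j. a \<in> grade (Fr ?r ?\<delta>) i \<and> b \<in> grade E j \<and> i + j = n}"
  have "?G \<subseteq> fs k ` grade (chain M F k) n"
  proof
    fix x assume "x \<in> ?G"
    then obtain a b i j where x: "x = pure_tensor R (Fr ?r ?\<delta>) E a b" "a \<in> grade (Fr ?r ?\<delta>) i" "b \<in> grade E j" "i + j = n" by blast
    obtain m where m: "m \<in> grade M j" "b = q m" using x(3) grade_image by blast
    have mc: "m \<in> carrier M" using M.grade_carrier[OF m(1)] .
    have ac: "a \<in> carrier (Fr ?r ?\<delta>)" and ag: "\<And>s. s < ?r \<Longrightarrow> a s \<in> grade (self_module R) (i - ?\<delta> s)"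
      using x(2) M.free_grade[OF finite_lessThan] by blast+
    have "spread M ?r a m \<in> grade (chain M F k) n"
      unfolding free_tensor_grade using spread_closed[OF ac mc] M.smult_grade_self[OF ag m(1)] x(4)
      by (auto simp: spread_def algebra_simps)
    then show "x \<in> fs k ` grade (chain M F k) n" using pure_tensor_eq_free_sum[OF ac mc] x(1) m(2) by blast
  qed
  moreover have "subgroup (fs k ` grade (chain M F k) n) (add_monoid T.TT)"
  proof (rule T.TT.M.add.subgroupI)
    show "fs k ` grade (chain M F k) n \<subseteq> carrier T.TT" using G.grade_carrier s.closed by blast
    show "fs k ` grade (chain M F k) n \<noteq> {}" using G.grade_zero by blast
    fix u assume "u \<in> fs k ` grade (chain M F k) n"
    then obtain f where f: "f \<in> grade (chain M F k) n" "u = fs k f" by blast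
    have "\<ominus>\<^bsub>chain M F k\<^esub> f \<in> grade (chain M F k) n" using f(1) G.proj_uminus unfolding G.grade_iff by simp
    then show "\<ominus>\<^bsub>T.TT\<^esub> u \<in> fs k ` grade (chain M F k) n"
      unfolding f(2) s.uminus[OF G.grade_carrier[OF f(1)], symmetric] by (rule imageI)
    fix v assume "v \<in> fs k ` grade (chain M F k) n"
    then obtain g where g: "g \<in> grade (chain M F k) n" "v = fs k g" by blast
    show "u \<oplus>\<^bsub>T.TT\<^esub> v \<in> fs k ` grade (chain M F k) n"
      unfolding f(2) g(2) s.add[OF G.grade_carrier[OF f(1)] G.grade_carrier[OF g(1)], symmetric]
      by (rule imageI[OF G.grade_add[OF f(1) g(1)]])
  qed
  ultimately have 1: "generate (add_monoid T.TT) ?G \<subseteq> fs k ` grade (chain M F k) n"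
    using T.TT.M.add.generate_subgroup_incl by blast
  have Gc: "?G \<subseteq> carrier T.TT"
  proof (rule subsetI, elim CollectE exE conjE)
    fix x a b i j
    assume x: "x = pure_tensor R (Fr ?r ?\<delta>) E a b" "a \<in> grade (Fr ?r ?\<delta>) i" "b \<in> grade E j"
    have "q ` grade M j \<subseteq> carrier E" using M.grade_carrier q.closed by (intro image_subsetI) simp
    then have b: "b \<in> carrier E" using x(3) grade_image[of j] by auto
    have a: "a \<in> carrier (Fr ?r ?\<delta>)" using x(2) M.free_grade[OF finite_lessThan] by blast
    show "x \<in> carrier T.TT" unfolding x(1) by (rule T.pure_tensor_closed[OF a b])
  qed
  have 2: "fs k f \<in> generate (add_monoid T.TT) ?G" if f: "f \<in> grade (chain M F k) n" for f
    unfolding free_sum_def sum_map_def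
  proof (rule T.TT.M.finsum_in_subset)
    show "generate (add_monoid T.TT) ?G \<subseteq> carrier T.TT" using T.TT.M.add.generate_incl[of ?G] Gc by simp
    show "\<zero>\<^bsub>T.TT\<^esub> \<in> generate (add_monoid T.TT) ?G" using generate.one[of "add_monoid T.TT"] by simp
    show "u \<oplus>\<^bsub>T.TT\<^esub> v \<in> generate (add_monoid T.TT) ?G"
      if "u \<in> generate (add_monoid T.TT) ?G" "v \<in> generate (add_monoid T.TT) ?G" for u v
      using generate.eng[OF that] by simp
    fix j assume "j \<in> {..<?r}"
    then have j: "j < ?r" by simp
    have "q (f j) \<in> grade E (n - ?\<delta> j)" using f j grade_image unfolding free_tensor_grade by blast
    then have "T.pt (unit_vec R j) (q (f j)) \<in> ?G" using unit_vec_grade[OF j, of ?\<delta>] by force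
    then show "T.pt (unit_vec R j) (q (f j)) \<in> generate (add_monoid T.TT) ?G" by (rule generate.incl)
  qed
  have "grade (tensor_graded R (res_term R F k) E) n = generate (add_monoid T.TT) ?G"
    by (simp add: tensor_graded_def res_term_def)
  also have "\<dots> = fs k ` grade (chain M F k) n" using 1 2 by blast
  finally show ?thesis .
qed

text \<open>\<open>cyc\<close> and \<open>bnd_ker\<close> are the preimages in \<open>M^r\<close> of
  the cycles and boundaries of \<open>F \<otimes> E\<close>. The quotient \<open>E\<close> enters
  only through \<open>ker\<close>, while \<open>bnd\<close> depends on \<open>M\<close> alone; this
  is why all \<open>n\<close> share one \<open>B\<close>.\<close>

definition "cyc k = {z \<in> carrier (chain M F k). bd R M F k z \<in> power_set M (tgt_rank F k) ker}"
definition "bnd k = bd R M F (Suc k) ` carrier (chain M F (Suc k))"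
definition "bnd_ker k = bnd k <+>\<^bsub>chain M F k\<^esub> power_set M (rank F k) ker"

definition "Zt k = (case k of 0 \<Rightarrow> carrier (tensor_graded R (res_term R F 0) E) 
  | Suc i \<Rightarrow> a_kernel (tensor_graded R (res_term R F (Suc i)) E) (tensor_graded R (res_term R F i) E) (dk i))"
definition "Bt k = dk k ` carrier (tensor_graded R (res_term R F (Suc k)) E)"

lemma tensor_graded_simps: "carrier (tensor_graded R (res_term R F k) E) = carrier (Ck k)"
  by (simp add: tensor_graded_def)

lemma bd_closed: "x \<in> carrier (chain M F k) \<Longrightarrow> bd R M F k x \<in> carrier (tgt M F k)"
  using linear_bd unfolding linear_map_def by blast

lemma fs_in_Zt: "x \<in> carrier (chain M F k) \<Longrightarrow> fs k x \<in> Zt k \<longleftrightarrow> x \<in> cyc k"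
proof (cases k)
  case 0
  assume x: "x \<in> carrier (chain M F k)"
  have "fs 0 x \<in> carrier (Ck 0)" using x fs_surj 0 by blast
  then show ?thesis using x unfolding Zt_def cyc_def 0 tensor_graded_simps by (simp add: bd_def tgt_rank_def power_set_def)
next
  case (Suc i)
  assume x: "x \<in> carrier (chain M F k)"
  have xc: "fs (Suc i) x \<in> carrier (Ck (Suc i))" using x fs_surj Suc by blast
  have bc: "bd R M F (Suc i) x \<in> carrier (chain M F i)"
    using bd_closed[of x "Suc i"] x Suc by (simp add: tgt_rank_def tgt_shift_def)
  have "fs (Suc i) x \<in> Zt (Suc i) \<longleftrightarrow> dk i (fs (Suc i) x) = \<zero>\<^bsub>Ck i\<^esub>"
    using xc by (simp add: Zt_def a_kernel_def kernel_def tensor_graded_def)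
  also have "\<dots> \<longleftrightarrow> bd R M F (Suc i) x \<in> power_set M (rank F i) ker"
    using dk_fs[of x i] x Suc fs_kernel[OF bc] by simp
  finally show ?thesis using x unfolding Suc cyc_def by (simp add: tgt_rank_def)
qed

lemma Zt_eq: "Zt k = fs k ` cyc k"
proof -
  have "Zt k \<subseteq> carrier (Ck k)"
    by (cases k) (auto simp: Zt_def a_kernel_def kernel_def tensor_graded_simps)
  then have "\<exists>x\<in>carrier (chain M F k). z = fs k x" if "z \<in> Zt k" for z using that fs_surj by blast
  then show ?thesis using fs_in_Zt unfolding cyc_def by blast
qed

lemma bd_Suc_closed: "x \<in> carrier (chain M F (Suc k)) \<Longrightarrow> bd R M F (Suc k) x \<in> carrier (chain M F k)"
  using bd_closed[of x "Suc k"] by (simp add: tgt_rank_def tgt_shift_def)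

lemma Bt_eq: "Bt k = fs k ` bnd k"
proof -
  have "Bt k = dk k ` (fs (Suc k) ` carrier (chain M F (Suc k)))"
    unfolding Bt_def tensor_graded_simps fs_surj ..
  also have "\<dots> = fs k ` bnd k" unfolding bnd_def image_image using dk_fs by (intro image_cong) auto
  finally show ?thesis .
qed

text \<open>Composed differentials vanish on \<open>F \<otimes> E\<close>, and this is pulled back
  along \<open>fs\<close>. For zero \<open>ker\<close> it says that composed differentials vanish on
  powers of \<open>M\<close>.\<close>

lemma bnd_cyc: "bnd k \<subseteq> cyc k"
proof
  fix b assume "b \<in> bnd k"
  then obtain x where x: "x \<in> carrier (chain M F (Suc k))" "b = bd R M F (Suc k) x" unfolding bnd_def by blast
  have bc: "b \<in> carrier (chain M F k)" using bd_Suc_closed x by blast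
  have "fs k b \<in> Zt k"
  proof (cases k)
    case 0
    then show ?thesis using bc fs_surj unfolding Zt_def tensor_graded_simps by auto
  next
    case (Suc i)
    have xc: "fs (Suc k) x \<in> carrier (Ck (Suc k))" using x(1) fs_surj by blast
    have "fs k b = dk k (fs (Suc k) x)" using dk_fs[OF x(1)] x(2) by simp
    moreover have "dk i (dk (Suc i) (fs (Suc k) x)) = \<zero>\<^bsub>Ck i\<^esub>" using dk_dk xc Suc by blast
    moreover have "fs k b \<in> carrier (Ck k)" using bc fs_surj by blast
    ultimately show ?thesis unfolding Suc by (simp add: Zt_def a_kernel_def kernel_def tensor_graded_def)
  qed
  then show "b \<in> cyc k" using fs_in_Zt[OF bc] by blast
qed

lemma submodule_bnd: "submodule (bnd k) R (chain M F k)"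
proof -
  interpret b: module_map R "chain M F (Suc k)" "chain M F k" "bd R M F (Suc k)"
    using map_bd[of "Suc k"] by (simp add: tgt_rank_def tgt_shift_def)
  show ?thesis unfolding bnd_def by (rule b.submodule_image[OF b.M.carrier_is_submodule])
qed

lemma submodule_cyc: "submodule (cyc k) R (chain M F k)"
proof -
  interpret b: module_map R "chain M F k" "tgt M F k" "bd R M F k" by (rule map_bd)
  show ?thesis unfolding cyc_def by (rule b.submodule_preimage[OF submodule_power_set[OF M.module_axioms' submodule_ker]])
qed

text \<open>Two vectors have the same image in \<open>F \<otimes> E\<close> when they differ by a
  vector over \<open>ker\<close>, which accounts for the second summand of
  \<open>bnd_ker\<close>.\<close>

lemma fs_in_Bt:
  assumes x: "x \<in> carrier (chain M F k)"
  shows "fs k x \<in> Bt k \<longleftrightarrow> x \<in> bnd_ker k"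
proof -
  interpret s: module_map R "chain M F k" "Ck k" "fs k" by (rule map_fs)
  have bc: "b \<in> carrier (chain M F k)" if "b \<in> bnd k" for b using s.M.submodule_carrier[OF submodule_bnd that] .
  note pw = submodule_power_set[OF M.module_axioms' submodule_ker, of "rank F k" "shift F k"]
  show ?thesis
  proof
    assume "fs k x \<in> Bt k"
    then obtain b where b: "b \<in> bnd k" "fs k x = fs k b" unfolding Bt_eq by blast
    have "fs k (x \<ominus>\<^bsub>chain M F k\<^esub> b) = \<zero>\<^bsub>Ck k\<^esub>"
      unfolding s.minus[OF x bc[OF b(1)]] b(2) using s.closed[OF bc[OF b(1)]] by (simp add: s.N.M.minus_eq s.N.M.r_neg)
    then have "x \<ominus>\<^bsub>chain M F k\<^esub> b \<in> power_set M (rank F k) ker"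
      using fs_kernel[OF s.M.M.minus_closed[OF x bc[OF b(1)]]] by blast
    moreover have "x = b \<oplus>\<^bsub>chain M F k\<^esub> (x \<ominus>\<^bsub>chain M F k\<^esub> b)"
      using s.M.minus_add_cancel[OF x bc[OF b(1)]] s.M.M.a_comm[OF bc[OF b(1)] s.M.M.minus_closed[OF x bc[OF b(1)]]] by metis
    ultimately show "x \<in> bnd_ker k" unfolding bnd_ker_def in_set_add using b(1) by blast
  next
    assume "x \<in> bnd_ker k"
    then obtain b w where bw: "b \<in> bnd k" "w \<in> power_set M (rank F k) ker" "x = b \<oplus>\<^bsub>chain M F k\<^esub> w"
      unfolding bnd_ker_def in_set_add by blast
    have wc: "w \<in> carrier (chain M F k)" using s.M.submodule_carrier[OF pw bw(2)] .
    have "fs k x = fs k b" unfolding bw(3) s.add[OF bc[OF bw(1)] wc]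
      using fs_kernel[OF wc] bw(2) s.closed[OF bc[OF bw(1)]] by simp
    then show "fs k x \<in> Bt k" unfolding Bt_eq using bw(1) by blast
  qed
qed

abbreviation "Sk k \<equiv> sub_graded (tensor_graded R (res_term R F k) E) (Zt k)"

lemma Sk_simps: "carrier (Sk k) = Zt k" "\<zero>\<^bsub>Sk k\<^esub> = \<zero>\<^bsub>Ck k\<^esub>" "add (Sk k) = add (Ck k)" "smult (Sk k) = smult (Ck k)"
  "grade (Sk k) n = grade (tensor_graded R (res_term R F k) E) n \<inter> Zt k"
  by (simp_all add: sub_graded_def tensor_graded_def)

lemma submodule_Zt: "submodule (Zt k) R (Ck k)"
  unfolding Zt_eq by (rule module_map.submodule_image[OF map_fs submodule_cyc])

lemma module_Sk: "module R (Sk k)"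
proof -
  have "module R ((Ck k)\<lparr>carrier := Zt k\<rparr>)"
    using submodule.submodule_is_module[OF submodule_Zt] module_Tn unfolding Ck_eq by blast
  then show ?thesis by (rule module_cong) (simp_all add: Sk_simps)
qed

lemma submodule_Bt: "submodule (Bt k) R (Sk k)"
proof -
  have B: "submodule (Bt k) R (Ck k)"
    unfolding Bt_eq by (rule module_map.submodule_image[OF map_fs submodule_bnd])
  have "module R (Ck k)" unfolding Ck_eq by (rule module_Tn)
  moreover have "Bt k \<subseteq> Zt k" unfolding Bt_eq Zt_eq using bnd_cyc by blast
  ultimately show ?thesis
    using B unfolding module.submodule_iff[OF module_Sk] Sk_simps by (simp add: module.submodule_iff)
qed

end

locale tor_quotient = resolved_quotient R M \<pi> E q L "some_resolution R L"
  for R :: "'a graded_ring" (structure) and M :: "('a, 'b) graded_module" and \<pi>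
    and E :: "('a, 'e) graded_module" and q and L :: "('a, 'l) graded_module"
begin

abbreviation "F \<equiv> some_resolution R L"

lemma Tor_eq: "Tor R k L E = quot_graded (Sk k) (Bt k)"
  by (cases k) (simp_all add: Tor_def Let_def Zt_def Bt_def)

text \<open>Scalars act on representatives, and a class is zero exactly when its representative is
  in \<open>bnd_ker\<close>. Annihilators in \<open>Tor\<close> thereby become colon ideals in
  \<open>M^r\<close>, the language of the asymptotic part.\<close>

lemma annihilator_coset:
  assumes z: "z \<in> cyc k"
  shows "annihilator R (Tor R k L E) (Bt k +>\<^bsub>Sk k\<^esub> fs k z) = module.colon R (chain M F k) (bnd_ker k) z"
proof -
  interpret S: module R "Sk k" by (rule module_Sk)
  interpret s: module_map R "chain M F k" "Ck k" "fs k" by (rule map_fs)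
  note Q = S.quot_module[OF submodule_Bt]
  have zc: "z \<in> carrier (chain M F k)" using z unfolding cyc_def by blast
  have "fs k z \<in> Zt k" using z Zt_eq by blast
  then have fz: "fs k z \<in> carrier (Sk k)" by (simp only: Sk_simps)
  have "a \<odot>\<^bsub>Tor R k L E\<^esub> (Bt k +>\<^bsub>Sk k\<^esub> fs k z) = \<zero>\<^bsub>Tor R k L E\<^esub> \<longleftrightarrow> a \<odot>\<^bsub>chain M F k\<^esub> z \<in> bnd_ker k"
    if a: "a \<in> carrier R" for a
  proof -
    have "a \<odot>\<^bsub>Tor R k L E\<^esub> (Bt k +>\<^bsub>Sk k\<^esub> fs k z) = Bt k +>\<^bsub>Sk k\<^esub> (a \<odot>\<^bsub>Sk k\<^esub> fs k z)"
      using Q(2) a fz unfolding Tor_eq quot_graded_def linear_map_def by simp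
    moreover have "\<zero>\<^bsub>Tor R k L E\<^esub> = Bt k"
      unfolding Tor_eq quot_graded_def by (simp add: S.quot_module_simps)
    moreover have "a \<odot>\<^bsub>Sk k\<^esub> fs k z = fs k (a \<odot>\<^bsub>chain M F k\<^esub> z)"
      using s.smult[OF a zc] by (simp only: Sk_simps)
    ultimately show ?thesis
      using Q(3)[OF S.smult_closed[OF a fz]] fs_in_Bt[OF s.M.smult_closed[OF a zc]] by simp
  qed
  then show ?thesis unfolding annihilator_def s.M.colon_def by blast
qed

lemma Tor_carrier: "carrier (Tor R k L E) = (\<lambda>z. Bt k +>\<^bsub>Sk k\<^esub> fs k z) ` cyc k"
proof -
  interpret S: module R "Sk k" by (rule module_Sk)
  show ?thesis unfolding Tor_eq quot_graded_def
    by (simp add: S.quot_module_simps Sk_simps(1)) (simp add: Zt_eq[of k] image_image)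
qed

lemma Tor_grade: "grade (Tor R k L E) n = (\<lambda>z. Bt k +>\<^bsub>Sk k\<^esub> fs k z) ` (cyc k \<inter> grade (chain M F k) n)"
proof -
  have "grade (Sk k) n = fs k ` (cyc k \<inter> grade (chain M F k) n)"
    unfolding Sk_simps tensor_grade_eq using fs_in_Zt free_tensor_grade by blast
  then show ?thesis unfolding Tor_eq quot_graded_def by (simp add: image_image)
qed

lemma Tor_zero_iff:
  assumes z: "z \<in> cyc k"
  shows "Bt k +>\<^bsub>Sk k\<^esub> fs k z = \<zero>\<^bsub>Tor R k L E\<^esub> \<longleftrightarrow> z \<in> bnd_ker k"
proof -
  interpret S: module R "Sk k" by (rule module_Sk)
  have "fs k z \<in> Zt k" using z Zt_eq by blast
  then have fz: "fs k z \<in> carrier (Sk k)" by (simp only: Sk_simps)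
  have "\<zero>\<^bsub>Tor R k L E\<^esub> = Bt k" unfolding Tor_eq quot_graded_def by (simp add: S.quot_module_simps)
  then show ?thesis using S.quot_module(3)[OF submodule_Bt fz] fs_in_Bt[of z k] z unfolding cyc_def by simp
qed

text \<open>The hypothesis on the torsion of \<open>Tor\<close> restated for cycles in
  \<open>M^r\<close>.\<close>

lemma torsion_by_Tor:
  assumes "torsion_by (Tor R k L E) I = {\<zero>\<^bsub>Tor R k L E\<^esub>}" "I \<subseteq> carrier R"
    and z: "z \<in> cyc k" "\<And>a. a \<in> I \<Longrightarrow> a \<odot>\<^bsub>chain M F k\<^esub> z \<in> bnd_ker k"
  shows "z \<in> bnd_ker k"
proof -
  interpret P: module R "chain M F k" by (rule module_free_tensor)
  let ?x = "Bt k +>\<^bsub>Sk k\<^esub> fs k z"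
  have "a \<in> annihilator R (Tor R k L E) ?x" if "a \<in> I" for a
    unfolding annihilator_coset[OF z(1)] P.colon_def using that assms(2) z(2) by blast
  then have "?x \<in> torsion_by (Tor R k L E) I"
    unfolding torsion_by_def annihilator_def Tor_carrier using z(1) by blast
  then show ?thesis using assms(1) Tor_zero_iff[OF z(1)] by simp
qed

end

section \<open>Graded submodules and powers of ideals\<close>

context proj_graded
begin

text \<open>Scalars have degree at least zero, so the elements without components below a given
  degree form a submodule; a bound for the generators is one for all of \<open>M\<close>.\<close>

lemma fin_gen_bounded_below:
  assumes "fin_gen_module R M"
  obtains e0 where "\<And>e x. e < e0 \<Longrightarrow> x \<in> carrier M \<Longrightarrow> \<pi> e x = \<zero>\<^bsub>M\<^esub>"
proof -
  obtain S where S: "finite S" "S \<subseteq> carrier M" "module_span R M S = carrier M"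
    using assms unfolding fin_gen_module_def by blast
  define A where "A = (\<Union>s\<in>S. {e. \<pi> e s \<noteq> \<zero>\<^bsub>M\<^esub>})"
  have "finite A" unfolding A_def using S(1,2) proj_finite by (intro finite_UN_I) auto
  \<comment> \<open>The inserted zero keeps \<open>Min\<close> defined when no generator has a
    nonzero component.\<close>
  define e0 where "e0 = Min (insert 0 A)"
  define W where "W = {x \<in> carrier M. \<forall>e<e0. \<pi> e x = \<zero>\<^bsub>M\<^esub>}"
  have "submodule W R M" unfolding submodule_iff
  proof (intro conjI ballI)
    show "W \<subseteq> carrier M" "\<zero>\<^bsub>M\<^esub> \<in> W" unfolding W_def by auto
    fix x assume x: "x \<in> W"
    then have xc: "x \<in> carrier M" unfolding W_def by blast
    show "x \<oplus>\<^bsub>M\<^esub> y \<in> W" if "y \<in> W" for y using that x unfolding W_def by (auto simp: proj_add)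
    fix a assume a: "a \<in> carrier R"
    have "a \<in> {a \<in> carrier R. a \<odot>\<^bsub>M\<^esub> x \<in> W}"
    proof (rule ring_homogeneous_induct[OF a])
      show "rgrade R i \<subseteq> {a \<in> carrier R. a \<odot>\<^bsub>M\<^esub> x \<in> W}" for i
      proof
        fix b assume b: "b \<in> rgrade R i"
        have "\<pi> e (b \<odot>\<^bsub>M\<^esub> x) = \<zero>\<^bsub>M\<^esub>" if "e < e0" for e
          using proj_smult'[OF b xc, of e] x that rgrade_carrier[OF b] unfolding W_def by simp
        then show "b \<in> {a \<in> carrier R. a \<odot>\<^bsub>M\<^esub> x \<in> W}" using rgrade_carrier[OF b] xc unfolding W_def by simp
      qed
    qed (use xc in \<open>auto simp: W_def smult_l_distr proj_add\<close>)
    then show "a \<odot>\<^bsub>M\<^esub> x \<in> W" by blast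
  qed
  moreover have "S \<subseteq> W"
  proof
    fix s assume s: "s \<in> S"
    have "\<pi> e s = \<zero>\<^bsub>M\<^esub>" if e: "e < e0" for e
    proof (rule ccontr)
      assume "\<pi> e s \<noteq> \<zero>\<^bsub>M\<^esub>"
      then have "e \<in> A" using s unfolding A_def by blast
      then have "e0 \<le> e" unfolding e0_def using \<open>finite A\<close> by (intro Min_le) auto
      then show False using e by simp
    qed
    then show "s \<in> W" using s S(2) unfolding W_def by blast
  qed
  ultimately have "carrier M \<subseteq> W" using module_span_least S(3) by metis
  then show thesis using that[of e0] unfolding W_def by blast
qed

text \<open>The homogeneous elements of \<open>W\<close> lie in its core, which is a submodule, so
  the subgroup they generate lies there as well.\<close>

lemma homog_if_homogeneous:
  assumes "submodule W R M" "homogeneous M (grade M) W"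
  shows "homog W"
proof -
  have "(\<Union>n. W \<inter> grade M n) \<subseteq> core W"
  proof
    fix x assume "x \<in> (\<Union>n. W \<inter> grade M n)"
    then obtain n where "x \<in> W" "x \<in> carrier M" "\<pi> n x = x" by (auto simp: grade_iff)
    then show "x \<in> core W" using core_homogeneous_iff assms(1) by blast
  qed
  then have "generate (add_monoid M) (\<Union>n. W \<inter> grade M n) \<subseteq> core W"
    by (rule generate_least[OF submodule_core[OF assms(1)]])
  then show ?thesis using assms(2) unfolding homogeneous_def homog_def core_def by blast
qed

lemma homog_ideal_smult:
  assumes I: "ideal I R" "proj_graded.homog ring_proj I" and N: "submodule N R M" "homog N"
  shows "homog (ideal_smult M I N)"
proof -
  interpret S: proj_graded R "self_module R" ring_proj by (rule proj_graded_self)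
  interpret I: ideal I R by (rule I(1))
  note W = submodule_ideal_smult[OF I(1) submodule_subset[OF N(1)]]
  have "ideal_smult M I N \<subseteq> core (ideal_smult M I N)"
  proof (rule ideal_smult_least[OF submodule_core[OF W]])
    fix a x assume a: "a \<in> I" and x: "x \<in> N"
    have xc: "x \<in> carrier M" using submodule_carrier[OF N(1) x] .
    have ac: "a \<in> carrier R" using I.Icarr[OF a] .
    let ?V = "{b \<in> carrier R. b \<odot>\<^bsub>M\<^esub> x \<in> core (ideal_smult M I N)}"
    have "a \<in> ?V"
    proof (rule S.homogeneous_induct)
      show "a \<in> carrier (self_module R)" using ac by simp
      show "\<zero>\<^bsub>self_module R\<^esub> \<in> ?V" using xc submodule_zero[OF submodule_core[OF W]] by simp
      show "u \<oplus>\<^bsub>self_module R\<^esub> v \<in> ?V" if "u \<in> ?V" "v \<in> ?V" for u v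
        using that xc submodule_add[OF submodule_core[OF W]] by (auto simp: smult_l_distr)
      fix j
      have aj: "ring_proj j a \<in> I" using S.homogD[OF I(2) a] .
      show "ring_proj j a \<in> ?V"
      proof (cases "0 \<le> j")
        case True
        have rh: "ring_proj j a \<in> rgrade R (nat j)"
          using direct_sum.component(1)[OF ring_direct_sum' ac] True by (simp add: ring_proj_def)
        have "\<pi> e (ring_proj j a \<odot>\<^bsub>M\<^esub> x) \<in> ideal_smult M I N" for e
          unfolding proj_smult'[OF rh xc] using ideal_smult_incl[OF aj homogD[OF N(2) x]] .
        then show ?thesis using rgrade_carrier[OF rh] xc unfolding core_def by simp
      next
        case False
        then show ?thesis using xc submodule_zero[OF submodule_core[OF W]] by (simp add: ring_proj_def)
      qed
    qed
    then show "a \<odot>\<^bsub>M\<^esub> x \<in> core (ideal_smult M I N)" by blast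
  qed
  then show ?thesis unfolding homog_def core_def by blast
qed

end

section \<open>Homogeneous ideals, products and powers\<close>

context graded_ring
begin

lemma homog_ideal:
  assumes "homogeneous_ideal R I"
  shows "proj_graded.homog ring_proj I"
proof -
  interpret S: proj_graded R "self_module R" ring_proj by (rule proj_graded_self)
  have I: "ideal I R" "homogeneous R (rgrade R) I" using assms unfolding homogeneous_ideal_def by auto
  have sI: "submodule I R (self_module R)" using I(1) submodule_self_iff is_cring by blast
  have "ideal (S.core I) R" using S.submodule_core[OF sI] submodule_self_iff is_cring by blast
  then have sg: "subgroup (S.core I) (add_monoid R)"
    using additive_subgroup.a_subgroup ideal.axioms(1) by blast
  have "(\<Union>n. I \<inter> rgrade R n) \<subseteq> S.core I"
  proof
    fix x assume "x \<in> (\<Union>n. I \<inter> rgrade R n)"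
    then obtain n where x: "x \<in> I" "x \<in> rgrade R n" by blast
    then have "x \<in> grade (self_module R) (int n)" by (simp add: self_module_def)
    then show "x \<in> S.core I" using x(1) S.core_homogeneous_iff[OF _ _ sI] unfolding S.grade_iff by blast
  qed
  then have "generate (add_monoid R) (\<Union>n. I \<inter> rgrade R n) \<subseteq> S.core I"
    using add.generate_subgroup_incl sg by blast
  then show ?thesis using I(2) unfolding homogeneous_def S.homog_def S.core_def by blast
qed

text \<open>Viewing \<open>B\<close> as a submodule of \<open>R\<close> makes homogeneity of
  products of ideals a case of \<open>homog_ideal_smult\<close>.\<close>

lemma ideal_prod_eq_smult:
  assumes "ideal A R" "ideal B R"
  shows "ideal_prod R A B = ideal_smult (self_module R) A B"
proof
  interpret S: proj_graded R "self_module R" ring_proj by (rule proj_graded_self)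
  have sB: "submodule B R (self_module R)" using assms(2) submodule_self_iff is_cring by blast
  note W = S.submodule_ideal_smult[OF assms(1) S.submodule_subset[OF sB]]
  show "ideal_prod R A B \<subseteq> ideal_smult (self_module R) A B"
  proof
    fix x assume "x \<in> ideal_prod R A B"
    then show "x \<in> ideal_smult (self_module R) A B"
    proof induction
      case (prod i j)
      then show ?case using S.ideal_smult_incl[of i A j B] by simp
    next
      case (sum s t)
      then show ?case using S.submodule_add[OF W] by simp
    qed
  qed
  have "submodule (ideal_prod R A B) R (self_module R)"
    using ideal_prod_is_ideal[OF assms] submodule_self_iff is_cring by blast
  then show "ideal_smult (self_module R) A B \<subseteq> ideal_prod R A B"
    by (rule S.ideal_smult_least) (simp add: ideal_prod.prod)
qed

lemma homog_ideal_prod: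
  assumes "ideal A R" "proj_graded.homog ring_proj A" "ideal B R" "proj_graded.homog ring_proj B"
  shows "proj_graded.homog ring_proj (ideal_prod R A B)"
  unfolding ideal_prod_eq_smult[OF assms(1,3)]
  by (rule proj_graded.homog_ideal_smult[OF proj_graded_self assms(1,2) _ assms(4)])
    (use assms(3) submodule_self_iff is_cring in blast)

end

context cring
begin

lemma ideals_set_simps: "\<one>\<^bsub>ideals_set R\<^esub> = carrier R" "monoid.mult (ideals_set R) = ideal_prod R"
  by (simp_all add: ideals_set_def)

lemma ideal_power_0: "ideal_power R I 0 = carrier R"
  and ideal_power_Suc: "ideal_power R I (Suc n) = ideal_prod R (ideal_power R I n) I"
  by (simp_all add: ideals_set_simps)

lemma ideal_ideal_power: "ideal I R \<Longrightarrow> ideal (ideal_power R I n) R"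
  by (induction n) (simp_all add: ideals_set_simps oneideal ideal_prod_is_ideal)

lemma pow_in_ideal_power: "ideal I R \<Longrightarrow> a \<in> I \<Longrightarrow> a [^] n \<in> ideal_power R I n"
  by (induction n) (auto simp: ideals_set_simps intro: ideal_prod.prod)

lemma reduction_power:
  assumes J: "ideal J R" and I: "ideal I R"
    and red: "ideal_prod R J (ideal_power R I m) = ideal_power R I (Suc m)"
  shows "ideal_prod R J (ideal_power R I (m + k)) = ideal_power R I (Suc (m + k))"
proof (induction k)
  case (Suc k)
  have "ideal_prod R J (ideal_power R I (m + Suc k)) = ideal_prod R (ideal_prod R J (ideal_power R I (m + k))) I"
    using ideal_prod_assoc[OF J ideal_ideal_power[OF I] I, of "m + k"] by (simp add: ideals_set_simps)
  also have "\<dots> = ideal_power R I (Suc (m + Suc k))" unfolding Suc by (simp add: ideals_set_simps)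
  finally show ?case .
qed (simp add: red)

end

lemma list_pow_shift: "list_pow_smult (shift_module d M) ys n U = list_pow_smult M ys n U"
proof -
  have "list_smult (shift_module d M) ys U = list_smult M ys U" for U by (induction ys) simp_all
  then show ?thesis by (induction n) simp_all
qed

context module
begin

text \<open>The power \<open>I\<^sup>n\<close> enters the asymptotic analysis only through \<open>I\<^sup>n\<^sup>+\<^sup>m N \<subseteq> J\<^sup>n M\<close> and
  \<open>J I\<^sup>n N \<subseteq> I\<^sup>n\<^sup>+\<^sup>1 N\<close>.\<close>

lemma genideal_smult:
  assumes ys: "set ys \<subseteq> carrier R" and W: "submodule W R M" and u: "u \<in> carrier M"
    and y: "\<And>y. y \<in> set ys \<Longrightarrow> y \<odot>\<^bsub>M\<^esub> u \<in> W" and j: "j \<in> genideal R (set ys)"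
  shows "j \<odot>\<^bsub>M\<^esub> u \<in> W"
proof -
  have "set ys \<subseteq> colon W u" using ys y unfolding colon_def by blast
  then have "genideal R (set ys) \<subseteq> colon W u" by (rule R.genideal_minimal[OF ideal_colon[OF W u]])
  then show ?thesis using j unfolding colon_def by blast
qed

text \<open>Each exponent beyond \<open>m\<close> trades one factor \<open>I\<close> for a factor
  \<open>J\<close>, by \<open>I^(m+n+1) = J I^(m+n)\<close>. The first \<open>m\<close> factors are
  given away, which is the origin of the offset \<open>m\<close> in
  \<open>tor_family\<close>.\<close>

lemma ideal_power_smult_subset_list_pow:
  assumes ys: "set ys \<subseteq> carrier R" and J: "J = genideal R (set ys)" "ideal J R" and I: "ideal I R"
    and red: "ideal_prod R J (ideal_power R I m) = ideal_power R I (Suc m)" and N: "submodule N R M"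
  shows "ideal_smult M (ideal_power R I (m + n)) N \<subseteq> list_pow_smult M ys n (carrier M)"
proof (induction n)
  case 0
  show ?case
    using submodule_subset[OF submodule_ideal_smult[OF R.ideal_ideal_power[OF I] submodule_subset[OF N]]] by simp
next
  case (Suc n)
  let ?L = "list_pow_smult M ys n (carrier M)"
  have L: "submodule ?L R M" by (rule submodule_list_pow[OF ys carrier_is_submodule])
  have W: "submodule (list_smult M ys ?L) R M" by (rule submodule_list_smult[OF ys L])
  have "ideal_smult M (ideal_power R I (m + Suc n)) N \<subseteq> list_smult M ys ?L"
  proof (rule ideal_smult_least[OF W])
    fix a x assume a: "a \<in> ideal_power R I (m + Suc n)" and x: "x \<in> N"
    have xc: "x \<in> carrier M" using submodule_carrier[OF N x] .
    have "a \<in> ideal_prod R J (ideal_power R I (m + n))"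
      using a R.reduction_power[OF J(2) I red, of n] by simp
    then show "a \<odot>\<^bsub>M\<^esub> x \<in> list_smult M ys ?L"
    proof induction
      case (prod j i)
      have ic: "i \<in> carrier R" "j \<in> carrier R"
        using prod ideal.Icarr[OF R.ideal_ideal_power[OF I]] ideal.Icarr[OF J(2)] by blast+
      have "i \<odot>\<^bsub>M\<^esub> x \<in> ?L" using ideal_smult_incl[OF prod(2) x] Suc by blast
      then have "j \<odot>\<^bsub>M\<^esub> (i \<odot>\<^bsub>M\<^esub> x) \<in> list_smult M ys ?L"
        using genideal_smult[OF ys W _ _ prod(1)[unfolded J(1)]] list_smult_incl[OF ys L] ic xc by simp
      then show ?case using ic xc by (simp add: smult_assoc1)
    next
      case (sum s t)
      have "s \<in> carrier R" "t \<in> carrier R"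
        using sum(1,2) R.ideal_prod_in_carrier[OF J(2) R.ideal_ideal_power[OF I]] by blast+
      then show ?case using submodule_add[OF W sum(3,4)] xc by (simp add: smult_l_distr)
    qed
  qed
  then show ?case by simp
qed

lemma rees_family_ideal_power:
  assumes I: "ideal I R" "set ys \<subseteq> I" and N: "submodule N R M"
  shows "rees_family ys (\<lambda>n. ideal_smult M (ideal_power R I n) N)"
  unfolding rees_family_def
proof (intro conjI allI ballI)
  show K: "submodule (ideal_smult M (ideal_power R I n) N) R M" for n
    by (rule submodule_ideal_smult[OF R.ideal_ideal_power[OF I(1)] submodule_subset[OF N]])
  fix y n x assume y: "y \<in> set ys" and x: "x \<in> ideal_smult M (ideal_power R I n) N"
  have yc: "y \<in> carrier R" using ideal.Icarr[OF I(1)] I(2) y by blast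
  have "ideal_smult M (ideal_power R I n) N \<subseteq>
    {x \<in> carrier M. y \<odot>\<^bsub>M\<^esub> x \<in> ideal_smult M (ideal_power R I (Suc n)) N}"
  proof (rule ideal_smult_least[OF submodule_colon_elem[OF yc K]])
    fix a u assume a: "a \<in> ideal_power R I n" and u: "u \<in> N"
    have ac: "a \<in> carrier R" using ideal.Icarr[OF R.ideal_ideal_power[OF I(1)] a] .
    have uc: "u \<in> carrier M" using submodule_carrier[OF N u] .
    have "a \<otimes> y \<in> ideal_power R I (Suc n)"
      unfolding R.ideal_power_Suc using ideal_prod.prod[OF a] y I(2) by blast
    then have "(a \<otimes> y) \<odot>\<^bsub>M\<^esub> u \<in> ideal_smult M (ideal_power R I (Suc n)) N" using u by (rule ideal_smult_incl)
    then show "a \<odot>\<^bsub>M\<^esub> u \<in> {x \<in> carrier M. y \<odot>\<^bsub>M\<^esub> x \<in> ideal_smult M (ideal_power R I (Suc n)) N}"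
      using ac yc uc smult_assoc1[OF ac yc uc] smult_left_commute[OF ac yc uc] by simp
  qed
  then show "y \<odot>\<^bsub>M\<^esub> x \<in> ideal_smult M (ideal_power R I (Suc n)) N" using x by blast
qed

end

lemma (in proj_graded) power_set_proj:
  assumes "homog W" "f \<in> power_set M r W"
  shows "prod_proj {..<r} (\<lambda>s. shift_module (\<delta> s) M) (\<lambda>s e. \<pi> (e - \<delta> s)) e f \<in> power_set M r W"
  using assms homogD unfolding power_set_def prod_proj_def by auto

lemma rees_family_power_set:
  fixes M :: "('a, 'b) graded_module"
  assumes M: "module R M" and W: "module.rees_family R M ys W" and ys: "set ys \<subseteq> carrier R"
  shows "module.rees_family R (free_tensor M r \<delta>) ys (\<lambda>n. power_set M r (W n))"
proof -
  interpret M: module R M by fact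
  interpret P: module R "free_tensor M r \<delta>" by (rule module_prod) (rule module_shift_module[OF M])
  show ?thesis unfolding P.rees_family_def
  proof (intro conjI allI ballI)
    show "submodule (power_set M r (W n)) R (free_tensor M r \<delta>)" for n
      by (rule submodule_power_set[OF M M.rees_familyD(1)[OF W]])
    fix u n f assume u: "u \<in> set ys" and f: "f \<in> power_set M r (W n)"
    have "u \<in> carrier R" using u ys by blast
    then show "u \<odot>\<^bsub>free_tensor M r \<delta>\<^esub> f \<in> power_set M r (W (Suc n))"
      using f M.rees_familyD(2)[OF W u] unfolding power_set_def by simp
  qed
qed

lemma power_set_list_pow:
  fixes M :: "('a, 'b) graded_module"
  assumes M: "module R M" and W: "W \<subseteq> list_pow_smult M ys n (carrier M)" "W \<subseteq> carrier M" and ys: "set ys \<subseteq> carrier R"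
  shows "power_set M r W \<subseteq> list_pow_smult (free_tensor M r \<delta>) ys n (carrier (free_tensor M r \<delta>))"
proof
  fix f assume f: "f \<in> power_set M r W"
  show "f \<in> list_pow_smult (free_tensor M r \<delta>) ys n (carrier (free_tensor M r \<delta>))"
  proof (rule prod_list_pow[OF module_shift_module[OF M] finite_lessThan ys])
    show "f \<in> carrier (free_tensor M r \<delta>)" using f W(2) unfolding free_tensor_carrier power_set_def by blast
    fix s assume "s \<in> {..<r}"
    then show "f s \<in> list_pow_smult (shift_module (\<delta> s) M) ys n (carrier (shift_module (\<delta> s) M))"
      using f W(1) unfolding list_pow_shift power_set_def by auto
  qed
qed

lemma power_set_zero: "power_set M r {\<zero>\<^bsub>M\<^esub>} = {\<zero>\<^bsub>free_tensor M r \<delta>\<^esub>}"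
proof -
  have "f = (\<lambda>s. \<zero>\<^bsub>M\<^esub>)" if "f \<in> power_set M r {\<zero>\<^bsub>M\<^esub>}" for f
  proof
    fix s show "f s = \<zero>\<^bsub>M\<^esub>" using that unfolding power_set_def by (cases "s < r") auto
  qed
  then show ?thesis by (auto simp: power_set_def)
qed

section \<open>The main theorem\<close>

locale reduction_setup =
  fixes R :: "'r graded_ring" (structure)
    and L :: "('r, 'l) graded_module"
    and M :: "('r, 'm) graded_module"
    and N :: "'m set" and I J :: "'r set" and c k :: nat and y :: "nat \<Rightarrow> 'r" and dg :: "nat \<Rightarrow> nat"
  assumes R: "graded_ring R" and noeth: "noetherian_ring R"
    and L: "graded_module R L" "fin_gen_module R L"
    and M: "graded_module R M" "fin_gen_module R M"
    and N: "graded_submodule R M N"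
    and I: "homogeneous_ideal R I"
    and red: "is_reduction R J I"
    and y: "\<forall>i\<in>{1..c}. y i \<in> rgrade R (dg i)"
    and mono: "mono_on {1..c} dg"
    and J: "J = genideal R (y ` {1..c})"
    and tors: "torsion_by (Tor R k L M) I = {\<zero>\<^bsub>Tor R k L M\<^esub>}"
begin

definition "\<pi>M e x = component M (grade M) x e"
definition "K n = ideal_smult M (ideal_power R I n) N"
text \<open>Generators are paired with their degrees because equal ring elements may carry different
  degrees, for instance when one of them is zero. The interval runs over
  \<open>1, ..., c\<close>.\<close>

definition "zs = map (\<lambda>i. (y i, dg i)) [1..<Suc c]"
definition "Hn n = Tor R k L (quot_graded M (K n))"

sublocale M: proj_graded R M \<pi>M
  unfolding \<pi>M_def[abs_def] by (rule graded_module.proj_graded_component[OF M(1)])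

lemma I_ideal: "ideal I R" using I unfolding homogeneous_ideal_def by blast
lemma J_ideal: "ideal J R" and J_subset: "J \<subseteq> I" using red unfolding is_reduction_def by auto
lemma N_submodule: "submodule N R M" using N unfolding graded_submodule_def by blast

lemma set_upt_c: "set [1..<Suc c] = {1..c}"
  by (simp add: atLeastLessThanSuc_atLeastAtMost del: upt_Suc)

lemma set_ys: "set (map fst zs) = y ` {1..c}"
  unfolding zs_def set_map set_upt_c image_image by simp

lemma ys_carrier: "set (map fst zs) \<subseteq> carrier R"
  unfolding set_ys using y M.rgrade_carrier by blast

lemma ys_J: "set (map fst zs) \<subseteq> J"
  unfolding J set_ys by (rule M.genideal_self) (use ys_carrier set_ys in simp)

lemma snd_zs: "snd ` set zs = dg ` {1..c}"
  unfolding zs_def set_map set_upt_c image_image by simp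

lemma zs_homogeneous: "(u, d) \<in> set zs \<Longrightarrow> u \<in> rgrade R d"
  using y unfolding zs_def by auto

lemma sorted_zs: "sorted (map snd zs)"
proof -
  have "sorted (map dg [1..<Suc c])"
    unfolding sorted_map by (rule sorted_wrt_mono_rel[OF _ sorted_upt[unfolded sorted_wrt_upt]])
      (use mono in \<open>auto simp: mono_on_def\<close>)
  then show ?thesis unfolding zs_def by (simp add: comp_def)
qed

lemma noetherian_M: "noetherian_module R M"
  by (rule M.noetherian_fin_gen[OF noeth M.module_axioms' M(2)])

lemma K_submodule: "submodule (K n) R M"
  unfolding K_def
  by (rule M.submodule_ideal_smult[OF M.ideal_ideal_power[OF I_ideal] M.submodule_subset[OF N_submodule]])

lemma K_homog: "M.homog (K n)"
proof -
  have I': "proj_graded.homog M.ring_proj I" by (rule M.homog_ideal[OF I])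
  have "proj_graded.homog M.ring_proj (ideal_power R I n)"
  proof (induction n)
    case 0
    then show ?case unfolding M.ideal_power_0 proj_graded.homog_def[OF M.proj_graded_self]
      using proj_graded.proj_closed[OF M.proj_graded_self] by simp
  next
    case (Suc n)
    then show ?case unfolding M.ideal_power_Suc
      by (rule M.homog_ideal_prod[OF M.ideal_ideal_power[OF I_ideal] _ I_ideal I'])
  qed
  moreover have "M.homog N" using N M.homog_if_homogeneous unfolding graded_submodule_def by blast
  ultimately show ?thesis unfolding K_def
    by (intro M.homog_ideal_smult M.ideal_ideal_power I_ideal N_submodule)
qed

lemma resolution: "graded_free_resolution R L (some_resolution R L)"
proof -
  interpret L: proj_graded R L "\<lambda>e x. component L (grade L) x e"
    by (rule graded_module.proj_graded_component[OF L(1)])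
  show ?thesis
    by (rule graded_free_resolution_exists[OF L.proj_graded_axioms noeth M.noetherian_fin_gen[OF noeth L.module_axioms' L(2)]])
qed

text \<open>The identity as a graded quotient describes \<open>Tor R k L M\<close>. Its kernel is
  zero, so here \<open>cyc\<close> and \<open>bnd_ker\<close> are the cycles and boundaries of
  \<open>F \<otimes> M\<close> themselves.\<close>

sublocale q0: tor_quotient R M \<pi>M M "\<lambda>x. x" L
proof -
  have "linear_map R M M (\<lambda>x. x)" by (auto simp: linear_map_def)
  then show "tor_quotient R M \<pi>M M (\<lambda>x. x) L"
    by (intro tor_quotient.intro resolved_quotient.intro resolved_quotient_axioms.intro graded_quotient.intro
      graded_quotient_axioms.intro module_map.intro module_map_axioms.intro M.proj_graded_axioms M.module_axioms' resolution) auto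
qed

text \<open>For the identity map this rule reads \<open>\<zero> = \<zero>\<close>, which makes the simplifier loop.\<close>

declare q0.q.zero [simp del]

sublocale qn: tor_quotient R M \<pi>M "quot_graded M (K n)" "\<lambda>x. K n +>\<^bsub>M\<^esub> x" L for n
proof -
  note Q = M.quot_module[OF K_submodule[of n]]
  have "module R (quot_graded M (K n))" unfolding quot_graded_def by (rule module_with_grade[OF Q(1)])
  moreover have "linear_map R M (quot_graded M (K n)) (\<lambda>x. K n +>\<^bsub>M\<^esub> x)"
    unfolding quot_graded_def using Q(2) by simp
  ultimately show "tor_quotient R M \<pi>M (quot_graded M (K n)) (\<lambda>x. K n +>\<^bsub>M\<^esub> x) L"
    by (intro tor_quotient.intro resolved_quotient.intro resolved_quotient_axioms.intro graded_quotient.intro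
      graded_quotient_axioms.intro module_map.intro module_map_axioms.intro M.proj_graded_axioms M.module_axioms' resolution)
      (auto simp: quot_graded_def M.quot_module_simps)
qed

abbreviation "F \<equiv> some_resolution R L"

lemma ker0: "q0.ker = {\<zero>\<^bsub>M\<^esub>}"
  unfolding q0.ker_def using M.M.zero_closed by blast

lemma kern: "qn.ker n = K n"
proof -
  have "\<zero>\<^bsub>quot_graded M (K n)\<^esub> = K n" by (simp add: quot_graded_def M.quot_module_simps)
  then have "x \<in> qn.ker n \<longleftrightarrow> x \<in> K n" for x
    unfolding qn.ker_def using M.quot_module(3)[OF K_submodule] M.submodule_carrier[OF K_submodule]
    by (metis (mono_tags, lifting) mem_Collect_eq)
  then show ?thesis by blast
qed

definition "\<pi>T = prod_proj {..<rank F k} (\<lambda>s. shift_module (shift F k s) M) (\<lambda>s e. \<pi>M (e - shift F k s))"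
definition "\<pi>T' = prod_proj {..<tgt_rank F k} (\<lambda>s. shift_module (tgt_shift F k s) M) (\<lambda>s e. \<pi>M (e - tgt_shift F k s))"

sublocale T: proj_graded R "chain M F k" \<pi>T
  unfolding \<pi>T_def by (rule q0.proj_graded_free_tensor)

sublocale T': proj_graded R "tgt M F k" \<pi>T'
  unfolding \<pi>T'_def by (rule q0.proj_graded_free_tensor)

lemma noetherian_free_tensor: "noetherian_module R (free_tensor M r \<delta>)"
  by (rule noetherian_prod_module)
    (auto intro: module_shift_module M.module_axioms' M.noetherian_shift noetherian_M)

lemma bd_proj: "x \<in> carrier (chain M F k) \<Longrightarrow> bd R M F k (\<pi>T e x) = \<pi>T' e (bd R M F k x)"
  by (rule linear_commutes_proj[OF T.proj_graded_axioms T'.proj_graded_axioms q0.linear_bd q0.bd_grade])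

lemma bnd_homog: "T.homog (q0.bnd k)"
proof -
  let ?p = "prod_proj {..<rank F (Suc k)} (\<lambda>s. shift_module (shift F (Suc k) s) M) (\<lambda>s e. \<pi>M (e - shift F (Suc k) s))"
  interpret S: proj_graded R "chain M F (Suc k)" ?p by (rule q0.proj_graded_free_tensor)
  have l: "linear_map R (chain M F (Suc k)) (chain M F k) (bd R M F (Suc k))"
    and g: "\<And>n x. x \<in> grade (chain M F (Suc k)) n \<Longrightarrow> bd R M F (Suc k) x \<in> grade (chain M F k) n"
    using q0.linear_bd[of "Suc k"] q0.bd_grade[of _ "Suc k"] by (auto simp: tgt_rank_def tgt_shift_def)
  show ?thesis unfolding T.homog_def q0.bnd_def
    using linear_commutes_proj[OF S.proj_graded_axioms T.proj_graded_axioms l g, symmetric] by auto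
qed

text \<open>Removing one factor \<open>I\<close> at a time from the annihilating power. Powers are
  needed because annihilation by \<open>J\<close> gives annihilation by a power of \<open>I\<close>,
  not by \<open>I\<close> itself.\<close>

lemma torsion_free_power:
  assumes "z \<in> q0.cyc k" "\<And>a. a \<in> ideal_power R I n \<Longrightarrow> a \<odot>\<^bsub>chain M F k\<^esub> z \<in> q0.bnd_ker k"
  shows "z \<in> q0.bnd_ker k"
  using assms
proof (induction n arbitrary: z)
  case 0
  have zc: "z \<in> carrier (chain M F k)" using 0(1) unfolding q0.cyc_def by blast
  then show ?case using 0(2)[of \<one>] T.smult_one[OF zc] unfolding M.ideal_power_0 by simp
next
  case (Suc n)
  have zc: "z \<in> carrier (chain M F k)" using Suc.prems(1) unfolding q0.cyc_def by blast
  have Ic: "I \<subseteq> carrier R" using ideal.Icarr[OF I_ideal] by blast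
  show ?case
  proof (rule q0.torsion_by_Tor[OF tors Ic Suc.prems(1)])
    fix b assume b: "b \<in> I"
    have bc: "b \<in> carrier R" using b Ic by blast
    show "b \<odot>\<^bsub>chain M F k\<^esub> z \<in> q0.bnd_ker k"
    proof (rule Suc.IH)
      show "b \<odot>\<^bsub>chain M F k\<^esub> z \<in> q0.cyc k" using T.submodule_smult[OF q0.submodule_cyc bc Suc.prems(1)] .
      fix a assume a: "a \<in> ideal_power R I n"
      have ac: "a \<in> carrier R" using ideal.Icarr[OF M.ideal_ideal_power[OF I_ideal] a] .
      have "a \<otimes> b \<in> ideal_power R I (Suc n)" unfolding M.ideal_power_Suc by (rule ideal_prod.prod[OF a b])
      then show "a \<odot>\<^bsub>chain M F k\<^esub> (b \<odot>\<^bsub>chain M F k\<^esub> z) \<in> q0.bnd_ker k"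
        using Suc.prems(2) T.smult_assoc1[OF ac bc zc] by metis
    qed
  qed
qed

lemma bnd_ker0: "q0.bnd_ker k = q0.bnd k"
proof -
  have "x \<oplus>\<^bsub>chain M F k\<^esub> \<zero>\<^bsub>chain M F k\<^esub> = x" if "x \<in> q0.bnd k" for x
    using T.M.r_zero[OF T.submodule_carrier[OF q0.submodule_bnd that]] .
  then show ?thesis
    unfolding q0.bnd_ker_def ker0 power_set_zero[of M _ "shift F k"] set_eq_iff in_set_add by (metis singletonD singletonI)
qed

text \<open>The data of \<open>tor_family\<close> are assembled from \<open>q0\<close>, which
  supplies \<open>h\<close> and \<open>B\<close>, and from \<open>K n\<close>, whose powers serve as
  \<open>U\<close> and \<open>V\<close>. The offset \<open>m\<close> is any exponent witnessing that
  \<open>J\<close> is a reduction of \<open>I\<close>.\<close>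

lemma main_family:
  obtains e0 m where "tor_family R (chain M F k) \<pi>T (tgt M F k) (bd R M F k) (q0.bnd k)
    (\<lambda>n. power_set M (rank F k) (K n)) (\<lambda>n. power_set M (tgt_rank F k) (K n)) zs e0 m"
proof -
  obtain m where m: "ideal_prod R J (ideal_power R I m) = ideal_power R I (Suc m)"
    using red unfolding is_reduction_def by blast
  obtain eM where eM: "\<And>e x. e < eM \<Longrightarrow> x \<in> carrier M \<Longrightarrow> \<pi>M e x = \<zero>\<^bsub>M\<^esub>"
    using M.fin_gen_bounded_below[OF M(2)] by blast
  \<comment> \<open>A coordinate of degree \<open>e\<close> in the shifted copy has degree
    \<open>e - shift F k s\<close> in \<open>M\<close>, so the bound for \<open>M\<close> moves by
    the least shift. The inserted zero covers rank zero.\<close>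
  define e0 where "e0 = eM + Min (insert 0 (shift F k ` {..<rank F k}))"
  let ?ys = "map fst zs"
  have ysI: "set ?ys \<subseteq> I" using ys_J J_subset by blast
  have KL: "K n \<subseteq> list_pow_smult M ?ys (n - m) (carrier M)" if "m \<le> n" for n
    using M.ideal_power_smult_subset_list_pow[OF ys_carrier _ J_ideal I_ideal m N_submodule, of "n - m"] that
    unfolding K_def J set_ys by simp
  have Kf: "M.rees_family ?ys K"
    unfolding K_def[abs_def] by (rule M.rees_family_ideal_power[OF I_ideal ysI N_submodule])
  have Kc: "K n \<subseteq> carrier M" for n using M.submodule_subset[OF K_submodule] .
  have "tor_family R (chain M F k) \<pi>T (tgt M F k) (bd R M F k) (q0.bnd k)
    (\<lambda>n. power_set M (rank F k) (K n)) (\<lambda>n. power_set M (tgt_rank F k) (K n)) zs e0 m"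
  proof (intro tor_family.intro tor_family_axioms.intro T.proj_graded_axioms q0.map_bd noetherian_free_tensor
      zs_homogeneous sorted_zs q0.submodule_bnd bnd_homog rees_family_power_set[OF M.module_axioms' Kf ys_carrier]
      power_set_list_pow[OF M.module_axioms' KL Kc ys_carrier])
    have "{W. submodule W R (self_module R)} = {I. ideal I R}" using submodule_self_iff[OF M.is_cring] by blast
    then show "acc {I. ideal I R}"
      using noetherian_self_module[OF M.is_cring noeth] unfolding noetherian_module_def by simp
    show "\<pi>T e x = \<zero>\<^bsub>chain M F k\<^esub>" if e: "e < e0" and x: "x \<in> carrier (chain M F k)" for e x
    proof -
      have "\<pi>M (e - shift F k s) (x s) = \<zero>\<^bsub>M\<^esub>" if s: "s < rank F k" for s
      proof (rule eM)
        have "Min (insert 0 (shift F k ` {..<rank F k})) \<le> shift F k s" using s by (intro Min_le) auto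
        then show "e - shift F k s < eM" using e unfolding e0_def by linarith
        show "x s \<in> carrier M" using x s unfolding free_tensor_carrier by blast
      qed
      then have "(if s \<in> {..<rank F k} then \<pi>M (e - shift F k s) (x s) else \<zero>\<^bsub>M\<^esub>) = \<zero>\<^bsub>M\<^esub>" for s by simp
      then show ?thesis unfolding \<pi>T_def prod_proj_def prod_module_simps shift_module_simps by (rule ext)
    qed
    show "bd R M F k x = \<zero>\<^bsub>tgt M F k\<^esub>" if "x \<in> q0.bnd k" for x
    proof -
      have "bd R M F k x \<in> power_set M (tgt_rank F k) {\<zero>\<^bsub>M\<^esub>}"
        using q0.bnd_cyc that unfolding q0.cyc_def ker0 by blast
      then show ?thesis unfolding power_set_zero[of M _ "tgt_shift F k"] by (rule singletonD)
    qed
    fix z assume z: "z \<in> carrier (chain M F k)" "bd R M F k z = \<zero>\<^bsub>tgt M F k\<^esub>"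
      and yz: "\<And>u. u \<in> set ?ys \<Longrightarrow> u \<odot>\<^bsub>chain M F k\<^esub> z \<in> q0.bnd k"
    have cyc: "z \<in> q0.cyc k" using z unfolding q0.cyc_def ker0 power_set_zero[of M _ "tgt_shift F k"] by blast
    have Jz: "j \<odot>\<^bsub>chain M F k\<^esub> z \<in> q0.bnd k" if "j \<in> J" for j
      using T.genideal_smult[OF ys_carrier q0.submodule_bnd z(1) yz] that unfolding J set_ys by blast
    \<comment> \<open>If \<open>J\<close> multiplies \<open>z\<close> into \<open>bnd\<close>, so
      does \<open>J I^m\<close>, which equals \<open>I^(m+1)\<close>; torsion-freeness for that
      power then applies.\<close>
    have "z \<in> q0.bnd_ker k"
    proof (rule torsion_free_power[OF cyc, of "Suc m"])
      fix a assume "a \<in> ideal_power R I (Suc m)"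
      then have "a \<in> ideal_prod R J (ideal_power R I m)" using m by simp
      then show "a \<odot>\<^bsub>chain M F k\<^esub> z \<in> q0.bnd_ker k" unfolding bnd_ker0
      proof induction
        case (prod j i)
        have ic: "i \<in> carrier R" "j \<in> carrier R"
          using prod ideal.Icarr[OF M.ideal_ideal_power[OF I_ideal]] ideal.Icarr[OF J_ideal] by blast+
        show ?case using T.submodule_smult[OF q0.submodule_bnd ic(1) Jz[OF prod(1)]]
            T.smult_assoc1[OF ic(2,1) z(1)] T.smult_left_commute[OF ic z(1)] by metis
      next
        case (sum s t)
        have "s \<in> carrier R" "t \<in> carrier R"
          using sum(1,2) M.ideal_prod_in_carrier[OF J_ideal M.ideal_ideal_power[OF I_ideal]] by blast+
        then show ?case using T.submodule_add[OF q0.submodule_bnd sum(3,4)] T.smult_l_distr z(1) by metis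
      qed
    qed
    then show "z \<in> q0.bnd k" unfolding bnd_ker0 .
  qed
  then show thesis by (rule that)
qed

end

lemma Inf_is_least:
  assumes "is_least m S"
  shows "Inf ((\<lambda>e. ereal (of_int e)) ` S) = ereal (of_int m)"
  by (rule antisym) (use assms in \<open>auto simp: is_least_def intro!: INF_lower INF_greatest\<close>)

lemma ev_linear_UN:
  assumes "finite A" "\<And>p. p \<in> A \<Longrightarrow> ev_linear B (D p)"
  shows "ev_linear B (\<lambda>n. \<Union>p\<in>A. D p n)"
  using assms
proof (induction A)
  case empty
  then show ?case by (simp add: ev_linear_def)
next
  case (insert p A)
  then have "ev_linear B (\<lambda>n. D p n \<union> (\<Union>p\<in>A. D p n))" by (intro ev_linear_union) auto
  then show ?case by simp
qed

lemma INF_UN_eq: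
  fixes f :: "'a \<Rightarrow> 'b::complete_lattice"
  shows "(INF x\<in>(\<Union>y\<in>A. g y). f x) = (INF y\<in>A. INF x\<in>g y. f x)"
  by (rule order_antisym) (blast intro: INF_greatest INF_lower2)+

section \<open>Local and global v-numbers of the Tor modules\<close>

context reduction_setup
begin

definition vdegs :: "'r set \<Rightarrow> nat \<Rightarrow> int set" where
  "vdegs p n = {e. \<exists>x\<in>grade (Hn n) e. p = annihilator R (Hn n) x}"

lemma local_v_number_eq: "local_v_number R (Hn n) p = Inf ((\<lambda>e. ereal (of_int e)) ` vdegs p n)"
proof -
  have "{ereal (of_int e) | e. \<exists>x\<in>grade (Hn n) e. p = annihilator R (Hn n) x} = (\<lambda>e. ereal (of_int e)) ` vdegs p n"
    unfolding vdegs_def by blast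
  then show ?thesis unfolding local_v_number_def by simp
qed

lemma annihilators_carrier:
  "(\<exists>x\<in>carrier (Hn n). p = annihilator R (Hn n) x) \<longleftrightarrow> (\<exists>z\<in>qn.cyc n k. p = T.colon (qn.bnd_ker n k) z)"
  unfolding Hn_def qn.Tor_carrier using qn.annihilator_coset[of _ n k] by auto

lemma vdegs_eq: "vdegs p n = {e. \<exists>z\<in>qn.cyc n k. \<pi>T e z = z \<and> p = T.colon (qn.bnd_ker n k) z}"
proof -
  have c: "qn.cyc n k \<subseteq> carrier (chain M F k)" unfolding qn.cyc_def by blast
  have "(\<exists>x\<in>grade (Hn n) e. p = annihilator R (Hn n) x) \<longleftrightarrow>
    (\<exists>z\<in>qn.cyc n k. \<pi>T e z = z \<and> p = T.colon (qn.bnd_ker n k) z)" for e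
  proof -
    have "(\<exists>x\<in>grade (Hn n) e. p = annihilator R (Hn n) x) \<longleftrightarrow>
      (\<exists>z\<in>qn.cyc n k \<inter> grade (chain M F k) e. p = annihilator R (Hn n) (qn.Bt n k +>\<^bsub>qn.Sk n k\<^esub> qn.fs n k z))"
      unfolding Hn_def qn.Tor_grade by blast
    also have "\<dots> \<longleftrightarrow> (\<exists>z\<in>qn.cyc n k \<inter> grade (chain M F k) e. p = T.colon (qn.bnd_ker n k) z)"
      unfolding Hn_def using qn.annihilator_coset[of _ n k] by blast
    also have "\<dots> \<longleftrightarrow> (\<exists>z\<in>qn.cyc n k. \<pi>T e z = z \<and> p = T.colon (qn.bnd_ker n k) z)"
      using c T.grade_iff by blast
    finally show ?thesis .
  qed
  then show ?thesis unfolding vdegs_def by blast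
qed

lemma Ass_iff:
  "p \<in> Ass R (Hn n) \<longleftrightarrow> primeideal p R \<and> (\<exists>z\<in>qn.cyc n k. p = T.colon (qn.bnd_ker n k) z)"
  unfolding Ass_def mem_Collect_eq annihilators_carrier ..

lemma vdegs_Ass: "primeideal p R \<Longrightarrow> e \<in> vdegs p n \<Longrightarrow> p \<in> Ass R (Hn n)"
  unfolding Ass_iff vdegs_eq by blast

lemma cyc_eq: "qn.cyc n k = {z \<in> carrier (chain M F k). bd R M F k z \<in> power_set M (tgt_rank F k) (K n)}"
  unfolding qn.cyc_def kern ..

lemma bnd_ker_eq: "qn.bnd_ker n k = q0.bnd k <+>\<^bsub>chain M F k\<^esub> power_set M (rank F k) (K n)"
  unfolding qn.bnd_ker_def kern qn.bnd_def q0.bnd_def ..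

lemma power_set_submodule: "submodule (power_set M (rank F k) (K n)) R (chain M F k)"
  by (rule submodule_power_set[OF M.module_axioms' K_submodule])

lemma bnd_ker_submodule: "submodule (qn.bnd_ker n k) R (chain M F k)"
  unfolding bnd_ker_eq by (rule T.submodule_set_add[OF q0.submodule_bnd power_set_submodule])

text \<open>Cycles and boundaries modulo \<open>K n\<close> are homogeneous, so some component of a
  representative is again a cycle and has the same prime annihilator. An associated prime thus has a
  finite local v-number.\<close>

lemma vdegs_nonempty:
  assumes "p \<in> Ass R (Hn n)"
  shows "vdegs p n \<noteq> {}"
proof -
  obtain e0 m where tf: "tor_family R (chain M F k) \<pi>T (tgt M F k) (bd R M F k) (q0.bnd k)
    (\<lambda>n. power_set M (rank F k) (K n)) (\<lambda>n. power_set M (tgt_rank F k) (K n)) zs e0 m"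
    by (rule main_family)
  obtain z where p: "primeideal p R" and z: "z \<in> qn.cyc n k" "p = T.colon (qn.bnd_ker n k) z"
    using assms unfolding Ass_iff by blast
  have zc: "z \<in> carrier (chain M F k)" using z(1) unfolding cyc_eq by blast
  have hom: "T.homog (qn.bnd_ker n k)" unfolding T.homog_def
  proof (intro ballI allI)
    fix x e assume "x \<in> qn.bnd_ker n k"
    then obtain b w where bw: "b \<in> q0.bnd k" "w \<in> power_set M (rank F k) (K n)" "x = b \<oplus>\<^bsub>chain M F k\<^esub> w"
      unfolding bnd_ker_eq in_set_add by blast
    have "\<pi>T e x = \<pi>T e b \<oplus>\<^bsub>chain M F k\<^esub> \<pi>T e w"
      unfolding bw(3) by (rule T.proj_add[OF T.submodule_carrier[OF q0.submodule_bnd bw(1)] T.submodule_carrier[OF power_set_submodule bw(2)]])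
    moreover have "\<pi>T e b \<in> q0.bnd k" by (rule T.homogD[OF bnd_homog bw(1)])
    moreover have "\<pi>T e w \<in> power_set M (rank F k) (K n)"
      unfolding \<pi>T_def by (rule M.power_set_proj[OF K_homog bw(2)])
    ultimately show "\<pi>T e x \<in> qn.bnd_ker n k" unfolding bnd_ker_eq in_set_add by blast
  qed
  obtain e where e: "T.colon (qn.bnd_ker n k) z = T.colon (qn.bnd_ker n k) (\<pi>T e z)"
    using T.homogeneous_prime[OF tor_family.bound[OF tf] bnd_ker_submodule hom zc] p z(2) by blast
  have "bd R M F k (\<pi>T e z) \<in> power_set M (tgt_rank F k) (K n)"
    unfolding bd_proj[OF zc] \<pi>T'_def
    by (rule M.power_set_proj[OF K_homog]) (use z(1) cyc_eq in blast)
  then have "\<pi>T e z \<in> qn.cyc n k" unfolding cyc_eq using T.proj_closed[OF zc] by blast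
  moreover have "\<pi>T e (\<pi>T e z) = \<pi>T e z" using T.proj_proj[OF zc, of e e] by simp
  ultimately show ?thesis using e z(2) unfolding vdegs_eq by blast
qed

lemma ev_linear_vdegs:
  assumes p: "primeideal p R" "I \<subseteq> p"
  shows "ev_linear (dg ` {1..c}) (vdegs p)"
proof -
  obtain e0 m where tf: "tor_family R (chain M F k) \<pi>T (tgt M F k) (bd R M F k) (q0.bnd k)
    (\<lambda>n. power_set M (rank F k) (K n)) (\<lambda>n. power_set M (tgt_rank F k) (K n)) zs e0 m"
    by (rule main_family)
  interpret W: tor_family R "chain M F k" \<pi>T "tgt M F k" "bd R M F k" "q0.bnd k"
    "\<lambda>n. power_set M (rank F k) (K n)" "\<lambda>n. power_set M (tgt_rank F k) (K n)" zs e0 m by (rule tf)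
  have "set (map fst zs) \<subseteq> p" using ys_J J_subset p(2) by blast
  then have "ev_linear (snd ` set zs) (W.prime_degs p)" by (rule W.ev_linear_prime_degs[OF p(1)])
  moreover have "W.prime_degs p = vdegs p"
    unfolding W.prime_degs_def[abs_def] W.Z_def W.BU_def vdegs_eq[abs_def] cyc_eq bnd_ker_eq ..
  ultimately show ?thesis unfolding snd_zs by simp
qed

lemma finite_Ass:
  obtains g \<Lambda> where "finite \<Lambda>" "\<And>n p. n \<ge> g \<Longrightarrow> p \<in> Ass R (Hn n) \<Longrightarrow> I \<subseteq> p \<Longrightarrow> p \<in> \<Lambda>"
proof -
  obtain e0 m where tf: "tor_family R (chain M F k) \<pi>T (tgt M F k) (bd R M F k) (q0.bnd k)
    (\<lambda>n. power_set M (rank F k) (K n)) (\<lambda>n. power_set M (tgt_rank F k) (K n)) zs e0 m"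
    by (rule main_family)
  interpret W: tor_family R "chain M F k" \<pi>T "tgt M F k" "bd R M F k" "q0.bnd k"
    "\<lambda>n. power_set M (rank F k) (K n)" "\<lambda>n. power_set M (tgt_rank F k) (K n)" zs e0 m by (rule tf)
  have Z: "W.Z n = qn.cyc n k" and B: "W.BU n = qn.bnd_ker n k" for n
    unfolding W.Z_def W.BU_def cyc_eq bnd_ker_eq by (rule refl)+
  obtain g \<Lambda> where g: "finite \<Lambda>"
    "\<And>n z. n \<ge> g \<Longrightarrow> z \<in> qn.cyc n k \<Longrightarrow> primeideal (T.colon (qn.bnd_ker n k) z) R \<Longrightarrow>
      set (map fst zs) \<subseteq> T.colon (qn.bnd_ker n k) z \<Longrightarrow> T.colon (qn.bnd_ker n k) z \<in> \<Lambda>"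
    by (rule W.finite_primes[unfolded Z B]) (rule that)
  have ysI: "set (map fst zs) \<subseteq> I" using ys_J J_subset by blast
  show thesis
  proof (rule that[OF g(1)])
    fix n p assume n: "n \<ge> g" and p: "p \<in> Ass R (Hn n)" and Ip: "I \<subseteq> p"
    obtain z where z: "primeideal p R" "z \<in> qn.cyc n k" "p = T.colon (qn.bnd_ker n k) z"
      using p unfolding Ass_iff by blast
    show "p \<in> \<Lambda>" using g(2)[OF n z(2)] z(1) ysI Ip unfolding z(3) by blast
  qed
qed

text \<open>For \<open>a \<in> I\<close> the power of exponent \<open>n + n0\<close> maps
  \<open>M\<close> into \<open>I^n N\<close> and so kills every class; a prime annihilator then
  contains \<open>a\<close>.\<close>

lemma Ass_contains:
  assumes n0: "ideal_smult M (ideal_power R I n0) (carrier M) \<subseteq> N" and p: "p \<in> Ass R (Hn n)"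
  shows "I \<subseteq> p"
proof
  fix a assume a: "a \<in> I"
  obtain z where pr: "primeideal p R" and z: "z \<in> qn.cyc n k" "p = T.colon (qn.bnd_ker n k) z"
    using p unfolding Ass_iff by blast
  have zc: "z \<in> carrier (chain M F k)" using z(1) unfolding cyc_eq by blast
  have ac: "a \<in> carrier R" using ideal.Icarr[OF I_ideal a] .
  have *: "(a [^] (n + n0)) \<odot>\<^bsub>M\<^esub> u \<in> K n" if u: "u \<in> carrier M" for u
  proof -
    have "(a [^] n0) \<odot>\<^bsub>M\<^esub> u \<in> N"
      using n0 M.ideal_smult_incl[OF M.pow_in_ideal_power[OF I_ideal a] u] by blast
    then have "(a [^] n) \<odot>\<^bsub>M\<^esub> ((a [^] n0) \<odot>\<^bsub>M\<^esub> u) \<in> K n"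
      unfolding K_def by (rule M.ideal_smult_incl[OF M.pow_in_ideal_power[OF I_ideal a]])
    then show ?thesis
      using M.smult_assoc1[OF M.nat_pow_closed[OF ac] M.nat_pow_closed[OF ac] u] M.nat_pow_mult[OF ac] by metis
  qed
  have "(a [^] (n + n0)) \<odot>\<^bsub>chain M F k\<^esub> z \<in> power_set M (rank F k) (K n)"
  proof -
    have "z s \<in> carrier M" if "s < rank F k" for s using zc that unfolding free_tensor_carrier by blast
    moreover have "z s = \<zero>\<^bsub>M\<^esub>" if "s \<ge> rank F k" for s using zc that unfolding free_tensor_carrier by blast
    moreover have "(a [^] (n + n0)) \<odot>\<^bsub>M\<^esub> \<zero>\<^bsub>M\<^esub> = \<zero>\<^bsub>M\<^esub>" by (rule M.smult_r_null[OF M.nat_pow_closed[OF ac]])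
    ultimately show ?thesis unfolding power_set_def prod_module_simps shift_module_simps using * by simp
  qed
  then have "(a [^] (n + n0)) \<odot>\<^bsub>chain M F k\<^esub> z \<in> qn.bnd_ker n k"
    unfolding bnd_ker_eq using T.set_add_upper2[OF q0.submodule_bnd T.submodule_subset[OF power_set_submodule]] by blast
  then have "a [^] (n + n0) \<in> p" unfolding z(2) T.colon_def using M.nat_pow_closed[OF ac] by blast
  then show "a \<in> p" by (rule M.prime_pow[OF pr ac])
qed

text \<open>Nonemptiness of \<open>vdegs\<close> at associated primes rules out the degenerate
  alternative of \<open>ev_linear\<close>.\<close>

lemma local_part:
  assumes "\<forall>\<^sub>F n in sequentially. p \<in> Ass R (Hn n)" "I \<subseteq> p"
  shows "\<exists>a\<in>dg ` {1..c}. \<exists>b::int. \<forall>\<^sub>F n in sequentially.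
           local_v_number R (Hn n) p = ereal (of_int (int a * int n + b))"
proof -
  have "primeideal p R"
    using eventually_happens[OF assms(1)] unfolding Ass_def by auto
  then have "ev_linear (dg ` {1..c}) (vdegs p)" using ev_linear_vdegs assms(2) by blast
  moreover have "\<not> (\<forall>\<^sub>F n in sequentially. vdegs p n = {})"
  proof
    assume "\<forall>\<^sub>F n in sequentially. vdegs p n = {}"
    then have "\<forall>\<^sub>F n in sequentially. False"
      using assms(1) by eventually_elim (use vdegs_nonempty in blast)
    then show False by simp
  qed
  ultimately obtain a b where ab: "a \<in> dg ` {1..c}"
    "\<forall>\<^sub>F n in sequentially. is_least (int a * int n + b) (vdegs p n)"
    unfolding ev_linear_def by blast
  have "\<forall>\<^sub>F n in sequentially. local_v_number R (Hn n) p = ereal (of_int (int a * int n + b))"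
    using ab(2) by eventually_elim (simp only: local_v_number_eq Inf_is_least)
  then show ?thesis using ab(1) by blast
qed

lemma global_part:
  assumes c: "1 \<le> c" and n0: "ideal_smult M (ideal_power R I n0) (carrier M) \<subseteq> N"
  shows "\<exists>a\<in>dg ` {1..c}. \<exists>b \<in> range (\<lambda>z::int. ereal (of_int z)) \<union> {\<infinity>}.
           \<forall>\<^sub>F n in sequentially. v_number R (Hn n) = ereal (of_int (int a * int n)) + b"
proof -
  obtain g \<Lambda> where g: "finite \<Lambda>" "\<And>n p. n \<ge> g \<Longrightarrow> p \<in> Ass R (Hn n) \<Longrightarrow> I \<subseteq> p \<Longrightarrow> p \<in> \<Lambda>"
    by (rule finite_Ass) (rule that)
  \<comment> \<open>A prime in \<open>A\<close> may fail to be associated to \<open>Hn n\<close> for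
    a particular \<open>n\<close>; its set of degrees is then empty and does not disturb the
    union.\<close>
  define A where "A = {p \<in> \<Lambda>. primeideal p R \<and> I \<subseteq> p}"
  define D where "D n = (\<Union>p\<in>A. vdegs p n)" for n
  have "ev_linear (dg ` {1..c}) D" unfolding D_def[abs_def]
  proof (rule ev_linear_UN)
    show "finite A" unfolding A_def by (rule finite_subset[OF _ g(1)]) blast
    show "ev_linear (dg ` {1..c}) (vdegs p)" if "p \<in> A" for p
      using that ev_linear_vdegs unfolding A_def by blast
  qed
  moreover have v: "v_number R (Hn n) = Inf ((\<lambda>e. ereal (of_int e)) ` D n)" if n: "n \<ge> g" for n
  proof -
    have "(\<Union>p\<in>Ass R (Hn n). vdegs p n) = D n"
    proof
      show "(\<Union>p\<in>Ass R (Hn n). vdegs p n) \<subseteq> D n"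
        unfolding D_def A_def using g(2)[OF n] Ass_contains[OF n0] Ass_iff by blast
      show "D n \<subseteq> (\<Union>p\<in>Ass R (Hn n). vdegs p n)" unfolding D_def A_def using vdegs_Ass by blast
    qed
    moreover have "v_number R (Hn n) = (INF e\<in>(\<Union>p\<in>Ass R (Hn n). vdegs p n). ereal (of_int e))"
      unfolding v_number_def local_v_number_eq INF_UN_eq ..
    ultimately show ?thesis by simp
  qed
  ultimately consider "\<forall>\<^sub>F n in sequentially. D n = {}" |
    a b where "a \<in> dg ` {1..c}" "\<forall>\<^sub>F n in sequentially. is_least (int a * int n + b) (D n)"
    unfolding ev_linear_def by blast
  then show ?thesis
  proof cases
    \<comment> \<open>Here the v-number is eventually infinite, so any slope is correct with
      \<open>b = \<infinity>\<close>; \<open>1 \<le> c\<close> provides one.\<close>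
    case 1
    have "\<forall>\<^sub>F n in sequentially. v_number R (Hn n) = ereal (of_int (int (dg 1) * int n)) + \<infinity>"
      using 1 eventually_ge_at_top[of g] by eventually_elim (simp add: v top_ereal_def)
    moreover have "dg 1 \<in> dg ` {1..c}" using c by simp
    ultimately show ?thesis by blast
  next
    case (2 a b)
    have "\<forall>\<^sub>F n in sequentially. v_number R (Hn n) = ereal (of_int (int a * int n)) + ereal (of_int b)"
      using 2(2) eventually_ge_at_top[of g] by eventually_elim (simp add: v Inf_is_least)
    then show ?thesis using 2(1) by blast
  qed
qed

end

theorem theorem3p10:
  fixes R :: "'r graded_ring"
    and L :: "('r, 'l) graded_module"
    and M :: "('r, 'm) graded_module"
    and N :: "'m set"
    and I J :: "'r set"
    and d c k :: nat
    and x y :: "nat \<Rightarrow> 'r"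
    and dg :: "nat \<Rightarrow> nat"
  assumes "graded_ring R" and "noetherian_ring R"
    and "\<forall>i\<in>{1..d}. \<exists>n. x i \<in> rgrade R n"
    and "carrier R = generate_ring R (rgrade R 0 \<union> x ` {1..d})"
    and "graded_module R L" and "fin_gen_module R L"
    and "graded_module R M" and "fin_gen_module R M"
    and "graded_submodule R M N"
    and "homogeneous_ideal R I"
    and "is_reduction R J I"
    and "1 \<le> c"
    and "\<forall>i\<in>{1..c}. y i \<in> rgrade R (dg i)"
    and "mono_on {1..c} dg"
    and "J = genideal R (y ` {1..c})"
  defines "H \<equiv> Tor R k L M"
  defines "Hn \<equiv> \<lambda>n. Tor R k L (quot_graded M (ideal_smult M (ideal_power R I n) N))"
  assumes "torsion_by H I = {\<zero>\<^bsub>H\<^esub>}"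
  shows
    "(\<forall>\<pp>. (\<forall>\<^sub>F n in sequentially. \<pp> \<in> Ass R (Hn n)) \<and> I \<subseteq> \<pp> \<longrightarrow>
        (\<exists>a\<in>dg ` {1..c}. \<exists>b::int. \<forall>\<^sub>F n in sequentially.
           local_v_number R (Hn n) \<pp> = ereal (of_int (int a * int n + b)))) \<and>
     ((\<exists>n0. ideal_smult M (ideal_power R I n0) (carrier M) \<subseteq> N) \<longrightarrow>
        (\<exists>a\<in>dg ` {1..c}. \<exists>b \<in> range (\<lambda>z::int. ereal (of_int z)) \<union> {\<infinity>}.
           \<forall>\<^sub>F n in sequentially.
             v_number R (Hn n) = ereal (of_int (int a * int n)) + b))"
proof -
  interpret S: reduction_setup R L M N I J c k y dg
    by (rule reduction_setup.intro) (use assms(1,2,5-11,13-15,18) in \<open>simp_all only: H_def\<close>)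
  have Hn: "Hn = S.Hn" unfolding Hn_def S.Hn_def[abs_def] S.K_def ..
  show ?thesis
    unfolding Hn using S.local_part S.global_part[OF assms(12)] by blast
qed

end
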